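(* Let $m,n\ge1$ and $k\ge0$. A crystal basis for the $U_q(gl_m)\otimes U_q(gl_n)$-module $S_k(X)$ (for both the $U_q(gl_m)$-action and the $U_q(gl_n)$-action) is the collection of monomials $\{z^d\mid d\ge0,\ \sum_{i,j}d_{i,j}=k\}$, where $d=(d_{i,j})$ runs over $m\times n$ matrices of non-negative integers.
   Context: For $N\ge 1$, $U_q(gl_N)$ is the standard quantized enveloping algebra over $\mathbb{C}(q)$ with generators $e_i,f_i,q^{\pm\epsilon_i}$, $q^{\epsilon_i}e_jq^{-\epsilon_i}=q^{\delta_{i,j}-\delta_{i,j+1}}e_j$, $q^{\epsilon_i}f_jq^{-\epsilon_i}=q^{-\delta_{i,j}+\delta_{i,j+1}}f_j$, $[e_i,f_j]=\delta_{ij}\frac{q^{h_i}-q^{-h_i}}{q-q^{-1}}$, $h_i=\epsilon_i-\epsilon_{i+1}$, and the quantum Serre relations; $\Delta q^{\epsilon_i}=q^{\epsilon_i}\otimes q^{\epsilon_i}$, $\Delta e_i=e_i\otimes1+q^{-h_i}\otimes e_i$, $\Delta f_i=f_i\otimes q^{h_i}+1\otimes f_i$. $\wedge^1=\mathbb{C}^{mn}$ has $\mathbb{C}(q)$-basis $z_{i,j}$ ($1\le i\le m$, $1\le j\le n$) with the $U_q(gl_m)\otimes U_q(gl_n)$-action: $E_i^L z_{i',j'}=z_{i,j'}$ if $i'=i+1$, else $0$; $F_i^Lz_{i',j'}=z_{i+1,j'}$ if $i'=i$, else $0$; $E_j^Rz_{i',j'}=z_{i',j}$ if $j'=j+1$,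 else $0$; $F_j^Rz_{i',j'}=z_{i',j+1}$ if $j'=j$, else $0$; $q^{\epsilon_i^L}z_{i',j'}=q^{\delta_{i,i'}}z_{i',j'}$; $q^{\epsilon_j^R}z_{i',j'}=q^{\delta_{j,j'}}z_{i',j'}$. Here $E_i^L,F_i^L,q^{\epsilon_i^L}$ (resp. $E_j^R,F_j^R,q^{\epsilon_j^R}$) denote the actions of the generators of $U_q(gl_m)$ (resp. $U_q(gl_n)$). $M_k=(\wedge^1)^{\otimes k}$, with action through $\Delta$ for each of the two algebras. Let $Im\subseteq\wedge^1\otimes\wedge^1$ be the $U_q(gl_m)\otimes U_q(gl_n)$-submodule generated by $q\,z_{1,1}\otimes z_{1,2}-z_{1,2}\otimes z_{1,1}$ (if $n\ge2$) and $q\,z_{1,1}\otimes z_{2,1}-z_{2,1}\otimes z_{1,1}$ (if $m\ge2$), let $\mathcal{S}\subseteq M_k$ be the sum over $t$ of the submodules having $Im$ in tensor positions $t,t+1$ and $\wedge^1$ elsewhere, and $S_k(X)=M_k/\mathcal{S}$. Explicitly (dropping $\otimes$), for $r,s\ge1$ the relations are $z_{i,j+r}z_{i,j}=q\,z_{i,j}z_{i,j+r}$, $z_{i+r,j}z_{i,j}=q\,z_{i,j}z_{i+r,j}$, $z_{i,j+s}z_{i+r,j}=z_{i+r,j}z_{i,j+s}$, $z_{i+r,j+s}z_{i,j}=z_{i,j}z_{i+r,j+s}+(q-1/q)z_{i+r,j}z_{i,j+s}$. For a matrix $d$ of non-negative integers, $z^d=z_{1,1}^{d_{1,1}}z_{2,1}^{d_{2,1}}\cdots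 z_{m,1}^{d_{m,1}}z_{1,2}^{d_{1,2}}\cdots z_{m,n}^{d_{m,n}}$ (column by column). Crystal basis (Kashiwara): for $(E,F)=(E_i^L,F_i^L)$ or $(E_j^R,F_j^R)$, every weight vector is uniquely $u=\sum_r F^{(r)}u_r$ with $Eu_r=0$, $u_r$ weight vectors, $F^{(r)}=F^r/[r]_q!$ (with $u_r=0$ when $F^{(r)}u_r=0$); set $\widetilde E u=\sum_{r\ge1}F^{(r-1)}u_r$, $\widetilde F u=\sum_rF^{(r+1)}u_r$. Let $A\subset\mathbb{C}(q)$ be the ring of functions regular at $q=0$. A basis $\mathcal{B}$ of weight vectors is a crystal basis if $\mathcal{L}=\bigoplus_{b\in\mathcal{B}}Ab$ is stable under all $\widetilde E,\widetilde F$, and in $\mathcal{L}/q\mathcal{L}$ one has $\widetilde Eb,\widetilde Fb\in\mathcal{B}\cup\{0\}$ and $\widetilde Eb=b'\iff\widetilde Fb'=b$ for $b,b'\in\mathcal{B}$. *)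

theory Defs
  imports
    "HOL-Computational_Algebra.Fraction_Field"
    "HOL-Algebra.AbelCoset"
    "Jordan_Normal_Form.VS_Connect"
begin

section \<open>The ground field\<close>

type_synonym cq = "complex poly fract"

definition qq :: cq where
  "qq = Fract [:0, 1:] 1"

text \<open>The local ring \<open>A\<close> of rational functions that are regular at \<open>q = 0\<close>.\<close>

definition regular_at_0 :: "cq set" where
  "regular_at_0 = {Fract a b | a b. poly b 0 \<noteq> 0}"

definition qint :: "nat \<Rightarrow> cq" where
  "qint r = (qq ^ r - inverse qq ^ r) / (qq - inverse qq)"

definition qfact :: "nat \<Rightarrow> cq" where
  "qfact r = (\<Prod>s = 1..r. qint s)"


section \<open>Modules over \<open>U\<^sub>q(gl\<^sub>N)\<close>\<close>

text \<open>Generators \<open>e\<^sub>i\<close>, \<open>f\<^sub>i\<close>, \<open>q\<^bsup>\<epsilon>\<^sub>i\<^esup>\<close>, \<open>q\<^bsup>-\<epsilon>\<^sub>i\<^esup>\<close>; indices start at \<open>1\<close>. A module over the algebra with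
  these generators is a vector space with one operator for each generator, subject to the defining
  relations.\<close>

datatype uq_gen = GE nat | GF nat | GQ nat | GQinv nat

definition uq_gens :: "nat \<Rightarrow> uq_gen set" where
  "uq_gens N = GE ` {1..<N} \<union> GF ` {1..<N} \<union> GQ ` {1..N} \<union> GQinv ` {1..N}"

text \<open>The actions of \<open>q\<^bsup>h\<^sub>i\<^esup>\<close> and \<open>q\<^bsup>-h\<^sub>i\<^esup>\<close>, where \<open>h\<^sub>i = \<epsilon>\<^sub>i - \<epsilon>\<^sub>i\<^sub>+\<^sub>1\<close>.\<close>

definition act_qh :: "(uq_gen \<Rightarrow> 'v \<Rightarrow> 'v) \<Rightarrow> nat \<Rightarrow> 'v \<Rightarrow> 'v" where
  "act_qh \<rho> i x = \<rho> (GQ i) (\<rho> (GQinv (Suc i)) x)"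

definition act_qh_inv :: "(uq_gen \<Rightarrow> 'v \<Rightarrow> 'v) \<Rightarrow> nat \<Rightarrow> 'v \<Rightarrow> 'v" where
  "act_qh_inv \<rho> i x = \<rho> (GQinv i) (\<rho> (GQ (Suc i)) x)"

definition serre_rel :: "(cq, 'v) module \<Rightarrow> nat \<Rightarrow> (nat \<Rightarrow> 'v \<Rightarrow> 'v) \<Rightarrow> bool" where
  "serre_rel V N X \<longleftrightarrow>
    (\<forall>i\<in>{1..<N}. \<forall>j\<in>{1..<N}. \<forall>x\<in>carrier V.
      (j = Suc i \<or> i = Suc j \<longrightarrow>
        X i (X i (X j x)) \<ominus>\<^bsub>V\<^esub> (qq + inverse qq) \<odot>\<^bsub>V\<^esub> X i (X j (X i x)) \<oplus>\<^bsub>V\<^esub> X j (X i (X i x))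
          = \<zero>\<^bsub>V\<^esub>) \<and>
      (Suc i < j \<or> Suc j < i \<longrightarrow> X i (X j x) = X j (X i x)))"

definition uq_gl_module ::
  "nat \<Rightarrow> (cq, 'v) module \<Rightarrow> (uq_gen \<Rightarrow> 'v \<Rightarrow> 'v) \<Rightarrow> bool" where
  "uq_gl_module N V \<rho> \<longleftrightarrow>
    vectorspace class_ring V \<and>
    (\<forall>g\<in>uq_gens N. linear_map class_ring V V (\<rho> g)) \<and>
    (\<forall>i\<in>{1..N}. \<forall>x\<in>carrier V.
      \<rho> (GQ i) (\<rho> (GQinv i) x) = x \<and> \<rho> (GQinv i) (\<rho> (GQ i) x) = x) \<and>
    (\<forall>i\<in>{1..N}. \<forall>j\<in>{1..N}. \<forall>x\<in>carrier V.
      \<rho> (GQ i) (\<rho> (GQ j) x) = \<rho> (GQ j) (\<rho> (GQ i) x)) \<and>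
    (\<forall>i\<in>{1..N}. \<forall>j\<in>{1..<N}. \<forall>x\<in>carrier V.
      \<rho> (GQ i) (\<rho> (GE j) (\<rho> (GQinv i) x)) =
        (qq powi (of_bool (i = j) - of_bool (i = Suc j))) \<odot>\<^bsub>V\<^esub> \<rho> (GE j) x \<and>
      \<rho> (GQ i) (\<rho> (GF j) (\<rho> (GQinv i) x)) =
        (qq powi (- of_bool (i = j) + of_bool (i = Suc j))) \<odot>\<^bsub>V\<^esub> \<rho> (GF j) x) \<and>
    (\<forall>i\<in>{1..<N}. \<forall>j\<in>{1..<N}. \<forall>x\<in>carrier V.
      \<rho> (GE i) (\<rho> (GF j) x) \<ominus>\<^bsub>V\<^esub> \<rho> (GF j) (\<rho> (GE i) x) =
        (if i = j
         then inverse (qq - inverse qq) \<odot>\<^bsub>V\<^esub> (act_qh \<rho> i x \<ominus>\<^bsub>V\<^esub> act_qh_inv \<rho> i x)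
         else \<zero>\<^bsub>V\<^esub>)) \<and>
    serre_rel V N (\<lambda>i. \<rho> (GE i)) \<and>
    serre_rel V N (\<lambda>i. \<rho> (GF i))"

text \<open>Modules over \<open>U\<^sub>q(gl\<^sub>m) \<otimes> U\<^sub>q(gl\<^sub>n)\<close>: two commuting actions.\<close>

definition uq_gl_bimodule ::
  "nat \<Rightarrow> nat \<Rightarrow> (cq, 'v) module \<Rightarrow> (uq_gen \<Rightarrow> 'v \<Rightarrow> 'v) \<Rightarrow> (uq_gen \<Rightarrow> 'v \<Rightarrow> 'v) \<Rightarrow> bool" where
  "uq_gl_bimodule m n V \<rho>L \<rho>R \<longleftrightarrow>
    uq_gl_module m V \<rho>L \<and> uq_gl_module n V \<rho>R \<and>
    (\<forall>g\<in>uq_gens m. \<forall>h\<in>uq_gens n. \<forall>x\<in>carrier V. \<rho>L g (\<rho>R h x) = \<rho>R h (\<rho>L g x))"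

definition generated_submodule ::
  "nat \<Rightarrow> nat \<Rightarrow> (cq, 'v) module \<Rightarrow> (uq_gen \<Rightarrow> 'v \<Rightarrow> 'v) \<Rightarrow> (uq_gen \<Rightarrow> 'v \<Rightarrow> 'v) \<Rightarrow> 'v set \<Rightarrow> 'v set"
  where
  "generated_submodule m n V \<rho>L \<rho>R G =
    \<Inter> {W. subspace class_ring W V \<and> G \<subseteq> W \<and>
          (\<forall>g\<in>uq_gens m. \<rho>L g ` W \<subseteq> W) \<and> (\<forall>h\<in>uq_gens n. \<rho>R h ` W \<subseteq> W)}"


section \<open>Quotients\<close>

text \<open>The quotient of \<open>V\<close> by a subspace \<open>W\<close>, with the cosets of \<open>W\<close> as elements, and the operator
  that an operator \<open>T\<close> with \<open>T W \<subseteq> W\<close> induces on it.\<close>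

definition quotient_space :: "(cq, 'v) module \<Rightarrow> 'v set \<Rightarrow> (cq, 'v set) module" where
  "quotient_space V W =
    \<lparr>carrier = a_rcosets\<^bsub>V\<^esub> W, mult = undefined, one = undefined, zero = W, add = set_add V,
     smult = (\<lambda>c C. \<Union>v\<in>C. W +>\<^bsub>V\<^esub> (c \<odot>\<^bsub>V\<^esub> v))\<rparr>"

definition quotient_map :: "(cq, 'v) module \<Rightarrow> 'v set \<Rightarrow> ('v \<Rightarrow> 'v) \<Rightarrow> 'v set \<Rightarrow> 'v set" where
  "quotient_map V W T C = (\<Union>v\<in>C. W +>\<^bsub>V\<^esub> T v)"


section \<open>Crystal bases\<close>

definition weight_vector ::
  "nat \<Rightarrow> nat \<Rightarrow> (cq, 'v) module \<Rightarrow> (uq_gen \<Rightarrow> 'v \<Rightarrow> 'v) \<Rightarrow> (uq_gen \<Rightarrow> 'v \<Rightarrow> 'v) \<Rightarrow> 'v \<Rightarrow> bool" where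
  "weight_vector m n V \<rho>L \<rho>R u \<longleftrightarrow>
    u \<in> carrier V \<and>
    (\<forall>i\<in>{1..m}. \<exists>a::int. \<rho>L (GQ i) u = (qq powi a) \<odot>\<^bsub>V\<^esub> u) \<and>
    (\<forall>j\<in>{1..n}. \<exists>a::int. \<rho>R (GQ j) u = (qq powi a) \<odot>\<^bsub>V\<^esub> u)"

definition divided_power :: "(cq, 'v) module \<Rightarrow> ('v \<Rightarrow> 'v) \<Rightarrow> nat \<Rightarrow> 'v \<Rightarrow> 'v" where
  "divided_power V F r u = inverse (qfact r) \<odot>\<^bsub>V\<^esub> (F ^^ r) u"

text \<open>The decomposition \<open>u = \<Sum>\<^sub>r F\<^sup>(\<^sup>r\<^sup>) u\<^sub>r\<close>; \<open>wt\<close> is the predicate of being a weight vector.\<close>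

definition string_decomposition ::
  "('v \<Rightarrow> bool) \<Rightarrow> (cq, 'v) module \<Rightarrow> ('v \<Rightarrow> 'v) \<Rightarrow> ('v \<Rightarrow> 'v) \<Rightarrow> 'v \<Rightarrow> (nat \<Rightarrow> 'v) \<Rightarrow> bool" where
  "string_decomposition wt V E F u us \<longleftrightarrow>
    finite {r. us r \<noteq> \<zero>\<^bsub>V\<^esub>} \<and>
    (\<forall>r. wt (us r) \<and> E (us r) = \<zero>\<^bsub>V\<^esub> \<and>
         (divided_power V F r (us r) = \<zero>\<^bsub>V\<^esub> \<longrightarrow> us r = \<zero>\<^bsub>V\<^esub>)) \<and>
    u = (\<Oplus>\<^bsub>V\<^esub>r\<in>{r. us r \<noteq> \<zero>\<^bsub>V\<^esub>}. divided_power V F r (us r))"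

text \<open>The Kashiwara operators are given on weight vectors by the decomposition and extended
  linearly to \<open>V\<close>, which is spanned by its weight vectors. The restriction to extensional functions
  only fixes the irrelevant values outside the carrier.\<close>

definition kashiwara_E ::
  "('v \<Rightarrow> bool) \<Rightarrow> (cq, 'v) module \<Rightarrow> ('v \<Rightarrow> 'v) \<Rightarrow> ('v \<Rightarrow> 'v) \<Rightarrow> 'v \<Rightarrow> 'v" where
  "kashiwara_E wt V E F = (THE T.
    linear_map class_ring V V T \<and> T \<in> extensional (carrier V) \<and>
    (\<forall>u us. wt u \<and> string_decomposition wt V E F u us \<longrightarrow>
      T u = (\<Oplus>\<^bsub>V\<^esub>r\<in>{r. r \<ge> 1 \<and> us r \<noteq> \<zero>\<^bsub>V\<^esub>}. divided_power V F (r - 1) (us r))))"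

definition kashiwara_F ::
  "('v \<Rightarrow> bool) \<Rightarrow> (cq, 'v) module \<Rightarrow> ('v \<Rightarrow> 'v) \<Rightarrow> ('v \<Rightarrow> 'v) \<Rightarrow> 'v \<Rightarrow> 'v" where
  "kashiwara_F wt V E F = (THE T.
    linear_map class_ring V V T \<and> T \<in> extensional (carrier V) \<and>
    (\<forall>u us. wt u \<and> string_decomposition wt V E F u us \<longrightarrow>
      T u = (\<Oplus>\<^bsub>V\<^esub>r\<in>{r. us r \<noteq> \<zero>\<^bsub>V\<^esub>}. divided_power V F (r + 1) (us r))))"

definition crystal_lattice :: "(cq, 'v) module \<Rightarrow> 'v set \<Rightarrow> 'v set" where
  "crystal_lattice V B =
    {\<Oplus>\<^bsub>V\<^esub>b\<in>S. a b \<odot>\<^bsub>V\<^esub> b | a S. finite S \<and> S \<subseteq> B \<and> a \<in> S \<rightarrow> regular_at_0}"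

text \<open>Equality of the classes of \<open>x\<close> and \<open>y\<close> in \<open>L / q L\<close>.\<close>

definition cong_mod_q :: "(cq, 'v) module \<Rightarrow> 'v set \<Rightarrow> 'v \<Rightarrow> 'v \<Rightarrow> bool" where
  "cong_mod_q V L x y \<longleftrightarrow> x \<ominus>\<^bsub>V\<^esub> y \<in> (\<lambda>v. qq \<odot>\<^bsub>V\<^esub> v) ` L"

definition EF_pairs ::
  "nat \<Rightarrow> nat \<Rightarrow> (uq_gen \<Rightarrow> 'v \<Rightarrow> 'v) \<Rightarrow> (uq_gen \<Rightarrow> 'v \<Rightarrow> 'v) \<Rightarrow> (('v \<Rightarrow> 'v) \<times> ('v \<Rightarrow> 'v)) set" where
  "EF_pairs m n \<rho>L \<rho>R =
    (\<lambda>i. (\<rho>L (GE i), \<rho>L (GF i))) ` {1..<m} \<union> (\<lambda>j. (\<rho>R (GE j), \<rho>R (GF j))) ` {1..<n}"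

definition crystal_basis ::
  "nat \<Rightarrow> nat \<Rightarrow> (cq, 'v) module \<Rightarrow> (uq_gen \<Rightarrow> 'v \<Rightarrow> 'v) \<Rightarrow> (uq_gen \<Rightarrow> 'v \<Rightarrow> 'v) \<Rightarrow> 'v set \<Rightarrow> bool"
  where
  "crystal_basis m n V \<rho>L \<rho>R B \<longleftrightarrow>
    vectorspace.basis class_ring V B \<and>
    (\<forall>b\<in>B. weight_vector m n V \<rho>L \<rho>R b) \<and>
    (\<forall>(E, F)\<in>EF_pairs m n \<rho>L \<rho>R.
      let L = crystal_lattice V B;
          Et = kashiwara_E (weight_vector m n V \<rho>L \<rho>R) V E F;
          Ft = kashiwara_F (weight_vector m n V \<rho>L \<rho>R) V E F
      in Et ` L \<subseteq> L \<and> Ft ` L \<subseteq> L \<and>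
         (\<forall>b\<in>B. \<exists>b'\<in>B \<union> {\<zero>\<^bsub>V\<^esub>}. cong_mod_q V L (Et b) b') \<and>
         (\<forall>b\<in>B. \<exists>b'\<in>B \<union> {\<zero>\<^bsub>V\<^esub>}. cong_mod_q V L (Ft b) b') \<and>
         (\<forall>b\<in>B. \<forall>b'\<in>B. cong_mod_q V L (Et b) b' \<longleftrightarrow> cong_mod_q V L (Ft b') b))"


section \<open>The module \<open>\<and>\<^sup>1\<close> and its tensor powers\<close>

text \<open>The pair \<open>(i, j)\<close> stands for the basis vector \<open>z\<^sub>i\<^sub>,\<^sub>j\<close> of \<open>\<and>\<^sup>1\<close> and a word of length \<open>k\<close> for the
  corresponding tensor product of basis vectors. A vector is the function that gives its
  coordinates.\<close>

type_synonym letter = "nat \<times> nat"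

definition letters :: "nat \<Rightarrow> nat \<Rightarrow> letter set" where
  "letters m n = {1..m} \<times> {1..n}"

definition words :: "nat \<Rightarrow> nat \<Rightarrow> nat \<Rightarrow> letter list set" where
  "words m n k = {w. length w = k \<and> set w \<subseteq> letters m n}"

definition ket :: "'a \<Rightarrow> 'a \<Rightarrow> cq" where
  "ket a = (\<lambda>b. of_bool (b = a))"

definition tensor_space :: "nat \<Rightarrow> nat \<Rightarrow> nat \<Rightarrow> (cq, letter list \<Rightarrow> cq) module" where
  "tensor_space m n k =
    \<lparr>carrier = {u. \<forall>w. w \<notin> words m n k \<longrightarrow> u w = 0}, mult = undefined, one = undefined,
     zero = (\<lambda>w. 0), add = (\<lambda>u v w. u w + v w), smult = (\<lambda>c u w. c * u w)\<rparr>"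

text \<open>Images of the basis vectors of \<open>\<and>\<^sup>1\<close> under the generators.\<close>

primrec basis_actL :: "uq_gen \<Rightarrow> letter \<Rightarrow> letter \<Rightarrow> cq" where
  "basis_actL (GE i) = (\<lambda>(i', j'). if i' = Suc i then ket (i, j') else (\<lambda>_. 0))"
| "basis_actL (GF i) = (\<lambda>(i', j'). if i' = i then ket (Suc i, j') else (\<lambda>_. 0))"
| "basis_actL (GQ i) = (\<lambda>(i', j') b. qq powi (of_bool (i = i')) * ket (i', j') b)"
| "basis_actL (GQinv i) = (\<lambda>(i', j') b. qq powi (- of_bool (i = i')) * ket (i', j') b)"

primrec basis_actR :: "uq_gen \<Rightarrow> letter \<Rightarrow> letter \<Rightarrow> cq" where
  "basis_actR (GE j) = (\<lambda>(i', j'). if j' = Suc j then ket (i', j) else (\<lambda>_. 0))"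
| "basis_actR (GF j) = (\<lambda>(i', j'). if j' = j then ket (i', Suc j) else (\<lambda>_. 0))"
| "basis_actR (GQ j) = (\<lambda>(i', j') b. qq powi (of_bool (j = j')) * ket (i', j') b)"
| "basis_actR (GQinv j) = (\<lambda>(i', j') b. qq powi (- of_bool (j = j')) * ket (i', j') b)"

definition linear_extension ::
  "letter set \<Rightarrow> (letter \<Rightarrow> letter \<Rightarrow> cq) \<Rightarrow> (letter \<Rightarrow> cq) \<Rightarrow> letter \<Rightarrow> cq" where
  "linear_extension Z \<phi> u = (\<lambda>b. \<Sum>a\<in>Z. u a * \<phi> a b)"

text \<open>\<open>X \<otimes> id\<close> and \<open>id \<otimes> Y\<close> on \<open>\<and>\<^sup>1 \<otimes> (\<and>\<^sup>1)\<^bsup>\<otimes>k\<^esup>\<close>.\<close>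

definition on_head ::
  "((letter \<Rightarrow> cq) \<Rightarrow> letter \<Rightarrow> cq) \<Rightarrow> (letter list \<Rightarrow> cq) \<Rightarrow> letter list \<Rightarrow> cq" where
  "on_head X u = (\<lambda>w. case w of [] \<Rightarrow> 0 | a # w' \<Rightarrow> X (\<lambda>b. u (b # w')) a)"

definition on_tail ::
  "((letter list \<Rightarrow> cq) \<Rightarrow> letter list \<Rightarrow> cq) \<Rightarrow> (letter list \<Rightarrow> cq) \<Rightarrow> letter list \<Rightarrow> cq" where
  "on_tail Y u = (\<lambda>w. case w of [] \<Rightarrow> 0 | a # w' \<Rightarrow> Y (\<lambda>v. u (a # v)) w')"

text \<open>The action on the \<open>k\<close>-th tensor power through \<open>\<Delta> e\<^sub>i = e\<^sub>i \<otimes> 1 + q\<^bsup>-h\<^sub>i\<^esup> \<otimes> e\<^sub>i\<close>,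
  \<open>\<Delta> f\<^sub>i = f\<^sub>i \<otimes> q\<^bsup>h\<^sub>i\<^esup> + 1 \<otimes> f\<^sub>i\<close>, \<open>\<Delta> q\<^bsup>\<epsilon>\<^sub>i\<^esup> = q\<^bsup>\<epsilon>\<^sub>i\<^esup> \<otimes> q\<^bsup>\<epsilon>\<^sub>i\<^esup>\<close>, and through the counit for \<open>k = 0\<close>.\<close>

fun tensor_act ::
  "(uq_gen \<Rightarrow> (letter \<Rightarrow> cq) \<Rightarrow> letter \<Rightarrow> cq) \<Rightarrow> nat \<Rightarrow> uq_gen \<Rightarrow> (letter list \<Rightarrow> cq) \<Rightarrow> letter list \<Rightarrow> cq"
  where
  "tensor_act \<rho> 0 (GE i) u = (\<lambda>w. 0)"
| "tensor_act \<rho> 0 (GF i) u = (\<lambda>w. 0)"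
| "tensor_act \<rho> 0 (GQ i) u = u"
| "tensor_act \<rho> 0 (GQinv i) u = u"
| "tensor_act \<rho> (Suc k) (GE i) u =
    (\<lambda>w. on_head (\<rho> (GE i)) u w
       + on_head (act_qh_inv \<rho> i) (on_tail (tensor_act \<rho> k (GE i)) u) w)"
| "tensor_act \<rho> (Suc k) (GF i) u =
    (\<lambda>w. on_head (\<rho> (GF i))
           (on_tail (\<lambda>v. tensor_act \<rho> k (GQ i) (tensor_act \<rho> k (GQinv (Suc i)) v)) u) w
       + on_tail (tensor_act \<rho> k (GF i)) u w)"
| "tensor_act \<rho> (Suc k) (GQ i) u = on_head (\<rho> (GQ i)) (on_tail (tensor_act \<rho> k (GQ i)) u)"
| "tensor_act \<rho> (Suc k) (GQinv i) u =
    on_head (\<rho> (GQinv i)) (on_tail (tensor_act \<rho> k (GQinv i)) u)"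

definition tensor_actL ::
  "nat \<Rightarrow> nat \<Rightarrow> nat \<Rightarrow> uq_gen \<Rightarrow> (letter list \<Rightarrow> cq) \<Rightarrow> letter list \<Rightarrow> cq" where
  "tensor_actL m n = tensor_act (\<lambda>g. linear_extension (letters m n) (basis_actL g))"

definition tensor_actR ::
  "nat \<Rightarrow> nat \<Rightarrow> nat \<Rightarrow> uq_gen \<Rightarrow> (letter list \<Rightarrow> cq) \<Rightarrow> letter list \<Rightarrow> cq" where
  "tensor_actR m n = tensor_act (\<lambda>g. linear_extension (letters m n) (basis_actR g))"


section \<open>The module \<open>S\<^sub>k(X)\<close>\<close>

definition rel_generators :: "nat \<Rightarrow> nat \<Rightarrow> (letter list \<Rightarrow> cq) set" where
  "rel_generators m n =
    (if n \<ge> 2 then {\<lambda>w. qq * ket [(1, 1), (1, 2)] w - ket [(1, 2), (1, 1)] w} else {}) \<union>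
    (if m \<ge> 2 then {\<lambda>w. qq * ket [(1, 1), (2, 1)] w - ket [(2, 1), (1, 1)] w} else {})"

definition Im2 :: "nat \<Rightarrow> nat \<Rightarrow> (letter list \<Rightarrow> cq) set" where
  "Im2 m n = generated_submodule m n (tensor_space m n 2) (tensor_actL m n 2) (tensor_actR m n 2)
    (rel_generators m n)"

text \<open>The tensor \<open>p \<otimes> x \<otimes> s\<close> for words \<open>p\<close>, \<open>s\<close> and \<open>x \<in> \<and>\<^sup>1 \<otimes> \<and>\<^sup>1\<close>.\<close>

definition insert_between ::
  "letter list \<Rightarrow> (letter list \<Rightarrow> cq) \<Rightarrow> letter list \<Rightarrow> letter list \<Rightarrow> cq" where
  "insert_between p x s = (\<lambda>w.
    if take (length p) w = p \<and> drop (length p + 2) w = s then x (take 2 (drop (length p) w)) else 0)"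

text \<open>With \<open>t = length p + 1\<close> fixed, the tensors below span the submodule having \<open>Im2\<close> in the
  positions \<open>t, t + 1\<close>; the span over all \<open>t\<close> is the sum of these submodules.\<close>

definition rel_submodule :: "nat \<Rightarrow> nat \<Rightarrow> nat \<Rightarrow> (letter list \<Rightarrow> cq) set" where
  "rel_submodule m n k = LinearCombinations.module.span class_ring (tensor_space m n k)
    {insert_between p x s | p x s.
       \<exists>t r. p \<in> words m n t \<and> x \<in> Im2 m n \<and> s \<in> words m n r \<and> t + 2 + r = k}"

definition S_space :: "nat \<Rightarrow> nat \<Rightarrow> nat \<Rightarrow> (cq, (letter list \<Rightarrow> cq) set) module" where
  "S_space m n k = quotient_space (tensor_space m n k) (rel_submodule m n k)"

definition S_actL ::
  "nat \<Rightarrow> nat \<Rightarrow> nat \<Rightarrow> uq_gen \<Rightarrow> (letter list \<Rightarrow> cq) set \<Rightarrow> (letter list \<Rightarrow> cq) set" where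
  "S_actL m n k g = quotient_map (tensor_space m n k) (rel_submodule m n k) (tensor_actL m n k g)"

definition S_actR ::
  "nat \<Rightarrow> nat \<Rightarrow> nat \<Rightarrow> uq_gen \<Rightarrow> (letter list \<Rightarrow> cq) set \<Rightarrow> (letter list \<Rightarrow> cq) set" where
  "S_actR m n k g = quotient_map (tensor_space m n k) (rel_submodule m n k) (tensor_actR m n k g)"

text \<open>Matrices of non-negative integers with sum of entries \<open>k\<close>, extended by zero.\<close>

definition exponent_matrices :: "nat \<Rightarrow> nat \<Rightarrow> nat \<Rightarrow> (nat \<times> nat \<Rightarrow> nat) set" where
  "exponent_matrices m n k =
    {d. (\<forall>a. a \<notin> letters m n \<longrightarrow> d a = 0) \<and> (\<Sum>a\<in>letters m n. d a) = k}"

definition z_word :: "nat \<Rightarrow> nat \<Rightarrow> (nat \<times> nat \<Rightarrow> nat) \<Rightarrow> letter list" where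
  "z_word m n d =
    concat (map (\<lambda>j. concat (map (\<lambda>i. replicate (d (i, j)) (i, j)) [1..<Suc m])) [1..<Suc n])"

definition z_monomial ::
  "nat \<Rightarrow> nat \<Rightarrow> nat \<Rightarrow> (nat \<times> nat \<Rightarrow> nat) \<Rightarrow> (letter list \<Rightarrow> cq) set" where
  "z_monomial m n k d = rel_submodule m n k +>\<^bsub>tensor_space m n k\<^esub> ket (z_word m n d)"

end

theory Submission
  imports Defs
begin

text \<open>The monomials are shown to be a basis by the diamond lemma: left multiplication by the letters defines operators
  on the span of the sorted words which satisfy the quadratic relations, and sending a word to the product of
  its operators applied to the empty word gives a normal form whose kernel is the submodule of relations.

  For the crystal structure, fix two neighbouring rows (or columns). On the monomials with prescribed sums of the
  pairs of entries, \<open>E\<close> and \<open>F\<close> act as on a tensor product of irreducible \<open>U\<^sub>q(sl\<^sub>2)\<close>-modules. In a product of two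
  such modules, strings built from the highest weight vectors reduce modulo \<open>q\<close> to pure tensors; starting them
  instead from the lowest weight vectors gives the same up to a factor congruent to \<open>1\<close>, which covers both legs of
  the tensor product rule. By induction on the number of factors, the monomials are congruent modulo \<open>q\<close> to a basis of full strings,
  on which the Kashiwara operators are shifts. The basis change is congruent to the identity modulo \<open>q\<close>, hence
  invertible over \<open>A\<close>. Monomials in the other order of the letters have the same normal form, as the transposed
  pairs commute, so that both actions are treated alike.\<close>

text \<open>The submodule Im is known only through two generators, so it is bounded from both sides.
  From below, the lowering operators turn each generator into relations that mix two rows and two
  columns; the explicit relations come out of these after division by q^2 + 1. From above, all of Im
  satisfies a system of linear equations that is stable under both actions, and whatever obeys the
  straightening rules pairs to zero with its solutions.

  In a product of modules of dimensions A + 1 and B + 1, the orders at q = 0 along a string whose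
  top sits at depth s can be bounded only up to position r = B - s, the corner of the tensor product
  rule. That the continuation from below fits there rests on the weight space p + j = B, on which E
  F has one-dimensional eigenspaces.

  The Kashiwara operators are defined by a property of all string decompositions of weight vectors,
  so a basis of strings determines them only if the shifts respect decompositions with several
  components. This holds because a weight vector killed by E meets only strings of one
  length.\<close>

lemma qq_neq_0 [simp]: "qq \<noteq> 0"
  by (simp add: qq_def Fract_conv_to_fract)

lemma qq_pow_eq_Fract: "qq ^ n = Fract (monom 1 n) 1"
proof (induct n)
  case (Suc n)
  then show ?case by (simp add: qq_def monom_altdef)
qed (simp add: One_fract_def)

lemma qq_pow_inj: "qq ^ a = qq ^ b \<longleftrightarrow> a = b"
proof
  assume "qq ^ a = qq ^ b"
  then have "monom (1::complex) a = monom 1 b" by (simp add: qq_pow_eq_Fract eq_fract)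
  then show "a = b" by (metis degree_monom_eq one_neq_zero)
qed simp

lemma qq_powi_eq_1: "qq powi z = 1 \<longleftrightarrow> z = 0"
proof
  assume h: "qq powi z = 1"
  show "z = 0"
  proof (cases "z \<ge> 0")
    case True
    then have "qq ^ nat z = qq ^ 0" using h by (simp add: power_int_def)
    then show ?thesis using True by (simp only: qq_pow_inj)
  next
    case False
    then have "inverse (qq ^ nat (- z)) = 1" using h by (simp add: power_int_def power_inverse)
    then have "qq ^ nat (- z) = qq ^ 0" by (metis inverse_eq_1_iff power_0)
    then show ?thesis using False by (simp only: qq_pow_inj)
  qed
qed simp

lemma qq_powi_inj: "qq powi a = qq powi b \<longleftrightarrow> a = b"
proof
  assume "qq powi a = qq powi b"
  then have "qq powi (a - b) = 1" by (simp add: power_int_diff)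
  then show "a = b" by (simp add: qq_powi_eq_1)
qed simp

lemma qq_diff_inverse_neq_0 [simp]: "qq - inverse qq \<noteq> 0" "inverse qq - qq \<noteq> 0"
proof -
  have "qq powi 1 \<noteq> qq powi (-1)" by (simp only: qq_powi_inj)
  then show "qq - inverse qq \<noteq> 0" "inverse qq - qq \<noteq> 0" by auto
qed

lemma qq_neq_inverse [simp]: "qq \<noteq> inverse qq" "inverse qq \<noteq> qq"
  using qq_diff_inverse_neq_0 by auto

text \<open>This is the denominator met when the mixed quadratic relations are solved for the
  explicit ones; if it vanished, q would be a fourth root of unity.\<close>

lemma qq_plus_inverse_neq_0 [simp]: "qq\<^sup>2 + 1 \<noteq> 0" 
proof
  assume "qq\<^sup>2 + 1 = 0"
  then have "qq ^ 2 = - 1" by (simp add: eq_neg_iff_add_eq_0)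
  then have "qq ^ 4 = 1" by (metis (no_types) mult_2 numeral_Bit0 power2_eq_iff power2_eq_square power_add power_one square_eq_1_iff)
  then show False using qq_pow_inj[of 4 0] by simp
qed

subsection \<open>The local ring\<close>

abbreviation regq :: "cq set" ("\<A>") where "\<A> \<equiv> regular_at_0"

lemma regqI: "poly b 0 \<noteq> 0 \<Longrightarrow> Fract a b \<in> \<A>"
  unfolding regular_at_0_def by blast

lemma regqE:
  assumes "x \<in> \<A>" obtains a b where "x = Fract a b" "poly b 0 \<noteq> 0" "b \<noteq> 0"
  using assms unfolding regular_at_0_def by force

lemma regq_0 [simp]: "0 \<in> \<A>" and regq_1 [simp]: "1 \<in> \<A>" and regq_qq [simp]: "qq \<in> \<A>"
  unfolding Zero_fract_def One_fract_def qq_def by (rule regqI; simp)+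

lemma regq_add [simp]: "x \<in> \<A> \<Longrightarrow> y \<in> \<A> \<Longrightarrow> x + y \<in> \<A>"
  by (elim regqE) (simp, rule regqI, simp)

lemma regq_mult [simp]: "x \<in> \<A> \<Longrightarrow> y \<in> \<A> \<Longrightarrow> x * y \<in> \<A>"
  by (elim regqE) (simp, rule regqI, simp)

lemma regq_uminus [simp]: "x \<in> \<A> \<Longrightarrow> - x \<in> \<A>"
  by (elim regqE) (simp, rule regqI, simp)

lemma regq_diff [simp]: "x \<in> \<A> \<Longrightarrow> y \<in> \<A> \<Longrightarrow> x - y \<in> \<A>"
  using regq_add[of x "-y"] by simp

lemma regq_sum: "(\<And>i. i \<in> I \<Longrightarrow> f i \<in> \<A>) \<Longrightarrow> sum f I \<in> \<A>"
  by (induct I rule: infinite_finite_induct) auto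

lemma regq_power [simp]: "x \<in> \<A> \<Longrightarrow> x ^ n \<in> \<A>"
  by (induct n) auto

text \<open>The maximal ideal of the local ring; congruence modulo q of two coefficients means that
  their difference lies in it.\<close>

definition qideal :: "cq set" where "qideal = (*) qq ` \<A>"

lemma qidealI: "a \<in> \<A> \<Longrightarrow> qq * a \<in> qideal"
  by (simp add: qideal_def)

lemma qideal_subset: "x \<in> qideal \<Longrightarrow> x \<in> \<A>"
  by (auto simp: qideal_def)

lemma qideal_0 [simp]: "0 \<in> qideal"
  using qidealI[of 0] by simp

lemma qideal_add [simp]: "x \<in> qideal \<Longrightarrow> y \<in> qideal \<Longrightarrow> x + y \<in> qideal"
  unfolding qideal_def image_iff by (metis distrib_left regq_add)

lemma qideal_uminus [simp]: "x \<in> qideal \<Longrightarrow> - x \<in> qideal"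
  unfolding qideal_def image_iff by (metis mult_minus_right regq_uminus)

lemma qideal_diff [simp]: "x \<in> qideal \<Longrightarrow> y \<in> qideal \<Longrightarrow> x - y \<in> qideal"
  using qideal_add[of x "-y"] by simp

lemma qideal_mult: "x \<in> qideal \<Longrightarrow> y \<in> \<A> \<Longrightarrow> x * y \<in> qideal" "x \<in> \<A> \<Longrightarrow> y \<in> qideal \<Longrightarrow> x * y \<in> qideal"
  unfolding qideal_def image_iff by (metis mult.assoc mult.left_commute regq_mult)+

lemma qideal_sum: "(\<And>i. i \<in> I \<Longrightarrow> f i \<in> qideal) \<Longrightarrow> sum f I \<in> qideal"
  by (induct I rule: infinite_finite_induct) auto

text \<open>An equation 1 = q a / b would give b = q a, whose constant term is zero.\<close>

lemma one_notin_qideal [simp]: "1 \<notin> qideal"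
proof
  assume "1 \<in> qideal"
  then obtain x where x: "x \<in> \<A>" "1 = qq * x" by (auto simp: qideal_def)
  from x(1) obtain a b where ab: "x = Fract a b" "poly b 0 \<noteq> 0" "b \<noteq> 0" by (rule regqE)
  have "b = [:0, 1:] * a" using x(2) ab by (simp add: qq_def One_fract_def eq_fract)
  then have "poly b 0 = 0" by simp
  then show False using ab by simp
qed

lemma qideal_shift: "x - y \<in> qideal \<Longrightarrow> (x \<in> qideal \<longleftrightarrow> y \<in> qideal)"
  using qideal_add[of "x - y" y] qideal_diff[of x "x - y"] by auto

text \<open>One plus the maximal ideal. Leading coefficients are controlled only up to this
  multiplicative group, which suffices for congruences modulo q.\<close>

definition unit1 :: "cq set" where "unit1 = {x. x - 1 \<in> qideal}"

lemma unit1_1 [simp]: "1 \<in> unit1" by (simp add: unit1_def)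

lemma unit1_regq: "x \<in> unit1 \<Longrightarrow> x \<in> \<A>"
  using regq_add[of "x - 1" 1] qideal_subset[of "x - 1"] by (simp add: unit1_def)

lemma unit1_neq_0: "x \<in> unit1 \<Longrightarrow> x \<noteq> 0"
  using qideal_uminus[of "-1"] by (auto simp: unit1_def)

lemma unit1_mult: "x \<in> unit1 \<Longrightarrow> y \<in> unit1 \<Longrightarrow> x * y \<in> unit1"
proof -
  assume a: "x \<in> unit1" "y \<in> unit1"
  have e: "x * y - 1 = (x - 1) * y + (y - 1)" by (simp add: algebra_simps)
  have "x * y - 1 \<in> qideal" unfolding e
    using a by (intro qideal_add qideal_mult(1)) (simp_all add: unit1_def unit1_regq)
  then show ?thesis by (simp add: unit1_def)
qed

text \<open>Such an element is a fraction whose numerator and denominator have the same nonzero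
  constant term, so the inverted fraction is again regular at 0.\<close>

lemma unit1_inverse: assumes "x \<in> unit1" shows "inverse x \<in> unit1"
proof -
  obtain a where a: "a \<in> \<A>" "x - 1 = qq * a" using assms by (auto simp: unit1_def qideal_def)
  from a(1) obtain n d where nd: "a = Fract n d" "poly d 0 \<noteq> 0" "d \<noteq> 0" by (rule regqE)
  have x: "x = Fract (d + [:0, 1:] * n) d"
    using a(2) nd by (simp add: qq_def One_fract_def diff_eq_eq add.commute)
  have p: "poly (d + [:0, 1:] * n) 0 \<noteq> 0" using nd by simp
  then have r: "inverse x \<in> \<A>" unfolding x by (simp only: inverse_fract) (rule regqI)
  have x0: "x \<noteq> 0" using assms by (rule unit1_neq_0)
  then have "inverse x - 1 = - (x - 1) * inverse x" by (simp add: field_simps)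
  then show ?thesis using assms r qideal_mult(1)[of "-(x - 1)" "inverse x"] qideal_uminus[of "x - 1"]
    by (simp add: unit1_def)
qed

lemma unit1_divide: "x \<in> unit1 \<Longrightarrow> y \<in> unit1 \<Longrightarrow> x / y \<in> unit1"
  by (simp add: divide_inverse unit1_mult unit1_inverse)

lemma unit1_prod: "(\<And>i. i \<in> I \<Longrightarrow> f i \<in> unit1) \<Longrightarrow> prod f I \<in> unit1"
  by (induct I rule: infinite_finite_induct) (auto intro: unit1_mult)

lemma unit1_add_qideal: "x \<in> unit1 \<Longrightarrow> y \<in> qideal \<Longrightarrow> x + y \<in> unit1"
  using qideal_add[of "x - 1" y] by (simp add: unit1_def algebra_simps)

subsection \<open>Quantum integers\<close>

text \<open>The symmetric quantum integer for all integers, so that identities between weights need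
  no case distinction on signs.\<close>

definition qi :: "int \<Rightarrow> cq" where
  "qi z = (qq powi z - qq powi (- z)) / (qq - inverse qq)"

text \<open>The unbalanced quantum integer (1 - q^(2n)) / (1 - q^2). For n > 0 it lies in
  \<open>unit1\<close>, whereas \<open>qi n\<close> has order 1 - n at q = 0.\<close>

definition qn :: "nat \<Rightarrow> cq" where
  "qn n = (\<Sum>t<n. qq ^ (2 * t))"

lemma qint_qi: "qint n = qi (int n)"
  by (simp add: qint_def qi_def power_int_minus power_inverse)

lemma qi_0 [simp]: "qi 0 = 0" by (simp add: qi_def)

lemma qi_1 [simp]: "qi 1 = 1" by (simp add: qi_def)

lemma qi_neq_0: "z \<noteq> 0 \<Longrightarrow> qi z \<noteq> 0"
  using qq_powi_inj[of z "-z"] by (simp add: qi_def)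

lemma qn_0 [simp]: "qn 0 = 0" by (simp add: qn_def)

lemma qn_Suc: "qn (Suc n) = 1 + qq\<^sup>2 * qn n"
  unfolding qn_def sum.lessThan_Suc_shift by (simp add: sum_distrib_left power2_eq_square ac_simps)

lemma qn_Suc_unit1: "qn (Suc n) \<in> unit1"
proof -
  have "qn n \<in> \<A>" unfolding qn_def by (rule regq_sum) simp
  then have "qq * (qq * qn n) \<in> qideal" by (intro qidealI) simp
  then show ?thesis by (simp add: unit1_def qn_Suc power2_eq_square ac_simps)
qed

lemma qn_unit1: "n > 0 \<Longrightarrow> qn n \<in> unit1"
  by (cases n) (auto simp: qn_Suc_unit1)

lemma qi_int: "qi (int n) = qq powi (1 - int n) * qn n"
proof (induct n)
  case (Suc n)
  have e: "qq powi (1 - int n) * qn n * (qq - inverse qq) = qq powi (int n) - qq powi (- int n)"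
    unfolding Suc[symmetric] by (simp add: qi_def)
  have "qq powi (1 - int (Suc n)) * qn (Suc n) * (qq - inverse qq)
      = qq powi (- int n) * (qq - inverse qq) + qq * (qq powi (1 - int n) * qn n * (qq - inverse qq))"
    by (simp add: qn_Suc power_int_diff power_int_minus power2_eq_square field_simps)
  also have "\<dots> = qq powi (int (Suc n)) - qq powi (- int (Suc n))"
    unfolding e by (simp add: power_int_add power_int_diff power_int_minus field_simps)
  finally have "qi (int (Suc n)) * (qq - inverse qq) = qq powi (1 - int (Suc n)) * qn (Suc n) * (qq - inverse qq)"
    by (simp only: qi_def) simp
  then show ?case using qq_diff_inverse_neq_0(1) by (simp only: mult_cancel_right) blast
qed simp

section \<open>Straightening operators on sorted words\<close>

definition lt_letter :: "letter \<Rightarrow> letter \<Rightarrow> bool" where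
  "lt_letter b a \<longleftrightarrow> snd b < snd a \<or> snd b = snd a \<and> fst b < fst a"

text \<open>With b before a in column order, all quadratic relations read z_a z_b =
  \<open>al a b\<close> z_b z_a + \<open>be a b\<close> z_(\<open>crossing a b\<close>)
  z_(\<open>crossing b a\<close>).\<close>

definition al :: "letter \<Rightarrow> letter \<Rightarrow> cq" where
  "al a b = (if fst a = fst b \<or> snd a = snd b then qq else 1)"

definition be :: "letter \<Rightarrow> letter \<Rightarrow> cq" where
  "be a b = (if fst b < fst a \<and> snd b < snd a then qq - inverse qq else 0)"

definition crossing :: "letter \<Rightarrow> letter \<Rightarrow> letter" where
  "crossing a b = (fst a, snd b)"

definition nwords :: "nat \<Rightarrow> nat \<Rightarrow> nat \<Rightarrow> letter list set" where
  "nwords m n k = {w \<in> words m n k. sorted_wrt (\<lambda>x y. \<not> lt_letter y x) w}"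

lemma finite_letters [simp]: "finite (letters m n)"
  by (simp add: letters_def)

lemma finite_words [simp]: "finite (words m n k)"
  using finite_lists_length_eq[of "letters m n" k] by (simp add: words_def conj_commute)

lemma finite_nwords [simp]: "finite (nwords m n k)"
  by (simp add: nwords_def)

lemma length_nwords: "w \<in> nwords m n k \<Longrightarrow> length w = k"
  by (simp add: nwords_def words_def)

text \<open>The coefficient of the sorted word v in the normal form of z_a times the sorted word w.
  In each recursive call the word is shorter, or it has the same length and the letter in front is
  smaller in column order; summing over sorted words of known length makes this visible. The guard
  repeats the support of \<open>be\<close>, since without it \<open>crossing a b\<close> may be a
  itself.\<close>

function zc :: "nat \<Rightarrow> nat \<Rightarrow> letter \<Rightarrow> letter list \<Rightarrow> letter list \<Rightarrow> cq" where
  "zc m n a [] v = of_bool (v = [a])"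
| "zc m n a (b # w) v =
    (if lt_letter b a
     then al a b * (\<Sum>w'\<in>nwords m n (Suc (length w)). zc m n a w w' * zc m n b w' v) +
       (if fst b < fst a \<and> snd b < snd a
        then be a b * (\<Sum>w'\<in>nwords m n (Suc (length w)). zc m n (crossing b a) w w' * zc m n (crossing a b) w' v)
        else 0)
     else of_bool (v = a # b # w))"
  by pat_completeness auto
termination
  by (relation "measures [\<lambda>(m, n, a, w, v). length w, \<lambda>(m, n, a, w, v). snd a, \<lambda>(m, n, a, w, v). fst a]")
    (auto simp: lt_letter_def length_nwords crossing_def)

text \<open>Left multiplication by z_a. No degree parameter is needed, as multiplication raises the
  length by one. At v = [] the truncated subtraction leaves w = [] only, and its coefficient there
  is 0.\<close>

definition ZZ :: "nat \<Rightarrow> nat \<Rightarrow> letter \<Rightarrow> (letter list \<Rightarrow> cq) \<Rightarrow> letter list \<Rightarrow> cq" where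
  "ZZ m n a u v = (\<Sum>w\<in>nwords m n (length v - 1). u w * zc m n a w v)"

lemma zc_length: "zc m n a w v \<noteq> 0 \<Longrightarrow> length v = Suc (length w)"
proof (induction m n a w v rule: zc.induct)
  case (2 m n a b w v)
  show ?case
  proof (cases "lt_letter b a")
    case True
    show ?thesis
    proof (rule ccontr)
      assume ne: "\<not> ?thesis"
      have "zc m n x w' v = 0" if "w' \<in> nwords m n (Suc (length w))"
        "x = b \<or> x = crossing a b \<and> fst b < fst a \<and> snd b < snd a" for x w'
      proof (rule ccontr)
        assume "zc m n x w' v \<noteq> 0"
        then have "length v = Suc (length w')"
          using that(2) 2(2)[OF True that(1)] 2(4)[OF True _ that(1)] by blast
        then show False using ne length_nwords[OF that(1)] by simp
      qed
      then have "zc m n a (b # w) v = 0" using True by (simp cong: if_cong)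
      then show False using 2(5) by simp
    qed
  next
    case False
    then show ?thesis using 2(5) by (simp split: if_splits)
  qed
qed (simp split: if_splits)

lemma ZZ_add: "ZZ m n a (\<lambda>w. f w + g w) = (\<lambda>w. ZZ m n a f w + ZZ m n a g w)"
  by (rule ext) (simp add: ZZ_def distrib_right sum.distrib)

lemma ZZ_cmult: "ZZ m n a (\<lambda>w. c * f w) = (\<lambda>w. c * ZZ m n a f w)"
  by (rule ext) (simp add: ZZ_def sum_distrib_left mult.assoc)

lemma ZZ_0 [simp]: "ZZ m n a (\<lambda>w. 0) = (\<lambda>w. 0)"
  by (rule ext) (simp add: ZZ_def)

lemma ZZ_ket: "w \<in> nwords m n k \<Longrightarrow> ZZ m n a (ket w) = zc m n a w"
proof (rule ext)
  fix v
  assume w: "w \<in> nwords m n k"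
  have k: "k = length w" using w by (simp add: length_nwords)
  have "ZZ m n a (ket w) v = (\<Sum>x\<in>nwords m n (length v - 1). if x = w then zc m n a x v else 0)"
    unfolding ZZ_def by (intro sum.cong) (auto simp: ket_def)
  also have "\<dots> = (if w \<in> nwords m n (length v - 1) then zc m n a w v else 0)"
    by simp
  also have "\<dots> = zc m n a w v"
    using w zc_length[of m n a w v] unfolding k by (cases "zc m n a w v = 0") auto
  finally show "ZZ m n a (ket w) v = zc m n a w v" .
qed

lemma ZZ_expand: "ZZ m n a u v = (\<Sum>w\<in>nwords m n (length v - 1). u w * ZZ m n a (ket w) v)"
  unfolding ZZ_def[of m n a u] by (intro sum.cong refl) (simp add: ZZ_ket)

lemma nwords_Nil: "[] \<in> nwords m n 0"
  by (simp add: nwords_def words_def)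

lemma nwords_Cons: "a # w \<in> nwords m n (Suc k) \<longleftrightarrow>
    a \<in> letters m n \<and> w \<in> nwords m n k \<and> (\<forall>b\<in>set w. \<not> lt_letter b a)"
  by (auto simp: nwords_def words_def)

lemma ZZ_Nil: "ZZ m n a (ket []) = ket [a]"
  unfolding ZZ_ket[OF nwords_Nil] by (rule ext) (simp add: ket_def)

lemma lt_letter_trans: "\<not> lt_letter y x \<Longrightarrow> \<not> lt_letter z y \<Longrightarrow> \<not> lt_letter z x"
  by (auto simp: lt_letter_def)

lemma ZZ_ket_Cons:
  assumes "\<forall>b\<in>set w. \<not> lt_letter b a" "w \<in> nwords m n k"
  shows "ZZ m n a (ket w) = ket (a # w)"
  unfolding ZZ_ket[OF assms(2)] by (cases w) (use assms(1) in \<open>auto simp: ket_def fun_eq_iff\<close>)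

text \<open>Turns the recursion of \<open>zc\<close> into an identity of operators. The gap to close
  is the range of summation: \<open>zc\<close> takes it from w, \<open>ZZ\<close> from the argument
  v, and where the lengths do not match all terms vanish.\<close>

lemma ZZ_ket_rewrite:
  assumes "b # w \<in> nwords m n (Suc k)" "lt_letter b a"
  shows "ZZ m n a (ket (b # w)) = (\<lambda>v. al a b * ZZ m n b (ZZ m n a (ket w)) v +
    be a b * ZZ m n (crossing a b) (ZZ m n (crossing b a) (ket w)) v)"
proof (rule ext)
  fix v
  have w: "w \<in> nwords m n k" and l: "length w = k" using assms length_nwords[of w m n k] by (simp_all add: nwords_Cons)
  have z: "ZZ m n x (ket w) w' = zc m n x w w'" for x w' using w by (simp add: ZZ_ket)
  have e: "(\<Sum>w'\<in>nwords m n (Suc (length w)). zc m n x w w' * zc m n y w' v) = ZZ m n y (ZZ m n x (ket w)) v" for x y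
  proof (cases "length v = Suc (Suc k)")
    case True then show ?thesis by (simp add: ZZ_def[of m n y] z l)
  next
    case False
    have "zc m n x w w' * zc m n y w' v = 0" for w'
    proof (cases "zc m n x w w' = 0")
      case F: False
      have "zc m n y w' v = 0"
        using zc_length[of m n y w' v] zc_length[OF F] l False by metis
      then show ?thesis by simp
    qed simp
    then show ?thesis by (simp add: ZZ_def[of m n y] z)
  qed
  show "ZZ m n a (ket (b # w)) v = al a b * ZZ m n b (ZZ m n a (ket w)) v +
    be a b * ZZ m n (crossing a b) (ZZ m n (crossing b a) (ket w)) v"
    using assms(2) unfolding ZZ_ket[OF assms(1)] zc.simps e by (simp add: be_def)
qed

lemma zc_support:
  "a \<in> letters m n \<Longrightarrow> w \<in> nwords m n k \<Longrightarrow> zc m n a w v \<noteq> 0 \<Longrightarrow> v \<in> nwords m n (Suc k)"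
proof (induction m n a w v arbitrary: k rule: zc.induct)
  case (2 m n a b w v)
  obtain k' where k: "k = Suc k'" using 2(6) length_nwords by (cases k) fastforce+
  have bw: "b \<in> letters m n" "w \<in> nwords m n k'" "length w = k'"
    using 2(6) unfolding k by (auto simp: nwords_Cons length_nwords)
  have cr: "crossing a b \<in> letters m n" using 2(5) bw by (auto simp: crossing_def letters_def)
  show ?case
  proof (cases "lt_letter b a")
    case True
    show ?thesis
    proof (rule ccontr)
      assume ne: "\<not> ?thesis"
      have "zc m n x w' v = 0" if "w' \<in> nwords m n (Suc (length w))"
        "x = b \<or> x = crossing a b \<and> fst b < fst a \<and> snd b < snd a" for x w'
        using 2(2)[OF True that(1), of k] 2(4)[OF True _ that(1), of k] ne bw cr that k by auto
      then have "zc m n a (b # w) v = 0" using True by (simp cong: if_cong)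
      then show False using 2(7) by simp
    qed
  next
    case False
    then have v: "v = a # b # w" using 2(7) by (simp split: if_splits)
    have "\<not> lt_letter x a" if "x \<in> set w" for x
      using 2(6) that False lt_letter_trans unfolding k nwords_Cons by blast
    then show ?thesis using 2(5,6) False unfolding v k nwords_Cons by simp
  qed
qed (auto simp: nwords_Cons nwords_def words_def split: if_splits)

lemma ZZ_support:
  assumes "a \<in> letters m n" "ZZ m n a u v \<noteq> 0"
  shows "v \<in> nwords m n (length v)"
proof -
  obtain w where w: "w \<in> nwords m n (length v - 1)" "u w * zc m n a w v \<noteq> 0"
    using assms(2) unfolding ZZ_def by (rule sum.not_neutral_contains_not_neutral)
  then have z: "zc m n a w v \<noteq> 0" by simp
  have "length v = Suc (length v - 1)" using zc_length[OF z] by simp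
  then show ?thesis using zc_support[OF assms(1) w(1) z] by simp
qed

text \<open>Homogeneity alone, without sortedness: \<open>ZZ\<close> reads only the coordinates at
  sorted words anyway.\<close>

definition degree_supp :: "nat \<Rightarrow> (letter list \<Rightarrow> cq) \<Rightarrow> bool" where
  "degree_supp k u \<longleftrightarrow> (\<forall>v. length v \<noteq> k \<longrightarrow> u v = 0)"

lemma degree_supp_ZZ:
  assumes "degree_supp k u"
  shows "degree_supp (Suc k) (ZZ m n a u)"
  unfolding degree_supp_def
proof (intro allI impI)
  fix v :: "letter list"
  assume v: "length v \<noteq> Suc k"
  have "u w * zc m n a w v = 0" for w
    using assms v zc_length[of m n a w v] unfolding degree_supp_def by (metis mult_zero_left mult_zero_right)
  then show "ZZ m n a u v = 0" by (simp add: ZZ_def)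
qed

definition straight :: "nat \<Rightarrow> nat \<Rightarrow> (letter list \<Rightarrow> cq) \<Rightarrow> letter \<Rightarrow> letter \<Rightarrow> bool" where
  "straight m n u a b \<longleftrightarrow> ZZ m n a (ZZ m n b u) = (\<lambda>v. al a b * ZZ m n b (ZZ m n a u) v +
    be a b * ZZ m n (crossing a b) (ZZ m n (crossing b a) u) v)"

text \<open>The straightening rule in its four positions, as rewrite rules between functions. The
  factor 1 in the commuting case keeps the equation from being permutative, so that it is applied
  from left to right.\<close>

lemma straight_rules:
  "straight m n u (i, j) (i, j') \<Longrightarrow>
    ZZ m n (i, j) (ZZ m n (i, j') u) = (\<lambda>v. qq * ZZ m n (i, j') (ZZ m n (i, j) u) v)"
  "straight m n u (i, j) (i', j) \<Longrightarrow>
    ZZ m n (i, j) (ZZ m n (i', j) u) = (\<lambda>v. qq * ZZ m n (i', j) (ZZ m n (i, j) u) v)"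
  "straight m n u (i, j) (i', j') \<Longrightarrow> i < i' \<Longrightarrow> j' < j \<Longrightarrow>
    ZZ m n (i, j) (ZZ m n (i', j') u) = (\<lambda>v. 1 * ZZ m n (i', j') (ZZ m n (i, j) u) v)"
  "straight m n u (i, j) (i', j') \<Longrightarrow> i' < i \<Longrightarrow> j' < j \<Longrightarrow>
    ZZ m n (i, j) (ZZ m n (i', j') u) =
     (\<lambda>v. ZZ m n (i', j') (ZZ m n (i, j) u) v + (qq - inverse qq) * ZZ m n (i, j') (ZZ m n (i', j) u) v)"
  by (auto simp: straight_def al_def be_def crossing_def)

lemma qq_cancel: "qq * (inverse qq * x) = x"
  by simp

section \<open>Resolution of the overlaps of three letters\<close>

context
  fixes m n k :: nat and u :: "letter list \<Rightarrow> cq" and a1 a2 b1 b2 d1 d2 :: nat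
  assumes u: "degree_supp k u"
    and H1: "\<And>x y. x \<in> letters m n \<Longrightarrow> y \<in> letters m n \<Longrightarrow> lt_letter y x \<Longrightarrow> straight m n u x y"
    and H2: "\<And>u x y. degree_supp (Suc k) u \<Longrightarrow> x \<in> letters m n \<Longrightarrow> y \<in> letters m n \<Longrightarrow> lt_letter y x \<Longrightarrow>
      lt_letter y (b1, b2) \<or> y = (b1, b2) \<and> lt_letter x (a1, a2) \<Longrightarrow> straight m n u x y"
    and L: "(a1, a2) \<in> letters m n" "(b1, b2) \<in> letters m n" "(d1, d2) \<in> letters m n"
begin

lemma mixed_letters: "(i, j) \<in> letters m n" if "i \<in> {a1, b1, d1}" "j \<in> {a2, b2, d2}"
  using L that by (auto simp: letters_def)

lemmas low_rules = straight_rules[OF H1]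
lemmas high_rules = straight_rules[OF H2[OF degree_supp_ZZ[OF u]]]

text \<open>The letters d before b before a have 24 relative positions: one if all columns agree,
  five if exactly a and b share a column, five if exactly b and d do, and thirteen weak orders of
  the rows if the columns are distinct. In each of them both sides are reduced by the relations on u
  and by those for smaller pairs one degree higher, and the results are compared as expressions in q
  and its inverse.\<close>

lemma straight_case0: "straight m n (ZZ m n (d1, d2) u) (a1, a2) (b1, b2)" if "b1 < a1" "d1 < a1" "d1 < b1" "b2 = a2" "d2 = b2"
    unfolding straight_def al_def be_def crossing_def using that
    by -
      (simp add: low_rules high_rules mixed_letters lt_letter_def ZZ_add ZZ_cmult; (rule ext; (simp add: algebra_simps; fail | simp add: field_simps; fail))?)
lemma straight_case1: "straight m n (ZZ m n (d1, d2) u) (a1, a2) (b1, b2)" if "b1 < a1" "d1 < a1" "b1 = d1" "b2 = a2" "d2 < b2"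
    unfolding straight_def al_def be_def crossing_def using that
    by -
      (simp add: low_rules high_rules mixed_letters lt_letter_def ZZ_add ZZ_cmult; (rule ext; (simp add: algebra_simps; fail | simp add: field_simps; fail))?)
lemma straight_case2: "straight m n (ZZ m n (d1, d2) u) (a1, a2) (b1, b2)" if "b1 < a1" "a1 = d1" "b1 < d1" "b2 = a2" "d2 < b2"
    unfolding straight_def al_def be_def crossing_def using that
    by -
      (simp add: low_rules high_rules mixed_letters lt_letter_def ZZ_add ZZ_cmult; (rule ext; (simp add: algebra_simps; fail | simp add: field_simps; fail))?)
lemma straight_case3: "straight m n (ZZ m n (d1, d2) u) (a1, a2) (b1, b2)" if "b1 < a1" "a1 < d1" "b1 < d1" "b2 = a2" "d2 < b2"
    unfolding straight_def al_def be_def crossing_def using that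
    by -
      (simp add: low_rules high_rules mixed_letters lt_letter_def ZZ_add ZZ_cmult; (rule ext; (simp add: algebra_simps; fail | simp add: field_simps; fail))?)
lemma straight_case4: "straight m n (ZZ m n (d1, d2) u) (a1, a2) (b1, b2)" if "b1 < a1" "d1 < a1" "b1 < d1" "b2 = a2" "d2 < b2"
    unfolding straight_def al_def be_def crossing_def using that
    by -
      (simp add: low_rules high_rules mixed_letters lt_letter_def ZZ_add ZZ_cmult; (rule ext; (simp add: algebra_simps; fail | simp add: field_simps; fail))?)
lemma straight_case5: "straight m n (ZZ m n (d1, d2) u) (a1, a2) (b1, b2)" if "b1 < a1" "d1 < a1" "d1 < b1" "b2 = a2" "d2 < b2"
    unfolding straight_def al_def be_def crossing_def using that
    by -
      (simp add: low_rules high_rules mixed_letters lt_letter_def ZZ_add ZZ_cmult; (rule ext; (simp add: algebra_simps; fail | simp add: field_simps; fail))?)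
lemma straight_case6: "straight m n (ZZ m n (d1, d2) u) (a1, a2) (b1, b2)" if "a1 < b1" "a1 = d1" "d1 < b1" "b2 < a2" "d2 = b2"
    unfolding straight_def al_def be_def crossing_def using that
    by -
      (simp add: low_rules high_rules mixed_letters lt_letter_def ZZ_add ZZ_cmult; (rule ext; (simp add: algebra_simps; fail | simp add: field_simps; fail))?)
lemma straight_case7: "straight m n (ZZ m n (d1, d2) u) (a1, a2) (b1, b2)" if "a1 < b1" "a1 < d1" "d1 < b1" "b2 < a2" "d2 = b2"
    unfolding straight_def al_def be_def crossing_def using that
    by -
      (simp add: low_rules high_rules mixed_letters lt_letter_def ZZ_add ZZ_cmult; (rule ext; (simp add: algebra_simps; fail | simp add: field_simps; fail))?)
lemma straight_case8: "straight m n (ZZ m n (d1, d2) u) (a1, a2) (b1, b2)" if "a1 = b1" "d1 < a1" "d1 < b1" "b2 < a2" "d2 = b2"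
    unfolding straight_def al_def be_def crossing_def using that
    by -
      (simp add: low_rules high_rules mixed_letters lt_letter_def ZZ_add ZZ_cmult; (rule ext; (simp add: algebra_simps; fail | simp add: field_simps; fail))?)
lemma straight_case9: "straight m n (ZZ m n (d1, d2) u) (a1, a2) (b1, b2)" if "a1 < b1" "d1 < a1" "d1 < b1" "b2 < a2" "d2 = b2"
    unfolding straight_def al_def be_def crossing_def using that
    by -
      (simp add: low_rules high_rules mixed_letters lt_letter_def ZZ_add ZZ_cmult; (rule ext; (simp add: algebra_simps; fail | simp add: field_simps; fail))?)
lemma straight_case10: "straight m n (ZZ m n (d1, d2) u) (a1, a2) (b1, b2)" if "b1 < a1" "d1 < a1" "d1 < b1" "b2 < a2" "d2 = b2"
    unfolding straight_def al_def be_def crossing_def using that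
    by -
      (simp add: low_rules high_rules mixed_letters lt_letter_def ZZ_add ZZ_cmult; (rule ext; (simp add: algebra_simps; fail | simp add: field_simps; fail))?)
lemma straight_case11: "straight m n (ZZ m n (d1, d2) u) (a1, a2) (b1, b2)" if "a1 = b1" "a1 = d1" "b1 = d1" "b2 < a2" "d2 < b2"
    unfolding straight_def al_def be_def crossing_def using that
    by -
      (simp add: low_rules high_rules mixed_letters lt_letter_def ZZ_add ZZ_cmult; (rule ext; (simp add: algebra_simps; fail | simp add: field_simps; fail))?)
lemma straight_case12: "straight m n (ZZ m n (d1, d2) u) (a1, a2) (b1, b2)" if "a1 = b1" "a1 < d1" "b1 < d1" "b2 < a2" "d2 < b2"
    unfolding straight_def al_def be_def crossing_def using that
    by -
      (simp add: low_rules high_rules mixed_letters lt_letter_def ZZ_add ZZ_cmult; (rule ext; (simp add: algebra_simps; fail | simp add: field_simps; fail))?)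
lemma straight_case13: "straight m n (ZZ m n (d1, d2) u) (a1, a2) (b1, b2)" if "a1 < b1" "a1 = d1" "d1 < b1" "b2 < a2" "d2 < b2"
    unfolding straight_def al_def be_def crossing_def using that
    by -
      (simp add: low_rules high_rules mixed_letters lt_letter_def ZZ_add ZZ_cmult; (rule ext; (simp add: algebra_simps; fail | simp add: field_simps; fail))?)
lemma straight_case14: "straight m n (ZZ m n (d1, d2) u) (a1, a2) (b1, b2)" if "a1 < b1" "a1 < d1" "b1 = d1" "b2 < a2" "d2 < b2"
    unfolding straight_def al_def be_def crossing_def using that
    by -
      (simp add: low_rules high_rules mixed_letters lt_letter_def ZZ_add ZZ_cmult; (rule ext; (simp add: algebra_simps; fail | simp add: field_simps; fail))?)
lemma straight_case15: "straight m n (ZZ m n (d1, d2) u) (a1, a2) (b1, b2)" if "a1 < b1" "a1 < d1" "b1 < d1" "b2 < a2" "d2 < b2"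
    unfolding straight_def al_def be_def crossing_def using that
    by -
      (simp add: low_rules high_rules mixed_letters lt_letter_def ZZ_add ZZ_cmult; (rule ext; (simp add: algebra_simps; fail | simp add: field_simps; fail))?)
lemma straight_case16: "straight m n (ZZ m n (d1, d2) u) (a1, a2) (b1, b2)" if "a1 < b1" "a1 < d1" "d1 < b1" "b2 < a2" "d2 < b2"
    unfolding straight_def al_def be_def crossing_def using that
    by -
      (simp add: low_rules high_rules mixed_letters lt_letter_def ZZ_add ZZ_cmult; (rule ext; (simp add: algebra_simps; fail | simp add: field_simps; fail))?)
lemma straight_case17: "straight m n (ZZ m n (d1, d2) u) (a1, a2) (b1, b2)" if "b1 < a1" "d1 < a1" "b1 = d1" "b2 < a2" "d2 < b2"
    unfolding straight_def al_def be_def crossing_def using that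
    by -
      (simp add: low_rules high_rules mixed_letters lt_letter_def ZZ_add ZZ_cmult; (rule ext; (simp add: algebra_simps; fail | simp add: field_simps; fail))?)
lemma straight_case18: "straight m n (ZZ m n (d1, d2) u) (a1, a2) (b1, b2)" if "b1 < a1" "a1 = d1" "b1 < d1" "b2 < a2" "d2 < b2"
    unfolding straight_def al_def be_def crossing_def using that
    by -
      (simp add: low_rules high_rules mixed_letters lt_letter_def ZZ_add ZZ_cmult; (rule ext; (simp add: algebra_simps; fail | simp add: field_simps; fail))?)
lemma straight_case19: "straight m n (ZZ m n (d1, d2) u) (a1, a2) (b1, b2)" if "b1 < a1" "a1 < d1" "b1 < d1" "b2 < a2" "d2 < b2"
    unfolding straight_def al_def be_def crossing_def using that
    by -
      (simp add: low_rules high_rules mixed_letters lt_letter_def ZZ_add ZZ_cmult; (rule ext; (simp add: algebra_simps; fail | simp add: field_simps; fail))?)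
lemma straight_case20: "straight m n (ZZ m n (d1, d2) u) (a1, a2) (b1, b2)" if "a1 = b1" "d1 < a1" "d1 < b1" "b2 < a2" "d2 < b2"
    unfolding straight_def al_def be_def crossing_def using that
    by -
      (simp add: low_rules high_rules mixed_letters lt_letter_def ZZ_add ZZ_cmult; (rule ext; (simp add: algebra_simps; fail | simp add: field_simps; fail))?)
lemma straight_case21: "straight m n (ZZ m n (d1, d2) u) (a1, a2) (b1, b2)" if "a1 < b1" "d1 < a1" "d1 < b1" "b2 < a2" "d2 < b2"
    unfolding straight_def al_def be_def crossing_def using that
    by -
      (simp add: low_rules high_rules mixed_letters lt_letter_def ZZ_add ZZ_cmult; (rule ext; (simp add: algebra_simps; fail | simp add: field_simps; fail))?)
lemma straight_case22: "straight m n (ZZ m n (d1, d2) u) (a1, a2) (b1, b2)" if "b1 < a1" "d1 < a1" "b1 < d1" "b2 < a2" "d2 < b2"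
    unfolding straight_def al_def be_def crossing_def using that
    by -
      (simp add: low_rules high_rules mixed_letters lt_letter_def ZZ_add ZZ_cmult; (rule ext; (simp add: algebra_simps; fail | simp add: field_simps; fail))?)
lemma straight_case23: "straight m n (ZZ m n (d1, d2) u) (a1, a2) (b1, b2)" if "b1 < a1" "d1 < a1" "d1 < b1" "b2 < a2" "d2 < b2"
    unfolding straight_def al_def be_def crossing_def using that
    by -
      (simp add: low_rules high_rules mixed_letters lt_letter_def ZZ_add ZZ_cmult; (rule ext; (simp add: algebra_simps; fail | simp add: field_simps; fail))?)

lemma straight_step:
  assumes "lt_letter (b1, b2) (a1, a2)" "lt_letter (d1, d2) (b1, b2)"
  shows "straight m n (ZZ m n (d1, d2) u) (a1, a2) (b1, b2)"
proof -
  have "a1 < b1 \<or> a1 = b1 \<or> b1 < a1" "a1 < d1 \<or> a1 = d1 \<or> d1 < a1" "b1 < d1 \<or> b1 = d1 \<or> d1 < b1"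
    by linarith+
  moreover have "b2 < a2 \<or> b2 = a2 \<and> b1 < a1" "d2 < b2 \<or> d2 = b2 \<and> d1 < b1"
    using assms unfolding lt_letter_def by auto
  ultimately show ?thesis
    by (elim disjE conjE) (((rule straight_case0; assumption) | (rule straight_case1; assumption) | (rule straight_case2; assumption) | (rule straight_case3; assumption) | (rule straight_case4; assumption) | (rule straight_case5; assumption)
      | (rule straight_case6; assumption) | (rule straight_case7; assumption) | (rule straight_case8; assumption) | (rule straight_case9; assumption) | (rule straight_case10; assumption) | (rule straight_case11; assumption)
      | (rule straight_case12; assumption) | (rule straight_case13; assumption) | (rule straight_case14; assumption) | (rule straight_case15; assumption) | (rule straight_case16; assumption) | (rule straight_case17; assumption)
      | (rule straight_case18; assumption) | (rule straight_case19; assumption) | (rule straight_case20; assumption) | (rule straight_case21; assumption) | (rule straight_case22; assumption) | (rule straight_case23; assumption) | linarith)+)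
qed

end

text \<open>Both sides are linear in u, and for homogeneous u only the coordinates at sorted words
  of length k enter.\<close>

lemma straight_ket_imp:
  assumes "\<And>w. w \<in> nwords m n k \<Longrightarrow> straight m n (ket w) a b" and u: "degree_supp k u"
  shows "straight m n u a b"
proof -
  have E: "ZZ m n x (ZZ m n y u) v = (\<Sum>w\<in>nwords m n k. u w * ZZ m n x (ZZ m n y (ket w)) v)" for x y v
  proof -
    have y: "ZZ m n y u w' = (\<Sum>w\<in>nwords m n k. u w * ZZ m n y (ket w) w')" for w'
    proof (cases "length w' = Suc k")
      case False
      have "ZZ m n y (ket w) w' = 0" if "w \<in> nwords m n k" for w
        using False zc_length[of m n y w w'] length_nwords[OF that] unfolding ZZ_ket[OF that] by auto
      then show ?thesis using degree_supp_ZZ[OF u, of m n y] False by (simp add: degree_supp_def)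
    qed (simp add: ZZ_expand[of m n y u])
    show ?thesis
      unfolding ZZ_def[of m n x] y sum_distrib_right sum_distrib_left
      by (subst sum.swap) (simp add: mult.assoc)
  qed
  have "u w * ZZ m n a (ZZ m n b (ket w)) v = al a b * (u w * ZZ m n b (ZZ m n a (ket w)) v)
      + be a b * (u w * ZZ m n (crossing a b) (ZZ m n (crossing b a) (ket w)) v)" if "w \<in> nwords m n k" for w v
    unfolding assms(1)[OF that, unfolded straight_def] by (simp add: algebra_simps)
  then show ?thesis
    unfolding straight_def E by (simp add: sum.distrib sum_distrib_left)
qed

definition triple_order where
  "triple_order = measures [\<lambda>(k, a, b). k, \<lambda>(k, a, b). snd b, \<lambda>(k, a, b). fst b, \<lambda>(k, a, b). snd a, \<lambda>(k, a, b :: letter). fst (a :: letter) :: nat]"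

lemma wf_triple_order: "wf triple_order"
  by (simp add: triple_order_def)

text \<open>Induction on the degree, then on b, then on a. If no letter of w precedes b, then z_b w
  is a sorted word and the claim is the recursion of \<open>zc\<close>. Otherwise w begins with a
  letter d before b, and the overlap of a, b, d is resolved by relations of lower degree and by
  those of the same degree for smaller pairs.\<close>

lemma ZZ_straight:
  "a \<in> letters m n \<Longrightarrow> b \<in> letters m n \<Longrightarrow> lt_letter b a \<Longrightarrow> degree_supp k u \<Longrightarrow> straight m n u a b"
proof (induction "(k, a, b)" arbitrary: k a b u rule: wf_induct_rule[OF wf_triple_order])
  case (1 k a b u)
  show ?case
  proof (rule straight_ket_imp[OF _ 1(5)])
    fix w assume w: "w \<in> nwords m n k"
    show "straight m n (ket w) a b"
    proof (cases "\<forall>d\<in>set w. \<not> lt_letter d b")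
      case True
      then have "ZZ m n b (ket w) = ket (b # w)" "b # w \<in> nwords m n (Suc k)"
        using ZZ_ket_Cons[OF True w] w 1(3) by (auto simp: nwords_Cons)
      then show ?thesis using ZZ_ket_rewrite[of b w m n k a] 1(4) by (simp add: straight_def)
    next
      case False
      then obtain d v where dv: "w = d # v" by (cases w) auto
      obtain k' where k: "k = Suc k'" using w length_nwords dv by fastforce
      have v: "d \<in> letters m n" "v \<in> nwords m n k'" "\<forall>b\<in>set v. \<not> lt_letter b d" using w unfolding dv k nwords_Cons by auto
      \<comment> \<open>The head of a sorted word is its smallest letter, so it precedes b as soon
        as some letter does.\<close>
      have db: "lt_letter d b"
        using False v(3) lt_letter_trans[of d b] unfolding dv by auto
      have kd: "ket w = ZZ m n d (ket v)" using ZZ_ket_Cons[OF v(3,2)] dv by simp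
      have s: "degree_supp k' (ket v)" using length_nwords[OF v(2)] by (auto simp: degree_supp_def ket_def)
      obtain a1 a2 b1 b2 d1 d2 where e: "a = (a1, a2)" "b = (b1, b2)" "d = (d1, d2)" by (metis surj_pair)
      show ?thesis unfolding kd e
      proof (rule straight_step[OF s])
        show "straight m n (ket v) x y" if "x \<in> letters m n" "y \<in> letters m n" "lt_letter y x" for x y
          by (rule 1(1)[OF _ that s]) (simp add: triple_order_def k)
        show "straight m n u x y" if "degree_supp (Suc k') u" "x \<in> letters m n" "y \<in> letters m n" "lt_letter y x"
           "lt_letter y (b1, b2) \<or> y = (b1, b2) \<and> lt_letter x (a1, a2)" for u x y
          by (rule 1(1)[OF _ that(2-4)]) (use that in \<open>auto simp: triple_order_def k e lt_letter_def\<close>)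
      qed (use 1(2-4) v db e in auto)
    qed
  qed
qed

section \<open>Two irreducible modules: strings and their orders at q = 0\<close>

lemma powi_mult: "qq powi a * qq powi b = qq powi (a + b)"
  by (simp add: power_int_add)

text \<open>The scalar form of [E, F] = [h] on an irreducible module: for highest weight A and the
  vector F^(p) v take x = A - p and y = p.\<close>

lemma qi_cross: "qi x * qi (y + 1) - qi y * qi (x + 1) = qi (x - y)"
proof -
  define X Y d where "X = qq powi x" and "Y = qq powi y" and "d = inverse (qq - inverse qq)"
  have n: "X \<noteq> 0" "Y \<noteq> 0" by (simp_all add: X_def Y_def)
  have d: "d * (qq - inverse qq) = 1" by (simp add: d_def)
  have e: "qi x = (X - inverse X) * d" "qi y = (Y - inverse Y) * d"
    "qi (x + 1) = (X * qq - inverse X * inverse qq) * d"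
    "qi (y + 1) = (Y * qq - inverse Y * inverse qq) * d"
    "qi (x - y) = (X * inverse Y - inverse X * Y) * d"
    unfolding qi_def X_def Y_def d_def
    by (simp_all add: power_int_add power_int_diff power_int_minus divide_inverse)
  have "qi x * qi (y + 1) - qi y * qi (x + 1) = (X * inverse Y - inverse X * Y) * d * (d * (qq - inverse qq))" 
    unfolding e by (simp add: algebra_simps)
  then show ?thesis unfolding d e by simp
qed

text \<open>The quantum integer of a weight is compatible with the coproduct: [h] splits into [h] on
  one factor times a power of q on the other.\<close>

lemma qi_split: "qq powi b * qi a + qq powi (- a) * qi b = qi (a + b)"
proof -
  define X Y d where "X = qq powi a" and "Y = qq powi b" and "d = inverse (qq - inverse qq)"
  have n: "X \<noteq> 0" "Y \<noteq> 0" by (simp_all add: X_def Y_def)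
  have e: "qi a = (X - inverse X) * d" "qi b = (Y - inverse Y) * d"
    "qi (a + b) = (X * Y - inverse (X * Y)) * d" "qq powi (- a) = inverse X"
    unfolding qi_def X_def Y_def d_def
    by (simp_all add: power_int_add power_int_diff power_int_minus divide_inverse del: minus_add_distrib)
  show ?thesis unfolding e Y_def[symmetric] using n by (simp add: algebra_simps)
qed

text \<open>The functions of order at least e at q = 0.\<close>

definition qv :: "int \<Rightarrow> cq set" where "qv e = (*) (qq powi e) ` \<A>"

lemma qvI: "a \<in> \<A> \<Longrightarrow> qq powi e * a \<in> qv e"
  by (simp add: qv_def)

lemma qv_mult: "x \<in> qv a \<Longrightarrow> y \<in> qv b \<Longrightarrow> a + b = c \<Longrightarrow> x * y \<in> qv c"
  unfolding qv_def by (auto simp: power_int_add image_iff intro!: bexI[OF _ regq_mult])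

lemma qv_add: "x \<in> qv a \<Longrightarrow> y \<in> qv a \<Longrightarrow> x + y \<in> qv a"
  unfolding qv_def image_iff by (metis distrib_left regq_add)

lemma qv_uminus: "x \<in> qv a \<Longrightarrow> - x \<in> qv a"
  unfolding qv_def image_iff by (metis mult_minus_right regq_uminus)

lemma qv_0 [simp]: "0 \<in> qv a"
  using qvI[of 0 a] by simp

lemma qv_powi: "qq powi a \<in> qv a"
  using qvI[of 1 a] by simp

lemma qv_mono: assumes "x \<in> qv a" "b \<le> a" shows "x \<in> qv b"
proof -
  obtain y where y: "y \<in> \<A>" "x = qq powi a * y" using assms by (auto simp: qv_def)
  have "qq powi a = qq powi b * qq ^ nat (a - b)"
    using assms(2) by (simp add: power_int_add[symmetric] flip: power_int_of_nat)
  then show ?thesis using y by (simp add: mult.assoc qvI)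
qed

lemma qv_qideal: "x \<in> qv a \<Longrightarrow> 1 \<le> a \<Longrightarrow> x \<in> qideal"
  using qv_mono[of x a 1] by (simp add: qv_def qideal_def)

lemma qi_qv: "n \<ge> 0 \<Longrightarrow> qi n \<in> qv (1 - n)"
  using qi_int[of "nat n"] qvI[of "qn (nat n)" "1 - n"]
  unit1_regq[OF qn_unit1[of "nat n"]] by (cases "n = 0") simp_all

lemma inverse_qi_qv: assumes "n > 0" shows "inverse (qi n) \<in> qv (n - 1)"
proof -
  have "inverse (qi n) = qq powi (n - 1) * inverse (qn (nat n))"
    using qi_int[of "nat n"] assms power_int_minus[of qq "1 - n"] by simp
  moreover have "inverse (qn (nat n)) \<in> \<A>" using assms by (intro unit1_regq unit1_inverse qn_unit1) simp
  ultimately show ?thesis by (simp add: qvI)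
qed

lemma divide_qi_qv: "x \<in> qv a \<Longrightarrow> n > 0 \<Longrightarrow> a + n - 1 = c \<Longrightarrow> x / qi n \<in> qv c"
  unfolding divide_inverse by (rule qv_mult[OF _ inverse_qi_qv]) auto

text \<open>The operators below are the actions of \<open>e\<close> and \<open>f\<close> on the tensor product of the irreducible modules of
  dimensions \<open>A + 1\<close> and \<open>B + 1\<close>; \<open>f p j\<close> is the coordinate at \<open>F\<^sup>(\<^sup>p\<^sup>) v \<otimes> F\<^sup>(\<^sup>j\<^sup>) v'\<close>.\<close>

definition cgE :: "nat \<Rightarrow> nat \<Rightarrow> (nat \<Rightarrow> nat \<Rightarrow> cq) \<Rightarrow> nat \<Rightarrow> nat \<Rightarrow> cq" where
  "cgE A B f p j = qi (int A - int p) * f (Suc p) j + qq powi (2 * int p - int A) * qi (int B - int j) * f p (Suc j)"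

text \<open>The cutoff encodes that F^(A+1) and F^(B+1) vanish on the factors. In \<open>cgE\<close>
  the coefficients \<open>qi (A - p)\<close> and \<open>qi (B - j)\<close> vanish at the border by
  themselves, and here \<open>qi 0\<close> covers the truncated subtractions.\<close>

definition cgF :: "nat \<Rightarrow> nat \<Rightarrow> (nat \<Rightarrow> nat \<Rightarrow> cq) \<Rightarrow> nat \<Rightarrow> nat \<Rightarrow> cq" where
  "cgF A B f p j = (if p \<le> A \<and> j \<le> B
     then qi (int p) * qq powi (int B - 2 * int j) * f (p - 1) j + qi (int j) * f p (j - 1) else 0)"

definition boxed :: "nat \<Rightarrow> nat \<Rightarrow> nat \<Rightarrow> (nat \<Rightarrow> nat \<Rightarrow> cq) \<Rightarrow> bool" where
  "boxed A B S f \<longleftrightarrow> (\<forall>p j. \<not> (p \<le> A \<and> j \<le> B \<and> p + j = S) \<longrightarrow> f p j = 0)"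

lemma boxed_0: "boxed A B S f \<Longrightarrow> \<not> (p \<le> A \<and> j \<le> B \<and> p + j = S) \<Longrightarrow> f p j = 0"
  by (simp add: boxed_def)

lemma boxed_cgF:
  assumes "boxed A B S f" shows "boxed A B (Suc S) (cgF A B f)"
  unfolding boxed_def
proof (intro allI impI)
  fix p j assume a: "\<not> (p \<le> A \<and> j \<le> B \<and> p + j = Suc S)"
  have "qi (int p) * x * f (p - 1) j = 0" "qi (int j) * f p (j - 1) = 0" if "p \<le> A" "j \<le> B" for x
    using a that boxed_0[OF assms, of "p - 1" j] boxed_0[OF assms, of p "j - 1"] by (cases p; cases j; simp)+
  then show "cgF A B f p j = 0" by (simp add: cgF_def del: mult_eq_0_iff)
qed

text \<open>The terms moving p and j in opposite directions agree in E F and F E. The diagonal terms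
  give the commutator on each factor by \<open>qi_cross\<close>, and \<open>qi_split\<close> adds
  them up to the weight of p + j = S.\<close>

lemma cg_sl2:
  assumes "boxed A B S f"
  shows "cgE A B (cgF A B f) p j = cgF A B (cgE A B f) p j + qi (int A + int B - 2 * int S) * f p j"
proof (cases "p \<le> A \<and> j \<le> B")
  case False
  then show ?thesis using boxed_0[OF assms] by (auto simp: cgE_def cgF_def)
next
  case True
  have p: "qi (int p) * f (Suc (p - 1)) j = qi (int p) * f p j" by (cases p) auto
  have j: "qi (int j) * f p (Suc (j - 1)) = qi (int j) * f p j" by (cases j) auto
  have w: "int A + int B - 2 * int S = (int A - 2 * int p) + (int B - 2 * int j) \<or> f p j = 0"
    using boxed_0[OF assms, of p j] by (cases "p + j = S") auto
  let ?a = "int A" and ?b = "int B" and ?p = "int p" and ?j = "int j"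
  \<comment> \<open>Where \<open>cgF\<close> is cut off, the coefficient coming from
    \<open>cgE\<close> is zero, so the cutoff is invisible in E F.\<close>
  have tp: "p < A \<or> qi (int A - int p) = 0" "j < B \<or> qi (int B - int j) = 0" using True by (cases "p = A"; cases "j = B"; simp)+
  have l: "cgE A B (cgF A B f) p j =
      (qi (?a - ?p) * qi (?p + 1) * qq powi (?b - 2 * ?j) + qq powi (2 * ?p - ?a) * qi (?b - ?j) * qi (?j + 1)) * f p j
      + qi (?a - ?p) * qi ?j * f (Suc p) (j - 1)
      + qq powi (2 * ?p - ?a) * qi (?b - ?j) * qi ?p * qq powi (?b - 2 * ?j - 2) * f (p - 1) (Suc j)"
    unfolding cgE_def cgF_def using tp True
    by (elim disjE; simp add: algebra_simps Suc_le_eq power_int_diff power_int_add)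
  have "cgF A B (cgE A B f) p j = qi ?p * qq powi (?b - 2 * ?j) * cgE A B f (p - 1) j + qi ?j * cgE A B f p (j - 1)"
    using True by (simp add: cgF_def)
  also have "qi ?p * qq powi (?b - 2 * ?j) * cgE A B f (p - 1) j
    = qq powi (?b - 2 * ?j) * (qi ?p * f (Suc (p - 1)) j * qi (?a - (?p - 1)) +
        qi ?p * qq powi (2 * (?p - 1) - ?a) * qi (?b - ?j) * f (p - 1) (Suc j))"
    by (cases p) (simp_all add: cgE_def algebra_simps)
  also have "qi ?j * cgE A B f p (j - 1) = qi ?j * qi (?a - ?p) * f (Suc p) (j - 1)
     + qq powi (2 * ?p - ?a) * (qi ?j * f p (Suc (j - 1)) * qi (?b - (?j - 1)))"
    by (cases j) (simp_all add: cgE_def algebra_simps)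
  finally have r: "cgF A B (cgE A B f) p j =
     (qq powi (?b - 2 * ?j) * qi ?p * qi (?a - ?p + 1) + qq powi (2 * ?p - ?a) * qi ?j * qi (?b - ?j + 1)) * f p j
      + qi (?a - ?p) * qi ?j * f (Suc p) (j - 1)
      + qq powi (2 * ?p - ?a) * qi (?b - ?j) * qi ?p * qq powi (?b - 2 * ?j - 2) * f (p - 1) (Suc j)"
    unfolding p j by (simp add: algebra_simps power_int_add power_int_diff)
  have "qi (?a - ?p) * qi (?p + 1) * qq powi (?b - 2 * ?j) + qq powi (2 * ?p - ?a) * qi (?b - ?j) * qi (?j + 1) -
    (qq powi (?b - 2 * ?j) * qi ?p * qi (?a - ?p + 1) + qq powi (2 * ?p - ?a) * qi ?j * qi (?b - ?j + 1))
    = qq powi (?b - 2 * ?j) * qi (?a - ?p - ?p) + qq powi (2 * ?p - ?a) * qi (?b - ?j - ?j)"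
    unfolding qi_cross[symmetric] by (simp add: algebra_simps)
  also have "\<dots> = qi ((?a - 2 * ?p) + (?b - 2 * ?j))"
    using qi_split[of "?b - 2 * ?j" "?a - 2 * ?p"] by (simp add: algebra_simps)
  finally have c: "qi (?a - ?p) * qi (?p + 1) * qq powi (?b - 2 * ?j) + qq powi (2 * ?p - ?a) * qi (?b - ?j) * qi (?j + 1) =
    (qq powi (?b - 2 * ?j) * qi ?p * qi (?a - ?p + 1) + qq powi (2 * ?p - ?a) * qi ?j * qi (?b - ?j + 1))
     + qi ((?a - 2 * ?p) + (?b - 2 * ?j))" by (simp add: algebra_simps)
  show ?thesis unfolding l r c using w by (auto simp: algebra_simps)
qed

lemma cgE_cmult: "cgE A B (\<lambda>p j. c * f p j) = (\<lambda>p j. c * cgE A B f p j)"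
  by (intro ext) (simp add: cgE_def algebra_simps)

lemma cgF_cmult: "cgF A B (\<lambda>p j. c * f p j) = (\<lambda>p j. c * cgF A B f p j)"
  by (intro ext) (simp add: cgF_def algebra_simps)

lemma cgE_diff: "cgE A B (\<lambda>p j. f p j - g p j) = (\<lambda>p j. cgE A B f p j - cgE A B g p j)"
  by (intro ext) (simp add: cgE_def algebra_simps)

lemma cgF_diff: "cgF A B (\<lambda>p j. f p j - g p j) = (\<lambda>p j. cgF A B f p j - cgF A B g p j)"
  by (intro ext) (simp add: cgF_def algebra_simps)

lemma boxed_cmult: "boxed A B S f \<Longrightarrow> boxed A B S (\<lambda>p j. c * f p j)"
  by (simp add: boxed_def)

text \<open>The highest weight vector with first coordinate 1 at (s, 0): the recursion is E = 0
  solved for the coordinate at j = v + 1, where p = s - v - 1.\<close>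

primrec cg_top :: "nat \<Rightarrow> nat \<Rightarrow> nat \<Rightarrow> nat \<Rightarrow> cq" where
  "cg_top A B s 0 = 1"
| "cg_top A B s (Suc v) = - (qi (int A - (int s - int v - 1)) * qq powi (int A - 2 * (int s - int v - 1))
     / qi (int B - int v)) * cg_top A B s v"

text \<open>The divided powers F^(r) of the highest weight vector with coordinates
  \<open>cg_top\<close>.\<close>

primrec cgY :: "nat \<Rightarrow> nat \<Rightarrow> nat \<Rightarrow> nat \<Rightarrow> nat \<Rightarrow> nat \<Rightarrow> cq" where
  "cgY A B s 0 = (\<lambda>p j. if p \<le> A \<and> j \<le> B \<and> p + j = s then cg_top A B s j else 0)"
| "cgY A B s (Suc r) = (\<lambda>p j. inverse (qi (int (Suc r))) * cgF A B (cgY A B s r) p j)"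

lemma boxed_cgY: "boxed A B (s + r) (cgY A B s r)"
proof (induct r)
  case (Suc r)
  show ?case using boxed_cmult[OF boxed_cgF[OF Suc]] by simp
qed (auto simp: boxed_def)

lemma cgF_cgY: "cgF A B (cgY A B s r) = (\<lambda>p j. qi (int r + 1) * cgY A B s (Suc r) p j)"
  using qi_neq_0[of "int r + 1"] by (intro ext) (simp add: add.commute mult.assoc[symmetric])

lemma cgE_cgY_0:
  assumes "s \<le> A" "s \<le> B"
  shows "cgE A B (cgY A B s 0) p j = 0"
proof (cases "p + j + 1 = s")
  case True
  have q: "qi (int B - int j) \<noteq> 0" using True assms by (intro qi_neq_0) simp
  have p: "int p = int s - int j - 1" using True by simp
  have c: "qq powi (2 * int p - int A) * qq powi (int A - 2 * int p) = 1" by (simp add: powi_mult)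
  have "cgE A B (cgY A B s 0) p j = qi (int A - int p) * cg_top A B s j
     + qq powi (2 * int p - int A) * qi (int B - int j) * cg_top A B s (Suc j)"
    using True assms by (simp add: cgE_def)
  also have "\<dots> = qi (int A - int p) * cg_top A B s j
     - (qq powi (2 * int p - int A) * qq powi (int A - 2 * int p)) * qi (int A - int p) * cg_top A B s j"
    using q unfolding cg_top.simps p[symmetric] by (simp add: field_simps)
  finally show ?thesis unfolding c by simp
qed (auto simp: cgE_def)

text \<open>The usual sl2 induction on a string with highest weight l = A + B - 2s; its step is
  \<open>qi_cross\<close> at l - r - 1 and r + 1.\<close>

lemma cgE_cgY_Suc:
  assumes "s \<le> A" "s \<le> B"
  shows "cgE A B (cgY A B s (Suc r)) = (\<lambda>p j. qi (int A + int B - 2 * int s - int r) * cgY A B s r p j)"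
proof (induct r)
  case 0
  have "cgE A B (cgY A B s (Suc 0)) p j = cgE A B (cgF A B (cgY A B s 0)) p j" for p j
    unfolding cgF_cgY cgE_cmult by simp
  moreover have "cgF A B (cgE A B (cgY A B s 0)) p j = 0" for p j
    using cgE_cgY_0[OF assms] unfolding cgF_def by simp
  ultimately show ?case using cg_sl2[OF boxed_cgY[of A B s 0]] by (simp add: fun_eq_iff)
next
  case (Suc r)
  let ?l = "int A + int B - 2 * int s"
  have n: "qi (int r + 2) \<noteq> 0" by (intro qi_neq_0) simp
  show ?case
  proof (intro ext)
    fix p j
    have "qi (int r + 2) * cgE A B (cgY A B s (Suc (Suc r))) p j = cgE A B (cgF A B (cgY A B s (Suc r))) p j"
      unfolding cgF_cgY cgE_cmult by (simp add: add.commute)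
    also have "\<dots> = cgF A B (cgE A B (cgY A B s (Suc r))) p j
        + qi (int A + int B - 2 * int (s + Suc r)) * cgY A B s (Suc r) p j"
      by (rule cg_sl2[OF boxed_cgY])
    also have "cgF A B (cgE A B (cgY A B s (Suc r))) p j = qi (?l - int r) * (qi (int r + 1) * cgY A B s (Suc r) p j)"
      unfolding Suc cgF_cmult cgF_cgY ..
    also have "\<dots> + qi (int A + int B - 2 * int (s + Suc r)) * cgY A B s (Suc r) p j
      = (qi (int r + 1) * qi (?l - int r - 1 + 1) + qi (?l - int r - 1 - (int r + 1))) * cgY A B s (Suc r) p j"
      by (simp add: algebra_simps)
    also have "\<dots> = qi (?l - int r - 1) * qi (int r + 1 + 1) * cgY A B s (Suc r) p j"
      unfolding qi_cross[symmetric] by simp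
    finally show "cgE A B (cgY A B s (Suc (Suc r))) p j = qi (?l - int (Suc r)) * cgY A B s (Suc r) p j"
      using n by (simp add: algebra_simps)
  qed
qed

text \<open>Every factor of the recursion contributes the order B - s + 1: in the sum of the three
  orders involved, A and v cancel.\<close>

lemma cg_top_qv: "s \<le> A \<Longrightarrow> s \<le> B \<Longrightarrow> v \<le> s \<Longrightarrow> cg_top A B s v \<in> qv (int v * (int B - int s + 1))"
proof (induct v)
  case 0
  show ?case using qvI[of 1 0] by simp
next
  case (Suc v)
  have "qi (int A - (int s - int v - 1)) * qq powi (int A - 2 * (int s - int v - 1)) / qi (int B - int v)
     \<in> qv (int B - int s + 1)"
    by (rule divide_qi_qv[OF qv_mult[OF qi_qv qv_powi refl]]) (use Suc in auto)
  then show ?case using Suc unfolding cg_top.simps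
    by (intro qv_mult[OF qv_uminus, of _ "int B - int s + 1" _ "int v * (int B - int s + 1)"]) (auto simp: algebra_simps)
qed

text \<open>A lower bound for the order of the coordinate at p = s + g in the r-th vector of a
  string, with D = B - s - r. At r = 0 it is the order of \<open>cg_top\<close>, and it survives
  both terms of F / [r + 1] while D drops by 1. For D >= 0 it is positive unless g = 0; at D = -1
  this fails, so the estimate ends at s + r = B.\<close>

definition cg_ord :: "int \<Rightarrow> int \<Rightarrow> int" where
  "cg_ord D g = (if g \<ge> 0 then g * (D + g) else - g * (D + 1))"

text \<open>The leading coordinate passes from (s, r) to (s, r + 1) with the factor [r + 1] /
  [r + 1], and the other term that reaches this place has positive order. Everywhere else both terms
  of F respect the bound.\<close>

lemma cgY_qv:
  assumes sA: "s \<le> A" and sB: "s \<le> B"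
  shows "s + r \<le> B \<Longrightarrow> cgY A B s r s r \<in> unit1 \<and>
    (\<forall>p j. p + j = s + r \<longrightarrow> cgY A B s r p j \<in> qv (cg_ord (int B - int s - int r) (int p - int s)))"
proof (induct r)
  case 0
  have "cg_ord (int B - int s) (int p - int s) = int j * (int B - int s + 1)" if "p + j = s" for p j
    using that by (cases "j = 0") (auto simp: cg_ord_def algebra_simps)
  then show ?case using cg_top_qv[OF sA sB] sA sB by auto
next
  case (Suc r)
  define D where "D = int B - int s - int r"
  have D: "D \<ge> 1" and B: "int B = D + int s + int r" using Suc(2) by (auto simp: D_def)
  have IH: "cgY A B s r s r \<in> unit1"
    "\<And>p j. p + j = s + r \<Longrightarrow> cgY A B s r p j \<in> qv (cg_ord D (int p - int s))"
    using Suc unfolding D_def by auto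
  have Y: "cgY A B s (Suc r) p j = qi (int p) * qq powi (int B - 2 * int j) * cgY A B s r (p - 1) j / qi (int (Suc r))
      + qi (int j) * cgY A B s r p (j - 1) / qi (int (Suc r))" if "p \<le> A" "j \<le> B" for p j
    using that by (simp add: cgF_def divide_inverse algebra_simps)
  \<comment> \<open>The orders of [p] and of 1 / [r + 1], which are 1 - p and r, are added to the
    bound for the previous vector.\<close>
  have T1: "qi (int p) * qq powi (int B - 2 * int j) * cgY A B s r (p - 1) j / qi (int (Suc r))
      \<in> qv (1 - int p + (int B - 2 * int j) + cg_ord D (int p - 1 - int s) + int r)"
    if "p + j = s + Suc r" for p j
  proof (cases p)
    case (Suc p')
    have "cgY A B s r (p - 1) j \<in> qv (cg_ord D (int p - 1 - int s))"
      using IH(2)[of "p - 1" j] that Suc by simp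
    then show ?thesis
      by (intro divide_qi_qv[OF qv_mult[OF qv_mult[OF qi_qv qv_powi refl] _ refl]]) auto
  qed simp
  have T2: "qi (int j) * cgY A B s r p (j - 1) / qi (int (Suc r))
      \<in> qv (1 - int j + cg_ord D (int p - int s) + int r)" if "p + j = s + Suc r" for p j
  proof (cases j)
    case (Suc j')
    have "cgY A B s r p (j - 1) \<in> qv (cg_ord D (int p - int s))"
      using IH(2)[of p "j - 1"] that Suc by simp
    then show ?thesis
      by (intro divide_qi_qv[OF qv_mult[OF qi_qv _ refl]]) auto
  qed simp
  have "cgY A B s (Suc r) s (Suc r) = cgY A B s r s r
     + qi (int s) * qq powi (int B - 2 * int (Suc r)) * cgY A B s r (s - 1) (Suc r) / qi (int (Suc r))"
    using qi_neq_0[of "1 + int r"] sA Suc(2) unfolding Y[OF sA, of "Suc r"] by (subst Y) auto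
  moreover have "qi (int s) * qq powi (int B - 2 * int (Suc r)) * cgY A B s r (s - 1) (Suc r) / qi (int (Suc r)) \<in> qideal"
    by (rule qv_qideal[OF T1]) (use D B in \<open>auto simp: cg_ord_def\<close>)
  ultimately have u: "cgY A B s (Suc r) s (Suc r) \<in> unit1"
    using unit1_add_qideal[OF IH(1)] by simp
  have "cgY A B s (Suc r) p j \<in> qv (cg_ord (int B - int s - int (Suc r)) (int p - int s))"
    if pj: "p + j = s + Suc r" for p j
  proof (cases "p \<le> A \<and> j \<le> B")
    case True
    have j: "int j = int s + int r + 1 - int p" using pj by simp
    define g where "g = int p - int s"
    have g: "int p = int s + g" by (simp add: g_def)
    consider "p = s" | "g \<ge> 1" | "g \<le> -1" unfolding g_def by linarith
    then have "cg_ord (D - 1) g \<le> 1 - int p + (int B - 2 * int j) + cg_ord D (int p - 1 - int s) + int r \<and>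
      cg_ord (D - 1) g \<le> 1 - int j + cg_ord D g + int r"
      using D unfolding j B g by cases (auto simp: cg_ord_def algebra_simps g_def)
    moreover have "int B - int s - int (Suc r) = D - 1" by (simp add: D_def)
    ultimately show ?thesis using True
      unfolding Y[OF conjunct1[OF True] conjunct2[OF True]] g_def[symmetric]
      by (simp only: qv_add[OF qv_mono[OF T1[OF pj]] qv_mono[OF T2[OF pj]]] g_def)
  next
    case False
    then show ?thesis using boxed_0[OF boxed_cgY[of A B s "Suc r"], of p j] by auto
  qed
  then show ?case using u by blast
qed

text \<open>So up to the corner s + r = B the vector reduces modulo q to the pure tensor of F^(s) v
  and F^(r) v'.\<close>

lemma cgY_leading:
  assumes "s \<le> A" "s + r \<le> B"
  shows "cgY A B s r s r \<in> unit1" "(p, j) \<noteq> (s, r) \<Longrightarrow> cgY A B s r p j \<in> qideal"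
proof -
  have sB: "s \<le> B" using assms by simp
  note L = cgY_qv[OF assms(1) sB assms(2)]
  show "cgY A B s r s r \<in> unit1" using L by simp
  assume ne: "(p, j) \<noteq> (s, r)"
  show "cgY A B s r p j \<in> qideal"
  proof (cases "p + j = s + r")
    case True
    then have "p \<noteq> s" using ne by auto
    then have "cg_ord (int B - int s - int r) (int p - int s) \<ge> 1"
      using assms(2) mult_mono[of 1 "int p - int s" 1 "int B - int s - int r + (int p - int s)"]
        mult_mono[of 1 "int s - int p" 1 "int B - int s - int r + 1"]
      by (cases "p < s") (auto simp: cg_ord_def)
    then show ?thesis using L True qv_qideal by blast
  next
    case False
    then show ?thesis using boxed_0[OF boxed_cgY[of A B s r], of p j] by auto
  qed
qed

text \<open>Exchange of the two factors together with the reversal of each of them: the symmetry of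
  the coproduct that swaps E and F.\<close>

definition cg_flip :: "nat \<Rightarrow> nat \<Rightarrow> (nat \<Rightarrow> nat \<Rightarrow> cq) \<Rightarrow> nat \<Rightarrow> nat \<Rightarrow> cq" where
  "cg_flip A B f p j = (if p \<le> A \<and> j \<le> B then f (B - j) (A - p) else 0)"

lemma boxed_flip: "boxed B A S f \<Longrightarrow> S + S' = A + B \<Longrightarrow> boxed A B S' (cg_flip A B f)"
  unfolding boxed_def cg_flip_def by (intro allI impI) auto

lemma cg_flip_cmult: "cg_flip A B (\<lambda>p j. c * f p j) = (\<lambda>p j. c * cg_flip A B f p j)"
  by (intro ext) (simp add: cg_flip_def)

lemma cgE_flip: "cgE A B (cg_flip A B f) = cg_flip A B (cgF B A f)"
proof (intro ext)
  fix p j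
  show "cgE A B (cg_flip A B f) p j = cg_flip A B (cgF B A f) p j"
  proof (cases "p \<le> A \<and> j \<le> B")
    case True
    then show ?thesis unfolding cgE_def cg_flip_def cgF_def
      by (cases "p = A"; cases "j = B") (auto simp: of_nat_diff algebra_simps Suc_le_eq Suc_diff_Suc)
  qed (auto simp: cgE_def cg_flip_def)
qed

lemma cgF_flip: assumes "boxed B A S f" shows "cgF A B (cg_flip A B f) = cg_flip A B (cgE B A f)"
proof (intro ext)
  fix p j
  show "cgF A B (cg_flip A B f) p j = cg_flip A B (cgE B A f) p j"
  proof (cases "p \<le> A \<and> j \<le> B")
    case True
    then show ?thesis unfolding cgE_def cg_flip_def cgF_def
      by (cases p; cases j) (auto simp: of_nat_diff algebra_simps Suc_diff_Suc)
  qed (auto simp: cgF_def cg_flip_def)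
qed

text \<open>Strings climbing from a lowest weight vector. Here r counts applications of E, and the
  leading term is known while s + r <= A.\<close>

definition cgZ :: "nat \<Rightarrow> nat \<Rightarrow> nat \<Rightarrow> nat \<Rightarrow> nat \<Rightarrow> nat \<Rightarrow> cq" where
  "cgZ A B s r = cg_flip A B (cgY B A s r)"

lemma cgE_cgZ: "cgE A B (cgZ A B s r) = (\<lambda>p j. qi (int r + 1) * cgZ A B s (Suc r) p j)"
  unfolding cgZ_def cgE_flip cgF_cgY cg_flip_cmult ..

lemma cgF_cgZ_0: "s \<le> A \<Longrightarrow> s \<le> B \<Longrightarrow> cgF A B (cgZ A B s 0) = (\<lambda>p j. 0)"
  unfolding cgZ_def cgF_flip[OF boxed_cgY] by (intro ext) (simp add: cg_flip_def cgE_cgY_0 del: cgY.simps)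

lemma cgF_cgZ_Suc: "s \<le> A \<Longrightarrow> s \<le> B \<Longrightarrow>
    cgF A B (cgZ A B s (Suc r)) = (\<lambda>p j. qi (int A + int B - 2 * int s - int r) * cgZ A B s r p j)"
  unfolding cgZ_def cgF_flip[OF boxed_cgY] cgE_cgY_Suc cg_flip_cmult by (simp add: algebra_simps)

lemma boxed_cgZ: "s + r + S = A + B \<Longrightarrow> boxed A B S (cgZ A B s r)"
  unfolding cgZ_def by (rule boxed_flip[OF boxed_cgY]) simp

lemma cgZ_leading:
  assumes "s \<le> B" "s + r \<le> A"
  shows "cgZ A B s r (A - r) (B - s) \<in> unit1" "(p, j) \<noteq> (A - r, B - s) \<Longrightarrow> cgZ A B s r p j \<in> qideal"
proof -
  show "cgZ A B s r (A - r) (B - s) \<in> unit1"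
    using assms cgY_leading(1)[of s B r A] by (simp add: cgZ_def cg_flip_def)
  show "cgZ A B s r p j \<in> qideal" if "(p, j) \<noteq> (A - r, B - s)"
  proof (cases "p \<le> A \<and> j \<le> B")
    case True
    then have "(B - j, A - p) \<noteq> (s, r)" using that assms by auto
    then show ?thesis using assms cgY_leading(2)[of s B r A "B - j" "A - p"] by (simp add: cgZ_def cg_flip_def)
  qed (auto simp: cgZ_def cg_flip_def)
qed

text \<open>On the weight space p + j = B the operator E F is tridiagonal in p, with nonzero entries
  next to the diagonal. The eigenvalue equation at p - 1 therefore determines the coordinate at p
  from the earlier ones, and an eigenvector from its coordinate at p = 0.\<close>

lemma cg_eigen_unique:
  assumes bx: "boxed A B B f" and ev: "\<And>p j. cgE A B (cgF A B f) p j = c * f p j" and z: "f 0 B = 0"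
  shows "f p j = 0"
proof -
  have "f p (B - p) = 0" if "p \<le> A" "p \<le> B" for p
    using that
  proof (induct p rule: less_induct)
    case (less p)
    show ?case
    proof (cases p)
      case 0 then show ?thesis using z by simp
    next
      case (Suc p')
      have a: "f p' (B - p') = 0" using less Suc by simp
      have b: "f (p' - 1) (Suc (B - p')) = 0"
      proof (cases p')
        case 0 then show ?thesis using boxed_0[OF bx] by simp
      next
        case Suc': (Suc k) 
        have "f k (B - k) = 0" using less(1)[of k] less(2,3) Suc Suc' by simp
        then show ?thesis using Suc Suc' less(3) by (simp add: Suc_diff_Suc)
      qed
      have B: "B - p' = Suc (B - p)" using less Suc by simp
      have "0 = cgE A B (cgF A B f) p' (B - p')" using ev a by simp
      also have "\<dots> = qi (int A - int p') * qi (int (B - p')) * f p (B - p)"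
        unfolding cgE_def cgF_def using a b less Suc B by auto
      finally show ?thesis using qi_neq_0[of "int A - int p'"] qi_neq_0[of "int (B - p')"] less Suc B by auto
    qed
  qed
  moreover have "j = B - p" if "p + j = B" using that by simp
  ultimately show ?thesis using boxed_0[OF bx, of p j] by (cases "p \<le> A \<and> j \<le> B \<and> p + j = B") auto
qed

text \<open>Both vectors lie in the weight space p + j = B and are eigenvectors of E F for
  [B - s + 1] [A - s], hence proportional. The factor is read off at (s, B - s), the leading place
  of both.\<close>

lemma cgZ_proportional:
  assumes "s \<le> A" "s \<le> B"
  obtains c where "c \<in> unit1" "cgZ A B s (A - s) = (\<lambda>p j. c * cgY A B s (B - s) p j)"
proof -
  let ?y = "cgY A B s (B - s)" and ?z = "cgZ A B s (A - s)"
  let ?e = "qi (int B - int s + 1) * qi (int A - int s)"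
  have bY: "boxed A B B ?y" using boxed_cgY[of A B s "B - s"] assms by simp
  have bZ: "boxed A B B ?z" using assms by (intro boxed_cgZ) simp
  have ey: "cgE A B (cgF A B ?y) p j = ?e * ?y p j" for p j
    unfolding cgF_cgY cgE_cmult cgE_cgY_Suc[OF assms] using assms by (simp add: algebra_simps of_nat_diff)
  \<comment> \<open>For A = s the vector is the lower end of its string: F kills it, and the
    eigenvalue contains [0].\<close>
  have ez: "cgE A B (cgF A B ?z) p j = ?e * ?z p j" for p j
  proof (cases "A = s")
    case True
    then show ?thesis using cgF_cgZ_0[OF assms] by (simp add: cgE_def)
  next
    case False
    then obtain k where k: "A - s = Suc k" "int A = int s + int k + 1" using assms by (cases "A - s") auto
    show ?thesis unfolding k(1) cgF_cgZ_Suc[OF assms] cgE_cmult cgE_cgZ unfolding k(2) by (simp add: algebra_simps)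
  qed
  have u: "?y s (B - s) \<in> unit1" "?z s (B - s) \<in> unit1"
    using cgY_leading(1)[of s A "B - s" B] cgZ_leading(1)[of s B "A - s" A] assms by auto
  \<comment> \<open>An eigenvector vanishing here would be zero, but the coordinate at its leading
    place is not.\<close>
  have n: "?y 0 B \<noteq> 0"
    using cg_eigen_unique[OF bY ey, of s "B - s"] unit1_neq_0[OF u(1)] by blast
  define c where "c = ?z 0 B / ?y 0 B"
  let ?h = "\<lambda>p j. ?z p j - c * ?y p j"
  have "?h p j = 0" for p j
  proof (rule cg_eigen_unique[where c = ?e])
    show "boxed A B B ?h" using bY bZ by (simp add: boxed_def)
    show "cgE A B (cgF A B ?h) p j = ?e * ?h p j" for p j
      unfolding cgF_diff cgF_cmult cgE_diff cgE_cmult ey ez by (simp add: algebra_simps)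
    show "?h 0 B = 0" using n by (simp add: c_def)
  qed
  then have e: "?z = (\<lambda>p j. c * ?y p j)" by (intro ext) simp
  have "c = ?z s (B - s) / ?y s (B - s)" using unit1_neq_0[OF u(1)] unfolding e by simp
  then have "c \<in> unit1" using u by (simp add: unit1_divide)
  then show ?thesis using e that by blast
qed

text \<open>The tensor product rule for crystals. The string with top (s, 0) first increases j up to
  B - s and then increases p up to A; \<open>cg_str\<close> and \<open>cg_pos\<close> recover the
  string and the position from a point, and \<open>cg_at\<close> is the inverse.\<close>

definition cg_str :: "nat \<Rightarrow> nat \<Rightarrow> nat \<Rightarrow> nat" where
  "cg_str B p j = (if p + j \<le> B then p else B - j)"

definition cg_pos :: "nat \<Rightarrow> nat \<Rightarrow> nat \<Rightarrow> nat" where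
  "cg_pos B p j = (if p + j \<le> B then j else p + 2 * j - B)"

definition cg_len :: "nat \<Rightarrow> nat \<Rightarrow> nat \<Rightarrow> nat \<Rightarrow> nat" where
  "cg_len A B p j = A + B - 2 * cg_str B p j"

definition cg_at :: "nat \<Rightarrow> nat \<Rightarrow> nat \<Rightarrow> nat \<times> nat" where
  "cg_at B s r = (if s + r \<le> B then (s, r) else (s + (s + r - B), B - s))"

lemma cg_at_pos: "p \<le> A \<Longrightarrow> j \<le> B \<Longrightarrow> cg_at B (cg_str B p j) (cg_pos B p j) = (p, j)"
  by (auto simp: cg_at_def cg_str_def cg_pos_def)

lemma cg_pos_at:
  assumes "s \<le> A" "s \<le> B" "r + 2 * s \<le> A + B" "cg_at B s r = (p, j)"
  shows "p \<le> A" "j \<le> B" "cg_str B p j = s" "cg_pos B p j = r" "p + j = s + r"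
  using assms by (auto simp: cg_at_def cg_str_def cg_pos_def split: if_splits)

lemma cg_str_le: "p \<le> A \<Longrightarrow> j \<le> B \<Longrightarrow> cg_str B p j \<le> A" "p \<le> A \<Longrightarrow> j \<le> B \<Longrightarrow> cg_str B p j \<le> B"
  "p \<le> A \<Longrightarrow> j \<le> B \<Longrightarrow> cg_pos B p j + 2 * cg_str B p j \<le> A + B"
  by (auto simp: cg_str_def cg_pos_def)

text \<open>The upper leg of each string is taken from its highest weight vector, the lower leg from
  its lowest weight vector. The scalar \<open>c s\<close> that compares them is congruent to 1, so
  dividing by it keeps the leading terms and makes E and F act by the same quantum integers along
  the whole string.\<close>

theorem tensor_string_family:
  fixes A B :: nat
  obtains G where
    "\<And>s r. s \<le> A \<Longrightarrow> s \<le> B \<Longrightarrow> r + 2 * s \<le> A + B \<Longrightarrow> boxed A B (s + r) (G s r)"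
    "\<And>s r. s \<le> A \<Longrightarrow> s \<le> B \<Longrightarrow> r + 2 * s \<le> A + B \<Longrightarrow> G s r (fst (cg_at B s r)) (snd (cg_at B s r)) \<in> unit1"
    "\<And>s r p j. s \<le> A \<Longrightarrow> s \<le> B \<Longrightarrow> r + 2 * s \<le> A + B \<Longrightarrow> (p, j) \<noteq> cg_at B s r \<Longrightarrow> G s r p j \<in> qideal"
    "\<And>s r. s \<le> A \<Longrightarrow> s \<le> B \<Longrightarrow> r + 2 * s \<le> A + B \<Longrightarrow> cgE A B (G s r) =
      (\<lambda>p j. if r = 0 then 0 else qi (int (A + B - 2 * s) - int r + 1) * G s (r - 1) p j)"
    "\<And>s r. s \<le> A \<Longrightarrow> s \<le> B \<Longrightarrow> r + 2 * s \<le> A + B \<Longrightarrow> cgF A B (G s r) =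
      (\<lambda>p j. if r + 2 * s = A + B then 0 else qi (int r + 1) * G s (Suc r) p j)"
proof -
  have "\<exists>c. \<forall>s. s \<le> A \<and> s \<le> B \<longrightarrow> c s \<in> unit1 \<and> cgZ A B s (A - s) = (\<lambda>p j. c s * cgY A B s (B - s) p j)"
    by (rule choice) (metis cgZ_proportional)
  then obtain c where c: "\<And>s. s \<le> A \<Longrightarrow> s \<le> B \<Longrightarrow> c s \<in> unit1"
    "\<And>s. s \<le> A \<Longrightarrow> s \<le> B \<Longrightarrow> cgZ A B s (A - s) = (\<lambda>p j. c s * cgY A B s (B - s) p j)" by blast
  define G where "G s r = (if s + r \<le> B then cgY A B s r else (\<lambda>p j. inverse (c s) * cgZ A B s (A + B - 2 * s - r) p j))" for s r
  have G1: "G s r = cgY A B s r" if "s + r \<le> B" for s r using that by (simp add: G_def)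
  \<comment> \<open>At the corner s + r = B both descriptions are available and agree by the choice
    of c; this makes the steps across the corner correct.\<close>
  have G2: "G s r = (\<lambda>p j. inverse (c s) * cgZ A B s (A + B - 2 * s - r) p j)" if "s \<le> A" "s \<le> B" "B \<le> s + r" for s r
  proof (cases "s + r = B")
    case True
    then have "r = B - s" "A + B - 2 * s - r = A - s" using that by auto
    then show ?thesis using c[OF that(1,2)] unit1_neq_0[of "c s"] that
      by (simp add: G1 mult.assoc[symmetric] del: cgY.simps)
  qed (use that in \<open>simp add: G_def\<close>)
  show ?thesis
  proof (rule that)
    fix s r assume s: "s \<le> A" "s \<le> B" "r + 2 * s \<le> A + B"
    have ic: "inverse (c s) \<in> unit1" using c s by (intro unit1_inverse) auto
    show "boxed A B (s + r) (G s r)"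
      unfolding G_def using s by (auto intro!: boxed_cgY boxed_cmult boxed_cgZ)
    show "G s r (fst (cg_at B s r)) (snd (cg_at B s r)) \<in> unit1"
    proof (cases "s + r \<le> B")
      case True
      then show ?thesis using cgY_leading(1)[OF s(1) True] by (simp add: G1 cg_at_def)
    next
      case False
      let ?r = "A + B - 2 * s - r"
      have "s + ?r \<le> A" "A - ?r = s + (s + r - B)" using s False by auto
      then show ?thesis using cgZ_leading(1)[OF s(2), of ?r A] False ic by (simp add: G_def cg_at_def unit1_mult)
    qed
    show "G s r p j \<in> qideal" if ne: "(p, j) \<noteq> cg_at B s r" for p j
    proof (cases "s + r \<le> B")
      case True
      then show ?thesis using cgY_leading(2)[OF s(1) True] ne by (simp add: G1 cg_at_def)
    next
      case False
      let ?r = "A + B - 2 * s - r"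
      have "s + ?r \<le> A" "A - ?r = s + (s + r - B)" using s False by auto
      then have "cgZ A B s ?r p j \<in> qideal" using cgZ_leading(2)[OF s(2), of ?r A p j] False ne by (simp add: cg_at_def)
      then show ?thesis using False ic by (simp add: G_def qideal_mult unit1_regq)
    qed
    show "cgE A B (G s r) = (\<lambda>p j. if r = 0 then 0 else qi (int (A + B - 2 * s) - int r + 1) * G s (r - 1) p j)"
    proof (cases "s + r \<le> B")
      case True
      show ?thesis
      proof (cases r)
        case 0
        then show ?thesis using True cgE_cgY_0[OF s(1,2)] by (simp add: G1 fun_eq_iff del: cgY.simps)
      next
        case (Suc r')
        then show ?thesis using True s cgE_cgY_Suc[OF s(1,2), of r'] by (simp add: G1 of_nat_diff algebra_simps del: cgY.simps)
      qed
    next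
      case False
      let ?r = "A + B - 2 * s - r"
      have r: "Suc ?r = A + B - 2 * s - (r - 1)" "int ?r + 1 = int (A + B - 2 * s) - int r + 1" "r \<noteq> 0" using s False by auto
      show ?thesis using False s unfolding G2[OF s(1,2), of "r - 1"] G2[OF s(1,2), of r] 
        by (subst G2[OF s(1,2)], simp, subst G2[OF s(1,2)], simp)
           (simp only: cgE_cmult cgE_cgZ r, simp add: r(3) algebra_simps)
    qed
    show "cgF A B (G s r) = (\<lambda>p j. if r + 2 * s = A + B then 0 else qi (int r + 1) * G s (Suc r) p j)"
    proof (cases "s + Suc r \<le> B")
      case True
      then show ?thesis using s by (simp only: G1 cgF_cgY) (auto simp: G1)
    next
      case False
      then have B: "B \<le> s + r" by simp
      show ?thesis
      proof (cases "r + 2 * s = A + B")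
        case True
        then show ?thesis using cgF_cgZ_0[OF s(1,2)] unfolding G2[OF s(1,2) B] cgF_cmult by simp
      next
        case F: False
        let ?r = "A + B - 2 * s - Suc r"
        have r: "A + B - 2 * s - r = Suc ?r" "int A + int B - 2 * int s - int ?r = int r + 1" using s F by auto
        show ?thesis using F B s unfolding G2[OF s(1,2) B] cgF_cmult r(1) cgF_cgZ_Suc[OF s(1,2)] r(2)
          by (subst G2[OF s(1,2)]) (simp_all add: algebra_simps)
      qed
    qed
  qed
qed

section \<open>Operators on words, for one of the two indices of a letter\<close>

text \<open>\<open>c\<close> reads one of the two indices of a letter and \<open>mv i\<close> replaces it by \<open>i\<close>, so that the actions of
  both algebras are instances. The operators act on coordinate functions, hence \<open>E\<^sub>i\<close> evaluated at a word
  replaces an index \<open>i\<close> by \<open>i + 1\<close>.\<close>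

locale coordinate =
  fixes c :: "letter \<Rightarrow> nat" and mv :: "nat \<Rightarrow> letter \<Rightarrow> letter"
  assumes c_mv [simp]: "c (mv i a) = i"
    and mv_mv [simp]: "mv i (mv j a) = mv i a"
    and mv_c: "c a = i \<Longrightarrow> mv i a = a"
begin

primrec charw :: "(nat \<Rightarrow> cq) \<Rightarrow> letter list \<Rightarrow> cq" where
  "charw \<chi> [] = 1"
| "charw \<chi> (a # w) = \<chi> (c a) * charw \<chi> w"

text \<open>The eigenvalue of q^(h_i), and below that of the weight generator with index i, on a
  letter whose index is x.\<close>

definition kp :: "nat \<Rightarrow> nat \<Rightarrow> cq" where
  "kp i x = (if x = i then qq else if x = Suc i then inverse qq else 1)"

definition qx :: "nat \<Rightarrow> nat \<Rightarrow> cq" where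
  "qx i x = (if x = i then qq else 1)"

text \<open>The iterated coproduct: where E_i acts on a letter, q^(-h_i) acts on all letters to its
  left; where F_i acts on a letter, q^(h_i) acts on all letters to its right.\<close>

primrec opE :: "nat \<Rightarrow> letter list \<Rightarrow> (letter list \<Rightarrow> cq) \<Rightarrow> cq" where
  "opE i [] u = 0"
| "opE i (a # w) u = (if c a = i then u (mv (Suc i) a # w) else 0) + inverse (kp i (c a)) * opE i w (\<lambda>v. u (a # v))"

primrec opF :: "nat \<Rightarrow> letter list \<Rightarrow> (letter list \<Rightarrow> cq) \<Rightarrow> cq" where
  "opF i [] u = 0"
| "opF i (a # w) u = (if c a = Suc i then charw (kp i) w * u (mv i a # w) else 0) + opF i w (\<lambda>v. u (a # v))"

primrec uop :: "uq_gen \<Rightarrow> (letter list \<Rightarrow> cq) \<Rightarrow> letter list \<Rightarrow> cq" where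
  "uop (GE i) u = (\<lambda>w. opE i w u)"
| "uop (GF i) u = (\<lambda>w. opF i w u)"
| "uop (GQ i) u = (\<lambda>w. charw (qx i) w * u w)"
| "uop (GQinv i) u = (\<lambda>w. inverse (charw (qx i) w) * u w)"

lemma kp_neq_0 [simp]: "kp i x \<noteq> 0" and qx_neq_0 [simp]: "qx i x \<noteq> 0"
  by (auto simp: kp_def qx_def)

lemma kp_simps [simp]: "kp i i = qq" "kp i (Suc i) = inverse qq"
    "x \<noteq> i \<Longrightarrow> x \<noteq> Suc i \<Longrightarrow> kp i x = 1"
  by (auto simp: kp_def)

lemma charw_neq_0: "(\<And>x. \<chi> x \<noteq> 0) \<Longrightarrow> charw \<chi> w \<noteq> 0"
  by (induct w) auto

lemma charw_kp_neq_0 [simp]: "charw (kp i) w \<noteq> 0" and charw_qx_neq_0 [simp]: "charw (qx i) w \<noteq> 0"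
  by (rule charw_neq_0; simp)+

lemma charw_kp: "charw (kp i) w = charw (qx i) w * inverse (charw (qx (Suc i)) w)"
  by (induct w) (auto simp: kp_def qx_def)

lemma opE_add: "opE i w (\<lambda>v. f v + g v) = opE i w f + opE i w g"
  by (induct w arbitrary: f g) (auto simp: algebra_simps)

lemma opE_cmult: "opE i w (\<lambda>v. x * f v) = x * opE i w f"
  by (induct w arbitrary: f) (auto simp: algebra_simps)

lemma opE_0 [simp]: "opE i w (\<lambda>v. 0) = 0"
  by (induct w) auto

lemma opF_add: "opF i w (\<lambda>v. f v + g v) = opF i w f + opF i w g"
  by (induct w arbitrary: f g) (auto simp: algebra_simps)

lemma opF_cmult: "opF i w (\<lambda>v. x * f v) = x * opF i w f"
  by (induct w arbitrary: f) (auto simp: algebra_simps)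

lemma opF_0 [simp]: "opF i w (\<lambda>v. 0) = 0"
  by (induct w) auto

text \<open>At w the function is read only at words in which one index i has become i + 1, so a
  character changes by the factor of this replacement.\<close>

lemma opE_charw:
  assumes "\<And>x. \<chi> x \<noteq> 0"
  shows "opE i w (\<lambda>v. charw \<chi> v * u v) = \<chi> (Suc i) * inverse (\<chi> i) * charw \<chi> w * opE i w u"
proof (induct w arbitrary: u)
  case (Cons a w)
  show ?case using assms
    by (auto simp: mult.assoc opE_cmult Cons algebra_simps)
qed simp

lemma opF_charw:
  assumes "\<And>x. \<chi> x \<noteq> 0"
  shows "opF i w (\<lambda>v. charw \<chi> v * u v) = \<chi> i * inverse (\<chi> (Suc i)) * charw \<chi> w * opF i w u"
proof (induct w arbitrary: u)
  case (Cons a w)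
  show ?case using assms
    by (auto simp: mult.assoc opF_cmult Cons algebra_simps)
qed simp

text \<open>Solved for one of its three products, the relation serves as a rewrite rule in the
  induction on the word; only the position of the first index relative to i, i + 1 and i + 2
  matters.\<close>

lemma opE_serre_up:
  "opE i w (\<lambda>w. opE i w (\<lambda>w. opE (Suc i) w u)) =
    (qq + inverse qq) * opE i w (\<lambda>w. opE (Suc i) w (\<lambda>w. opE i w u)) - opE (Suc i) w (\<lambda>w. opE i w (\<lambda>w. opE i w u))"
proof (induct w arbitrary: u)
  case (Cons a w)
  consider "c a = i" | "c a = Suc i" | "c a = Suc (Suc i)" | "c a \<noteq> i" "c a \<noteq> Suc i" "c a \<noteq> Suc (Suc i)" by blast
  then show ?case
    by cases (simp add: opE_add opE_cmult Cons; (simp add: field_simps; fail)?)+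
qed simp

lemma opE_serre_down:
  "opE (Suc i) w (\<lambda>w. opE (Suc i) w (\<lambda>w. opE i w u)) =
    (qq + inverse qq) * opE (Suc i) w (\<lambda>w. opE i w (\<lambda>w. opE (Suc i) w u)) - opE i w (\<lambda>w. opE (Suc i) w (\<lambda>w. opE (Suc i) w u))"
proof (induct w arbitrary: u)
  case (Cons a w)
  consider "c a = i" | "c a = Suc i" | "c a = Suc (Suc i)" | "c a \<noteq> i" "c a \<noteq> Suc i" "c a \<noteq> Suc (Suc i)" by blast
  then show ?case
    by cases (simp add: opE_add opE_cmult Cons; (simp add: field_simps; fail)?)+
qed simp

lemma opE_far:
  assumes "Suc i < j \<or> Suc j < i"
  shows "opE i w (\<lambda>w. opE j w u) = opE j w (\<lambda>w. opE i w u)"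
proof (induct w arbitrary: u)
  case (Cons a w)
  consider "c a = i" | "c a = Suc i" | "c a = j" | "c a = Suc j"
    | "c a \<noteq> i" "c a \<noteq> Suc i" "c a \<noteq> j" "c a \<noteq> Suc j" by blast
  then show ?case using assms
    by cases (simp add: kp_def opE_add opE_cmult Cons[of "\<lambda>v. u (a # v)"]; (auto; fail)?)+
qed simp

lemma opF_serre_up:
  "opF i w (\<lambda>w. opF i w (\<lambda>w. opF (Suc i) w u)) =
    (qq + inverse qq) * opF i w (\<lambda>w. opF (Suc i) w (\<lambda>w. opF i w u)) - opF (Suc i) w (\<lambda>w. opF i w (\<lambda>w. opF i w u))"
proof (induct w arbitrary: u)
  case (Cons a w)
  consider "c a = i" | "c a = Suc i" | "c a = Suc (Suc i)" | "c a \<noteq> i" "c a \<noteq> Suc i" "c a \<noteq> Suc (Suc i)" by blast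
  then show ?case
    by cases (simp add: opF_add opF_cmult opF_charw mult.assoc Cons; (simp add: field_simps; fail)?)+
qed simp

lemma opF_serre_down:
  "opF (Suc i) w (\<lambda>w. opF (Suc i) w (\<lambda>w. opF i w u)) =
    (qq + inverse qq) * opF (Suc i) w (\<lambda>w. opF i w (\<lambda>w. opF (Suc i) w u)) - opF i w (\<lambda>w. opF (Suc i) w (\<lambda>w. opF (Suc i) w u))"
proof (induct w arbitrary: u)
  case (Cons a w)
  consider "c a = i" | "c a = Suc i" | "c a = Suc (Suc i)" | "c a \<noteq> i" "c a \<noteq> Suc i" "c a \<noteq> Suc (Suc i)" by blast
  then show ?case
    by cases (simp add: opF_add opF_cmult opF_charw mult.assoc Cons; (simp add: field_simps; fail)?)+
qed simp

lemma opF_far: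
  assumes "Suc i < j \<or> Suc j < i"
  shows "opF i w (\<lambda>w. opF j w u) = opF j w (\<lambda>w. opF i w u)"
proof (induct w arbitrary: u)
  case (Cons a w)
  consider "c a = i" | "c a = Suc i" | "c a = j" | "c a = Suc j"
    | "c a \<noteq> i" "c a \<noteq> Suc i" "c a \<noteq> j" "c a \<noteq> Suc j" by blast
  then show ?case using assms
    by cases (simp add: kp_def opF_add opF_cmult opF_charw mult.assoc Cons[of "\<lambda>v. u (a # v)"]; (auto; fail)?)+
qed simp

lemma opE_opF:
  "opE i w (\<lambda>w. opF j w u) - opF j w (\<lambda>w. opE i w u) =
    (if i = j then inverse (qq - inverse qq) * (charw (kp i) w * u w - inverse (charw (kp i) w) * u w) else 0)"
proof (induct w arbitrary: u)
  case (Cons a w)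
  have IH: "opE i w (\<lambda>w. opF j w (\<lambda>v. u (a # v))) = opF j w (\<lambda>w. opE i w (\<lambda>v. u (a # v))) +
    (if i = j then inverse (qq - inverse qq) * (charw (kp i) w * u (a # w) - inverse (charw (kp i) w) * u (a # w)) else 0)"
    using Cons[of "\<lambda>v. u (a # v)"] by (simp add: algebra_simps)
  have q: "inverse (qq - inverse qq) * (qq - inverse qq) = 1" by simp
  define d where "d = inverse (qq - inverse qq)"
  \<comment> \<open>Replacing d q by 1 + d / q removes all products of d with q, which leaves a
    normal form for the comparison without fractions.\<close>
  have e: "d * qq = 1 + d * inverse qq" using q unfolding d_def[symmetric] by (simp add: right_diff_distrib diff_eq_eq)
  have d: "d * (qq * x) = x + d * (inverse qq * x)" for x
    unfolding mult.assoc[symmetric] e by (simp add: distrib_right)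
  have d': "qq * (d * x) = x + d * (inverse qq * x)" "qq * (inverse qq * x) = x" for x
    using d[of x] by (simp_all add: mult.left_commute)
  have d'': "inverse qq * (qq * x) = x" for x by simp
  show ?case
  proof (cases "i = j")
    case True
    have IH': "opE j w (\<lambda>w. opF j w (\<lambda>v. u (a # v))) = opF j w (\<lambda>w. opE j w (\<lambda>v. u (a # v))) +
      d * (charw (kp j) w * u (a # w) - inverse (charw (kp j) w) * u (a # w))"
      using IH unfolding True d_def by simp
    consider "c a = j" | "c a = Suc j" | "c a \<noteq> j" "c a \<noteq> Suc j" by blast
    then show ?thesis unfolding d_def[symmetric] True
      by cases (simp_all add: opE_add opE_cmult opF_add opF_cmult opE_charw IH' mv_c d d'
          mult.assoc right_diff_distrib distrib_left)
  next
    case False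
    consider "c a = i" | "c a = Suc i" | "c a = j" | "c a = Suc j"
      | "c a \<noteq> i" "c a \<noteq> Suc i" "c a \<noteq> j" "c a \<noteq> Suc j" by blast
    then show ?thesis using False
      by cases (auto simp: opE_add opE_cmult opF_add opF_cmult opE_charw IH kp_def
          distrib_left mult.assoc d'')
  qed
qed simp

lemma opE_commute_char:
  assumes "\<And>i a. \<chi> (mv i a) = (\<chi> a :: cq)"
  shows "opE i w (\<lambda>v. (\<Prod>a\<leftarrow>v. \<chi> a) * u v) = (\<Prod>a\<leftarrow>w. \<chi> a) * opE i w u"
proof (induct w arbitrary: u)
  case (Cons a w)
  show ?case by (simp add: assms mult.assoc opE_cmult Cons algebra_simps)
qed simp

lemma opF_commute_char:
  assumes "\<And>i a. \<chi> (mv i a) = (\<chi> a :: cq)"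
  shows "opF i w (\<lambda>v. (\<Prod>a\<leftarrow>v. \<chi> a) * u v) = (\<Prod>a\<leftarrow>w. \<chi> a) * opF i w u"
proof (induct w arbitrary: u)
  case (Cons a w)
  show ?case by (simp add: assms mult.assoc opF_cmult Cons algebra_simps)
qed simp

lemma charw_prod: "charw \<chi> w = (\<Prod>a\<leftarrow>w. \<chi> (c a))"
  by (induct w) auto

lemma uop_add: "uop g (\<lambda>v. f v + h v) = (\<lambda>v. uop g f v + uop g h v)"
  by (cases g) (simp_all add: opE_add opF_add algebra_simps)

lemma uop_cmult: "uop g (\<lambda>v. x * f v) = (\<lambda>v. x * uop g f v)"
  by (cases g) (simp_all add: opE_cmult opF_cmult algebra_simps)

lemma uop_0 [simp]: "uop g (\<lambda>v. 0) = (\<lambda>v. 0)"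
  by (cases g) simp_all

primrec act1 :: "uq_gen \<Rightarrow> (letter \<Rightarrow> cq) \<Rightarrow> letter \<Rightarrow> cq" where
  "act1 (GE i) f = (\<lambda>a. if c a = i then f (mv (Suc i) a) else 0)"
| "act1 (GF i) f = (\<lambda>a. if c a = Suc i then f (mv i a) else 0)"
| "act1 (GQ i) f = (\<lambda>a. qx i (c a) * f a)"
| "act1 (GQinv i) f = (\<lambda>a. inverse (qx i (c a)) * f a)"

end

lemma tensor_carrier: "carrier (tensor_space m n k) = {u. \<forall>w. w \<notin> words m n k \<longrightarrow> u w = 0}"
  by (simp add: tensor_space_def)

lemma words_Nil: "[] \<in> words m n k \<longleftrightarrow> k = 0"
  by (auto simp: words_def)

lemma words_Cons: "a # w \<in> words m n k \<longleftrightarrow> a \<in> letters m n \<and> (\<exists>k'. k = Suc k' \<and> w \<in> words m n k')"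
  by (auto simp: words_def)

lemma tensor_slice:
  "u \<in> carrier (tensor_space m n (Suc k)) \<Longrightarrow> (\<lambda>v. u (a # v)) \<in> carrier (tensor_space m n k)"
  "u \<in> carrier (tensor_space m n (Suc k)) \<Longrightarrow> a \<notin> letters m n \<Longrightarrow> u (a # v) = 0"
  "u \<in> carrier (tensor_space m n (Suc k)) \<Longrightarrow> u [] = 0"
  by (auto simp: tensor_carrier words_Cons words_Nil)

context coordinate
begin

lemma uop_Q_carrier:
  "u \<in> carrier (tensor_space m n k) \<Longrightarrow> uop (GQ i) u \<in> carrier (tensor_space m n k)"
  "u \<in> carrier (tensor_space m n k) \<Longrightarrow> uop (GQinv i) u \<in> carrier (tensor_space m n k)"
  by (auto simp: tensor_carrier)

lemma tensor_act_uop: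
  assumes \<rho>: "\<And>g f. (\<And>a. a \<notin> letters m n \<Longrightarrow> f a = 0) \<Longrightarrow> \<rho> g f = act1 g f"
  shows "u \<in> carrier (tensor_space m n k) \<Longrightarrow> tensor_act \<rho> k g u = uop g u"
proof (induct k arbitrary: g u)
  case 0
  have z: "u (a # w) = 0" for a w using 0 by (simp add: tensor_carrier words_Cons)
  have "opE i w u = 0" "opF i w u = 0" "charw \<chi> w * u w = u w" "inverse (charw \<chi> w) * u w = u w" for i w \<chi>
    by (cases w; simp add: z)+
  then show ?case by (cases g) auto
next
  case (Suc k)
  note sl = tensor_slice[OF Suc(2)]
  have IH: "tensor_act \<rho> k g (\<lambda>v. u (b # v)) = uop g (\<lambda>v. u (b # v))" for g b
    by (rule Suc(1)[OF sl(1)])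
  have z: "(\<lambda>v. u (b # v)) = (\<lambda>v. 0)" if "b \<notin> letters m n" for b
    using sl(2)[OF that] by auto
  have r: "\<rho> g (\<lambda>b. uop g' (\<lambda>v. u (b # v)) w) = act1 g (\<lambda>b. uop g' (\<lambda>v. u (b # v)) w)" for g g' w
    by (rule \<rho>) (simp add: z)
  have r0: "\<rho> g (\<lambda>b. u (b # w)) = act1 g (\<lambda>b. u (b # w))" for g w
    by (rule \<rho>) (simp add: sl)
  have r2: "\<rho> g (\<lambda>b. x * uop g' (\<lambda>v. u (b # v)) w) = act1 g (\<lambda>b. x * uop g' (\<lambda>v. u (b # v)) w)" for g g' w x
    by (rule \<rho>) (simp add: z)
  show ?case
  proof (rule ext)
    fix w
    show "tensor_act \<rho> (Suc k) g u w = uop g u w"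
    proof (cases w)
      case Nil
      then show ?thesis by (cases g) (simp_all add: on_head_def on_tail_def sl)
    next
      case (Cons a w')
      show ?thesis
      proof (cases g)
        case (GE i)
        have "\<rho> (GQ (Suc i)) (\<lambda>b. opE i w' (\<lambda>v. u (b # v))) = act1 (GQ (Suc i)) (\<lambda>b. opE i w' (\<lambda>v. u (b # v)))"
          using r[of "GQ (Suc i)" "GE i"] by simp
        moreover have "\<rho> (GQinv i) (\<lambda>b. qx (Suc i) (c b) * opE i w' (\<lambda>v. u (b # v)))
          = act1 (GQinv i) (\<lambda>b. qx (Suc i) (c b) * opE i w' (\<lambda>v. u (b # v)))"
          by (rule \<rho>) (simp add: z)
        ultimately show ?thesis unfolding GE Cons
          by (simp add: on_head_def on_tail_def IH r0 act_qh_inv_def) (auto simp: kp_def qx_def)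
      next
        case (GF i)
        have "tensor_act \<rho> k (GQ i) (uop (GQinv (Suc i)) (\<lambda>v. u (b # v))) = uop (GQ i) (uop (GQinv (Suc i)) (\<lambda>v. u (b # v)))" for b
          by (rule Suc(1)[OF uop_Q_carrier(2)[OF sl(1)]])
        moreover have "\<rho> (GF i) (\<lambda>b. charw (qx i) w' * (inverse (charw (qx (Suc i)) w') * u (b # w')))
            = act1 (GF i) (\<lambda>b. charw (qx i) w' * (inverse (charw (qx (Suc i)) w') * u (b # w')))"
          by (rule \<rho>) (simp add: sl)
        ultimately show ?thesis unfolding GF Cons
          by (simp add: on_head_def on_tail_def IH charw_kp)
      next
        case (GQ i)
        show ?thesis using r[of "GQ i" "GQ i"] unfolding GQ Cons
          by (simp add: on_head_def on_tail_def IH)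
      next
        case (GQinv i)
        show ?thesis using r[of "GQinv i" "GQinv i"] unfolding GQinv Cons
          by (simp add: on_head_def on_tail_def IH)
      qed
    qed
  qed
qed

end

interpretation cL: coordinate fst "\<lambda>i a. (i, snd a)"
  by unfold_locales auto

interpretation cR: coordinate snd "\<lambda>j a. (fst a, j)"
  by unfold_locales auto

text \<open>In the sum of the linear extension only the one letter survives that the generator sends
  to a multiple of the letter b.\<close>

lemma tensor_actL_uop: "u \<in> carrier (tensor_space m n k) \<Longrightarrow> tensor_actL m n k g u = cL.uop g u"
  unfolding tensor_actL_def
proof (rule cL.tensor_act_uop)
  fix g and f :: "letter \<Rightarrow> cq"
  assume f: "\<And>a. a \<notin> letters m n \<Longrightarrow> f a = 0"
  show "linear_extension (letters m n) (basis_actL g) f = cL.act1 g f"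
  proof (rule ext)
    fix b
    have s: "(\<Sum>a\<in>letters m n. if a = x then h a else 0) = (if x \<in> letters m n then h x else 0)" for x and h :: "letter \<Rightarrow> cq"
      by simp
    show "linear_extension (letters m n) (basis_actL g) f b = cL.act1 g f b"
    proof (cases g)
      case (GE i)
      have "linear_extension (letters m n) (basis_actL g) f b =
        (\<Sum>a\<in>letters m n. if a = (Suc i, snd b) then (if fst b = i then f a else 0) else 0)"
        unfolding linear_extension_def GE by (intro sum.cong refl) (auto simp: ket_def prod_eq_iff split: prod.splits)
      then show ?thesis using f[of "(Suc i, snd b)"] unfolding s GE by (cases b) auto
    next
      case (GF i)
      have "linear_extension (letters m n) (basis_actL g) f b =
        (\<Sum>a\<in>letters m n. if a = (i, snd b) then (if fst b = Suc i then f a else 0) else 0)"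
        unfolding linear_extension_def GF by (intro sum.cong refl) (auto simp: ket_def prod_eq_iff split: prod.splits)
      then show ?thesis using f[of "(i, snd b)"] unfolding s GF by (cases b) auto
    next
      case (GQ i)
      have "linear_extension (letters m n) (basis_actL g) f b =
        (\<Sum>a\<in>letters m n. if a = b then cL.qx i (fst b) * f a else 0)"
        unfolding linear_extension_def GQ by (intro sum.cong refl) (auto simp: ket_def cL.qx_def split: prod.splits)
      then show ?thesis using f[of b] unfolding s GQ by auto
    next
      case (GQinv i)
      have "linear_extension (letters m n) (basis_actL g) f b =
        (\<Sum>a\<in>letters m n. if a = b then inverse (cL.qx i (fst b)) * f a else 0)"
        unfolding linear_extension_def GQinv
        by (intro sum.cong refl) (auto simp: ket_def cL.qx_def power_int_minus split: prod.splits)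
      then show ?thesis using f[of b] unfolding s GQinv by auto
    qed
  qed
qed

lemma tensor_actR_uop: "u \<in> carrier (tensor_space m n k) \<Longrightarrow> tensor_actR m n k g u = cR.uop g u"
  unfolding tensor_actR_def
proof (rule cR.tensor_act_uop)
  fix g and f :: "letter \<Rightarrow> cq"
  assume f: "\<And>a. a \<notin> letters m n \<Longrightarrow> f a = 0"
  show "linear_extension (letters m n) (basis_actR g) f = cR.act1 g f"
  proof (rule ext)
    fix b
    have s: "(\<Sum>a\<in>letters m n. if a = x then h a else 0) = (if x \<in> letters m n then h x else 0)" for x and h :: "letter \<Rightarrow> cq"
      by simp
    show "linear_extension (letters m n) (basis_actR g) f b = cR.act1 g f b"
    proof (cases g)
      case (GE i)
      have "linear_extension (letters m n) (basis_actR g) f b =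
        (\<Sum>a\<in>letters m n. if a = (fst b, Suc i) then (if snd b = i then f a else 0) else 0)"
        unfolding linear_extension_def GE by (intro sum.cong refl) (auto simp: ket_def prod_eq_iff split: prod.splits)
      then show ?thesis using f[of "(fst b, Suc i)"] unfolding s GE by (cases b) auto
    next
      case (GF i)
      have "linear_extension (letters m n) (basis_actR g) f b =
        (\<Sum>a\<in>letters m n. if a = (fst b, i) then (if snd b = Suc i then f a else 0) else 0)"
        unfolding linear_extension_def GF by (intro sum.cong refl) (auto simp: ket_def prod_eq_iff split: prod.splits)
      then show ?thesis using f[of "(fst b, i)"] unfolding s GF by (cases b) auto
    next
      case (GQ i)
      have "linear_extension (letters m n) (basis_actR g) f b =
        (\<Sum>a\<in>letters m n. if a = b then cR.qx i (snd b) * f a else 0)"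
        unfolding linear_extension_def GQ by (intro sum.cong refl) (auto simp: ket_def cR.qx_def split: prod.splits)
      then show ?thesis using f[of b] unfolding s GQ by auto
    next
      case (GQinv i)
      have "linear_extension (letters m n) (basis_actR g) f b =
        (\<Sum>a\<in>letters m n. if a = b then inverse (cR.qx i (snd b)) * f a else 0)"
        unfolding linear_extension_def GQinv
        by (intro sum.cong refl) (auto simp: ket_def cR.qx_def power_int_minus split: prod.splits)
      then show ?thesis using f[of b] unfolding s GQinv by auto
    qed
  qed
qed

text \<open>Left operators change first indices only, and their characters see nothing else; right
  operators do the same with second indices. The operators therefore commute letter by
  letter.\<close>

lemma uop_LR_commute: "cL.uop g (cR.uop h u) = cR.uop h (cL.uop g u)"
proof -
  have EE: "cL.opE i w (\<lambda>w. cR.opE j w u) = cR.opE j w (\<lambda>w. cL.opE i w u)" for i j w u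
    by (induct w arbitrary: u) (auto simp: cL.opE_add cR.opE_add cL.opE_cmult cR.opE_cmult algebra_simps)
  have kL: "cL.charw \<chi> w = (\<Prod>a\<leftarrow>w. \<chi> (fst a))" and kR: "cR.charw \<chi> w = (\<Prod>a\<leftarrow>w. \<chi> (snd a))" for \<chi> w
    by (rule cL.charw_prod cR.charw_prod)+
  have L: "cL.opE i w (\<lambda>v. cR.charw \<chi> v * u v) = cR.charw \<chi> w * cL.opE i w u"
    "cL.opF i w (\<lambda>v. cR.charw \<chi> v * u v) = cR.charw \<chi> w * cL.opF i w u"
    "cR.opE i w (\<lambda>v. cL.charw \<chi> v * u v) = cL.charw \<chi> w * cR.opE i w u"
    "cR.opF i w (\<lambda>v. cL.charw \<chi> v * u v) = cL.charw \<chi> w * cR.opF i w u" for i w \<chi> u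
    unfolding kL kR
    by (rule cL.opE_commute_char cL.opF_commute_char cR.opE_commute_char cR.opF_commute_char; simp)+
  have inv: "inverse (cL.charw \<chi> w) = cL.charw (\<lambda>x. inverse (\<chi> x)) w"
     "inverse (cR.charw \<chi> w) = cR.charw (\<lambda>x. inverse (\<chi> x)) w" for \<chi> w
    by (induct w; simp)+
  have EF: "cL.opE i w (\<lambda>w. cR.opF j w u) = cR.opF j w (\<lambda>w. cL.opE i w u)" for i j w u
    by (induct w arbitrary: u) (auto simp: cL.opE_add cR.opF_add cL.opE_cmult cR.opF_cmult L algebra_simps)
  have FE: "cL.opF i w (\<lambda>w. cR.opE j w u) = cR.opE j w (\<lambda>w. cL.opF i w u)" for i j w u
    by (induct w arbitrary: u) (auto simp: cL.opF_add cR.opE_add cL.opF_cmult cR.opE_cmult L algebra_simps)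
  have FF: "cL.opF i w (\<lambda>w. cR.opF j w u) = cR.opF j w (\<lambda>w. cL.opF i w u)" for i j w u
    by (induct w arbitrary: u) (auto simp: cL.opF_add cR.opF_add cL.opF_cmult cR.opF_cmult L algebra_simps)
  show ?thesis
    by (cases g; cases h) (simp_all add: EE EF FE FF L inv mult.left_commute)
qed

section \<open>Vector spaces and linear maps over the field of rational functions\<close>

lemma class_vsI:
  fixes V :: "(cq, 'v) module"
  assumes "\<zero>\<^bsub>V\<^esub> \<in> carrier V"
    "\<And>v w. v \<in> carrier V \<Longrightarrow> w \<in> carrier V \<Longrightarrow> v \<oplus>\<^bsub>V\<^esub> w \<in> carrier V"
    "\<And>v. v \<in> carrier V \<Longrightarrow> \<exists>w\<in>carrier V. v \<oplus>\<^bsub>V\<^esub> w = \<zero>\<^bsub>V\<^esub>"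
    "\<And>c v. v \<in> carrier V \<Longrightarrow> c \<odot>\<^bsub>V\<^esub> v \<in> carrier V"
    "\<And>v w. v \<in> carrier V \<Longrightarrow> w \<in> carrier V \<Longrightarrow> v \<oplus>\<^bsub>V\<^esub> w = w \<oplus>\<^bsub>V\<^esub> v"
    "\<And>v w x. v \<in> carrier V \<Longrightarrow> w \<in> carrier V \<Longrightarrow> x \<in> carrier V \<Longrightarrow> (v \<oplus>\<^bsub>V\<^esub> w) \<oplus>\<^bsub>V\<^esub> x = v \<oplus>\<^bsub>V\<^esub> (w \<oplus>\<^bsub>V\<^esub> x)"
    "\<And>v. v \<in> carrier V \<Longrightarrow> v \<oplus>\<^bsub>V\<^esub> \<zero>\<^bsub>V\<^esub> = v"
    "\<And>a b v. v \<in> carrier V \<Longrightarrow> (a * b) \<odot>\<^bsub>V\<^esub> v = a \<odot>\<^bsub>V\<^esub> (b \<odot>\<^bsub>V\<^esub> v)"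
    "\<And>v. v \<in> carrier V \<Longrightarrow> 1 \<odot>\<^bsub>V\<^esub> v = v"
    "\<And>a b v. v \<in> carrier V \<Longrightarrow> (a + b) \<odot>\<^bsub>V\<^esub> v = a \<odot>\<^bsub>V\<^esub> v \<oplus>\<^bsub>V\<^esub> b \<odot>\<^bsub>V\<^esub> v"
    "\<And>a v w. v \<in> carrier V \<Longrightarrow> w \<in> carrier V \<Longrightarrow> a \<odot>\<^bsub>V\<^esub> (v \<oplus>\<^bsub>V\<^esub> w) = a \<odot>\<^bsub>V\<^esub> v \<oplus>\<^bsub>V\<^esub> a \<odot>\<^bsub>V\<^esub> w"
  shows "vectorspace class_ring V"
  by (rule vs_criteria) (use assms in \<open>auto simp: class_field\<close>)

lemma class_linearI:
  fixes V :: "(cq, 'v) module" and W :: "(cq, 'w) module"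
  assumes "vectorspace class_ring V" "vectorspace class_ring W"
    "\<And>v. v \<in> carrier V \<Longrightarrow> T v \<in> carrier W"
    "\<And>v w. v \<in> carrier V \<Longrightarrow> w \<in> carrier V \<Longrightarrow> T (v \<oplus>\<^bsub>V\<^esub> w) = T v \<oplus>\<^bsub>W\<^esub> T w"
    "\<And>c v. v \<in> carrier V \<Longrightarrow> T (c \<odot>\<^bsub>V\<^esub> v) = c \<odot>\<^bsub>W\<^esub> T v"
  shows "linear_map class_ring V W T"
  using assms unfolding linear_map_def mod_hom_def mod_hom_axioms_def LinearCombinations.module_hom_def vectorspace_def by auto

lemma class_linearD:
  fixes V :: "(cq, 'v) module" and W :: "(cq, 'w) module"
  assumes "linear_map class_ring V W T"
  shows "v \<in> carrier V \<Longrightarrow> T v \<in> carrier W"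
    "v \<in> carrier V \<Longrightarrow> w \<in> carrier V \<Longrightarrow> T (v \<oplus>\<^bsub>V\<^esub> w) = T v \<oplus>\<^bsub>W\<^esub> T w"
    "v \<in> carrier V \<Longrightarrow> T (c \<odot>\<^bsub>V\<^esub> v) = c \<odot>\<^bsub>W\<^esub> T v"
    "v \<in> carrier V \<Longrightarrow> w \<in> carrier V \<Longrightarrow> T (v \<ominus>\<^bsub>V\<^esub> w) = T v \<ominus>\<^bsub>W\<^esub> T w"
    "T \<zero>\<^bsub>V\<^esub> = \<zero>\<^bsub>W\<^esub>"
proof -
  interpret linear_map class_ring V W T by (rule assms)
  show "v \<in> carrier V \<Longrightarrow> T v \<in> carrier W"
    "v \<in> carrier V \<Longrightarrow> w \<in> carrier V \<Longrightarrow> T (v \<oplus>\<^bsub>V\<^esub> w) = T v \<oplus>\<^bsub>W\<^esub> T w"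
    "v \<in> carrier V \<Longrightarrow> T (c \<odot>\<^bsub>V\<^esub> v) = c \<odot>\<^bsub>W\<^esub> T v"
    "v \<in> carrier V \<Longrightarrow> w \<in> carrier V \<Longrightarrow> T (v \<ominus>\<^bsub>V\<^esub> w) = T v \<ominus>\<^bsub>W\<^esub> T w"
    "T \<zero>\<^bsub>V\<^esub> = \<zero>\<^bsub>W\<^esub>" by auto
qed

lemma class_vs_minus:
  fixes V :: "(cq, 'v) module"
  assumes "vectorspace class_ring V" "x \<in> carrier V" "y \<in> carrier V"
  shows "x \<ominus>\<^bsub>V\<^esub> y = x \<oplus>\<^bsub>V\<^esub> (- 1) \<odot>\<^bsub>V\<^esub> y"
proof -
  interpret V: vectorspace class_ring V by (rule assms)
  show ?thesis using V.smult_minus_1[of y] assms(3) by (simp add: a_minus_def class_ring_simps)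
qed

lemma subspace_iff:
  fixes V :: "(cq, 'v) module"
  assumes "vectorspace class_ring V"
  shows "subspace class_ring W V \<longleftrightarrow> W \<subseteq> carrier V \<and> \<zero>\<^bsub>V\<^esub> \<in> W \<and>
    (\<forall>x\<in>W. \<forall>y\<in>W. x \<oplus>\<^bsub>V\<^esub> y \<in> W) \<and> (\<forall>c. \<forall>x\<in>W. c \<odot>\<^bsub>V\<^esub> x \<in> W)"
  using assms unfolding subspace_def submodule_def vectorspace_def by auto

subsection \<open>Quotients by invariant subspaces\<close>

locale quotient =
  fixes V :: "(cq, 'v) module" and W :: "'v set"
  assumes vs: "vectorspace class_ring V" and sub: "subspace class_ring W V"
begin

sublocale V: vectorspace class_ring V by (rule vs)

abbreviation pr :: "'v \<Rightarrow> 'v set" where "pr x \<equiv> W +>\<^bsub>V\<^esub> x"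
abbreviation Q where "Q \<equiv> quotient_space V W"

lemma W_facts: "W \<subseteq> carrier V" "\<zero>\<^bsub>V\<^esub> \<in> W" "x \<in> W \<Longrightarrow> y \<in> W \<Longrightarrow> x \<oplus>\<^bsub>V\<^esub> y \<in> W" "x \<in> W \<Longrightarrow> c \<odot>\<^bsub>V\<^esub> x \<in> W"
  using sub unfolding subspace_iff[OF vs] by auto

lemma V_uminus: "x \<in> carrier V \<Longrightarrow> \<ominus>\<^bsub>V\<^esub> x = (- 1) \<odot>\<^bsub>V\<^esub> x"
  using V.smult_minus_1[of x] by (simp add: class_ring_simps)

lemma W_additive: "additive_subgroup W V"
proof -
  have "\<ominus>\<^bsub>V\<^esub> x \<in> W" if "x \<in> W" for x
    using V_uminus[of x] W_facts(1) W_facts(4)[OF that] that by auto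
  then have "subgroup W (add_monoid V)"
    using W_facts(1-3) by (intro V.add.subgroupI) (auto simp: a_inv_def)
  then show ?thesis by (simp add: additive_subgroup_def)
qed

sublocale W: abelian_subgroup W V
  by (rule abelian_subgroupI3[OF W_additive]) unfold_locales

lemma pr_zero_iff: "x \<in> carrier V \<Longrightarrow> pr x = W \<longleftrightarrow> x \<in> W"
  using V.a_coset_join1[OF _ _ W.a_subgroup] V.a_coset_join2[OF _ W.a_subgroup] by blast

lemma pr_eq_iff:
  assumes "x \<in> carrier V" "y \<in> carrier V"
  shows "pr x = pr y \<longleftrightarrow> x \<ominus>\<^bsub>V\<^esub> y \<in> W"
proof -
  have "pr x = pr y \<longleftrightarrow> pr (x \<ominus>\<^bsub>V\<^esub> y) = W"
    using V.a_coset_add_inv1[of W x y] V.a_coset_add_inv2[of W x y] assms W_facts(1) by (auto simp: a_minus_def)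
  then show ?thesis using pr_zero_iff assms by simp
qed

lemma carrier_Q: "carrier Q = pr ` carrier V"
  by (auto simp: quotient_space_def A_RCOSETS_def RCOSETS_def a_r_coset_def)

lemma Q_ball: "(\<forall>X\<in>carrier Q. P X) \<longleftrightarrow> (\<forall>x\<in>carrier V. P (pr x))"
  by (auto simp: carrier_Q)

lemma pr_closed [simp]: "x \<in> carrier V \<Longrightarrow> pr x \<in> carrier Q"
  by (simp add: carrier_Q)

lemma Q_zero: "\<zero>\<^bsub>Q\<^esub> = pr \<zero>\<^bsub>V\<^esub>"
  using W_facts by (simp add: quotient_space_def pr_zero_iff)

lemma Q_zero': "\<zero>\<^bsub>Q\<^esub> = W"
  by (simp add: quotient_space_def)

lemma Q_add: "x \<in> carrier V \<Longrightarrow> y \<in> carrier V \<Longrightarrow> pr x \<oplus>\<^bsub>Q\<^esub> pr y = pr (x \<oplus>\<^bsub>V\<^esub> y)"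
  using W.a_rcos_sum by (simp add: quotient_space_def)

lemma pr_memD: assumes "x \<in> carrier V" "v \<in> pr x" shows "v \<in> carrier V" "v \<ominus>\<^bsub>V\<^esub> x \<in> W"
proof -
  obtain w where w: "w \<in> W" "v = w \<oplus>\<^bsub>V\<^esub> x" using assms unfolding a_r_coset_def' by auto
  then show "v \<in> carrier V" using W_facts(1) assms by auto
  have "v \<ominus>\<^bsub>V\<^esub> x = w" using w assms W_facts(1) by (auto simp: a_minus_def V.a_assoc V.r_neg)
  then show "v \<ominus>\<^bsub>V\<^esub> x \<in> W" using w by simp
qed

text \<open>All representatives of a coset have the same image coset, so the union defining
  \<open>quotient_map\<close> is a union of copies of one set.\<close>

lemma quotient_map_pr:
  assumes T: "linear_map class_ring V V T" "T ` W \<subseteq> W" and x: "x \<in> carrier V"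
  shows "quotient_map V W T (pr x) = pr (T x)"
proof -
  have "pr (T v) = pr (T x)" if v: "v \<in> pr x" for v
  proof -
    note v' = pr_memD[OF x v]
    have "T v \<ominus>\<^bsub>V\<^esub> T x \<in> W" using class_linearD(4)[OF T(1) v'(1) x] v'(2) T(2) by (metis image_subset_iff)
    then show ?thesis using pr_eq_iff class_linearD(1)[OF T(1)] v'(1) x by simp
  qed
  then show ?thesis using W.a_rcos_self[OF x] unfolding quotient_map_def by blast
qed

text \<open>Scalar multiplication on the quotient is built like an induced map, so it is the case
  where the operator is multiplication by c.\<close>

lemma Q_smult: assumes "x \<in> carrier V" shows "c \<odot>\<^bsub>Q\<^esub> pr x = pr (c \<odot>\<^bsub>V\<^esub> x)"
proof -
  have "linear_map class_ring V V (\<lambda>v. c \<odot>\<^bsub>V\<^esub> v)"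
    by (rule class_linearI[OF vs vs])
      (auto simp: V.smult_r_distr class_ring_simps mult.commute simp flip: V.smult_assoc1[unfolded class_ring_simps, simplified])
  moreover have "(\<lambda>v. c \<odot>\<^bsub>V\<^esub> v) ` W \<subseteq> W" using W_facts by auto
  ultimately have "quotient_map V W (\<lambda>v. c \<odot>\<^bsub>V\<^esub> v) (pr x) = pr (c \<odot>\<^bsub>V\<^esub> x)"
    by (rule quotient_map_pr[OF _ _ assms])
  then show ?thesis by (simp add: quotient_space_def quotient_map_def)
qed

lemma vectorspace_Q: "vectorspace class_ring Q"
proof -
  have c: "\<And>c x. x \<in> carrier V \<Longrightarrow> c \<odot>\<^bsub>V\<^esub> x \<in> carrier V" by simp
  show ?thesis
  proof (rule class_vsI)
    fix X assume "X \<in> carrier Q"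
    then obtain x where x: "x \<in> carrier V" "X = pr x" by (auto simp: carrier_Q)
    show "\<exists>Y\<in>carrier Q. X \<oplus>\<^bsub>Q\<^esub> Y = \<zero>\<^bsub>Q\<^esub>"
      using x by (intro bexI[of _ "pr (\<ominus>\<^bsub>V\<^esub> x)"]) (simp_all add: Q_add Q_zero V.r_neg)
  next
    show "\<zero>\<^bsub>Q\<^esub> \<in> carrier Q" by (simp add: Q_zero)
  qed (auto simp: carrier_Q Q_add Q_smult Q_zero V.a_ac V.smult_l_distr[unfolded class_ring_simps, simplified]
      V.smult_r_distr V.smult_assoc1[unfolded class_ring_simps, simplified] V.smult_one[unfolded class_ring_simps, simplified])
qed

lemma Q_minus: assumes "x \<in> carrier V" "y \<in> carrier V" shows "pr x \<ominus>\<^bsub>Q\<^esub> pr y = pr (x \<ominus>\<^bsub>V\<^esub> y)"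
  using assms by (simp add: class_vs_minus[OF vectorspace_Q] class_vs_minus[OF vs] Q_add Q_smult)

lemma linear_quotient_map:
  assumes T: "linear_map class_ring V V T" "T ` W \<subseteq> W"
  shows "linear_map class_ring Q Q (quotient_map V W T)"
  by (rule class_linearI[OF vectorspace_Q vectorspace_Q])
    (auto simp: carrier_Q Q_add Q_smult quotient_map_pr[OF T] class_linearD[OF T(1)])

text \<open>Each defining relation is an equation between elements obtained by operators and linear
  operations, all of which commute with the projection.\<close>

lemma uq_gl_module_quotient:
  assumes M: "uq_gl_module N V \<rho>" and inv: "\<And>g. g \<in> uq_gens N \<Longrightarrow> \<rho> g ` W \<subseteq> W"
  shows "uq_gl_module N Q (\<lambda>g. quotient_map V W (\<rho> g))"
proof -
  have lin: "linear_map class_ring V V (\<rho> g)" if "g \<in> uq_gens N" for g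
    using M that unfolding uq_gl_module_def by blast
  note [simp] = quotient_map_pr[OF lin inv] class_linearD(1)[OF lin]
  have [simp]: "i \<in> {1..<N} \<Longrightarrow> GE i \<in> uq_gens N" "i \<in> {1..<N} \<Longrightarrow> GF i \<in> uq_gens N"
    "i \<in> {1..N} \<Longrightarrow> GQ i \<in> uq_gens N" "i \<in> {1..N} \<Longrightarrow> GQinv i \<in> uq_gens N"
    "i \<in> {1..<N} \<Longrightarrow> GQ i \<in> uq_gens N" "i \<in> {1..<N} \<Longrightarrow> GQinv i \<in> uq_gens N"
    "i \<in> {1..<N} \<Longrightarrow> GQ (Suc i) \<in> uq_gens N" "i \<in> {1..<N} \<Longrightarrow> GQinv (Suc i) \<in> uq_gens N" for i
    by (auto simp: uq_gens_def)
  show ?thesis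
    unfolding uq_gl_module_def serre_rel_def Q_ball
    using M unfolding uq_gl_module_def serre_rel_def
    by (simp add: vectorspace_Q linear_quotient_map[OF lin inv] Q_add Q_smult Q_minus Q_zero act_qh_def act_qh_inv_def
        del: atLeastLessThan_iff atLeastAtMost_iff One_nat_def)
qed

end

theorem uq_gl_bimodule_quotient:
  assumes B: "uq_gl_bimodule m n V \<rho>L \<rho>R" and sub: "subspace class_ring W V"
    and L: "\<And>g. g \<in> uq_gens m \<Longrightarrow> \<rho>L g ` W \<subseteq> W" and R: "\<And>g. g \<in> uq_gens n \<Longrightarrow> \<rho>R g ` W \<subseteq> W"
  shows "uq_gl_bimodule m n (quotient_space V W) (\<lambda>g. quotient_map V W (\<rho>L g)) (\<lambda>g. quotient_map V W (\<rho>R g))"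
proof -
  have M: "uq_gl_module m V \<rho>L" "uq_gl_module n V \<rho>R" using B by (simp_all add: uq_gl_bimodule_def)
  have "vectorspace class_ring V" using M by (simp add: uq_gl_module_def)
  from quotient.intro[OF this sub] interpret quotient V W .
  have l: "linear_map class_ring V V (\<rho>L g)" if "g \<in> uq_gens m" for g
    using M(1) that unfolding uq_gl_module_def by simp
  have r: "linear_map class_ring V V (\<rho>R g)" if "g \<in> uq_gens n" for g
    using M(2) that unfolding uq_gl_module_def by simp
  show ?thesis unfolding uq_gl_bimodule_def
  proof (intro conjI ballI)
    show "uq_gl_module m Q (\<lambda>g. quotient_map V W (\<rho>L g))" by (rule uq_gl_module_quotient[OF M(1) L])
    show "uq_gl_module n Q (\<lambda>g. quotient_map V W (\<rho>R g))" by (rule uq_gl_module_quotient[OF M(2) R])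
    fix g h X assume gh: "g \<in> uq_gens m" "h \<in> uq_gens n" and "X \<in> carrier Q"
    then obtain x where x: "x \<in> carrier V" "X = pr x" by (auto simp: carrier_Q)
    have "\<rho>L g (\<rho>R h x) = \<rho>R h (\<rho>L g x)" using B gh x unfolding uq_gl_bimodule_def by blast
    then show "quotient_map V W (\<rho>L g) (quotient_map V W (\<rho>R h) X) = quotient_map V W (\<rho>R h) (quotient_map V W (\<rho>L g) X)"
      unfolding x(2) using x(1) gh
      by (simp only: quotient_map_pr[OF l L] quotient_map_pr[OF r R] class_linearD(1)[OF l] class_linearD(1)[OF r])
  qed
qed

subsection \<open>Tensor powers\<close>

lemma tensor_simps [simp]:
  "\<zero>\<^bsub>tensor_space m n k\<^esub> = (\<lambda>w. 0)" "u \<oplus>\<^bsub>tensor_space m n k\<^esub> v = (\<lambda>w. u w + v w)"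
  "x \<odot>\<^bsub>tensor_space m n k\<^esub> u = (\<lambda>w. x * u w)"
  by (simp_all add: tensor_space_def)

lemma vectorspace_tensor: "vectorspace class_ring (tensor_space m n k)"
proof (rule class_vsI)
  fix v assume "v \<in> carrier (tensor_space m n k)"
  then show "\<exists>w\<in>carrier (tensor_space m n k). v \<oplus>\<^bsub>tensor_space m n k\<^esub> w = \<zero>\<^bsub>tensor_space m n k\<^esub>"
    by (intro bexI[of _ "\<lambda>w. - v w"]) (auto simp: tensor_carrier)
qed (auto simp: tensor_carrier algebra_simps)

lemma tensor_minus:
  assumes "u \<in> carrier (tensor_space m n k)" "v \<in> carrier (tensor_space m n k)"
  shows "u \<ominus>\<^bsub>tensor_space m n k\<^esub> v = (\<lambda>w. u w - v w)"
  using class_vs_minus[OF vectorspace_tensor assms] by simp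

text \<open>Since the operators act on coordinate functions, the grid has to be closed under undoing
  a move: the value at a word outside the grid is read only at words that lie outside as
  well.\<close>

lemma (in coordinate) uop_carrier:
  assumes mv: "\<And>i a. i \<in> {1..N} \<Longrightarrow> c a \<in> {1..N} \<Longrightarrow> mv i a \<in> letters m n \<Longrightarrow> a \<in> letters m n"
    and g: "g \<in> uq_gens N" and u: "u \<in> carrier (tensor_space m n k)"
  shows "uop g u \<in> carrier (tensor_space m n k)"
proof -
  have sl: "(\<lambda>v. u (a # v)) \<in> carrier (tensor_space m n (k - 1))" "a \<notin> letters m n \<or> k = 0 \<Longrightarrow> u (a # v) = 0"
    if "u \<in> carrier (tensor_space m n k)" for u k a v
    using that by (cases k; auto simp: tensor_carrier words_Cons words_def)+
  have E: "opE i w u = 0" if "i \<in> {1..<N}" "w \<notin> words m n k" "u \<in> carrier (tensor_space m n k)" for i w u k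
    using that(2,3)
  proof (induct w arbitrary: u k)
    case (Cons a w)
    have 1: "c a = i \<Longrightarrow> u (mv (Suc i) a # w) = 0"
      using mv[of "Suc i" a] that(1) Cons(2,3) by (auto simp: tensor_carrier words_Cons)
    have 2: "opE i w (\<lambda>v. u (a # v)) = 0"
    proof (cases "a \<notin> letters m n \<or> k = 0")
      case True
      then show ?thesis using sl(2)[OF Cons(3)] by simp
    next
      case False
      then show ?thesis using Cons(1)[OF _ sl(1)[OF Cons(3)]] Cons(2) by (cases k) (auto simp: words_Cons)
    qed
    show ?case using 1 2 by simp
  qed simp
  have F: "opF i w u = 0" if "i \<in> {1..<N}" "w \<notin> words m n k" "u \<in> carrier (tensor_space m n k)" for i w u k
    using that(2,3)
  proof (induct w arbitrary: u k)
    case (Cons a w)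
    have 1: "c a = Suc i \<Longrightarrow> u (mv i a # w) = 0"
      using mv[of i a] that(1) Cons(2,3) by (auto simp: tensor_carrier words_Cons)
    have 2: "opF i w (\<lambda>v. u (a # v)) = 0"
    proof (cases "a \<notin> letters m n \<or> k = 0")
      case True
      then show ?thesis using sl(2)[OF Cons(3)] by simp
    next
      case False
      then show ?thesis using Cons(1)[OF _ sl(1)[OF Cons(3)]] Cons(2) by (cases k) (auto simp: words_Cons)
    qed
    show ?case using 1 2 by simp
  qed simp
  show ?thesis using g E[OF _ _ u] F[OF _ _ u] uop_Q_carrier[OF u]
    by (auto simp: uq_gens_def) (auto simp: tensor_carrier)
qed

lemma (in coordinate) uq_gl_module_tensor:
  assumes mv: "\<And>i a. i \<in> {1..N} \<Longrightarrow> c a \<in> {1..N} \<Longrightarrow> mv i a \<in> letters m n \<Longrightarrow> a \<in> letters m n"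
    and act: "\<And>u g. u \<in> carrier (tensor_space m n k) \<Longrightarrow> act g u = uop g u"
  shows "uq_gl_module N (tensor_space m n k) act"
proof -
  let ?C = "carrier (tensor_space m n k)"
  have [simp]: "i \<in> {1..<N} \<Longrightarrow> GE i \<in> uq_gens N" "i \<in> {1..<N} \<Longrightarrow> GF i \<in> uq_gens N" for i
    by (auto simp: uq_gens_def)
  have U: "g \<in> uq_gens N \<Longrightarrow> u \<in> ?C \<Longrightarrow> uop g u \<in> ?C" for g u by (rule uop_carrier[OF mv]) auto
  have E: "i \<in> {1..<N} \<Longrightarrow> u \<in> ?C \<Longrightarrow> (\<lambda>w. opE i w u) \<in> ?C" for i u using U[of "GE i" u] by simp
  have F: "i \<in> {1..<N} \<Longrightarrow> u \<in> ?C \<Longrightarrow> (\<lambda>w. opF i w u) \<in> ?C" for i u using U[of "GF i" u] by simp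
  have Q: "u \<in> ?C \<Longrightarrow> (\<lambda>w. charw (qx i) w * u w) \<in> ?C" "u \<in> ?C \<Longrightarrow> (\<lambda>w. inverse (charw (qx i) w) * u w) \<in> ?C" for u i
    using uop_Q_carrier[of u m n k i] by simp_all
  have sm: "u \<in> ?C \<Longrightarrow> (\<lambda>w. x * u w) \<in> ?C" for u x by (auto simp: tensor_carrier)
  have df: "u \<in> ?C \<Longrightarrow> v \<in> ?C \<Longrightarrow> (\<lambda>w. u w - v w) \<in> ?C" for u v by (auto simp: tensor_carrier)
  have lin: "linear_map class_ring (tensor_space m n k) (tensor_space m n k) (act g)" if "g \<in> uq_gens N" for g
  proof (rule class_linearI[OF vectorspace_tensor vectorspace_tensor])
    fix v w assume "v \<in> ?C" "w \<in> ?C"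
    moreover from this have "(\<lambda>x. v x + w x) \<in> ?C" by (auto simp: tensor_carrier)
    ultimately show "act g (v \<oplus>\<^bsub>tensor_space m n k\<^esub> w) = act g v \<oplus>\<^bsub>tensor_space m n k\<^esub> act g w"
      by (simp add: act uop_add)
  qed (use U that in \<open>simp_all add: act sm uop_cmult\<close>)
  have inv: "inverse (charw \<chi> w) = charw (\<lambda>x. inverse (\<chi> x)) w" for \<chi> w by (induct w) auto
  have cancel: "charw (qx i) w * (inverse (charw (qx i) w) * x) = x" "inverse (charw (qx i) w) * (charw (qx i) w * x) = x" for i w x
    by (simp_all add: mult.assoc[symmetric])
  have QE: "charw (qx i) w * opE j w (\<lambda>w. inverse (charw (qx i) w) * u w) =
      (qq powi (of_bool (i = j) - of_bool (i = Suc j))) * opE j w u" for i j w u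
    using opE_charw[of "\<lambda>x. inverse (qx i x)" j w u] charw_qx_neq_0[of i w]
    by (simp add: inv[symmetric]) (auto simp: qx_def power_int_minus)
  have QF: "charw (qx i) w * opF j w (\<lambda>w. inverse (charw (qx i) w) * u w) =
      (qq powi (- of_bool (i = j) + of_bool (i = Suc j))) * opF j w u" for i j w u
    using opF_charw[of "\<lambda>x. inverse (qx i x)" j w u] charw_qx_neq_0[of i w]
    by (simp add: inv[symmetric]) (auto simp: qx_def power_int_minus)
  show ?thesis
    unfolding uq_gl_module_def serre_rel_def
  proof (intro conjI ballI impI lin vectorspace_tensor)
    fix i j x assume "i \<in> {1..<N}" "j \<in> {1..<N}" and x: "x \<in> ?C"
    note ij = this(1,2)
    note [simp] = E[OF ij(1)] E[OF ij(2)] F[OF ij(1)] F[OF ij(2)] Q sm df x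
    show "act (GE i) (act (GF j) x) \<ominus>\<^bsub>tensor_space m n k\<^esub> act (GF j) (act (GE i) x) =
       (if i = j then inverse (qq - inverse qq) \<odot>\<^bsub>tensor_space m n k\<^esub> (act_qh act i x \<ominus>\<^bsub>tensor_space m n k\<^esub> act_qh_inv act i x)
        else \<zero>\<^bsub>tensor_space m n k\<^esub>)"
      by (auto simp: act tensor_minus act_qh_def act_qh_inv_def opE_opF charw_kp mult.assoc mult.left_commute)
    show "act (GE i) (act (GE i) (act (GE j) x)) \<ominus>\<^bsub>tensor_space m n k\<^esub>
       (qq + inverse qq) \<odot>\<^bsub>tensor_space m n k\<^esub> act (GE i) (act (GE j) (act (GE i) x)) \<oplus>\<^bsub>tensor_space m n k\<^esub>
       act (GE j) (act (GE i) (act (GE i) x)) = \<zero>\<^bsub>tensor_space m n k\<^esub>" if "j = Suc i \<or> i = Suc j"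
      using that by (auto simp: act tensor_minus opE_serre_up opE_serre_down simp del: tensor_carrier)
    show "act (GF i) (act (GF i) (act (GF j) x)) \<ominus>\<^bsub>tensor_space m n k\<^esub>
       (qq + inverse qq) \<odot>\<^bsub>tensor_space m n k\<^esub> act (GF i) (act (GF j) (act (GF i) x)) \<oplus>\<^bsub>tensor_space m n k\<^esub>
       act (GF j) (act (GF i) (act (GF i) x)) = \<zero>\<^bsub>tensor_space m n k\<^esub>" if "j = Suc i \<or> i = Suc j"
      using that by (auto simp: act tensor_minus opF_serre_up opF_serre_down simp del: tensor_carrier)
    show "act (GE i) (act (GE j) x) = act (GE j) (act (GE i) x)" if "Suc i < j \<or> Suc j < i"
      using opE_far[OF that] by (simp add: act)
    show "act (GF i) (act (GF j) x) = act (GF j) (act (GF i) x)" if "Suc i < j \<or> Suc j < i"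
      using opF_far[OF that] by (simp add: act)
  next
    fix i j x assume "i \<in> {1..N}" "j \<in> {1..<N}" and x: "x \<in> ?C"
    then show "act (GQ i) (act (GE j) (act (GQinv i) x)) =
        qq powi (of_bool (i = j) - of_bool (i = Suc j)) \<odot>\<^bsub>tensor_space m n k\<^esub> act (GE j) x"
      "act (GQ i) (act (GF j) (act (GQinv i) x)) =
        qq powi (- of_bool (i = j) + of_bool (i = Suc j)) \<odot>\<^bsub>tensor_space m n k\<^esub> act (GF j) x"
      by (simp_all add: act Q E F QE QF)
  qed (simp_all add: act Q cancel, simp_all add: mult.left_commute)
qed

theorem uq_gl_bimodule_tensor:
  "uq_gl_bimodule m n (tensor_space m n k) (tensor_actL m n k) (tensor_actR m n k)"
  unfolding uq_gl_bimodule_def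
proof (intro conjI ballI)
  show "uq_gl_module m (tensor_space m n k) (tensor_actL m n k)"
    by (rule cL.uq_gl_module_tensor[OF _ tensor_actL_uop]) (auto simp: letters_def)
  show "uq_gl_module n (tensor_space m n k) (tensor_actR m n k)"
    by (rule cR.uq_gl_module_tensor[OF _ tensor_actR_uop]) (auto simp: letters_def)
  fix g h x assume "g \<in> uq_gens m" "h \<in> uq_gens n" and x: "x \<in> carrier (tensor_space m n k)"
  moreover have "cL.uop g x \<in> carrier (tensor_space m n k)" if "g \<in> uq_gens m"
    by (rule cL.uop_carrier[OF _ that x]) (auto simp: letters_def)
  moreover have "cR.uop h x \<in> carrier (tensor_space m n k)" if "h \<in> uq_gens n"
    by (rule cR.uop_carrier[OF _ that x]) (auto simp: letters_def)
  ultimately show "tensor_actL m n k g (tensor_actR m n k h x) = tensor_actR m n k h (tensor_actL m n k g x)"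
    by (simp add: tensor_actL_uop tensor_actR_uop uop_LR_commute)
qed

section \<open>Tensoring with a letter on the left\<close>

definition prep :: "letter \<Rightarrow> (letter list \<Rightarrow> cq) \<Rightarrow> letter list \<Rightarrow> cq" where
  "prep a u = (\<lambda>w. case w of [] \<Rightarrow> 0 | b # v \<Rightarrow> if b = a then u v else 0)"

lemma prep_simps [simp]: "prep a u [] = 0" "prep a u (b # v) = (if b = a then u v else 0)"
  by (simp_all add: prep_def)

lemma ket_Cons: "ket (a # w) = prep a (ket w)"
  by (rule ext) (auto simp: ket_def prep_def split: list.splits)

lemma ket_simps: "ket a a = 1" "b \<noteq> a \<Longrightarrow> ket a b = 0"
  by (auto simp: ket_def)

lemma fun_list_eqI: "f [] = g [] \<Longrightarrow> (\<And>a w. f (a # w) = g (a # w)) \<Longrightarrow> f = g"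
  by (rule ext) (metis neq_Nil_conv)

lemma (in coordinate) mv_eq_iff: "mv i a = b \<longleftrightarrow> c b = i \<and> mv (c a) b = a"
  by (metis c_mv mv_c mv_mv)

context coordinate
begin

text \<open>Back from coordinates to vectors: \<open>prep a u\<close> is the tensor product of z_a
  and u, and the right hand side is the coproduct of e_i applied to it.\<close>

lemma opE_prep:
  "(\<lambda>w. opE i w (prep a u)) = (\<lambda>w. (if c a = Suc i then prep (mv i a) u w else 0) +
      inverse (kp i (c a)) * prep a (\<lambda>w. opE i w u) w)"
proof (rule fun_list_eqI)
  fix b w
  have "c b = i \<and> mv (Suc i) b = a \<longleftrightarrow> c a = Suc i \<and> b = mv i a"
    by (metis c_mv mv_c mv_mv)
  moreover have "opE i w (\<lambda>v. if b = a then u v else 0) = (if b = a then opE i w u else 0)" by simp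
  ultimately show "opE i (b # w) (prep a u) = (if c a = Suc i then prep (mv i a) u (b # w) else 0) +
      inverse (kp i (c a)) * prep a (\<lambda>w. opE i w u) (b # w)" by auto
qed simp

lemma opF_prep:
  "(\<lambda>w. opF i w (prep a u)) = (\<lambda>w. (if c a = i then prep (mv (Suc i) a) (\<lambda>v. charw (kp i) v * u v) w else 0) +
      prep a (\<lambda>w. opF i w u) w)"
proof (rule fun_list_eqI)
  fix b w
  have "c b = Suc i \<and> mv i b = a \<longleftrightarrow> c a = i \<and> b = mv (Suc i) a"
    by (metis c_mv mv_c mv_mv)
  moreover have "opF i w (\<lambda>v. if b = a then u v else 0) = (if b = a then opF i w u else 0)" by simp
  ultimately show "opF i (b # w) (prep a u) = (if c a = i then prep (mv (Suc i) a) (\<lambda>v. charw (kp i) v * u v) (b # w) else 0) +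
      prep a (\<lambda>w. opF i w u) (b # w)" by auto
qed simp

lemma Q_prep:
  "(\<lambda>w. charw \<chi> w * prep a u w) = (\<lambda>w. \<chi> (c a) * prep a (\<lambda>w. charw \<chi> w * u w) w)"
  by (rule fun_list_eqI) auto

lemma opF_ket2:
  "opF i w (ket [a, b]) = (if c a = i then kp i (c b) * ket [mv (Suc i) a, b] w else 0) +
     (if c b = i then ket [a, mv (Suc i) b] w else 0)"
proof -
  have n: "(\<lambda>w. opF i w (ket [])) = (\<lambda>w. 0)"
  proof (rule ext)
    fix w show "opF i w (ket []) = 0" by (cases w) (simp_all add: ket_def)
  qed
  have k: "(\<lambda>v. charw \<chi> v * ket [] v) = ket []" for \<chi> by (rule fun_list_eqI) (auto simp: ket_def)
  have p0: "prep a (\<lambda>w. 0) = (\<lambda>w. 0)" for a by (rule fun_list_eqI) auto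
  have "(\<lambda>w. opF i w (ket [a, b])) = (\<lambda>w. (if c a = i then kp i (c b) * ket [mv (Suc i) a, b] w else 0) +
     (if c b = i then ket [a, mv (Suc i) b] w else 0))"
    unfolding ket_Cons opF_prep Q_prep k n p0 by (rule fun_list_eqI) (auto simp: prep_def split: list.splits)
  then show ?thesis by (rule fun_cong)
qed

end

subsection \<open>The quadratic relations\<close>

text \<open>Linear equations on the coordinates of a tensor of degree 2. They hold for the two
  generators and are stable under both actions, hence hold on all of Im and bound it from
  above.\<close>

definition relK :: "(letter list \<Rightarrow> cq) \<Rightarrow> bool" where
  "relK x \<longleftrightarrow> (\<forall>a. x [a, a] = 0) \<and>
    (\<forall>i j j'. j < j' \<longrightarrow> x [(i, j), (i, j')] = - qq * x [(i, j'), (i, j)]) \<and>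
    (\<forall>i i' j. i < i' \<longrightarrow> x [(i, j), (i', j)] = - qq * x [(i', j), (i, j)]) \<and>
    (\<forall>i i' j j'. i < i' \<and> j < j' \<longrightarrow> x [(i, j), (i', j')] = - x [(i', j'), (i, j)] \<and>
      x [(i', j), (i, j')] = - x [(i, j'), (i', j)] - (qq - inverse qq) * x [(i', j'), (i, j)])"

lemma relK_rules:
  assumes "relK x"
  shows "x [a, a] = 0" "j < j' \<Longrightarrow> x [(i, j), (i, j')] = - qq * x [(i, j'), (i, j)]"
    "i < i' \<Longrightarrow> x [(i, j), (i', j)] = - qq * x [(i', j), (i, j)]"
    "i < i' \<Longrightarrow> j < j' \<Longrightarrow> x [(i, j), (i', j')] = - x [(i', j'), (i, j)]"
    "i < i' \<Longrightarrow> j < j' \<Longrightarrow> x [(i', j), (i, j')] = - x [(i, j'), (i', j)] - (qq - inverse qq) * x [(i', j'), (i, j)]"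
  using assms unfolding relK_def by blast+

lemma relKI:
  assumes "\<And>a. x [a, a] = 0" "\<And>i j j'. j < j' \<Longrightarrow> x [(i, j), (i, j')] = - qq * x [(i, j'), (i, j)]"
    "\<And>i i' j. i < i' \<Longrightarrow> x [(i, j), (i', j)] = - qq * x [(i', j), (i, j)]"
    "\<And>i i' j j'. i < i' \<Longrightarrow> j < j' \<Longrightarrow> x [(i, j), (i', j')] = - x [(i', j'), (i, j)]"
    "\<And>i i' j j'. i < i' \<Longrightarrow> j < j' \<Longrightarrow>
      x [(i', j), (i, j')] = - x [(i, j'), (i', j)] - (qq - inverse qq) * x [(i', j'), (i, j)]"
  shows "relK x"
  unfolding relK_def by (intro conjI allI impI; (elim conjE)?) (fact assms(1), (rule assms; assumption)+)

lemma opE2: "cL.opE t [(i, j), (i', j')] x =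
    (if i = t then x [(Suc t, j), (i', j')] else 0) + inverse (cL.kp t i) * (if i' = t then x [(i, j), (Suc t, j')] else 0)"
  "cR.opE t [(i, j), (i', j')] x =
    (if j = t then x [(i, Suc t), (i', j')] else 0) + inverse (cR.kp t j) * (if j' = t then x [(i, j), (i', Suc t)] else 0)"
  "cL.opF t [(i, j), (i', j')] x =
    (if i = Suc t then cL.kp t i' * x [(t, j), (i', j')] else 0) + (if i' = Suc t then x [(i, j), (t, j')] else 0)"
  "cR.opF t [(i, j), (i', j')] x =
    (if j = Suc t then cR.kp t j' * x [(i, t), (i', j')] else 0) + (if j' = Suc t then x [(i, j), (i', t)] else 0)"
  by simp_all

text \<open>E_t x is read at words where a row t has become t + 1, so the equations for it combine
  equations for x with shifted rows. Rows may coincide or separate by the shift, and then an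
  equation of another type enters, as the last facts given to each step show.\<close>

lemma relK_opE_L: assumes "relK x" shows "relK (\<lambda>w. cL.opE t w x)"
proof -
  note R = relK_rules[OF assms]
  have 1: "cL.opE t [a, a] x = 0" for a
    using R(3)[of t "Suc t" "snd a"] by (cases a) (simp add: opE2 del: cL.opE.simps)
  have 2: "cL.opE t [(i, j), (i, j')] x = - qq * cL.opE t [(i, j'), (i, j)] x" if "j < j'" for i j j'
    using that R(4)[of t "Suc t" j j'] R(5)[of t "Suc t" j j']
    by (simp add: opE2 algebra_simps qq_cancel del: cL.opE.simps)
  have 3: "cL.opE t [(i, j), (i', j)] x = - qq * cL.opE t [(i', j), (i, j)] x" if "i < i'" for i i' j
    using that R(1)[of "(Suc t, j)"] R(3)[of "Suc t" i' j] R(3)[of i "Suc t" j]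
    by (cases "i = t"; cases "i' = t"; cases "i' = Suc t"; cases "i = Suc t")
      (simp_all add: opE2 algebra_simps del: cL.opE.simps)
  have 4: "cL.opE t [(i, j), (i', j')] x = - cL.opE t [(i', j'), (i, j)] x" if "i < i'" "j < j'" for i i' j j'
    using that R(2)[of j j' "Suc t"] R(4)[of "Suc t" i' j j'] R(4)[of i "Suc t" j j']
    by (cases "i = t"; cases "i' = t"; cases "i' = Suc t"; cases "i = Suc t")
      (simp_all add: opE2 algebra_simps del: cL.opE.simps)
  have 5: "cL.opE t [(i', j), (i, j')] x = - cL.opE t [(i, j'), (i', j)] x -
      (qq - inverse qq) * cL.opE t [(i', j'), (i, j)] x" if "i < i'" "j < j'" for i i' j j'
    using that R(2)[of j j' "Suc t"] R(5)[of "Suc t" i' j j'] R(5)[of i "Suc t" j j']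
    by (cases "i = t"; cases "i' = t"; cases "i' = Suc t"; cases "i = Suc t")
      (simp_all add: opE2 algebra_simps del: cL.opE.simps)
  show ?thesis by (rule relKI, rule 1, (rule 2 3 4 5; assumption)+)
qed

lemma relK_opF_L: assumes "relK x" shows "relK (\<lambda>w. cL.opF t w x)"
proof -
  note R = relK_rules[OF assms]
  have 1: "cL.opF t [a, a] x = 0" for a
    using R(3)[of t "Suc t" "snd a"] by (cases a) (simp add: opE2 del: cL.opF.simps)
  have 2: "cL.opF t [(i, j), (i, j')] x = - qq * cL.opF t [(i, j'), (i, j)] x" if "j < j'" for i j j'
    using that R(4)[of t "Suc t" j j'] R(5)[of t "Suc t" j j']
    by (simp add: opE2 algebra_simps qq_cancel del: cL.opF.simps)
  have 3: "cL.opF t [(i, j), (i', j)] x = - qq * cL.opF t [(i', j), (i, j)] x" if "i < i'" for i i' j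
    using that R(1)[of "(t, j)"] R(3)[of t i' j] R(3)[of i t j]
    by (cases "i = t"; cases "i' = t"; cases "i' = Suc t"; cases "i = Suc t")
      (simp_all add: opE2 algebra_simps del: cL.opF.simps)
  have 4: "cL.opF t [(i, j), (i', j')] x = - cL.opF t [(i', j'), (i, j)] x" if "i < i'" "j < j'" for i i' j j'
    using that R(2)[of j j' t] R(4)[of t i' j j'] R(4)[of i t j j']
    by (cases "i = t"; cases "i' = t"; cases "i' = Suc t"; cases "i = Suc t")
      (simp_all add: opE2 algebra_simps del: cL.opF.simps)
  have 5: "cL.opF t [(i', j), (i, j')] x = - cL.opF t [(i, j'), (i', j)] x -
      (qq - inverse qq) * cL.opF t [(i', j'), (i, j)] x" if "i < i'" "j < j'" for i i' j j'
    using that R(2)[of j j' t] R(5)[of t i' j j'] R(5)[of i t j j']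
    by (cases "i = t"; cases "i' = t"; cases "i' = Suc t"; cases "i = Suc t")
      (simp_all add: opE2 algebra_simps del: cL.opF.simps)
  show ?thesis by (rule relKI, rule 1, (rule 2 3 4 5; assumption)+)
qed

text \<open>Exchange of rows and columns. It carries the right action to the left one and preserves
  \<open>relK\<close>, so stability is computed for one side only.\<close>

definition transp :: "(letter list \<Rightarrow> cq) \<Rightarrow> letter list \<Rightarrow> cq" where
  "transp x w = x (map prod.swap w)"

lemma transp_transp [simp]: "transp (transp x) = x"
  by (simp add: transp_def fun_eq_iff comp_def)

lemma relK_transp: assumes "relK x" shows "relK (transp x)"
proof -
  note R = relK_rules[OF assms]
  have t: "transp x [(i, j), (i', j')] = x [(j, i), (j', i')]" for i j i' j' by (simp add: transp_def)
  show ?thesis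
  proof (rule relKI)
    show "transp x [a, a] = 0" for a by (cases a) (simp add: t R(1))
    fix i i' j j' :: nat assume ij: "i < i'" "j < j'"
    show "transp x [(i', j), (i, j')] = - transp x [(i, j'), (i', j)] - (qq - inverse qq) * transp x [(i', j'), (i, j)]"
      unfolding t using R(5)[OF ij(2,1)] by (simp add: algebra_simps)
  qed (simp_all add: t R)
qed

lemma opE_transp: "cR.opE t w x = cL.opE t (map prod.swap w) (transp x)"
proof (induct w arbitrary: x)
  case (Cons a w)
  have "transp (\<lambda>v. x (a # v)) = (\<lambda>v. transp x (prod.swap a # v))"
    by (simp add: transp_def fun_eq_iff comp_def)
  then show ?case by (auto simp: Cons cL.kp_def cR.kp_def) (auto simp: transp_def comp_def)
qed simp

lemma opF_transp: "cR.opF t w x = cL.opF t (map prod.swap w) (transp x)"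
proof (induct w arbitrary: x)
  case (Cons a w)
  have "transp (\<lambda>v. x (a # v)) = (\<lambda>v. transp x (prod.swap a # v))"
    by (simp add: transp_def fun_eq_iff comp_def)
  moreover have "cR.charw (cR.kp t) w = cL.charw (cL.kp t) (map prod.swap w)"
    by (induct w) (auto simp: cL.kp_def cR.kp_def)
  ultimately show ?case by (auto simp: Cons) (auto simp: transp_def comp_def)
qed simp

lemma relK_opE_R: assumes "relK x" shows "relK (\<lambda>w. cR.opE t w x)"
  using relK_transp[OF relK_opE_L[OF relK_transp[OF assms], of t]] unfolding opE_transp by (simp add: transp_def[abs_def])

lemma relK_opF_R: assumes "relK x" shows "relK (\<lambda>w. cR.opF t w x)"
  using relK_transp[OF relK_opF_L[OF relK_transp[OF assms], of t]] unfolding opF_transp by (simp add: transp_def[abs_def])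

text \<open>Each equation involves only words with the same rows and the same columns up to order,
  so a function that is constant on such words can be multiplied in.\<close>

lemma relK_char:
  assumes "relK x" "\<And>a b. \<psi> [a, b] = \<psi> [b, a]" 
    "\<And>i i' j j'. \<psi> [(i, j), (i', j')] = \<psi> [(i, j'), (i', j)]"
  shows "relK (\<lambda>w. (\<psi> w :: cq) * x w)"
proof -
  note R = relK_rules[OF assms(1)]
  have e: "\<psi> [(i', j'), (i, j)] = \<psi> [(i, j), (i', j')]" "\<psi> [(i, j'), (i', j)] = \<psi> [(i, j), (i', j')]"
    "\<psi> [(i', j), (i, j')] = \<psi> [(i, j), (i', j')]" for i i' j j'
    using assms(2,3) by metis+
  have "\<psi> [(i, j), (i, j')] * x [(i, j), (i, j')] = - qq * (\<psi> [(i, j'), (i, j)] * x [(i, j'), (i, j)])" if "j < j'" for i j j'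
    using R(2)[OF that, of i] assms(2)[of "(i, j)" "(i, j')"] by simp
  moreover have "\<psi> [(i, j), (i', j)] * x [(i, j), (i', j)] = - qq * (\<psi> [(i', j), (i, j)] * x [(i', j), (i, j)])" if "i < i'" for i i' j
    using R(3)[OF that, of j] assms(2)[of "(i, j)" "(i', j)"] by simp
  moreover have "\<psi> [(i, j), (i', j')] * x [(i, j), (i', j')] = - (\<psi> [(i', j'), (i, j)] * x [(i', j'), (i, j)]) \<and>
      \<psi> [(i', j), (i, j')] * x [(i', j), (i, j')] = - (\<psi> [(i, j'), (i', j)] * x [(i, j'), (i', j)]) -
      (qq - inverse qq) * (\<psi> [(i', j'), (i, j)] * x [(i', j'), (i, j)])" if "i < i'" "j < j'" for i i' j j'
  proof -
    define p where "p = \<psi> [(i, j), (i', j')]"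
    have p: "\<psi> [(i, j), (i', j')] = p" "\<psi> [(i', j'), (i, j)] = p" "\<psi> [(i, j'), (i', j)] = p" "\<psi> [(i', j), (i, j')] = p"
      using e p_def by metis+
    show ?thesis unfolding p R(4)[OF that] R(5)[OF that] by (simp add: algebra_simps)
  qed
  ultimately show ?thesis using R(1) by (intro relKI) auto
qed


lemma relK_uop:
  assumes "relK x" shows "relK (cL.uop g x)" "relK (cR.uop g x)"
proof -
  have L: "relK (\<lambda>w. cL.charw \<chi> w * x w)" "relK (\<lambda>w. inverse (cL.charw \<chi> w) * x w)" for \<chi>
    by (rule relK_char[OF assms]; simp)+
  have R: "relK (\<lambda>w. cR.charw \<chi> w * x w)" "relK (\<lambda>w. inverse (cR.charw \<chi> w) * x w)" for \<chi>
    by (rule relK_char[OF assms]; simp)+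
  show "relK (cL.uop g x)" using L relK_opE_L[OF assms] relK_opF_L[OF assms] by (cases g) simp_all
  show "relK (cR.uop g x)" using R relK_opE_R[OF assms] relK_opF_R[OF assms] by (cases g) simp_all
qed

lemma relK_add: assumes "relK x" "relK y" shows "relK (\<lambda>w. x w + y w)"
proof (rule relKI)
  note R = relK_rules[OF assms(1)] and S = relK_rules[OF assms(2)]
  show "x [a, a] + y [a, a] = 0" for a using R(1) S(1) by simp
  show "x [(i, j), (i, j')] + y [(i, j), (i, j')] = - qq * (x [(i, j'), (i, j)] + y [(i, j'), (i, j)])" if "j < j'" for i j j'
    unfolding R(2)[OF that] S(2)[OF that] by (simp add: algebra_simps)
  show "x [(i, j), (i', j)] + y [(i, j), (i', j)] = - qq * (x [(i', j), (i, j)] + y [(i', j), (i, j)])" if "i < i'" for i i' j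
    unfolding R(3)[OF that] S(3)[OF that] by (simp add: algebra_simps)
  fix i i' j j' :: nat assume a: "i < i'" "j < j'"
  show "x [(i, j), (i', j')] + y [(i, j), (i', j')] = - (x [(i', j'), (i, j)] + y [(i', j'), (i, j)])"
    unfolding R(4)[OF a] S(4)[OF a] by simp
  show "x [(i', j), (i, j')] + y [(i', j), (i, j')] = - (x [(i, j'), (i', j)] + y [(i, j'), (i', j)]) -
      (qq - inverse qq) * (x [(i', j'), (i, j)] + y [(i', j'), (i, j)])"
    unfolding R(5)[OF a] S(5)[OF a] by (simp add: algebra_simps)
qed

lemma relK_cmult: assumes "relK x" shows "relK (\<lambda>w. c * x w)"
  by (rule relK_char[OF assms]) simp_all

text \<open>Closure properties pass to the intersection that defines Im, and the solutions of
  \<open>relK\<close> form one of the submodules that are intersected.\<close>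

lemma Im2_facts:
  assumes mn: "m \<ge> 1" "n \<ge> 1"
  shows "x \<in> Im2 m n \<Longrightarrow> x \<in> carrier (tensor_space m n 2)"
  "(\<lambda>w. 0) \<in> Im2 m n"
  "x \<in> Im2 m n \<Longrightarrow> y \<in> Im2 m n \<Longrightarrow> (\<lambda>w. x w + y w) \<in> Im2 m n"
  "x \<in> Im2 m n \<Longrightarrow> (\<lambda>w. c * x w) \<in> Im2 m n"
  "g \<in> uq_gens m \<Longrightarrow> x \<in> Im2 m n \<Longrightarrow> cL.uop g x \<in> Im2 m n"
  "g \<in> uq_gens n \<Longrightarrow> x \<in> Im2 m n \<Longrightarrow> cR.uop g x \<in> Im2 m n"
  "rel_generators m n \<subseteq> Im2 m n"
  "x \<in> Im2 m n \<Longrightarrow> relK x"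
proof -
  let ?V = "tensor_space m n 2"
  have L: "cL.uop g u \<in> carrier ?V" if "g \<in> uq_gens m" "u \<in> carrier ?V" for g u
    by (rule cL.uop_carrier[OF _ that]) (auto simp: letters_def)
  have R: "cR.uop g u \<in> carrier ?V" if "g \<in> uq_gens n" "u \<in> carrier ?V" for g u
    by (rule cR.uop_carrier[OF _ that]) (auto simp: letters_def)
  have gen: "rel_generators m n \<subseteq> {x \<in> carrier ?V. relK x}"
  proof -
    have "relK (\<lambda>w. qq * ket [(1, 1), (1, 2)] w - ket [(1, 2), (1, 1)] w)"
      "relK (\<lambda>w. qq * ket [(1, 1), (2, 1)] w - ket [(2, 1), (1, 1)] w)"
      by (rule relKI; auto simp: ket_def)+
    then show ?thesis
      unfolding rel_generators_def using mn by (auto simp: tensor_carrier words_def letters_def ket_def)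
  qed
  have "subspace class_ring {x \<in> carrier ?V. relK x} ?V"
    unfolding subspace_iff[OF vectorspace_tensor]
    by (auto simp: tensor_carrier intro: relK_add relK_cmult) (simp add: relK_def)
  then have "{x \<in> carrier ?V. relK x} \<in> {W. subspace class_ring W ?V \<and> rel_generators m n \<subseteq> W \<and>
      (\<forall>g\<in>uq_gens m. tensor_actL m n 2 g ` W \<subseteq> W) \<and> (\<forall>h\<in>uq_gens n. tensor_actR m n 2 h ` W \<subseteq> W)}"
    using gen L R relK_uop by (auto simp: tensor_actL_uop tensor_actR_uop)
  then have "Im2 m n \<subseteq> {x \<in> carrier ?V. relK x}"
    unfolding Im2_def generated_submodule_def by (rule Inter_lower)
  then have A: "x \<in> carrier ?V" "relK x" if "x \<in> Im2 m n" for x using that by auto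
  then show "x \<in> Im2 m n \<Longrightarrow> x \<in> carrier ?V" "x \<in> Im2 m n \<Longrightarrow> relK x" by blast+
  show "(\<lambda>w. 0) \<in> Im2 m n" "x \<in> Im2 m n \<Longrightarrow> y \<in> Im2 m n \<Longrightarrow> (\<lambda>w. x w + y w) \<in> Im2 m n"
    "x \<in> Im2 m n \<Longrightarrow> (\<lambda>w. c * x w) \<in> Im2 m n" "rel_generators m n \<subseteq> Im2 m n"
    unfolding Im2_def generated_submodule_def by (auto simp: subspace_iff[OF vectorspace_tensor])
  define P where "P W \<longleftrightarrow> subspace class_ring W ?V \<and> rel_generators m n \<subseteq> W \<and>
      (\<forall>g\<in>uq_gens m. tensor_actL m n 2 g ` W \<subseteq> W) \<and> (\<forall>h\<in>uq_gens n. tensor_actR m n 2 h ` W \<subseteq> W)" for W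
  have iff: "x \<in> Im2 m n \<longleftrightarrow> (\<forall>W. P W \<longrightarrow> x \<in> W)" for x
    by (simp add: Im2_def generated_submodule_def P_def)
  show "cL.uop g x \<in> Im2 m n" if g: "g \<in> uq_gens m" and x: "x \<in> Im2 m n"
    unfolding iff
  proof (intro allI impI)
    fix W assume W: "P W"
    then have "tensor_actL m n 2 g ` W \<subseteq> W" "x \<in> W" using g x[unfolded iff] by (auto simp: P_def)
    then show "cL.uop g x \<in> W" using tensor_actL_uop[OF A(1)[OF x], of g] by auto
  qed
  show "cR.uop g x \<in> Im2 m n" if g: "g \<in> uq_gens n" and x: "x \<in> Im2 m n"
    unfolding iff
  proof (intro allI impI)
    fix W assume W: "P W"
    then have "tensor_actR m n 2 g ` W \<subseteq> W" "x \<in> W" using g x[unfolded iff] by (auto simp: P_def)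
    then show "cR.uop g x \<in> W" using tensor_actR_uop[OF A(1)[OF x], of g] by auto
  qed
qed

subsection \<open>The explicit relations\<close>

text \<open>The two coordinates of a letter with their roles left open, so that every argument about
  rows is also one about columns.\<close>

locale grid = P: coordinate c mv + Q: coordinate d dmv for c mv d dmv +
  fixes mk :: "nat \<Rightarrow> nat \<Rightarrow> letter"
  assumes mk_simps [simp]: "c (mk x y) = x" "d (mk x y) = y" "mv i (mk x y) = mk i y" "dmv j (mk x y) = mk x j"
begin

lemma line_relations:
  fixes W :: "(letter list \<Rightarrow> cq) set"
  assumes add: "\<And>u v. u \<in> W \<Longrightarrow> v \<in> W \<Longrightarrow> (\<lambda>w. u w + v w) \<in> W"
    and cm: "\<And>u c. u \<in> W \<Longrightarrow> (\<lambda>w. c * u w) \<in> W"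
    and PF: "\<And>i u. i \<in> {1..<N} \<Longrightarrow> u \<in> W \<Longrightarrow> (\<lambda>w. P.opF i w u) \<in> W"
    and QF: "\<And>i u. i \<in> {1..<M} \<Longrightarrow> u \<in> W \<Longrightarrow> (\<lambda>w. Q.opF i w u) \<in> W"
    and gen: "M \<ge> 2 \<Longrightarrow> (\<lambda>w. qq * ket [mk 1 1, mk 1 2] w - ket [mk 1 2, mk 1 1] w) \<in> W"
  shows "\<lbrakk>x \<in> {1..N}; 1 \<le> y; y < y'; y' \<le> M\<rbrakk> \<Longrightarrow> (\<lambda>w. qq * ket [mk x y, mk x y'] w - ket [mk x y', mk x y] w) \<in> W"
    and "\<lbrakk>1 \<le> x; x < x'; x' \<le> N; 1 \<le> y; y < y'; y' \<le> M\<rbrakk> \<Longrightarrow>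
      (\<lambda>w. qq\<^sup>2 * ket [mk x' y, mk x y'] w + qq * ket [mk x y, mk x' y'] w
        - qq * ket [mk x' y', mk x y] w - ket [mk x y', mk x' y] w) \<in> W"
proof -
  let ?r = "\<lambda>x y y' w. qq * ket [mk x y, mk x y'] w - ket [mk x y', mk x y] w"
  let ?s = "\<lambda>x x' y y' w. qq\<^sup>2 * ket [mk x' y, mk x y'] w + qq * ket [mk x y, mk x' y'] w
        - qq * ket [mk x' y', mk x y] w - ket [mk x y', mk x' y] w"
  have df: "(\<lambda>w. u w - v w) = (\<lambda>w. u w + (- 1) * v w)" for u v :: "letter list \<Rightarrow> cq" by simp
  have FP: "P.opF i w (\<lambda>w. u w - v w) = P.opF i w u - P.opF i w v" for i w u v
    unfolding df P.opF_add P.opF_cmult by simp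
  have FQ: "Q.opF i w (\<lambda>w. u w - v w) = Q.opF i w u - Q.opF i w v" for i w u v
    unfolding df Q.opF_add Q.opF_cmult by simp
  note FP = FP P.opF_add P.opF_cmult P.opF_ket2 and FQ = FQ Q.opF_add Q.opF_cmult Q.opF_ket2
  \<comment> \<open>The larger of the two indices is moved first, so that the two stay distinct
    throughout.\<close>
  have a: "?r 1 1 (Suc (Suc k)) \<in> W" if "Suc (Suc k) \<le> M" for k
    using that
  proof (induct k)
    case 0 then show ?case using gen by (simp add: numeral_2_eq_2)
  next
    case (Suc k)
    have "(\<lambda>w. Q.opF (Suc (Suc k)) w (?r 1 1 (Suc (Suc k)))) \<in> W" using Suc by (intro QF) auto
    then show ?case by (simp add: FQ)
  qed
  have b: "?r 1 (Suc k) y' \<in> W" if "Suc k < y'" "y' \<le> M" for k y'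
    using that
  proof (induct k)
    case 0
    then obtain l where "y' = Suc (Suc l)" by (metis One_nat_def less_iff_Suc_add plus_1_eq_Suc add_Suc_right)
    then show ?case using a[of l] 0 by simp
  next
    case (Suc k)
    have "(\<lambda>w. Q.opF (Suc k) w (?r 1 (Suc k) y')) \<in> W" using Suc by (intro QF) auto
    then show ?case using Suc by (simp add: FQ)
  qed
  have step: "(\<lambda>w. P.opF i w (?r i y y')) = ?s i (Suc i) y y'" if "y < y'" for i y y'
    by (rule ext) (simp add: FP algebra_simps power2_eq_square)
  have c: "?r (Suc k) y y' \<in> W" if "Suc k \<le> N" "1 \<le> y" "y < y'" "y' \<le> M" for k y y'
    using that
  proof (induct k)
    case 0
    then show ?case using b[of "y - 1" y'] by simp
  next
    case (Suc k)
    have "(\<lambda>w. P.opF (Suc k) w (\<lambda>w. P.opF (Suc k) w (?r (Suc k) y y'))) \<in> W" using Suc by (intro PF) auto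
    moreover have "(\<lambda>w. P.opF (Suc k) w (?s (Suc k) (Suc (Suc k)) y y')) = (\<lambda>w. (qq + inverse qq) * ?r (Suc (Suc k)) y y' w)"
      by (rule ext) (simp add: FP algebra_simps power2_eq_square)
    ultimately have "(\<lambda>w. (qq + inverse qq) * ?r (Suc (Suc k)) y y' w) \<in> W"
      unfolding step[OF Suc(4)] by simp
    from cm[OF this, of "inverse (qq + inverse qq)"]
    have "(\<lambda>w. (inverse (qq + inverse qq) * (qq + inverse qq)) * ?r (Suc (Suc k)) y y' w) \<in> W" by (simp only: mult.assoc)
    moreover have "qq + inverse qq \<noteq> 0"
      using qq_plus_inverse_neq_0 by (simp add: power2_eq_square field_simps)
    ultimately show ?case by simp
  qed
  show "\<lbrakk>x \<in> {1..N}; 1 \<le> y; y < y'; y' \<le> M\<rbrakk> \<Longrightarrow> ?r x y y' \<in> W"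
    using c[of "x - 1" y y'] by simp
  \<comment> \<open>Starting from two neighbouring lines, only the farther one is moved on, so no
    new terms appear.\<close>
  have e: "?s (Suc k) (Suc (Suc k + l)) y y' \<in> W" if "Suc (Suc k + l) \<le> N" "1 \<le> y" "y < y'" "y' \<le> M" for k l y y'
    using that
  proof (induct l)
    case 0
    have "(\<lambda>w. P.opF (Suc k) w (?r (Suc k) y y')) \<in> W" using 0 c by (intro PF) auto
    then show ?case unfolding step[OF 0(3)] by simp
  next
    case (Suc l)
    have "(\<lambda>w. P.opF (Suc (Suc k + l)) w (?s (Suc k) (Suc (Suc k + l)) y y')) \<in> W" using Suc by (intro PF) auto
    then show ?case by (simp add: FP)
  qed
  show "\<lbrakk>1 \<le> x; x < x'; x' \<le> N; 1 \<le> y; y < y'; y' \<le> M\<rbrakk> \<Longrightarrow> ?s x x' y y' \<in> W"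
    using e[of "x - 1" "x' - x - 1" y y'] by simp
qed

end

interpretation LR: grid fst "\<lambda>i a. (i, snd a)" snd "\<lambda>j a. (fst a, j)" "\<lambda>x y. (x, y)"
  by unfold_locales auto

interpretation RL: grid snd "\<lambda>j a. (fst a, j)" fst "\<lambda>i a. (i, snd a)" "\<lambda>x y. (y, x)"
  by unfold_locales auto

definition rho :: "letter \<Rightarrow> letter \<Rightarrow> letter list \<Rightarrow> cq" where
  "rho a b w = ket [a, b] w - al a b * ket [b, a] w - be a b * ket [crossing a b, crossing b a] w"

text \<open>On a common row or column this is a line relation up to sign. In general position the
  row generator and the column generator each yield a mixed relation on the rectangle; their
  difference is q^2 + 1 times the commutation of the antidiagonal pair, and inserting this into one
  of them isolates the relation for the diagonal pair.\<close>

lemma rho_Im2: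
  assumes "a \<in> letters m n" "b \<in> letters m n" "lt_letter b a"
  shows "rho a b \<in> Im2 m n"
proof -
  let ?W = "Im2 m n"
  have mn: "m \<ge> 1" "n \<ge> 1" using assms(1) by (auto simp: letters_def)
  note Im2_facts = Im2_facts[OF mn]
  have F: "(\<lambda>w. cL.opF i w u) \<in> ?W" if "i \<in> {1..<m}" "u \<in> ?W" for i u
    using Im2_facts(5)[where g = "GF i" and x = u] that by (simp add: uq_gens_def)
  have G: "(\<lambda>w. cR.opF i w u) \<in> ?W" if "i \<in> {1..<n}" "u \<in> ?W" for i u
    using Im2_facts(6)[where g = "GF i" and x = u] that by (simp add: uq_gens_def)
  have gL: "n \<ge> 2 \<Longrightarrow> (\<lambda>w. qq * ket [(1, 1), (1, 2)] w - ket [(1, 2), (1, 1)] w) \<in> ?W"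
    and gR: "m \<ge> 2 \<Longrightarrow> (\<lambda>w. qq * ket [(1, 1), (2, 1)] w - ket [(2, 1), (1, 1)] w) \<in> ?W"
    using Im2_facts(7) unfolding rel_generators_def by auto
  note LR = LR.line_relations[OF Im2_facts(3,4) F G gL]
  note RL = RL.line_relations[OF Im2_facts(3,4) G F gR]
  obtain a1 a2 b1 b2 where e: "a = (a1, a2)" "b = (b1, b2)" by (metis surj_pair)
  have r: "1 \<le> a1" "a1 \<le> m" "1 \<le> b1" "b1 \<le> m" "1 \<le> a2" "a2 \<le> n" "1 \<le> b2" "b2 \<le> n"
    using assms(1,2) by (auto simp: e letters_def)
  consider "a1 = b1" "b2 < a2" | "a2 = b2" "b1 < a1" | "a1 < b1" "b2 < a2" | "b1 < a1" "b2 < a2"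
    using assms(3) unfolding lt_letter_def e by fastforce
  then show ?thesis
  proof cases
    case 1
    have "(\<lambda>w. (- 1) * (qq * ket [(b1, b2), (b1, a2)] w - ket [(b1, a2), (b1, b2)] w)) \<in> ?W"
      by (rule Im2_facts(4)[OF LR(1)]) (use 1 r in auto)
    moreover have "rho a b = (\<lambda>w. (- 1) * (qq * ket [(b1, b2), (b1, a2)] w - ket [(b1, a2), (b1, b2)] w))"
      using 1 by (simp add: fun_eq_iff rho_def e al_def be_def)
    ultimately show ?thesis by simp
  next
    case 2
    have "(\<lambda>w. (- 1) * (qq * ket [(b1, b2), (a1, b2)] w - ket [(a1, b2), (b1, b2)] w)) \<in> ?W"
      by (rule Im2_facts(4)[OF RL(1)]) (use 2 r in auto)
    moreover have "rho a b = (\<lambda>w. (- 1) * (qq * ket [(b1, b2), (a1, b2)] w - ket [(a1, b2), (b1, b2)] w))"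
      using 2 by (simp add: fun_eq_iff rho_def e al_def be_def)
    ultimately show ?thesis by simp
  next
    case 3
    let ?s = "\<lambda>w. qq\<^sup>2 * ket [(b1, b2), (a1, a2)] w + qq * ket [(a1, b2), (b1, a2)] w
        - qq * ket [(b1, a2), (a1, b2)] w - ket [(a1, a2), (b1, b2)] w"
    let ?t = "\<lambda>w. qq\<^sup>2 * ket [(a1, a2), (b1, b2)] w + qq * ket [(a1, b2), (b1, a2)] w
        - qq * ket [(b1, a2), (a1, b2)] w - ket [(b1, b2), (a1, a2)] w"
    have s: "?s \<in> ?W" by (rule LR(2)) (use 3 r in auto)
    have t: "?t \<in> ?W" by (rule RL(2)[where x = b2 and x' = a2 and y = a1 and y' = b1]) (use 3 r in simp_all)
    have "(\<lambda>w. inverse (qq\<^sup>2 + 1) * (?t w + (- 1) * ?s w)) \<in> ?W"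
      by (intro Im2_facts(3,4) s t)
    moreover have "inverse (qq\<^sup>2 + 1) * (?t w + (- 1) * ?s w) = rho a b w" for w
    proof -
      have "?t w + (- 1) * ?s w = (qq\<^sup>2 + 1) * rho a b w"
        using 3 by (simp add: rho_def e al_def be_def algebra_simps)
      then show ?thesis by (simp add: mult.assoc[symmetric])
    qed
    ultimately show ?thesis by simp
  next
    case 4
    let ?s = "\<lambda>w. qq\<^sup>2 * ket [(a1, b2), (b1, a2)] w + qq * ket [(b1, b2), (a1, a2)] w
        - qq * ket [(a1, a2), (b1, b2)] w - ket [(b1, a2), (a1, b2)] w"
    let ?t = "\<lambda>w. qq\<^sup>2 * ket [(b1, a2), (a1, b2)] w + qq * ket [(b1, b2), (a1, a2)] w
        - qq * ket [(a1, a2), (b1, b2)] w - ket [(a1, b2), (b1, a2)] w"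
    have s: "?s \<in> ?W" by (rule LR(2)) (use 4 r in auto)
    have t: "?t \<in> ?W" by (rule RL(2)[where x = b2 and x' = a2 and y = b1 and y' = a1]) (use 4 r in simp_all)
    have "(\<lambda>w. (- inverse qq) * (?s w + inverse (qq\<^sup>2 + 1) * (?t w + (- 1) * ?s w))) \<in> ?W"
      by (intro Im2_facts(3,4) s t)
    moreover have "(- inverse qq) * (?s w + inverse (qq\<^sup>2 + 1) * (?t w + (- 1) * ?s w)) = rho a b w" for w
    proof -
      let ?A = "ket [(a1, b2), (b1, a2)] w" and ?B = "ket [(b1, a2), (a1, b2)] w"
      have "?t w + (- 1) * ?s w = (qq\<^sup>2 + 1) * (?B - ?A)"
        by (simp add: algebra_simps)
      then have t': "inverse (qq\<^sup>2 + 1) * (?t w + (- 1) * ?s w) = ?B - ?A" by (simp add: mult.assoc[symmetric])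
      have c: "inverse qq * (qq * x) = x" for x by simp
      show ?thesis unfolding t'
        using 4 by (simp add: rho_def e al_def be_def crossing_def algebra_simps power2_eq_square c qq_cancel)
    qed
    ultimately show ?thesis by simp
  qed
qed

section \<open>Normal forms of tensors\<close>

definition Zs :: "nat \<Rightarrow> nat \<Rightarrow> letter list \<Rightarrow> (letter list \<Rightarrow> cq) \<Rightarrow> letter list \<Rightarrow> cq" where
  "Zs m n w = foldr (ZZ m n) w"

lemma Zs_simps [simp]: "Zs m n [] u = u" "Zs m n (a # w) u = ZZ m n a (Zs m n w u)"
  "Zs m n (v @ w) u = Zs m n v (Zs m n w u)"
  by (simp_all add: Zs_def)

lemma Zs_add: "Zs m n w (\<lambda>v. f v + g v) = (\<lambda>v. Zs m n w f v + Zs m n w g v)"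
  by (induct w) (simp_all add: ZZ_add)

lemma Zs_cmult: "Zs m n w (\<lambda>v. c * f v) = (\<lambda>v. c * Zs m n w f v)"
  by (induct w) (simp_all add: ZZ_cmult)

lemma Zs_0 [simp]: "Zs m n w (\<lambda>v. 0) = (\<lambda>v. 0)"
  by (induct w) simp_all

lemma ZZ_sum: "ZZ m n a (\<lambda>v. \<Sum>i\<in>I. f i * g i v) = (\<lambda>v. \<Sum>i\<in>I. f i * ZZ m n a (g i) v)"
  by (induct I rule: infinite_finite_induct) (simp_all add: ZZ_add ZZ_cmult)

lemma degree_supp_Zs: "degree_supp k u \<Longrightarrow> degree_supp (length w + k) (Zs m n w u)"
  by (induct w) (simp_all add: degree_supp_ZZ)

lemma degree_supp_ket: "degree_supp (length w) (ket w)"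
  by (auto simp: degree_supp_def ket_def)

lemma Zs_ket_support:
  assumes "w \<in> words m n k" "v \<notin> nwords m n k"
  shows "Zs m n w (ket []) v = 0"
proof (cases "length v = k")
  case False
  then show ?thesis using degree_supp_Zs[OF degree_supp_ket, of w "[]"] assms by (auto simp: degree_supp_def words_def)
next
  case True
  show ?thesis
  proof (cases w)
    case Nil
    then show ?thesis using assms True nwords_Nil by (auto simp: words_def)
  next
    case (Cons a w')
    then have "a \<in> letters m n" using assms(1) by (auto simp: words_def)
    then show ?thesis using ZZ_support[of a m n "Zs m n w' (ket [])" v] assms(2) True Cons by auto
  qed
qed

text \<open>Letters of a sorted word are put in front one after the other without rewriting; so
  \<open>nf\<close> fixes sorted words.\<close>

lemma Zs_ket_nword: "w \<in> nwords m n k \<Longrightarrow> Zs m n w (ket []) = ket w"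
proof (induct w arbitrary: k)
  case (Cons a w)
  then obtain k' where "k = Suc k'" using length_nwords by fastforce
  then show ?case using Cons ZZ_ket_Cons[of w a m n k'] by (auto simp: nwords_Cons)
qed simp

definition nf :: "nat \<Rightarrow> nat \<Rightarrow> nat \<Rightarrow> (letter list \<Rightarrow> cq) \<Rightarrow> letter list \<Rightarrow> cq" where
  "nf m n k u v = (\<Sum>w\<in>words m n k. u w * Zs m n w (ket []) v)"

lemma nf_add: "nf m n k (\<lambda>w. u w + v w) = (\<lambda>w. nf m n k u w + nf m n k v w)"
  by (rule ext) (simp add: nf_def distrib_right sum.distrib)

lemma nf_cmult: "nf m n k (\<lambda>w. c * u w) = (\<lambda>w. c * nf m n k u w)"
  by (rule ext) (simp add: nf_def sum_distrib_left mult.assoc)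

lemma nf_0 [simp]: "nf m n k (\<lambda>w. 0) = (\<lambda>w. 0)"
  by (rule ext) (simp add: nf_def)

lemma nf_support: "v \<notin> nwords m n k \<Longrightarrow> nf m n k u v = 0"
  by (simp add: nf_def Zs_ket_support)

lemma nf_ket: assumes "w \<in> words m n k" shows "nf m n k (ket w) = Zs m n w (ket [])"
proof (rule ext)
  fix v
  have "nf m n k (ket w) v = (\<Sum>x\<in>words m n k. if x = w then Zs m n x (ket []) v else 0)"
    unfolding nf_def by (intro sum.cong) (auto simp: ket_def)
  then show "nf m n k (ket w) v = Zs m n w (ket []) v" using assms by simp
qed

text \<open>The pairs (a, b) and (b, a) are taken together. For letters on a common line the two
  terms cancel; a diagonal pair leaves a multiple of W at the crossed letters, an antidiagonal pair
  a multiple of x at the crossed letters, and these leftovers cancel over each rectangle.\<close>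

lemma relK_sum:
  fixes W :: "letter \<Rightarrow> letter \<Rightarrow> cq"
  assumes x: "relK x"
    and W: "\<And>a b. a \<in> letters m n \<Longrightarrow> b \<in> letters m n \<Longrightarrow> lt_letter b a \<Longrightarrow>
      W a b = al a b * W b a + be a b * W (crossing a b) (crossing b a)"
  shows "(\<Sum>(a, b)\<in>letters m n \<times> letters m n. x [a, b] * W a b) = 0"
proof -
  let ?L = "letters m n \<times> letters m n"
  let ?f = "\<lambda>(a, b). x [a, b] * W a b"
  define D where "D = {(a, b) \<in> ?L. lt_letter b a}"
  define D' where "D' = {(a, b) \<in> ?L. lt_letter a b}"
  define D0 where "D0 = {(a, b) \<in> ?L. a = b}"
  define E3 where "E3 = {(a, b) \<in> ?L. fst b < fst a \<and> snd b < snd a}"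
  define E4 where "E4 = {(a, b) \<in> ?L. fst a < fst b \<and> snd b < snd a}"
  define E0 where "E0 = {(a, b) \<in> D. fst a = fst b \<or> snd a = snd b}"
  note R = relK_rules[OF x]
  have fin: "finite D" "finite D'" "finite D0" "finite E3" "finite E4" "finite E0"
    unfolding D_def D'_def D0_def E3_def E4_def E0_def by (auto intro: finite_subset[of _ ?L])
  have L: "?L = D \<union> D' \<union> D0" unfolding D_def D'_def D0_def lt_letter_def by (auto simp: prod_eq_iff)
  have "sum ?f ?L = sum ?f D + sum ?f D' + sum ?f D0"
    unfolding L by (subst sum.union_disjoint; (subst sum.union_disjoint)?; (use fin in \<open>auto simp: D_def D'_def D0_def lt_letter_def\<close>)?)
  also have "sum ?f D0 = 0" by (rule sum.neutral) (auto simp: D0_def R(1))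
  also have "sum ?f D' = sum (\<lambda>(a, b). x [b, a] * W b a) D"
    by (rule sum.reindex_bij_witness[of _ prod.swap prod.swap]) (auto simp: D_def D'_def)
  also have "sum ?f D + sum (\<lambda>(a, b). x [b, a] * W b a) D + 0 =
      (\<Sum>(a, b)\<in>D. x [a, b] * W a b + x [b, a] * W b a)"
    unfolding add_0_right by (subst sum.distrib[symmetric]) (rule sum.cong; auto)
  finally have 1: "sum ?f ?L = (\<Sum>(a, b)\<in>D. x [a, b] * W a b + x [b, a] * W b a)" .
  define g where "g = (\<lambda>(a, b). x [a, b] * W a b + x [b, a] * W b a)"
  have D: "D = E3 \<union> E4 \<union> E0" unfolding D_def E3_def E4_def E0_def lt_letter_def by auto
  have "sum g D = sum g E3 + sum g E4 + sum g E0"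
    unfolding D by (subst sum.union_disjoint; (subst sum.union_disjoint)?; (use fin in \<open>auto simp: E3_def E4_def E0_def\<close>)?)
  also have "sum g E0 = 0"
  proof (rule sum.neutral, clarify)
    fix a1 a2 b1 b2 assume "((a1, a2), (b1, b2)) \<in> E0"
    then have "(a1, a2) \<in> letters m n" "(b1, b2) \<in> letters m n" "lt_letter (b1, b2) (a1, a2)"
      and c: "a1 = b1 \<and> b2 < a2 \<or> a2 = b2 \<and> b1 < a1" by (auto simp: E0_def D_def lt_letter_def)
    from W[OF this(1-3)] c show "g ((a1, a2), (b1, b2)) = 0"
      by (auto simp: g_def al_def be_def R(2,3) mult.assoc mult.left_commute)
  qed
  also have "sum g E3 = (\<Sum>(a, b)\<in>E3. (qq - inverse qq) * x [a, b] * W (crossing a b) (crossing b a))"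
  proof (rule sum.cong[OF refl], clarify)
    fix a1 a2 b1 b2 assume "((a1, a2), (b1, b2)) \<in> E3"
    then have "(a1, a2) \<in> letters m n" "(b1, b2) \<in> letters m n" "lt_letter (b1, b2) (a1, a2)"
      and c: "b1 < a1" "b2 < a2" by (auto simp: E3_def lt_letter_def)
    from W[OF this(1-3)] c have w: "W (a1, a2) (b1, b2) = W (b1, b2) (a1, a2) +
        (qq - inverse qq) * W (crossing (a1, a2) (b1, b2)) (crossing (b1, b2) (a1, a2))"
      by (simp add: al_def be_def)
    from c show "g ((a1, a2), (b1, b2)) = (qq - inverse qq) * x [(a1, a2), (b1, b2)] *
      W (crossing (a1, a2) (b1, b2)) (crossing (b1, b2) (a1, a2))"
      by (simp add: g_def w R(4) algebra_simps)
  qed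
  also have "sum g E4 = (\<Sum>(a, b)\<in>E4. - (qq - inverse qq) * x [crossing b a, crossing a b] * W b a)"
  proof (rule sum.cong[OF refl], clarify)
    fix a1 a2 b1 b2 assume "((a1, a2), (b1, b2)) \<in> E4"
    then have "(a1, a2) \<in> letters m n" "(b1, b2) \<in> letters m n" "lt_letter (b1, b2) (a1, a2)"
      and c: "a1 < b1" "b2 < a2" by (auto simp: E4_def lt_letter_def)
    from W[OF this(1-3)] c have w: "W (a1, a2) (b1, b2) = W (b1, b2) (a1, a2)"
      by (simp add: al_def be_def)
    from c show "g ((a1, a2), (b1, b2)) = - (qq - inverse qq) *
      x [crossing (b1, b2) (a1, a2), crossing (a1, a2) (b1, b2)] * W (b1, b2) (a1, a2)"
      by (simp add: g_def w crossing_def R(5)[OF c] algebra_simps)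
  qed
  \<comment> \<open>Crossing exchanges the diagonal and the antidiagonal pair of a rectangle, a
    bijection between \<open>E4\<close> and \<open>E3\<close>.\<close>
  also have "(\<Sum>(a, b)\<in>E4. - (qq - inverse qq) * x [crossing b a, crossing a b] * W b a) =
     (\<Sum>(a, b)\<in>E3. - (qq - inverse qq) * x [a, b] * W (crossing a b) (crossing b a))"
    by (rule sum.reindex_bij_witness[of _ "\<lambda>(a, b). (crossing b a, crossing a b)" "\<lambda>(a, b). (crossing b a, crossing a b)"])
      (auto simp: E3_def E4_def crossing_def letters_def)
  also have "(\<Sum>(a, b)\<in>E3. (qq - inverse qq) * x [a, b] * W (crossing a b) (crossing b a)) +
      (\<Sum>(a, b)\<in>E3. - (qq - inverse qq) * x [a, b] * W (crossing a b) (crossing b a)) + 0 = 0"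
    unfolding add_0_right by (subst sum.distrib[symmetric]) (rule sum.neutral; auto simp: algebra_simps)
  finally have "sum g D = 0" .
  then show ?thesis unfolding 1 g_def .
qed

subsection \<open>The relation submodule is the kernel of the normal form\<close>

text \<open>The last part is the induction principle of the span: the relations with property P form
  a subspace that contains the spanning tensors.\<close>

lemma rel_subspace: "subspace class_ring (rel_submodule m n k) (tensor_space m n k)"
  and rel_gen: "p \<in> words m n t \<Longrightarrow> x \<in> Im2 m n \<Longrightarrow> s \<in> words m n r \<Longrightarrow> t + 2 + r = k \<Longrightarrow>
    insert_between p x s \<in> rel_submodule m n k"
  and rel_induct: "u \<in> rel_submodule m n k \<Longrightarrow> P (\<lambda>w. 0) \<Longrightarrow>
    (\<And>u v. u \<in> rel_submodule m n k \<Longrightarrow> v \<in> rel_submodule m n k \<Longrightarrow> P u \<Longrightarrow> P v \<Longrightarrow> P (\<lambda>w. u w + v w)) \<Longrightarrow>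
    (\<And>c u. u \<in> rel_submodule m n k \<Longrightarrow> P u \<Longrightarrow> P (\<lambda>w. c * u w)) \<Longrightarrow>
    (\<And>p x s t r. p \<in> words m n t \<Longrightarrow> x \<in> Im2 m n \<Longrightarrow> s \<in> words m n r \<Longrightarrow> t + 2 + r = k \<Longrightarrow> P (insert_between p x s)) \<Longrightarrow> P u"
  if mn: "m \<ge> 1" "n \<ge> 1"
proof -
  let ?V = "tensor_space m n k"
  interpret V: vectorspace class_ring ?V by (rule vectorspace_tensor)
  let ?S = "{insert_between p x s | p x s. \<exists>t r. p \<in> words m n t \<and> x \<in> Im2 m n \<and> s \<in> words m n r \<and> t + 2 + r = k}"
  have S: "?S \<subseteq> carrier ?V"
  proof clarify
    fix p x s t r assume a: "p \<in> words m n t" "x \<in> Im2 m n" "s \<in> words m n r" "k = t + 2 + r"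
    show "insert_between p x s \<in> carrier (tensor_space m n (t + 2 + r))"
      unfolding tensor_carrier
    proof (clarify, rule ccontr)
      fix w assume w: "w \<notin> words m n (t + 2 + r)" "insert_between p x s w \<noteq> 0"
      then have e: "take (length p) w = p" "drop (length p + 2) w = s" "x (take 2 (drop (length p) w)) \<noteq> 0"
        by (auto simp: insert_between_def split: if_splits)
      then have "take 2 (drop (length p) w) \<in> words m n 2"
        using Im2_facts(1)[OF mn a(2)] by (auto simp: tensor_carrier)
      moreover have "w = take (length p) w @ take 2 (drop (length p) w) @ drop (length p + 2) w"
        by (metis add.commute append_take_drop_id drop_drop)
      ultimately have "w = p @ take 2 (drop (length p) w) @ s" "take 2 (drop (length p) w) \<in> words m n 2"
        using e by auto
      then obtain y where "w = p @ y @ s" "y \<in> words m n 2" by blast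
      then show False using w(1) a by (auto simp: words_def)
    qed
  qed
  have R: "rel_submodule m n k = V.span ?S" by (simp add: rel_submodule_def)
  show sub: "subspace class_ring (rel_submodule m n k) ?V"
    unfolding R subspace_def using V.span_is_submodule[OF S] vectorspace_tensor by blast
  show "p \<in> words m n t \<Longrightarrow> x \<in> Im2 m n \<Longrightarrow> s \<in> words m n r \<Longrightarrow> t + 2 + r = k \<Longrightarrow>
    insert_between p x s \<in> rel_submodule m n k"
    unfolding R using V.in_own_span[OF S] by blast
  assume u: "u \<in> rel_submodule m n k" and P0: "P (\<lambda>w. 0)"
    and Pa: "\<And>u v. u \<in> rel_submodule m n k \<Longrightarrow> v \<in> rel_submodule m n k \<Longrightarrow> P u \<Longrightarrow> P v \<Longrightarrow> P (\<lambda>w. u w + v w)"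
    and Pc: "\<And>c u. u \<in> rel_submodule m n k \<Longrightarrow> P u \<Longrightarrow> P (\<lambda>w. c * u w)"
    and Pg: "\<And>p x s t r. p \<in> words m n t \<Longrightarrow> x \<in> Im2 m n \<Longrightarrow> s \<in> words m n r \<Longrightarrow> t + 2 + r = k \<Longrightarrow> P (insert_between p x s)"
  have "subspace class_ring {u \<in> rel_submodule m n k. P u} ?V"
    using sub P0 Pa Pc unfolding subspace_iff[OF vectorspace_tensor] by auto
  then have sm: "submodule class_ring {u \<in> rel_submodule m n k. P u} ?V" by (simp add: subspace_def)
  have "?S \<subseteq> {u \<in> rel_submodule m n k. P u}" using Pg V.in_own_span[OF S] unfolding R by blast
  from V.span_is_subset[OF this sm] have "V.span ?S \<subseteq> {u \<in> rel_submodule m n k. P u}" .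
  then show "P u" using u unfolding R by blast
qed

lemma insert_between_Nil: "insert_between [] x s w = (if drop 2 w = s then x (take 2 w) else 0)"
  by (simp add: insert_between_def numeral_2_eq_2)

lemma insert_between_Cons: "insert_between (a # p) x s = prep a (insert_between p x s)"
  by (rule fun_list_eqI) (auto simp: insert_between_def)

lemma prep_linear: "prep a (\<lambda>w. u w + v w) = (\<lambda>w. prep a u w + prep a v w)"
  "prep a (\<lambda>w. c * u w) = (\<lambda>w. c * prep a u w)" "prep a (\<lambda>w. 0) = (\<lambda>w. 0)"
  by (rule fun_list_eqI; simp)+

context
  fixes m n :: nat
  assumes mn: "m \<ge> 1" "n \<ge> 1"
begin

private abbreviation R :: "nat \<Rightarrow> (letter list \<Rightarrow> cq) set" where "R \<equiv> rel_submodule m n"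
private abbreviation L :: "letter set" where "L \<equiv> letters m n"

lemma R_facts:
  "u \<in> R k \<Longrightarrow> u \<in> carrier (tensor_space m n k)" "(\<lambda>w. 0) \<in> R k"
  "u \<in> R k \<Longrightarrow> v \<in> R k \<Longrightarrow> (\<lambda>w. u w + v w) \<in> R k" "u \<in> R k \<Longrightarrow> (\<lambda>w. c * u w) \<in> R k"
  using rel_subspace[OF mn, of k] unfolding subspace_iff[OF vectorspace_tensor] by auto

lemma R_sum: "(\<And>i. i \<in> I \<Longrightarrow> g i \<in> R k) \<Longrightarrow> (\<lambda>w. \<Sum>i\<in>I. f i * g i w) \<in> R k"
proof (induct I rule: infinite_finite_induct)
  case (insert i I)
  have "(\<lambda>w. f i * g i w + (\<Sum>i\<in>I. f i * g i w)) \<in> R k"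
    using insert by (intro R_facts(3) R_facts(4)) auto
  then show ?case using insert by simp
qed (simp_all add: R_facts)

lemma R_prep: "u \<in> R k \<Longrightarrow> a \<in> L \<Longrightarrow> prep a u \<in> R (Suc k)"
proof (induct u rule: rel_induct[OF mn, consumes 1])
  case (4 p x s t r)
  then show ?case unfolding insert_between_Cons[symmetric]
    by (intro rel_gen[OF mn, of _ "Suc t"]) (auto simp: words_Cons)
next
  case 1 show ?case unfolding prep_linear by (rule R_facts(2))
next
  case (2 u v) then show ?case unfolding prep_linear by (intro R_facts(3)) auto
next
  case (3 c u) then show ?case unfolding prep_linear by (intro R_facts(4)) auto
qed

text \<open>For the tensor of p, x and s only the words p @ [a, b] @ s contribute. Their normal
  forms, as functions of a and b, obey the straightening rule by \<open>ZZ_straight\<close>, while x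
  satisfies \<open>relK\<close>; such a pairing is zero.\<close>

lemma nf_R: "u \<in> R k \<Longrightarrow> nf m n k u = (\<lambda>v. 0)"
proof (induct u rule: rel_induct[OF mn, consumes 1])
  case (4 p x s t r)
  show ?case
  proof (rule ext)
    fix v
    let ?h = "\<lambda>(a, b). p @ [a, b] @ s"
    let ?f = "\<lambda>w. insert_between p x s w * Zs m n w (ket []) v"
    define W where "W a b = Zs m n (p @ [a, b] @ s) (ket []) v" for a b
    have lp: "length p = t" "length s = r" using 4 by (auto simp: words_def)
    have inj: "inj_on ?h (L \<times> L)" by (auto simp: inj_on_def)
    have sub: "?h ` (L \<times> L) \<subseteq> words m n k" using 4 by (auto simp: words_def)
    have "?f w = 0" if "w \<in> words m n k - ?h ` (L \<times> L)" for w
    proof (rule ccontr)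
      assume "?f w \<noteq> 0"
      then have e: "take (length p) w = p" "drop (length p + 2) w = s"
        by (auto simp: insert_between_def split: if_splits)
      define y where "y = take 2 (drop (length p) w)"
      have w: "w = p @ y @ s" unfolding y_def using e by (metis add.commute append_take_drop_id drop_drop)
      have "length y = 2" "set y \<subseteq> L" using that 4 lp unfolding w by (auto simp: words_def)
      then obtain a b where "y = [a, b]" "a \<in> L" "b \<in> L" by (auto simp: length_Suc_conv numeral_2_eq_2)
      then have "w \<in> ?h ` (L \<times> L)" using w by force
      then show False using that by simp
    qed
    then have "nf m n k (insert_between p x s) v = sum ?f (?h ` (L \<times> L))"
      unfolding nf_def using sub by (intro sum.mono_neutral_right) auto
    also have "\<dots> = (\<Sum>(a, b)\<in>L \<times> L. x [a, b] * W a b)"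
      unfolding sum.reindex[OF inj] by (intro sum.cong refl) (auto simp: insert_between_def W_def)
    also have "\<dots> = 0"
    proof (rule relK_sum)
      show "relK x" using Im2_facts(8)[OF mn 4(2)] .
      fix a b assume ab: "a \<in> L" "b \<in> L" "lt_letter b a"
      define u where "u = Zs m n s (ket [])"
      have "degree_supp (length s) u" unfolding u_def using degree_supp_Zs[OF degree_supp_ket, of s "[]"] by simp
      from ZZ_straight[OF ab this] show "W a b = al a b * W b a + be a b * W (crossing a b) (crossing b a)"
        unfolding W_def by (simp add: u_def[symmetric] straight_def Zs_add Zs_cmult)
    qed
    finally show "nf m n k (insert_between p x s) v = 0" .
  qed
qed (simp_all add: nf_add nf_cmult)

lemma wf_lt_letter: "wf {(b, a). lt_letter b a}"
  by (rule wf_subset[OF wf_measures[of "[snd, fst]"]]) (auto simp: lt_letter_def)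

lemma prep_ZZ_extend:
  assumes "\<And>w. w \<in> nwords m n k \<Longrightarrow> (\<lambda>v. prep a (ket w) v - ZZ m n a (ket w) v) \<in> R (Suc k)"
    and u: "\<And>v. v \<notin> nwords m n k \<Longrightarrow> u v = 0"
  shows "(\<lambda>v. prep a u v - ZZ m n a u v) \<in> R (Suc k)"
proof -
  have e: "u = (\<lambda>v. \<Sum>w\<in>nwords m n k. u w * ket w v)"
  proof (rule ext)
    fix v
    have "(\<Sum>w\<in>nwords m n k. u w * ket w v) = (\<Sum>w\<in>nwords m n k. if v = w then u w else 0)"
      by (intro sum.cong) (auto simp: ket_def)
    then show "u v = (\<Sum>w\<in>nwords m n k. u w * ket w v)" using u[of v] by simp
  qed
  have p: "prep a (\<lambda>v. \<Sum>w\<in>I. u w * g w v) = (\<lambda>v. \<Sum>w\<in>I. u w * prep a (g w) v)" for I :: "letter list set" and g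
    by (rule fun_list_eqI) (auto intro!: sum.neutral)
  have "(\<lambda>v. prep a u v - ZZ m n a u v) =
      (\<lambda>v. \<Sum>w\<in>nwords m n k. u w * (prep a (ket w) v - ZZ m n a (ket w) v))"
    by (subst (1 2) e) (simp add: p ZZ_sum sum_subtractf right_diff_distrib)
  also have "\<dots> \<in> R (Suc k)" by (intro R_sum assms)
  finally show ?thesis .
qed

text \<open>Modulo the relations, tensoring with z_a on the left is the operator \<open>ZZ\<close>.
  The two nested inductions, on the degree and on the letter a, follow the recursion of
  \<open>zc\<close>, and each rewriting step subtracts a relation \<open>rho a b\<close>.\<close>

lemma prep_ZZ_ket: "w \<in> nwords m n k \<Longrightarrow> a \<in> L \<Longrightarrow> (\<lambda>v. prep a (ket w) v - ZZ m n a (ket w) v) \<in> R (Suc k)"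
proof (induct k arbitrary: a w)
  case 0
  then have "w = []" using length_nwords by fastforce
  then show ?case by (simp add: ZZ_Nil ket_Cons R_facts)
next
  case (Suc k)
  show ?case using Suc(3,2)
  proof (induct a arbitrary: w rule: wf_induct_rule[OF wf_lt_letter])
    case (1 a)
    show ?case
    proof (cases "\<forall>b\<in>set w. \<not> lt_letter b a")
      case True
      then show ?thesis using 1(3) by (simp add: ZZ_ket_Cons ket_Cons R_facts)
    next
      case False
      then obtain b v where bv: "w = b # v" by (cases w) auto
      have bv': "b \<in> L" "v \<in> nwords m n k" "\<forall>c\<in>set v. \<not> lt_letter c b" using 1(3) unfolding bv nwords_Cons by auto
      have ba: "lt_letter b a" using False bv'(3) lt_letter_trans[of b a] unfolding bv by auto
      have cr: "crossing a b \<in> L" "crossing b a \<in> L" using 1(2) bv'(1) by (auto simp: crossing_def letters_def)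
      \<comment> \<open>The outer induction replaces the product of d and v by its normal form, the
        inner one then the product with c; the latter is available because c precedes a.\<close>
      have step: "(\<lambda>x. ket (c # d # v) x - ZZ m n c (ZZ m n d (ket v)) x) \<in> R (Suc (Suc k))"
        if "c \<in> L" "d \<in> L" "lt_letter c a" for c d
      proof -
        have s: "ZZ m n d (ket v) x = 0" if "x \<notin> nwords m n (Suc k)" for x
          using zc_support[OF \<open>d \<in> L\<close> bv'(2), of x] that ZZ_ket[OF bv'(2)] by auto
        have "(\<lambda>x. prep c (ZZ m n d (ket v)) x - ZZ m n c (ZZ m n d (ket v)) x) \<in> R (Suc (Suc k))"
          by (rule prep_ZZ_extend[OF 1(1) s]) (use that in auto)
        moreover have "prep c (\<lambda>x. prep d (ket v) x - ZZ m n d (ket v) x) \<in> R (Suc (Suc k))"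
          by (rule R_prep[OF Suc(1)[OF bv'(2) that(2)] that(1)])
        moreover have "prep c (\<lambda>x. prep d (ket v) x - ZZ m n d (ket v) x) =
            (\<lambda>x. ket (c # d # v) x - prep c (ZZ m n d (ket v)) x)"
          by (rule fun_list_eqI) (auto simp: ket_Cons)
        ultimately show ?thesis using R_facts(3) by fastforce
      qed
      have "insert_between [] (rho a b) v \<in> R (Suc (Suc k))"
        by (rule rel_gen[OF mn, of _ 0 _ _ k]) (use rho_Im2[OF 1(2) bv'(1) ba] bv'(2) in \<open>auto simp: words_Nil nwords_def\<close>)
      also have "insert_between [] (rho a b) v = (\<lambda>x. ket (a # b # v) x - al a b * ket (b # a # v) x
          - be a b * ket (crossing a b # crossing b a # v) x)"
      proof (rule ext)
        fix x
        have k2: "(if drop 2 x = v then ket [c, d] (take 2 x) else 0) = ket (c # d # v) x" for c d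
          by (cases x; cases "tl x") (auto simp: ket_def numeral_2_eq_2)
        have "insert_between [] (rho a b) v x = (if drop 2 x = v then ket [a, b] (take 2 x) else 0)
            - al a b * (if drop 2 x = v then ket [b, a] (take 2 x) else 0)
            - be a b * (if drop 2 x = v then ket [crossing a b, crossing b a] (take 2 x) else 0)"
          by (simp add: insert_between_Nil rho_def)
        then show "insert_between [] (rho a b) v x = ket (a # b # v) x - al a b * ket (b # a # v) x
          - be a b * ket (crossing a b # crossing b a # v) x" unfolding k2 .
      qed
      finally have r: "(\<lambda>x. ket (a # b # v) x - al a b * ket (b # a # v) x
          - be a b * ket (crossing a b # crossing b a # v) x) \<in> R (Suc (Suc k))" .
      have s1: "(\<lambda>x. al a b * (ket (b # a # v) x - ZZ m n b (ZZ m n a (ket v)) x)) \<in> R (Suc (Suc k))"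
        by (rule R_facts(4)[OF step]) (use bv' 1(2) ba in auto)
      have s2: "(\<lambda>x. be a b * (ket (crossing a b # crossing b a # v) x -
          ZZ m n (crossing a b) (ZZ m n (crossing b a) (ket v)) x)) \<in> R (Suc (Suc k))"
      \<comment> \<open>Only where \<open>be a b\<close> is nonzero does \<open>crossing a b\<close>
        precede a, as the inner induction requires.\<close>
      proof (cases "be a b = 0")
        case True then show ?thesis using R_facts(2) by simp
      next
        case False
        then have "lt_letter (crossing a b) a" by (auto simp: be_def lt_letter_def crossing_def split: if_splits)
        then show ?thesis by (intro R_facts(4)[OF step] cr)
      qed
      have z: "ZZ m n a (ket (b # v)) = (\<lambda>x. al a b * ZZ m n b (ZZ m n a (ket v)) x +
          be a b * ZZ m n (crossing a b) (ZZ m n (crossing b a) (ket v)) x)"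
        by (rule ZZ_ket_rewrite) (use 1(3) ba bv in auto)
      have "(\<lambda>x. ket (a # b # v) x - ZZ m n a (ket (b # v)) x) =
        (\<lambda>x. (ket (a # b # v) x - al a b * ket (b # a # v) x
          - be a b * ket (crossing a b # crossing b a # v) x) +
          (al a b * (ket (b # a # v) x - ZZ m n b (ZZ m n a (ket v)) x) +
           be a b * (ket (crossing a b # crossing b a # v) x -
          ZZ m n (crossing a b) (ZZ m n (crossing b a) (ket v)) x)))"
        unfolding z by (simp add: algebra_simps)
      also have "\<dots> \<in> R (Suc (Suc k))" by (intro R_facts(3) r s1 s2)
      finally show ?thesis unfolding bv by (simp add: ket_Cons)
    qed
  qed
qed

lemma ket_Zs_R: "w \<in> words m n k \<Longrightarrow> (\<lambda>v. ket w v - Zs m n w (ket []) v) \<in> R k"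
proof (induct w arbitrary: k)
  case Nil
  then show ?case by (simp add: R_facts)
next
  case (Cons a w)
  then obtain k' where k: "k = Suc k'" "a \<in> L" "w \<in> words m n k'" by (auto simp: words_Cons)
  let ?u = "Zs m n w (ket [])"
  have "(\<lambda>v. prep a ?u v - ZZ m n a ?u v) \<in> R (Suc k')"
    by (rule prep_ZZ_extend[OF prep_ZZ_ket]) (use k Zs_ket_support in auto)
  moreover have "prep a (\<lambda>v. ket w v - ?u v) \<in> R (Suc k')" by (rule R_prep[OF Cons(1)[OF k(3)] k(2)])
  moreover have "prep a (\<lambda>v. ket w v - ?u v) = (\<lambda>v. ket (a # w) v - prep a ?u v)"
    by (rule fun_list_eqI) (auto simp: ket_Cons)
  ultimately show ?case using R_facts(3) unfolding k(1) by fastforce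
qed

lemma minus_nf_R:
  assumes "u \<in> carrier (tensor_space m n k)"
  shows "(\<lambda>v. u v - nf m n k u v) \<in> R k"
proof -
  have "u v - nf m n k u v = (\<Sum>w\<in>words m n k. u w * (ket w v - Zs m n w (ket []) v))" for v
  proof -
    have "(\<Sum>w\<in>words m n k. u w * ket w v) = (\<Sum>w\<in>words m n k. if v = w then u w else 0)"
      by (intro sum.cong) (auto simp: ket_def)
    also have "\<dots> = u v" using assms by (simp add: tensor_carrier)
    finally show ?thesis by (simp add: nf_def sum_subtractf right_diff_distrib)
  qed
  then have "(\<lambda>v. u v - nf m n k u v) = (\<lambda>v. \<Sum>w\<in>words m n k. u w * (ket w v - Zs m n w (ket []) v))"
    by (rule ext)
  also have "\<dots> \<in> R k" by (intro R_sum ket_Zs_R)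
  finally show ?thesis .
qed

text \<open>The normal form kills all relations, and u minus its normal form is always a
  relation.\<close>

lemma R_iff: "u \<in> carrier (tensor_space m n k) \<Longrightarrow> u \<in> R k \<longleftrightarrow> nf m n k u = (\<lambda>v. 0)"
proof
  assume "u \<in> R k"
  then show "nf m n k u = (\<lambda>v. 0)" by (rule nf_R)
next
  assume u: "u \<in> carrier (tensor_space m n k)" and "nf m n k u = (\<lambda>v. 0)"
  then have e: "(\<lambda>v. u v - nf m n k u v) = u" by (simp only: diff_zero)
  show "u \<in> R k" by (rule subst[OF e, of "\<lambda>x. x \<in> R k"], rule minus_nf_R[OF u])
qed

end

lemma Zs_append: "Zs m n (v @ w) u = Zs m n v (Zs m n w u)"
  by (simp add: Zs_def)

context coordinate
begin

lemma charw_append: "charw \<chi> (v @ w) = charw \<chi> v * charw \<chi> w"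
  by (induct v) simp_all

lemma charw_replicate: "charw \<chi> (replicate k a) = \<chi> (c a) ^ k"
  by (induct k) simp_all

text \<open>Characters are multiplicative on words, so p and s contribute constants and only the two
  letters of x remain.\<close>

lemma char_rel_invariant:
  assumes mn: "m \<ge> 1" "n \<ge> 1" and Im: "\<And>x. x \<in> Im2 m n \<Longrightarrow> (\<lambda>w. charw \<chi> w * x w) \<in> Im2 m n"
  shows "u \<in> rel_submodule m n k \<Longrightarrow> (\<lambda>w. charw \<chi> w * u w) \<in> rel_submodule m n k"
proof (induct u rule: rel_induct[OF mn, consumes 1])
  case 1 show ?case using R_facts(2)[OF mn] by simp
next
  case (2 u v) then show ?case using R_facts(3)[OF mn] by (simp add: distrib_left)
next
  case (3 a u) then show ?case using R_facts(4)[OF mn, of _ k a] by (simp add: mult.left_commute)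
next
  case (4 p x s t r)
  have "(\<lambda>w. charw \<chi> w * insert_between p x s w) =
      (\<lambda>w. (charw \<chi> p * charw \<chi> s) * insert_between p (\<lambda>w. charw \<chi> w * x w) s w)"
  proof (rule ext)
    fix w
    show "charw \<chi> w * insert_between p x s w = (charw \<chi> p * charw \<chi> s) * insert_between p (\<lambda>w. charw \<chi> w * x w) s w"
    proof (cases "take (length p) w = p \<and> drop (length p + 2) w = s")
      case True
      then have "w = p @ take 2 (drop (length p) w) @ s" by (metis add.commute append_take_drop_id drop_drop)
      then have "charw \<chi> w = charw \<chi> p * charw \<chi> (take 2 (drop (length p) w)) * charw \<chi> s"
        by (metis charw_append mult.assoc)
      then show ?thesis using True by (simp add: insert_between_def mult.assoc mult.left_commute)
    qed (auto simp: insert_between_def)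
  qed
  also have "\<dots> \<in> rel_submodule m n k" by (intro R_facts(4)[OF mn] rel_gen[OF mn 4(1) Im[OF 4(2)] 4(3,4)])
  finally show ?case .
qed

lemma ket_carrier: "w \<in> words m n k \<Longrightarrow> ket w \<in> carrier (tensor_space m n k)"
  by (auto simp: tensor_carrier ket_def)

lemma sum_ib: assumes "\<And>v. v \<notin> words m n r \<Longrightarrow> f v = 0"
  shows "(\<Sum>s'\<in>words m n r. f s' * insert_between [] y s' w) = f (drop 2 w) * y (take 2 w)"
proof -
  have "(\<Sum>s'\<in>words m n r. f s' * insert_between [] y s' w) =
      (\<Sum>s'\<in>words m n r. if drop 2 w = s' then f s' * y (take 2 w) else 0)"
    by (intro sum.cong) (auto simp: insert_between_Nil)
  then show ?thesis using assms[of "drop 2 w"] by simp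
qed

text \<open>The coproduct cut after the second letter: E_i acts either on x, or on s with q^(-h_i)
  on x.\<close>

lemma opE_tensor2:
  assumes x: "x \<in> carrier (tensor_space m n 2)"
  shows "opE i w (insert_between [] x s) = insert_between [] (\<lambda>y. opE i y x) s w +
    opE i (drop 2 w) (ket s) * (inverse (charw (kp i) (take 2 w)) * x (take 2 w))"
proof -
  have x0: "length y \<noteq> 2 \<Longrightarrow> x y = 0" for y using x by (auto simp: tensor_carrier words_def)
  consider "w = []" | a where "w = [a]" | a b v where "w = a # b # v" by (metis neq_Nil_conv)
  then show ?thesis
  proof cases
    case (3 a b v)
    have ib: "insert_between [] y s (a' # b' # v') = ket s v' * y [a', b']" for y a' b' v'
      by (simp add: insert_between_Nil ket_def numeral_2_eq_2)
    have o: "opE i v (\<lambda>v. ket s v * f) = f * opE i v (ket s)" for f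
      using opE_cmult[of i v f "ket s"] by (simp only: mult.commute)
    show ?thesis unfolding 3 by (simp add: ib algebra_simps o)
  qed (auto simp: insert_between_Nil x0)
qed

lemma opF_tensor2:
  assumes x: "x \<in> carrier (tensor_space m n 2)"
  shows "opF i w (insert_between [] x s) = charw (kp i) s * insert_between [] (\<lambda>y. opF i y x) s w +
    opF i (drop 2 w) (ket s) * x (take 2 w)"
proof -
  have x0: "length y \<noteq> 2 \<Longrightarrow> x y = 0" for y using x by (auto simp: tensor_carrier words_def)
  consider "w = []" | a where "w = [a]" | a b v where "w = a # b # v" by (metis neq_Nil_conv)
  then show ?thesis
  proof cases
    case (3 a b v)
    have ib: "insert_between [] y s (a' # b' # v') = ket s v' * y [a', b']" for y a' b' v'
      by (simp add: insert_between_Nil ket_def numeral_2_eq_2)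
    have o: "opF i v (\<lambda>v. ket s v * f) = f * opF i v (ket s)" for f v
      using opF_cmult[of i v f "ket s"] by (simp only: mult.commute)
    have k: "v \<noteq> s \<Longrightarrow> ket s v = 0" by (simp add: ket_def)
    show ?thesis unfolding 3 by (cases "v = s") (simp_all add: ib algebra_simps o k)
  qed (auto simp: insert_between_Nil x0)
qed

text \<open>For an empty prefix the coproduct is cut after the two letters of x, and both parts are
  relations because Im is a submodule. The letters of the prefix are then added one by one on the
  left.\<close>

lemma rel_invariant:
  assumes mn: "m \<ge> 1" "n \<ge> 1"
    and mvL: "\<And>i a. a \<in> letters m n \<Longrightarrow> i \<in> {1..N} \<Longrightarrow> mv i a \<in> letters m n"
    and car: "\<And>g u k. g \<in> uq_gens N \<Longrightarrow> u \<in> carrier (tensor_space m n k) \<Longrightarrow> uop g u \<in> carrier (tensor_space m n k)"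
    and Im: "\<And>g x. g \<in> uq_gens N \<Longrightarrow> x \<in> Im2 m n \<Longrightarrow> uop g x \<in> Im2 m n"
    and g: "g \<in> uq_gens N" and u: "u \<in> rel_submodule m n k"
  shows "uop g u \<in> rel_submodule m n k"
proof -
  let ?R = "rel_submodule m n"
  note R = R_facts[OF mn]
  have inv: "inverse (charw \<chi> w) = charw (\<lambda>x. inverse (\<chi> x)) w" for \<chi> w by (induct w) auto
  have Q: "uop (GQ i) u \<in> ?R k" "uop (GQinv i) u \<in> ?R k" if "i \<in> {1..N}" "u \<in> ?R k" for i u k
  proof -
    have "GQ i \<in> uq_gens N" "GQinv i \<in> uq_gens N" using that by (auto simp: uq_gens_def)
    note I = Im[OF this(1)] Im[OF this(2)]
    show "uop (GQ i) u \<in> ?R k" using char_rel_invariant[OF mn _ that(2), of "qx i"] I(1) by simp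
    show "uop (GQinv i) u \<in> ?R k"
      using char_rel_invariant[OF mn _ that(2), of "\<lambda>x. inverse (qx i x)"] I(2) by (simp add: inv)
  qed
  \<comment> \<open>The weights that occur in the coproduct are composed of generators, under which
    Im and the relations are closed.\<close>
  have kpu: "(\<lambda>w. charw (kp i) w * u w) = uop (GQ i) (uop (GQinv (Suc i)) u)"
    "(\<lambda>w. inverse (charw (kp i) w) * u w) = uop (GQinv i) (uop (GQ (Suc i)) u)" for i u
    by (simp_all add: charw_kp mult.assoc)
  have E: "(\<lambda>w. opE i w u) \<in> ?R k" if i: "i \<in> {1..<N}" and u: "u \<in> ?R k" for i u k
    using u
  proof (induct u rule: rel_induct[OF mn, consumes 1])
    case 1 show ?case using R(2) by simp
  next
    case (2 u v) then show ?case using R(3) by (simp add: opE_add)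
  next
    case (3 a u) then show ?case using R(4) by (simp add: opE_cmult)
  next
    case (4 p x s t r)
    have gE: "GE i \<in> uq_gens N" "GQ (Suc i) \<in> uq_gens N" "GQinv i \<in> uq_gens N" using i by (auto simp: uq_gens_def)
    have x: "x \<in> carrier (tensor_space m n 2)" using Im2_facts(1)[OF mn 4(2)] .
    have s0: "opE i v (ket s) = 0" if "v \<notin> words m n r" for v
      using car[OF gE(1) ket_carrier[OF 4(3)]] that by (simp add: tensor_carrier)
    have base: "(\<lambda>w. opE i w (insert_between [] x s)) \<in> ?R (2 + r)"
    proof -
      \<comment> \<open>The vector E_i s is expanded into words, so that each summand is again a
        spanning tensor of the relations.\<close>
      have "(\<lambda>w. opE i w (insert_between [] x s)) = (\<lambda>w. insert_between [] (\<lambda>y. opE i y x) s w +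
        (\<Sum>s'\<in>words m n r. opE i s' (ket s) * insert_between [] (\<lambda>y. inverse (charw (kp i) y) * x y) s' w))"
        unfolding opE_tensor2[OF x] by (subst sum_ib[OF s0]) simp_all
      also have "\<dots> \<in> ?R (2 + r)"
      proof (intro R(3) R_sum[OF mn])
        show "insert_between [] (\<lambda>y. opE i y x) s \<in> ?R (2 + r)"
          using Im[OF gE(1) 4(2)] 4(3) by (intro rel_gen[OF mn, of _ 0 _ _ r]) (auto simp: words_Nil)
        fix s' assume "s' \<in> words m n r"
        then show "insert_between [] (\<lambda>y. inverse (charw (kp i) y) * x y) s' \<in> ?R (2 + r)"
          unfolding kpu using Im[OF gE(3) Im[OF gE(2) 4(2)]]
          by (intro rel_gen[OF mn, of _ 0 _ _ r]) (auto simp: words_Nil)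
      qed
      finally show ?thesis .
    qed
    have "(\<lambda>w. opE i w (insert_between p x s)) \<in> ?R (t + 2 + r)" using 4(1)
    proof (induct p arbitrary: t)
      case Nil
      then show ?case using base by (simp add: words_Nil)
    next
      case (Cons a p)
      then obtain t' where t: "t = Suc t'" "a \<in> letters m n" "p \<in> words m n t'" by (auto simp: words_Cons)
      have ib: "insert_between p x s \<in> ?R (t' + 2 + r)" by (rule rel_gen[OF mn t(3) 4(2,3)]) simp
      have 1: "(\<lambda>w. if c a = Suc i then prep (mv i a) (insert_between p x s) w else 0) \<in> ?R (Suc (t' + 2 + r))"
        using R_prep[OF mn ib mvL[OF t(2), of i]] i R(2) by (cases "c a = Suc i") auto
      show ?case unfolding insert_between_Cons opE_prep t(1)
        using R(3)[OF 1 R(4)[OF R_prep[OF mn Cons(1)[OF t(3)] t(2)]]] by simp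
    qed
    then show ?case using 4(4) by simp
  qed
  have F: "(\<lambda>w. opF i w u) \<in> ?R k" if i: "i \<in> {1..<N}" and u: "u \<in> ?R k" for i u k
    using u
  proof (induct u rule: rel_induct[OF mn, consumes 1])
    case 1 show ?case using R(2) by simp
  next
    case (2 u v) then show ?case using R(3) by (simp add: opF_add)
  next
    case (3 a u) then show ?case using R(4) by (simp add: opF_cmult)
  next
    case (4 p x s t r)
    have gF: "GF i \<in> uq_gens N" using i by (auto simp: uq_gens_def)
    have x: "x \<in> carrier (tensor_space m n 2)" using Im2_facts(1)[OF mn 4(2)] .
    have s0: "opF i v (ket s) = 0" if "v \<notin> words m n r" for v
      using car[OF gF ket_carrier[OF 4(3)]] that by (simp add: tensor_carrier)
    have base: "(\<lambda>w. opF i w (insert_between [] x s)) \<in> ?R (2 + r)"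
    proof -
      have "(\<lambda>w. opF i w (insert_between [] x s)) = (\<lambda>w. charw (kp i) s * insert_between [] (\<lambda>y. opF i y x) s w +
        (\<Sum>s'\<in>words m n r. opF i s' (ket s) * insert_between [] x s' w))"
        unfolding opF_tensor2[OF x] by (subst sum_ib[OF s0]) simp_all
      also have "\<dots> \<in> ?R (2 + r)"
      proof (intro R(3) R(4) R_sum[OF mn])
        show "insert_between [] (\<lambda>y. opF i y x) s \<in> ?R (2 + r)"
          using Im[OF gF 4(2)] 4(3) by (intro rel_gen[OF mn, of _ 0 _ _ r]) (auto simp: words_Nil)
        fix s' assume "s' \<in> words m n r"
        then show "insert_between [] x s' \<in> ?R (2 + r)"
          using 4(2) by (intro rel_gen[OF mn, of _ 0 _ _ r]) (auto simp: words_Nil)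
      qed
      finally show ?thesis .
    qed
    have "(\<lambda>w. opF i w (insert_between p x s)) \<in> ?R (t + 2 + r)" using 4(1)
    proof (induct p arbitrary: t)
      case Nil
      then show ?case using base by (simp add: words_Nil)
    next
      case (Cons a p)
      then obtain t' where t: "t = Suc t'" "a \<in> letters m n" "p \<in> words m n t'" by (auto simp: words_Cons)
      have ib: "insert_between p x s \<in> ?R (t' + 2 + r)" by (rule rel_gen[OF mn t(3) 4(2,3)]) simp
      have "(\<lambda>v. charw (kp i) v * insert_between p x s v) \<in> ?R (t' + 2 + r)"
        unfolding kpu by (intro Q ib) (use i in auto)
      then have 1: "(\<lambda>w. if c a = i then prep (mv (Suc i) a) (\<lambda>v. charw (kp i) v * insert_between p x s v) w else 0) \<in> ?R (Suc (t' + 2 + r))"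
        using R_prep[OF mn _ mvL[OF t(2), of "Suc i"]] i R(2) by (cases "c a = i") auto
      show ?case unfolding insert_between_Cons opF_prep t(1)
        using R(3)[OF 1 R_prep[OF mn Cons(1)[OF t(3)] t(2)]] by simp
    qed
    then show ?case using 4(4) by simp
  qed
  show ?thesis using g u E F Q by (auto simp: uq_gens_def simp del: uop.simps(3,4))
qed

subsection \<open>The action on monomials\<close>

text \<open>Collects the terms of E_i on a product of the letters of w with a fixed right factor u
  in which a letter of w is hit. In \<open>FZ\<close> below, the weight q^(h_i) of the right factor
  is left out and reappears when words are concatenated.\<close>

primrec EZ :: "nat \<Rightarrow> nat \<Rightarrow> nat \<Rightarrow> letter list \<Rightarrow> (letter list \<Rightarrow> cq) \<Rightarrow> letter list \<Rightarrow> cq" where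
  "EZ m n i [] u = (\<lambda>v. 0)"
| "EZ m n i (a # w) u = (\<lambda>v. (if c a = Suc i then ZZ m n (mv i a) (Zs m n w u) v else 0) +
    inverse (kp i (c a)) * ZZ m n a (EZ m n i w u) v)"

primrec FZ :: "nat \<Rightarrow> nat \<Rightarrow> nat \<Rightarrow> letter list \<Rightarrow> (letter list \<Rightarrow> cq) \<Rightarrow> letter list \<Rightarrow> cq" where
  "FZ m n i [] u = (\<lambda>v. 0)"
| "FZ m n i (a # w) u = (\<lambda>v. (if c a = i then charw (kp i) w * ZZ m n (mv (Suc i) a) (Zs m n w u) v else 0) +
    ZZ m n a (FZ m n i w u) v)"

lemma EZ_append: "EZ m n i (v @ w) u = (\<lambda>x. EZ m n i v (Zs m n w u) x + inverse (charw (kp i) v) * Zs m n v (EZ m n i w u) x)"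
proof (induct v)
  case (Cons a v)
  show ?case by (rule ext) (simp add: Cons Zs_append ZZ_add ZZ_cmult algebra_simps)
qed simp

lemma FZ_append: "FZ m n i (v @ w) u = (\<lambda>x. charw (kp i) w * FZ m n i v (Zs m n w u) x + Zs m n v (FZ m n i w u) x)"
proof (induct v)
  case (Cons a v)
  show ?case by (rule ext) (simp add: Cons Zs_append ZZ_add ZZ_cmult charw_append algebra_simps)
qed simp

lemma EZ_none: "\<forall>a\<in>set w. c a \<noteq> Suc i \<Longrightarrow> EZ m n i w u = (\<lambda>v. 0)"
  by (induct w) simp_all

lemma FZ_none: "\<forall>a\<in>set w. c a \<noteq> i \<Longrightarrow> FZ m n i w u = (\<lambda>v. 0)"
  by (induct w) simp_all

end

text \<open>A word of length k + 1 is a letter followed by a word of length k, so the sum defining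
  the normal form factors.\<close>

lemma nf_prep:
  assumes "a \<in> letters m n"
  shows "nf m n (Suc k) (prep a u) = ZZ m n a (nf m n k u)"
proof (rule ext)
  fix v
  let ?h = "\<lambda>(b, w). b # w"
  have W: "words m n (Suc k) = ?h ` (letters m n \<times> words m n k)"
    by (auto simp: words_def length_Suc_conv image_iff)
  have "nf m n (Suc k) (prep a u) v = (\<Sum>(b, w)\<in>letters m n \<times> words m n k. prep a u (b # w) * Zs m n (b # w) (ket []) v)"
    unfolding nf_def W by (subst sum.reindex) (auto simp: inj_on_def case_prod_unfold)
  also have "\<dots> = (\<Sum>b\<in>letters m n. \<Sum>w\<in>words m n k. if a = b then u w * Zs m n (a # w) (ket []) v else 0)"
    unfolding sum.cartesian_product by (intro sum.cong) auto
  also have "\<dots> = (\<Sum>w\<in>words m n k. u w * ZZ m n a (Zs m n w (ket [])) v)"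
    using assms by (subst sum.swap) simp
  finally show "nf m n (Suc k) (prep a u) v = ZZ m n a (nf m n k u) v"
    unfolding nf_def[abs_def] ZZ_sum .
qed

context coordinate
begin

lemma nf_opE_ket:
  assumes mvL: "\<And>a. a \<in> letters m n \<Longrightarrow> mv i a \<in> letters m n"
  shows "w \<in> words m n k \<Longrightarrow> nf m n k (\<lambda>x. opE i x (ket w)) = EZ m n i w (ket [])"
proof (induct w arbitrary: k)
  case Nil
  have "opE i x (ket []) = 0" for x by (cases x) (simp_all add: ket_def)
  then show ?case by simp
next
  case (Cons a w)
  then obtain k' where k: "k = Suc k'" "a \<in> letters m n" "w \<in> words m n k'" by (auto simp: words_Cons)
  have "nf m n k (\<lambda>x. if c a = Suc i then prep (mv i a) (ket w) x else 0) =
      (\<lambda>v. if c a = Suc i then ZZ m n (mv i a) (Zs m n w (ket [])) v else 0)"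
    using nf_prep[OF mvL[OF k(2)], of k' "ket w"] nf_ket[OF k(3)] k(1) by (cases "c a = Suc i") auto
  then show ?case
    unfolding ket_Cons opE_prep nf_add nf_cmult using Cons(1)[OF k(3)] k nf_prep[OF k(2)] by simp
qed

lemma nf_opF_ket:
  assumes mvL: "\<And>a. a \<in> letters m n \<Longrightarrow> mv (Suc i) a \<in> letters m n"
  shows "w \<in> words m n k \<Longrightarrow> nf m n k (\<lambda>x. opF i x (ket w)) = FZ m n i w (ket [])"
proof (induct w arbitrary: k)
  case Nil
  have "opF i x (ket []) = 0" for x by (cases x) (simp_all add: ket_def)
  then show ?case by simp
next
  case (Cons a w)
  then obtain k' where k: "k = Suc k'" "a \<in> letters m n" "w \<in> words m n k'" by (auto simp: words_Cons)
  have kk: "(\<lambda>v. charw (kp i) v * ket w v) = (\<lambda>v. charw (kp i) w * ket w v)" by (auto simp: ket_def)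
  have "nf m n k (\<lambda>x. if c a = i then prep (mv (Suc i) a) (\<lambda>v. charw (kp i) v * ket w v) x else 0) =
      (\<lambda>v. if c a = i then charw (kp i) w * ZZ m n (mv (Suc i) a) (Zs m n w (ket [])) v else 0)"
    unfolding kk prep_linear
    using nf_prep[OF mvL[OF k(2)], of k' "ket w"] nf_ket[OF k(3)] k(1) nf_cmult by (cases "c a = i") auto
  then show ?case
    unfolding ket_Cons opF_prep nf_add using Cons(1)[OF k(3)] k nf_prep[OF k(2)] by simp
qed

end

context grid
begin

definition line_word :: "nat \<Rightarrow> (letter \<Rightarrow> nat) \<Rightarrow> nat \<Rightarrow> letter list" where
  "line_word N e y = concat (map (\<lambda>x. replicate (e (mk x y)) (mk x y)) [1..<Suc N])"

text \<open>Truncated subtraction is harmless here and in \<open>lower\<close>: the result is always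
  multiplied by \<open>qn\<close> of the exponent that is decreased.\<close>

definition raise :: "nat \<Rightarrow> nat \<Rightarrow> (letter \<Rightarrow> nat) \<Rightarrow> letter \<Rightarrow> nat" where
  "raise i y e = e(mk i y := Suc (e (mk i y)), mk (Suc i) y := e (mk (Suc i) y) - 1)"

definition lower :: "nat \<Rightarrow> nat \<Rightarrow> (letter \<Rightarrow> nat) \<Rightarrow> letter \<Rightarrow> nat" where
  "lower i y e = e(mk i y := e (mk i y) - 1, mk (Suc i) y := Suc (e (mk (Suc i) y)))"

lemma mk_eq_iff [simp]: "mk x y = mk x' y' \<longleftrightarrow> x = x' \<and> y = y'"
  by (metis mk_simps(1,2))

text \<open>Only the two middle blocks see the entries at i and i + 1. The outer parts contain
  neither index, so E_i and F_i kill them and q^(h_i) acts on them by 1.\<close>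

lemma line_word_split:
  assumes "1 \<le> i" "i < N"
  obtains P S where
    "\<And>e'. (\<And>x. x \<noteq> i \<Longrightarrow> x \<noteq> Suc i \<Longrightarrow> e' (mk x y) = e (mk x y)) \<Longrightarrow>
      line_word N e' y = P @ replicate (e' (mk i y)) (mk i y) @ replicate (e' (mk (Suc i) y)) (mk (Suc i) y) @ S"
    "\<And>a. a \<in> set P \<union> set S \<Longrightarrow> c a \<noteq> i \<and> c a \<noteq> Suc i"
proof -
  let ?w = "\<lambda>e x. replicate (e (mk x y)) (mk x y)"
  have s: "[1..<Suc N] = [1..<i] @ [i, Suc i] @ [Suc (Suc i)..<Suc N]"
    using assms upt_add_eq_append[of 1 i "Suc N - i"] by (simp add: upt_conv_Cons del: upt_Suc)
  show ?thesis
  proof (rule that[of "concat (map (?w e) [1..<i])" "concat (map (?w e) [Suc (Suc i)..<Suc N])"])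
    fix e' assume e': "\<And>x. x \<noteq> i \<Longrightarrow> x \<noteq> Suc i \<Longrightarrow> e' (mk x y) = e (mk x y)"
    have m: "map (?w e') [1..<i] = map (?w e) [1..<i]" "map (?w e') [Suc (Suc i)..<Suc N] = map (?w e) [Suc (Suc i)..<Suc N]"
      using e' by auto
    then show "line_word N e' y = concat (map (?w e) [1..<i]) @ replicate (e' (mk i y)) (mk i y) @
        replicate (e' (mk (Suc i) y)) (mk (Suc i) y) @ concat (map (?w e) [Suc (Suc i)..<Suc N])"
      unfolding line_word_def s map_append m by simp
  qed auto
qed

context
  fixes m n i y :: nat
  assumes comm: "\<And>u k. degree_supp k u \<Longrightarrow> ZZ m n (mk (Suc i) y) (ZZ m n (mk i y) u) =
      (\<lambda>v. qq * ZZ m n (mk i y) (ZZ m n (mk (Suc i) y) u) v)"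
begin

text \<open>Changing a letter with t letters to its left contributes q^(2t): q^t from q^(-h_i) on
  those letters, and another q^t from moving the new letter past them to the front.\<close>

lemma EZ_replicate:
  assumes "degree_supp k u"
  shows "P.EZ m n i (replicate b (mk (Suc i) y)) u =
    (\<lambda>v. qn b * Zs m n (mk i y # replicate (b - 1) (mk (Suc i) y)) u v)"
proof (induct b)
  case (Suc b)
  show ?case
  proof (cases b)
    case 0
    then show ?thesis by (simp add: qn_Suc)
  next
    case b: (Suc b')
    have "degree_supp (b' + k) (Zs m n (replicate b' (mk (Suc i) y)) u)"
      using degree_supp_Zs[OF assms, of "replicate b' (mk (Suc i) y)" m n] by simp
    note C = comm[OF this]
    show ?thesis using Suc unfolding b
      by (simp add: ZZ_cmult C qn_Suc[of "Suc b'"] algebra_simps power2_eq_square)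
  qed
qed simp

lemma ZZ_pass_replicate:
  assumes "degree_supp k u"
  shows "ZZ m n (mk (Suc i) y) (Zs m n (replicate a (mk i y)) u) = (\<lambda>v. qq ^ a * Zs m n (replicate a (mk i y)) (ZZ m n (mk (Suc i) y) u) v)"
proof (induct a)
  case (Suc a)
  have "degree_supp (a + k) (Zs m n (replicate a (mk i y)) u)"
    using degree_supp_Zs[OF assms, of "replicate a (mk i y)" m n] by simp
  from comm[OF this] show ?case by (simp add: Suc ZZ_cmult mult.assoc)
qed simp

text \<open>Every letter to the right of the changed one contributes q^2: a factor q from q^(h_i)
  acting on it, and another from moving the new letter to the right past it.\<close>

lemma FZ_replicate:
  assumes "degree_supp k u"
  shows "P.FZ m n i (replicate a (mk i y)) u =
    (\<lambda>v. qn a * Zs m n (replicate (a - 1) (mk i y)) (ZZ m n (mk (Suc i) y) u) v)"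
proof (induct a)
  case (Suc a)
  have q: "qn (Suc b) = qn b + qq ^ b * qq ^ b" for b by (simp add: qn_def power_add[symmetric] mult_2)
  show ?case
  proof (cases a)
    case 0
    then show ?thesis by (simp add: qn_Suc)
  next
    case (Suc a')
    then show ?thesis using Suc.hyps
      by (simp add: P.charw_replicate ZZ_pass_replicate[OF assms, of "Suc a'", simplified] q ZZ_cmult ZZ_add algebra_simps)
  qed
qed simp

text \<open>The power of q comes from q^(-h_i) on the block of letters with index i, which stands to
  the left of the letters that E_i changes. For F_i in the next lemma it comes from the block with
  index i + 1 on the right.\<close>

lemma EZ_line:
  assumes i: "1 \<le> i" "i < N" and u: "degree_supp k u"
  shows "P.EZ m n i (line_word N e y) u =
    (\<lambda>v. qq powi (- int (e (mk i y))) * qn (e (mk (Suc i) y)) * Zs m n (line_word N (raise i y e) y) u v)"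
proof -
  obtain P S where PS: "\<And>e'. (\<And>x. x \<noteq> i \<Longrightarrow> x \<noteq> Suc i \<Longrightarrow> e' (mk x y) = e (mk x y)) \<Longrightarrow>
      line_word N e' y = P @ replicate (e' (mk i y)) (mk i y) @ replicate (e' (mk (Suc i) y)) (mk (Suc i) y) @ S"
    "\<And>a. a \<in> set P \<union> set S \<Longrightarrow> c a \<noteq> i \<and> c a \<noteq> Suc i"
    using line_word_split[OF i] by blast
  have k1: "P.charw (P.kp i) P = 1" using PS(2) by (induct P) auto
  have w: "line_word N e y = P @ replicate (e (mk i y)) (mk i y) @ replicate (e (mk (Suc i) y)) (mk (Suc i) y) @ S"
    by (rule PS(1)) simp
  have w': "line_word N (raise i y e) y = P @ replicate (Suc (e (mk i y))) (mk i y) @ replicate (e (mk (Suc i) y) - 1) (mk (Suc i) y) @ S"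
    by (subst PS(1)) (auto simp: raise_def)
  have n: "P.EZ m n i P u = (\<lambda>v. 0)" "P.EZ m n i S u = (\<lambda>v. 0)"
    "P.EZ m n i (replicate a (mk i y)) u = (\<lambda>v. 0)" for u a
    by (rule P.EZ_none; use PS(2) in auto)+
  have s: "degree_supp (length S + k) (Zs m n S u)" by (rule degree_supp_Zs[OF u])
  have z: "Zs m n (replicate a (mk i y)) (ZZ m n (mk i y) f) = ZZ m n (mk i y) (Zs m n (replicate a (mk i y)) f)" for a f
    by (induct a) simp_all
  show ?thesis unfolding w w'
    by (simp add: P.EZ_append n k1 EZ_replicate[OF s] P.charw_replicate Zs_cmult z ZZ_cmult
        power_int_minus power_inverse mult.assoc)
qed

lemma FZ_line:
  assumes i: "1 \<le> i" "i < N" and u: "degree_supp k u"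
  shows "P.FZ m n i (line_word N e y) u =
    (\<lambda>v. qq powi (- int (e (mk (Suc i) y))) * qn (e (mk i y)) * Zs m n (line_word N (lower i y e) y) u v)"
proof -
  obtain P S where PS: "\<And>e'. (\<And>x. x \<noteq> i \<Longrightarrow> x \<noteq> Suc i \<Longrightarrow> e' (mk x y) = e (mk x y)) \<Longrightarrow>
      line_word N e' y = P @ replicate (e' (mk i y)) (mk i y) @ replicate (e' (mk (Suc i) y)) (mk (Suc i) y) @ S"
    "\<And>a. a \<in> set P \<union> set S \<Longrightarrow> c a \<noteq> i \<and> c a \<noteq> Suc i"
    using line_word_split[OF i] by blast
  have k1: "P.charw (P.kp i) S = 1" using PS(2) by (induct S) auto
  have w: "line_word N e y = P @ replicate (e (mk i y)) (mk i y) @ replicate (e (mk (Suc i) y)) (mk (Suc i) y) @ S"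
    by (rule PS(1)) simp
  have w': "line_word N (lower i y e) y = P @ replicate (e (mk i y) - 1) (mk i y) @ replicate (Suc (e (mk (Suc i) y))) (mk (Suc i) y) @ S"
    by (subst PS(1)) (auto simp: lower_def)
  have n: "P.FZ m n i P u = (\<lambda>v. 0)" "P.FZ m n i S u = (\<lambda>v. 0)"
    "P.FZ m n i (replicate a (mk (Suc i) y)) u = (\<lambda>v. 0)" for u a
    by (rule P.FZ_none; use PS(2) in auto)+
  let ?u = "Zs m n (replicate (e (mk (Suc i) y)) (mk (Suc i) y)) (Zs m n S u)"
  have s: "degree_supp (e (mk (Suc i) y) + (length S + k)) ?u"
    using degree_supp_Zs[OF degree_supp_Zs[OF u], of "replicate (e (mk (Suc i) y)) (mk (Suc i) y)"] by simp
  show ?thesis unfolding w w'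
    by (simp add: P.FZ_append n k1 FZ_replicate[OF s] P.charw_replicate P.charw_append Zs_cmult ZZ_cmult
        power_int_minus power_inverse mult.assoc)
qed

end

end

section \<open>Products of several irreducible modules\<close>

definition box :: "nat list \<Rightarrow> nat list set" where
  "box C = {ps. list_all2 (\<le>) ps C}"

lemma box_simps [simp]: "[] \<in> box []" "p # ps \<in> box [] \<longleftrightarrow> False" "[] \<in> box (A # C) \<longleftrightarrow> False"
  "p # ps \<in> box (A # C) \<longleftrightarrow> p \<le> A \<and> ps \<in> box C"
  by (auto simp: box_def)

lemma box_Nil: "box [] = {[]}"
  by (auto simp: box_def)

lemma box_Cons: "box (A # C) = (\<lambda>(p, ps). p # ps) ` ({..A} \<times> box C)"
  by (force simp: box_def list_all2_Cons2 image_iff)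

lemma finite_box [simp]: "finite (box C)"
  by (induct C) (auto simp: box_Nil box_Cons)

definition box_wt :: "nat list \<Rightarrow> nat list \<Rightarrow> int" where
  "box_wt C ps = int (sum_list C) - 2 * int (sum_list ps)"

text \<open>The actions of \<open>E\<close> and \<open>F\<close> in coordinates: the entry \<open>p\<close> of a list at a position with bound \<open>A\<close> stands
  for \<open>z\<^sub>i\<^bsup>A - p\<^esup> z\<^sub>i\<^sub>+\<^sub>1\<^bsup>p\<^esup>\<close>.\<close>

fun mE :: "nat list \<Rightarrow> (nat list \<Rightarrow> cq) \<Rightarrow> nat list \<Rightarrow> cq" where
  "mE (A # C) f (p # ps) =
    (if p < A then qq powi (1 + int p - int A) * qn (Suc p) * f (Suc p # ps) else 0) +
    qq powi (2 * int p - int A) * mE C (\<lambda>ps. f (p # ps)) ps"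
| "mE _ f _ = 0"

fun mF :: "nat list \<Rightarrow> (nat list \<Rightarrow> cq) \<Rightarrow> nat list \<Rightarrow> cq" where
  "mF (A # C) f (p # ps) =
    (if 0 < p then qq powi (box_wt C ps + 1 - int p) * qn (Suc (A - p)) * f ((p - 1) # ps) else 0) +
    mF C (\<lambda>ps. f (p # ps)) ps"
| "mF _ f _ = 0"

lemma mE_cmult: "mE C (\<lambda>ps. c * f ps) ps = c * mE C f ps"
  by (induct C f ps rule: mE.induct) (auto simp: algebra_simps)

lemma mF_cmult: "mF C (\<lambda>ps. c * f ps) ps = c * mF C f ps"
  by (induct C f ps rule: mF.induct) (auto simp: algebra_simps)

lemma mE_add: "mE C (\<lambda>ps. f ps + g ps) ps = mE C f ps + mE C g ps"
proof (induct C f ps arbitrary: g rule: mE.induct)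
  case (1 A C f p ps)
  show ?case unfolding mE.simps 1[of "\<lambda>ps. g (p # ps)"] by (simp add: algebra_simps)
qed auto

lemma mF_add: "mF C (\<lambda>ps. f ps + g ps) ps = mF C f ps + mF C g ps"
proof (induct C f ps arbitrary: g rule: mF.induct)
  case (1 A C f p ps)
  show ?case unfolding mF.simps 1[of "\<lambda>ps. g (p # ps)"] by (simp add: algebra_simps)
qed auto

lemma mE_0: "mE C (\<lambda>ps. 0) ps = 0"
  using mE_cmult[of C 0 "\<lambda>_. 0"] by simp

lemma mF_0: "mF C (\<lambda>ps. 0) ps = 0"
  using mF_cmult[of C 0 "\<lambda>_. 0"] by simp

lemma mE_sum: "mE C (\<lambda>ps. \<Sum>j\<in>J. c j * f j ps) ps = (\<Sum>j\<in>J. c j * mE C (f j) ps)"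
  by (induct J rule: infinite_finite_induct) (simp_all add: mE_0 mE_add mE_cmult)

lemma mF_sum: "mF C (\<lambda>ps. \<Sum>j\<in>J. c j * f j ps) ps = (\<Sum>j\<in>J. c j * mF C (f j) ps)"
  by (induct J rule: infinite_finite_induct) (simp_all add: mF_0 mF_add mF_cmult)

lemma sum_atMost_shift_up: "(\<Sum>j\<le>B. a j * (if j = 0 then 0 else b (j - 1))) = (\<Sum>j<B. a (Suc j) * (b j :: cq))"
  unfolding sum.atMost_shift by simp

lemma sum_atMost_shift_down: "(\<Sum>j\<le>B. a j * (if j = B then 0 else b (Suc j))) = (\<Sum>j<B. a j * (b (Suc j) :: cq))"
  by (simp flip: lessThan_Suc_atMost)

text \<open>A decomposition of D into strings: \<open>along x r\<close> is the element at position r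
  of the string through x.\<close>

locale strings =
  fixes D :: "'d set" and len pos :: "'d \<Rightarrow> nat" and along :: "'d \<Rightarrow> nat \<Rightarrow> 'd"
  assumes pos_le: "x \<in> D \<Longrightarrow> pos x \<le> len x"
    and at_mem: "x \<in> D \<Longrightarrow> r \<le> len x \<Longrightarrow> along x r \<in> D"
    and len_at: "x \<in> D \<Longrightarrow> r \<le> len x \<Longrightarrow> len (along x r) = len x"
    and pos_at: "x \<in> D \<Longrightarrow> r \<le> len x \<Longrightarrow> pos (along x r) = r"
    and at_at: "x \<in> D \<Longrightarrow> r \<le> len x \<Longrightarrow> r' \<le> len x \<Longrightarrow> along (along x r) r' = along x r'"
    and at_pos: "x \<in> D \<Longrightarrow> along x (pos x) = x"

text \<open>Vectors \<open>Y x\<close> congruent to x modulo q on which E and F act as on the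
  divided powers of a highest weight vector: \<open>Y x\<close> stands \<open>pos x\<close> steps
  below the top of a module of dimension \<open>len x + 1\<close>.\<close>

locale string_family = strings "box C" len pos along for C len pos along +
  fixes Y :: "nat list \<Rightarrow> nat list \<Rightarrow> cq"
  assumes Y_supp: "x \<in> box C \<Longrightarrow> Y x x' \<noteq> 0 \<Longrightarrow> x' \<in> box C \<and> sum_list x' = sum_list x"
    and Y_cong: "x \<in> box C \<Longrightarrow> Y x x' - of_bool (x' = x) \<in> qideal"
    and len_pos: "x \<in> box C \<Longrightarrow> int (len x) - 2 * int (pos x) = box_wt C x"
    and mE_Y: "x \<in> box C \<Longrightarrow> x' \<in> box C \<Longrightarrow> mE C (Y x) x' =
      (if pos x = 0 then 0 else qi (int (len x) - int (pos x) + 1) * Y (along x (pos x - 1)) x')"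
    and mF_Y: "x \<in> box C \<Longrightarrow> x' \<in> box C \<Longrightarrow> mF C (Y x) x' =
      (if pos x = len x then 0 else qi (int (pos x) + 1) * Y (along x (Suc (pos x))) x')"
begin

lemma Y_at_wt: "x \<in> box C \<Longrightarrow> j \<le> len x \<Longrightarrow> Y (along x j) x' \<noteq> 0 \<Longrightarrow> box_wt C x' = int (len x) - 2 * int j"
  using Y_supp[of "along x j" x'] len_pos[of "along x j"] by (simp add: at_mem len_at pos_at box_wt_def)

lemma mE_Y_at: "x \<in> box C \<Longrightarrow> j \<le> len x \<Longrightarrow> x' \<in> box C \<Longrightarrow> mE C (Y (along x j)) x' =
    (if j = 0 then 0 else qi (int (len x) - int (j - 1)) * Y (along x (j - 1)) x')"
  using mE_Y[of "along x j" x'] by (cases j) (simp_all add: at_mem len_at pos_at at_at algebra_simps)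

lemma mF_Y_at: "x \<in> box C \<Longrightarrow> j \<le> len x \<Longrightarrow> x' \<in> box C \<Longrightarrow> mF C (Y (along x j)) x' =
    (if j = len x then 0 else qi (int (Suc j)) * Y (along x (Suc j)) x')"
  using mF_Y[of "along x j" x'] by (simp add: at_mem len_at pos_at at_at add.commute)

text \<open>A string of length B in the product for C spans an irreducible module of dimension B +
  1. Its product with the new first factor is the two-factor case, whose strings are then expressed
  through the vectors of the old string.\<close>

lemma string_family_Cons:
  fixes A :: nat
  shows "\<exists>len pos along Y. string_family (A # C) len pos along Y"
proof -
  \<comment> \<open>The coefficients are chosen for all B at once, because the strings of C have
    different lengths.\<close>
  have "\<exists>G. \<forall>B. (\<forall>s r. s \<le> A \<and> s \<le> B \<and> r + 2 * s \<le> A + B \<longrightarrow> boxed A B (s + r) (G B s r) \<and>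
      G B s r (fst (cg_at B s r)) (snd (cg_at B s r)) \<in> unit1 \<and>
      (\<forall>p j. (p, j) \<noteq> cg_at B s r \<longrightarrow> G B s r p j \<in> qideal) \<and>
      cgE A B (G B s r) = (\<lambda>p j. if r = 0 then 0 else qi (int (A + B - 2 * s) - int r + 1) * G B s (r - 1) p j) \<and>
      cgF A B (G B s r) = (\<lambda>p j. if r + 2 * s = A + B then 0 else qi (int r + 1) * G B s (Suc r) p j))"
  proof (rule choice, rule allI)
    fix B
    obtain G where
      "\<And>s r. s \<le> A \<Longrightarrow> s \<le> B \<Longrightarrow> r + 2 * s \<le> A + B \<Longrightarrow> boxed A B (s + r) (G s r)"
      "\<And>s r. s \<le> A \<Longrightarrow> s \<le> B \<Longrightarrow> r + 2 * s \<le> A + B \<Longrightarrow> G s r (fst (cg_at B s r)) (snd (cg_at B s r)) \<in> unit1"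
      "\<And>s r p j. s \<le> A \<Longrightarrow> s \<le> B \<Longrightarrow> r + 2 * s \<le> A + B \<Longrightarrow> (p, j) \<noteq> cg_at B s r \<Longrightarrow> G s r p j \<in> qideal"
      "\<And>s r. s \<le> A \<Longrightarrow> s \<le> B \<Longrightarrow> r + 2 * s \<le> A + B \<Longrightarrow> cgE A B (G s r) =
        (\<lambda>p j. if r = 0 then 0 else qi (int (A + B - 2 * s) - int r + 1) * G s (r - 1) p j)"
      "\<And>s r. s \<le> A \<Longrightarrow> s \<le> B \<Longrightarrow> r + 2 * s \<le> A + B \<Longrightarrow> cgF A B (G s r) =
        (\<lambda>p j. if r + 2 * s = A + B then 0 else qi (int r + 1) * G s (Suc r) p j)"
      by (rule tensor_string_family[of A B]) (rule that; assumption)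
    note G = this
    show "\<exists>G. \<forall>s r. s \<le> A \<and> s \<le> B \<and> r + 2 * s \<le> A + B \<longrightarrow> boxed A B (s + r) (G s r) \<and>
      G s r (fst (cg_at B s r)) (snd (cg_at B s r)) \<in> unit1 \<and>
      (\<forall>p j. (p, j) \<noteq> cg_at B s r \<longrightarrow> G s r p j \<in> qideal) \<and>
      cgE A B (G s r) = (\<lambda>p j. if r = 0 then 0 else qi (int (A + B - 2 * s) - int r + 1) * G s (r - 1) p j) \<and>
      cgF A B (G s r) = (\<lambda>p j. if r + 2 * s = A + B then 0 else qi (int r + 1) * G s (Suc r) p j)"
      by (rule exI[of _ G], intro allI impI, elim conjE) (intro conjI allI impI G)
  qed
  then obtain G where G0: "\<And>B s r. s \<le> A \<and> s \<le> B \<and> r + 2 * s \<le> A + B \<Longrightarrow> boxed A B (s + r) (G B s r) \<and>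
      G B s r (fst (cg_at B s r)) (snd (cg_at B s r)) \<in> unit1 \<and>
      (\<forall>p j. (p, j) \<noteq> cg_at B s r \<longrightarrow> G B s r p j \<in> qideal) \<and>
      cgE A B (G B s r) = (\<lambda>p j. if r = 0 then 0 else qi (int (A + B - 2 * s) - int r + 1) * G B s (r - 1) p j) \<and>
      cgF A B (G B s r) = (\<lambda>p j. if r + 2 * s = A + B then 0 else qi (int r + 1) * G B s (Suc r) p j)"
    by blast
  \<comment> \<open>The Gaussian binomial coefficient of A over p in q^2: F^(p) applied to the power
    z_i^A is \<open>g p\<close> times the monomial with entry p. It is congruent to 1 modulo q, so
    it does not disturb leading terms.\<close>
  define g where "g p = (\<Prod>t<p. qn (A - t) / qn (Suc t))" for p
  have g1: "g p \<in> unit1" if "p \<le> A" for p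
    unfolding g_def by (rule unit1_prod, rule unit1_divide) (use that in \<open>auto intro: qn_unit1\<close>)
  have qnz: "qn (Suc t) \<noteq> 0" for t using unit1_neq_0[OF qn_Suc_unit1] .
  have gE: "qq powi (1 + int p - int A) * qn (Suc p) * g (Suc p) = g p * qi (int A - int p)" if "p < A" for p
    using qi_int[of "A - p"] that qnz[of p] by (simp add: g_def of_nat_diff algebra_simps)
  have gF: "qq powi (1 - int p) * qn (Suc (A - p)) * g (p - 1) = g p * qi (int p)" if "0 < p" "p \<le> A" for p
  proof -
    obtain p' where p': "p = Suc p'" using \<open>0 < p\<close> by (cases p) auto
    have "A - p' = Suc (A - p)" using that p' by simp
    then show ?thesis using qi_int[of p] qnz[of p'] by (simp add: g_def p' algebra_simps)
  qed
  \<comment> \<open>The head of x and the position of its tail on the old string form the point to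
    which the tensor product rule is applied.\<close>
  define st where "st x = cg_str (len (tl x)) (hd x) (pos (tl x))" for x
  define po where "po x = cg_pos (len (tl x)) (hd x) (pos (tl x))" for x
  define le where "le x = A + len (tl x) - 2 * st x" for x
  \<comment> \<open>The two-factor coefficients applied to the products of F^(p) v with the vectors
    of the old string, with \<open>g\<close> passing from divided powers to monomials. The empty
    list is outside the box and gets the value 0.\<close>
  define Z where "Z ps s r x' = (if x' = [] then 0 else
    g (hd x') * (\<Sum>j\<le>len ps. G (len ps) s r (hd x') j * Y (along ps j) (tl x')))" for ps s r x'
  define ar where "ar x r = fst (cg_at (len (tl x)) (st x) r) # along (tl x) (snd (cg_at (len (tl x)) (st x) r))" for x r
  define Y' where "Y' x = Z (tl x) (st x) (po x)" for x
  have str: "st x \<le> A" "st x \<le> len (tl x)" "po x + 2 * st x \<le> A + len (tl x)" if "x \<in> box (A # C)" for x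
    using that cg_str_le[of "hd x" A "pos (tl x)" "len (tl x)"] pos_le[of "tl x"]
    by (cases x; simp add: st_def po_def)+
  have tlx: "tl x \<in> box C" if "x \<in> box (A # C)" for x using that by (cases x) auto
  have ar: "ar x r \<in> box (A # C)" "len (tl (ar x r)) = len (tl x)" "st (ar x r) = st x" "po (ar x r) = r" "le (ar x r) = le x"
    "Y' (ar x r) = Z (tl x) (st x) r" "r' \<le> le x \<Longrightarrow> ar (ar x r) r' = ar x r'"
    if x: "x \<in> box (A # C)" "r \<le> le x" for x r r'
  proof -
    let ?B = "len (tl x)"
    have s: "st x \<le> A" "st x \<le> ?B" "\<And>r. r \<le> le x \<Longrightarrow> r + 2 * st x \<le> A + ?B"
      using str[OF x(1)] unfolding le_def by linarith+
    have C: "fst (cg_at ?B (st x) r) \<le> A" "snd (cg_at ?B (st x) r) \<le> ?B"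
      "cg_str ?B (fst (cg_at ?B (st x) r)) (snd (cg_at ?B (st x) r)) = st x"
      "cg_pos ?B (fst (cg_at ?B (st x) r)) (snd (cg_at ?B (st x) r)) = r" if "r \<le> le x" for r
      using cg_pos_at[OF s(1,2) s(3)[OF that] prod.collapse[symmetric]] by auto
    note c = C[OF x(2)]
    note t = at_mem[OF tlx[OF x(1)] c(2)] len_at[OF tlx[OF x(1)] c(2)] pos_at[OF tlx[OF x(1)] c(2)]
    show 1: "ar x r \<in> box (A # C)" "len (tl (ar x r)) = len (tl x)" using c t by (simp_all add: ar_def)
    show 2: "st (ar x r) = st x" "po (ar x r) = r" unfolding st_def[of "ar x r"] po_def[of "ar x r"] using c t by (simp_all add: ar_def)
    show "le (ar x r) = le x" using 1 2 by (simp add: le_def)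
    have "Y (along (tl (ar x r)) j) = Y (along (tl x) j)" if "j \<le> ?B" for j
      using at_at[OF tlx[OF x(1)] c(2) that] by (simp add: ar_def)
    then show "Y' (ar x r) = Z (tl x) (st x) r" unfolding Y'_def Z_def 1 2 by (intro ext if_cong refl arg_cong2[where f = "(*)"] sum.cong) auto
    show "ar (ar x r) r' = ar x r'" if "r' \<le> le x"
      unfolding ar_def[of "ar x r"] 1 2 using at_at[OF tlx[OF x(1)] c(2) C(2)[OF that]] by (simp add: ar_def)
  qed
  have arpo: "ar x (po x) = x" if "x \<in> box (A # C)" for x
    using that cg_at_pos[of "hd x" A "pos (tl x)" "len (tl x)"] pos_le[of "tl x"] at_pos[of "tl x"]
    by (cases x) (simp_all add: ar_def st_def po_def)
  have pole: "po x \<le> le x" if "x \<in> box (A # C)" for x using str[OF that] by (simp add: le_def)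
  show ?thesis
  proof (rule exI[of _ le], rule exI[of _ po], rule exI[of _ ar], rule exI[of _ Y'], unfold_locales)
    fix x r r' assume x: "x \<in> box (A # C)"
    show "po x \<le> le x" by (rule pole[OF x])
    show "ar x (po x) = x" by (rule arpo[OF x])
    assume r: "r \<le> le x"
    show "ar x r \<in> box (A # C)" "le (ar x r) = le x" "po (ar x r) = r" by (rule ar[OF x r])+
    assume "r' \<le> le x"
    then show "ar (ar x r) r' = ar x r'" by (rule ar(7)[OF x r])
  next
    fix x x' assume x: "x \<in> box (A # C)"
    let ?B = "len (tl x)" and ?s = "st x" and ?r = "po x" and ?ps = "tl x"
    note tx = tlx[OF x] and s = str[OF x]
    have sr: "?s \<le> A \<and> ?s \<le> ?B \<and> ?r + 2 * ?s \<le> A + ?B" using s by simp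
    note G = G0[OF sr]
    note GE = G[THEN conjunct2, THEN conjunct2, THEN conjunct2, THEN conjunct1]
      and GF = G[THEN conjunct2, THEN conjunct2, THEN conjunct2, THEN conjunct2]
    have cgx: "cg_at ?B ?s ?r = (hd x, pos ?ps)" "hd x \<le> A"
      using cg_at_pos[of "hd x" A "pos ?ps" ?B] pos_le[OF tx] x by (cases x; simp add: st_def po_def)+
    have sumx: "sum_list x = hd x + sum_list ?ps" using x by (cases x) auto
    have lenps: "int ?B - 2 * int (pos ?ps) = box_wt C ?ps" by (rule len_pos[OF tx])
    have hp: "hd x + pos ?ps = ?s + ?r" using cg_pos_at(5)[OF s cgx(1)] .
    show "Y' x x' \<noteq> 0 \<Longrightarrow> x' \<in> box (A # C) \<and> sum_list x' = sum_list x"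
    proof -
      assume n: "Y' x x' \<noteq> 0"
      then have ne: "x' \<noteq> []" by (auto simp: Y'_def Z_def)
      then have "(\<Sum>j\<le>?B. G ?B ?s ?r (hd x') j * Y (along ?ps j) (tl x')) \<noteq> 0" using n by (auto simp: Y'_def Z_def)
      then obtain j where j: "j \<le> ?B" "G ?B ?s ?r (hd x') j \<noteq> 0" "Y (along ?ps j) (tl x') \<noteq> 0"
        by (rule sum.not_neutral_contains_not_neutral) (rule that; auto)
      have "hd x' \<le> A" "hd x' + j = ?s + ?r" using boxed_0[of A ?B "?s + ?r" "G ?B ?s ?r" "hd x'" j] G j by auto
      moreover have "tl x' \<in> box C" using Y_supp[OF at_mem[OF tx j(1)] j(3)] by simp
      moreover have "int ?B - 2 * int j = box_wt C (tl x')" using Y_at_wt[OF tx j(1,3)] by simp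
      ultimately show ?thesis using ne lenps hp sumx by (cases x') (auto simp: box_wt_def)
    qed
    show "Y' x x' - of_bool (x' = x) \<in> qideal"
    proof (cases "x' \<in> box (A # C)")
      case False
      then show ?thesis using \<open>Y' x x' \<noteq> 0 \<Longrightarrow> x' \<in> box (A # C) \<and> sum_list x' = sum_list x\<close> x by force
    next
      case True
      then obtain p' ps' where x': "x' = p' # ps'" "p' \<le> A" "ps' \<in> box C" by (cases x') auto
      have Yj: "Y (along ?ps j) ps' - of_bool (ps' = along ?ps j) \<in> qideal" if "j \<le> ?B" for j
        by (rule Y_cong[OF at_mem[OF tx that]])
      have YA: "Y (along ?ps j) ps' \<in> \<A>" if "j \<le> ?B" for j
        using regq_add[OF qideal_subset[OF Yj[OF that]], of "of_bool (ps' = along ?ps j)"] by simp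
      have gA: "g p' \<in> \<A>" by (rule unit1_regq[OF g1[OF x'(2)]])
      \<comment> \<open>Only the leading place of G, which is (\<open>hd x\<close>,
        \<open>pos ?ps\<close>), can contribute modulo q; the bracket is therefore charged to the
        summand j = \<open>pos ?ps\<close>.\<close>
      have tm: "g p' * (G ?B ?s ?r p' j * Y (along ?ps j) ps') - of_bool (x' = x \<and> j = pos ?ps) \<in> qideal" if j: "j \<le> ?B" for j
      proof (cases "(p', j) = cg_at ?B ?s ?r")
        case False
        then have "G ?B ?s ?r p' j \<in> qideal" using G by blast
        then have "g p' * (G ?B ?s ?r p' j * Y (along ?ps j) ps') \<in> qideal" by (intro qideal_mult YA gA j)
        moreover have "\<not> (x' = x \<and> j = pos ?ps)" using False cgx x' by auto
        ultimately show ?thesis by simp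
      next
        case True
        then have pj: "p' = hd x" "j = pos ?ps" using cgx by auto
        have u: "g p' * G ?B ?s ?r p' j \<in> unit1" using G unit1_mult[OF g1[OF x'(2)]] unfolding pj cgx by simp
        have e: "(x' = x) = (ps' = along ?ps j)" using x x' pj at_pos[OF tx] by (cases x) auto
        let ?u = "g p' * G ?B ?s ?r p' j"
        have "?u * Y (along ?ps j) ps' - of_bool (ps' = along ?ps j) =
            ?u * (Y (along ?ps j) ps' - of_bool (ps' = along ?ps j)) + (?u - 1) * of_bool (ps' = along ?ps j)"
          by (simp add: algebra_simps)
        also have "\<dots> \<in> qideal"
          by (rule qideal_add[OF qideal_mult(2)[OF unit1_regq[OF u] Yj[OF j]] qideal_mult(1)])
            (use u in \<open>auto simp: unit1_def\<close>)
        finally show ?thesis using pj by (simp add: e mult.assoc)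
      qed
      have "Y' x x' - of_bool (x' = x) = (\<Sum>j\<le>?B. g p' * (G ?B ?s ?r p' j * Y (along ?ps j) ps') - of_bool (x' = x \<and> j = pos ?ps))"
        using pos_le[OF tx] unfolding sum_subtractf by (simp add: Y'_def Z_def x'(1) sum_distrib_left of_bool_def if_distrib sum.If_cases)
      also have "\<dots> \<in> qideal" by (rule qideal_sum) (use tm in auto)
      finally show ?thesis .
    qed
    show "int (le x) - 2 * int (po x) = box_wt (A # C) x"
      using lenps hp sumx s unfolding le_def by (simp add: box_wt_def of_nat_diff)
    assume x': "x' \<in> box (A # C)"
    then obtain p' ps' where x'': "x' = p' # ps'" "p' \<le> A" "ps' \<in> box C" by (cases x') auto
    have "mE (A # C) (Y' x) x' = g p' * (\<Sum>j\<le>?B. cgE A ?B (G ?B ?s ?r) p' j * Y (along ?ps j) ps')"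
    proof -
      let ?G = "G ?B ?s ?r"
      have "mE C (\<lambda>ps. Y' x (p' # ps)) ps' = g p' * (\<Sum>j\<le>?B. ?G p' j * mE C (Y (along ?ps j)) ps')"
        by (simp add: Y'_def Z_def mE_cmult mE_sum)
      also have "(\<Sum>j\<le>?B. ?G p' j * mE C (Y (along ?ps j)) ps') =
          (\<Sum>j\<le>?B. ?G p' j * (if j = 0 then 0 else qi (int ?B - int (j - 1)) * Y (along ?ps (j - 1)) ps'))"
        by (intro sum.cong refl) (simp add: mE_Y_at[OF tx _ x''(3)])
      also have "\<dots> = (\<Sum>j<?B. ?G p' (Suc j) * (qi (int ?B - int j) * Y (along ?ps j) ps'))"
        by (rule sum_atMost_shift_up)
      \<comment> \<open>The summand j = \<open>?B\<close> may be added, since it carries the factor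
        \<open>qi 0\<close>.\<close>
      also have "\<dots> = (\<Sum>j\<le>?B. ?G p' (Suc j) * (qi (int ?B - int j) * Y (along ?ps j) ps'))"
        by (simp flip: lessThan_Suc_atMost)
      finally have 1: "mE C (\<lambda>ps. Y' x (p' # ps)) ps' = g p' * (\<Sum>j\<le>?B. ?G p' (Suc j) * (qi (int ?B - int j) * Y (along ?ps j) ps'))" .
      have 2: "(if p' < A then qq powi (1 + int p' - int A) * qn (Suc p') * Y' x (Suc p' # ps') else 0) =
          g p' * (\<Sum>j\<le>?B. qi (int A - int p') * ?G (Suc p') j * Y (along ?ps j) ps')"
      proof (cases "p' < A")
        case True
        have "qq powi (1 + int p' - int A) * qn (Suc p') * Y' x (Suc p' # ps') =
          (qq powi (1 + int p' - int A) * qn (Suc p') * g (Suc p')) * (\<Sum>j\<le>?B. ?G (Suc p') j * Y (along ?ps j) ps')"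
          by (simp add: Y'_def Z_def)
        then show ?thesis unfolding gE[OF True] using True by (simp add: sum_distrib_left mult.assoc)
      qed (use x''(2) in simp)
      have 3: "(\<Sum>j\<le>?B. cgE A ?B ?G p' j * Y (along ?ps j) ps') =
          (\<Sum>j\<le>?B. qi (int A - int p') * ?G (Suc p') j * Y (along ?ps j) ps') +
          qq powi (2 * int p' - int A) * (\<Sum>j\<le>?B. ?G p' (Suc j) * (qi (int ?B - int j) * Y (along ?ps j) ps'))"
        unfolding cgE_def distrib_right sum.distrib sum_distrib_left by (simp add: mult_ac)
      show ?thesis unfolding x''(1) mE.simps 1 2 3 by (simp only: distrib_left mult.left_commute)
    qed
    also have "\<dots> = (if po x = 0 then 0 else qi (int (le x) - int (po x) + 1) * Y' (ar x (po x - 1)) x')"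
    proof (cases "po x = 0")
      case False
      have "Y' (ar x (po x - 1)) = Z ?ps ?s (?r - 1)" by (rule ar(6)[OF x]) (use pole[OF x] in simp)
      then show ?thesis unfolding GE using False by (simp add: Z_def x''(1) le_def sum_distrib_left mult_ac)
    next
      case True
      then show ?thesis unfolding GE by simp
    qed
    finally show "mE (A # C) (Y' x) x' = (if po x = 0 then 0 else qi (int (le x) - int (po x) + 1) * Y' (ar x (po x - 1)) x')" .
    have "mF (A # C) (Y' x) x' = g p' * (\<Sum>j\<le>?B. cgF A ?B (G ?B ?s ?r) p' j * Y (along ?ps j) ps')"
    proof -
      let ?G = "G ?B ?s ?r"
      have "mF C (\<lambda>ps. Y' x (p' # ps)) ps' = g p' * (\<Sum>j\<le>?B. ?G p' j * mF C (Y (along ?ps j)) ps')"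
        by (simp add: Y'_def Z_def mF_cmult mF_sum)
      also have "(\<Sum>j\<le>?B. ?G p' j * mF C (Y (along ?ps j)) ps') =
          (\<Sum>j\<le>?B. ?G p' j * (if j = ?B then 0 else qi (int (Suc j)) * Y (along ?ps (Suc j)) ps'))"
        by (intro sum.cong refl) (simp add: mF_Y_at[OF tx _ x''(3)])
      also have "\<dots> = (\<Sum>j<?B. ?G p' j * (qi (int (Suc j)) * Y (along ?ps (Suc j)) ps'))"
        by (rule sum_atMost_shift_down)
      also have "\<dots> = (\<Sum>j\<le>?B. ?G p' (j - 1) * (qi (int j) * Y (along ?ps j) ps'))"
        unfolding sum.atMost_shift by simp
      finally have 1: "mF C (\<lambda>ps. Y' x (p' # ps)) ps' = g p' * (\<Sum>j\<le>?B. ?G p' (j - 1) * (qi (int j) * Y (along ?ps j) ps'))" .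
      have 2: "(if 0 < p' then qq powi (box_wt C ps' + 1 - int p') * qn (Suc (A - p')) * Y' x ((p' - 1) # ps') else 0) =
          g p' * (\<Sum>j\<le>?B. qi (int p') * qq powi (int ?B - 2 * int j) * ?G (p' - 1) j * Y (along ?ps j) ps')"
      proof (cases "0 < p'")
        case True
        \<comment> \<open>The vector at position j of the old string is supported on words of one
          weight, so the power of q in \<open>mF\<close> that depends on ps' can be replaced by the
          one in \<open>cgF\<close> that depends on j.\<close>
        have w: "qq powi box_wt C ps' * Y (along ?ps j) ps' = qq powi (int ?B - 2 * int j) * Y (along ?ps j) ps'" if "j \<le> ?B" for j
          using Y_at_wt[OF tx that, of ps'] by (cases "Y (along ?ps j) ps' = 0") auto
        have q: "qq powi (box_wt C ps' + 1 - int p') = qq powi (1 - int p') * qq powi box_wt C ps'"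
          by (simp add: power_int_add[symmetric] algebra_simps)
        have "qq powi (box_wt C ps' + 1 - int p') * qn (Suc (A - p')) * Y' x ((p' - 1) # ps') =
          (qq powi (1 - int p') * qn (Suc (A - p')) * g (p' - 1)) *
          (\<Sum>j\<le>?B. ?G (p' - 1) j * (qq powi box_wt C ps' * Y (along ?ps j) ps'))"
          unfolding q by (simp add: Y'_def Z_def sum_distrib_left algebra_simps)
        also have "\<dots> = g p' * (\<Sum>j\<le>?B. qi (int p') * qq powi (int ?B - 2 * int j) * ?G (p' - 1) j * Y (along ?ps j) ps')"
          unfolding gF[OF True x''(2)] sum_distrib_left by (intro sum.cong refl) (simp add: w algebra_simps)
        finally show ?thesis using True by simp
      qed simp
      have "(\<Sum>j\<le>?B. cgF A ?B ?G p' j * Y (along ?ps j) ps') =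
          (\<Sum>j\<le>?B. qi (int p') * qq powi (int ?B - 2 * int j) * ?G (p' - 1) j * Y (along ?ps j) ps' +
            ?G p' (j - 1) * (qi (int j) * Y (along ?ps j) ps'))"
        using x''(2) by (intro sum.cong refl) (simp add: cgF_def algebra_simps)
      then show ?thesis unfolding x''(1) mF.simps 1 2 by (simp only: sum.distrib distrib_left)
    qed
    also have "\<dots> = (if po x = le x then 0 else qi (int (po x) + 1) * Y' (ar x (Suc (po x))) x')"
    proof (cases "po x = le x")
      case False
      have "Y' (ar x (Suc (po x))) = Z ?ps ?s (Suc ?r)" by (rule ar(6)[OF x]) (use pole[OF x] False in simp)
      moreover have "po x + 2 * st x \<noteq> A + ?B" using False s by (simp add: le_def)
      ultimately show ?thesis unfolding GF using False by (simp add: Z_def x''(1) sum_distrib_left mult_ac)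
    next
      case True
      then have "po x + 2 * st x = A + ?B" using s by (simp add: le_def)
      then show ?thesis unfolding GF using True by simp
    qed
    finally show "mF (A # C) (Y' x) x' = (if po x = le x then 0 else qi (int (po x) + 1) * Y' (ar x (Suc (po x))) x')" .
  qed
qed

end

theorem string_family_exists: "\<exists>len pos along Y. string_family C len pos along Y"
proof (induct C)
  case Nil
  have "string_family [] (\<lambda>_. 0) (\<lambda>_. 0) (\<lambda>_ _. []) (\<lambda>x x'. of_bool (x' = []))"
    by unfold_locales (auto simp: box_Nil box_wt_def)
  then show ?case by blast
next
  case (Cons A C)
  then show ?case using string_family.string_family_Cons by blast
qed

section \<open>Matrices congruent to the identity modulo q\<close>

lemma near_identity_solve:
  fixes M :: "'d \<Rightarrow> 'd \<Rightarrow> cq"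
  assumes "finite D" "\<And>a b. a \<in> D \<Longrightarrow> b \<in> D \<Longrightarrow> M a b - of_bool (b = a) \<in> qideal"
  shows "\<exists>c. (\<forall>b\<in>D. (\<Sum>a\<in>D. c a * M a b) = f b) \<and> ((\<forall>b\<in>D. f b \<in> \<A>) \<longrightarrow> (\<forall>a\<in>D. c a \<in> \<A>))"
  using assms
proof (induct D arbitrary: M f rule: finite_induct)
  case (insert x D)
  let ?i = "inverse (M x x)"
  have u: "M x x \<in> unit1" using insert(4)[of x x] by (simp add: unit1_def)
  have iA: "?i \<in> \<A>" using unit1_regq[OF unit1_inverse[OF u]] .
  have q: "M a x \<in> qideal" "M x a \<in> qideal" if "a \<in> D" for a
    using insert(4)[of a x] insert(4)[of x a] that insert(2) by (cases "x = a"; simp)+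
  \<comment> \<open>Gaussian elimination with the pivot \<open>M x x\<close>, a unit congruent to 1.
    The off-diagonal entries lie in the ideal, so the Schur complement is again congruent to the
    identity.\<close>
  define M' where "M' a b = M a b - M a x * (M x b * ?i)" for a b
  have M'q: "M' a b - of_bool (b = a) \<in> qideal" if "a \<in> D" "b \<in> D" for a b
  proof -
    have "M' a b - of_bool (b = a) = (M a b - of_bool (b = a)) - M a x * (M x b * ?i)" by (simp add: M'_def)
    also have "\<dots> \<in> qideal"
      by (rule qideal_diff[OF insert(4)[OF insertI2[OF that(1)] insertI2[OF that(2)]]
        qideal_mult(1)[OF q(1)[OF that(1)] regq_mult[OF qideal_subset[OF q(2)[OF that(2)]] iA]]])
    finally show ?thesis .
  qed
  from insert(3)[of M' "\<lambda>b. f b - f x * (M x b * ?i)", OF M'q]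
  obtain c where c: "\<forall>b\<in>D. (\<Sum>a\<in>D. c a * M' a b) = f b - f x * (M x b * ?i)"
    "(\<forall>b\<in>D. f b - f x * (M x b * ?i) \<in> \<A>) \<longrightarrow> (\<forall>a\<in>D. c a \<in> \<A>)" by auto
  define c' where "c' = c(x := (f x - (\<Sum>a\<in>D. c a * M a x)) * ?i)"
  have c'D: "(\<Sum>a\<in>D. c' a * M a b) = (\<Sum>a\<in>D. c a * M a b)" for b
    by (rule sum.cong) (use insert(2) in \<open>auto simp: c'_def\<close>)
  have "(\<Sum>a\<in>insert x D. c' a * M a b) = f b" if "b \<in> insert x D" for b
  proof (cases "b = x")
    case True
    then show ?thesis using insert(1,2) unit1_neq_0[OF u] by (simp add: c'D) (simp add: c'_def mult.assoc)
  next
    case False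
    then have b: "b \<in> D" using that by simp
    have "(\<Sum>a\<in>D. c a * M a b) = (\<Sum>a\<in>D. c a * M' a b) + (\<Sum>a\<in>D. c a * M a x) * (M x b * ?i)"
      unfolding sum_distrib_right sum.distrib[symmetric] by (intro sum.cong refl) (simp add: M'_def algebra_simps)
    also have "(\<Sum>a\<in>D. c a * M' a b) = f b - f x * (M x b * ?i)" using c(1) b by blast
    finally show ?thesis using insert(1,2) by (simp add: c'D) (simp add: c'_def algebra_simps)
  qed
  moreover have "c' a \<in> \<A>" if f: "\<forall>b\<in>insert x D. f b \<in> \<A>" and a: "a \<in> insert x D" for a
  proof -
    have "f b - f x * (M x b * ?i) \<in> \<A>" if "b \<in> D" for b
      using f that qideal_subset[OF q(2)[OF that]] iA by (intro regq_diff regq_mult) auto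
    then have cA: "a \<in> D \<Longrightarrow> c a \<in> \<A>" for a using c(2) by blast
    have "(f x - (\<Sum>a\<in>D. c a * M a x)) * ?i \<in> \<A>"
      using f iA qideal_subset[OF q(1)] by (intro regq_mult regq_diff regq_sum cA) auto
    then show ?thesis using a cA by (auto simp: c'_def)
  qed
  ultimately show ?case by (intro exI[of _ c']) blast
qed simp

lemma near_identity_left_inverse:
  fixes M :: "'d \<Rightarrow> 'd \<Rightarrow> cq"
  assumes D: "finite D" and M: "\<And>a b. a \<in> D \<Longrightarrow> b \<in> D \<Longrightarrow> M a b - of_bool (b = a) \<in> qideal"
  obtains N where "\<And>a b. a \<in> D \<Longrightarrow> b \<in> D \<Longrightarrow> N a b - of_bool (b = a) \<in> qideal"
    "\<And>a b. a \<in> D \<Longrightarrow> b \<in> D \<Longrightarrow> (\<Sum>c\<in>D. N a c * M c b) = of_bool (b = a)"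
proof -
  have "\<exists>N. \<forall>a. (\<forall>b\<in>D. (\<Sum>c\<in>D. N a c * M c b) = of_bool (b = a)) \<and> (\<forall>c\<in>D. N a c \<in> \<A>)"
  proof (rule choice, rule allI)
    fix a
    show "\<exists>c. (\<forall>b\<in>D. (\<Sum>e\<in>D. c e * M e b) = of_bool (b = a)) \<and> (\<forall>e\<in>D. c e \<in> \<A>)"
    proof -
      have "(of_bool P :: cq) \<in> \<A>" for P by (cases P) auto
      then show ?thesis using near_identity_solve[OF D M, where f = "\<lambda>b. of_bool (b = a)"] by blast
    qed
  qed
  then obtain N where N: "\<And>a b. b \<in> D \<Longrightarrow> (\<Sum>c\<in>D. N a c * M c b) = of_bool (b = a)" "\<And>a c. c \<in> D \<Longrightarrow> N a c \<in> \<A>"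
    by blast
  show ?thesis
  proof (rule that[of N])
    fix a b assume ab: "a \<in> D" "b \<in> D"
    have "(\<Sum>c\<in>D. N a c * of_bool (b = c)) = N a b" using ab D by simp
    then have "N a b - of_bool (b = a) = - (\<Sum>c\<in>D. N a c * (M c b - of_bool (b = c)))"
      using N(1)[OF ab(2), of a] by (simp add: right_diff_distrib sum_subtractf)
    also have "\<dots> \<in> qideal" by (intro qideal_uminus qideal_sum qideal_mult(2) N M ab)
    finally show "N a b - of_bool (b = a) \<in> qideal" .
  qed (use N in auto)
qed

text \<open>The left inverse is itself congruent to the identity and has a left inverse in turn; by
  associativity the latter is the given matrix.\<close>

lemma near_identity_inverse:
  fixes M :: "'d \<Rightarrow> 'd \<Rightarrow> cq"
  assumes D: "finite D" and M: "\<And>a b. a \<in> D \<Longrightarrow> b \<in> D \<Longrightarrow> M a b - of_bool (b = a) \<in> qideal"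
  obtains N where "\<And>a b. a \<in> D \<Longrightarrow> b \<in> D \<Longrightarrow> N a b - of_bool (b = a) \<in> qideal"
    "\<And>a b. a \<in> D \<Longrightarrow> b \<in> D \<Longrightarrow> (\<Sum>c\<in>D. N a c * M c b) = of_bool (b = a)"
    "\<And>a b. a \<in> D \<Longrightarrow> b \<in> D \<Longrightarrow> (\<Sum>c\<in>D. M a c * N c b) = of_bool (b = a)"
proof -
  obtain N where N: "\<And>a b. a \<in> D \<Longrightarrow> b \<in> D \<Longrightarrow> N a b - of_bool (b = a) \<in> qideal"
    "\<And>a b. a \<in> D \<Longrightarrow> b \<in> D \<Longrightarrow> (\<Sum>c\<in>D. N a c * M c b) = of_bool (b = a)"
    by (rule near_identity_left_inverse[of D M], rule D, erule (1) M) (rule that; assumption)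
  obtain K where K: "\<And>a b. a \<in> D \<Longrightarrow> b \<in> D \<Longrightarrow> (\<Sum>c\<in>D. K a c * N c b) = of_bool (b = a)"
    by (rule near_identity_left_inverse[of D N], rule D, erule (1) N(1)) (rule that; assumption)
  have KM: "K a b = M a b" if "a \<in> D" "b \<in> D" for a b
  proof -
    have "M a b = (\<Sum>c\<in>D. of_bool (c = a) * M c b)" using that D by simp
    also have "\<dots> = (\<Sum>c\<in>D. \<Sum>e\<in>D. K a e * N e c * M c b)"
      using that by (intro sum.cong refl) (simp add: K[symmetric] sum_distrib_right)
    also have "\<dots> = (\<Sum>e\<in>D. K a e * (\<Sum>c\<in>D. N e c * M c b))"
      by (subst sum.swap) (simp add: sum_distrib_left mult.assoc)
    also have "\<dots> = (\<Sum>e\<in>D. K a e * of_bool (b = e))" using that by (intro sum.cong refl) (simp add: N)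
    also have "\<dots> = K a b" using that D by simp
    finally show ?thesis by simp
  qed
  have MN: "(\<Sum>c\<in>D. M a c * N c b) = of_bool (b = a)" if "a \<in> D" "b \<in> D" for a b
    unfolding K[OF that, symmetric] using that by (intro sum.cong refl) (simp add: KM)
  show ?thesis by (rule that[of N, OF N(1) N(2) MN])
qed

lemma of_bool_diff_qideal: "(of_bool P :: cq) - of_bool Q \<in> qideal \<longleftrightarrow> P = Q"
  using qideal_uminus[of "-1"] by auto

section \<open>Coordinates, lattices and changes of basis\<close>

locale coords =
  fixes V :: "(cq, 'v) module" and D :: "'d set" and co :: "'v \<Rightarrow> 'd \<Rightarrow> cq" and z :: "'d \<Rightarrow> 'v"
  assumes vs: "vectorspace class_ring V" and finite_D: "finite D"
    and co_add: "x \<in> carrier V \<Longrightarrow> y \<in> carrier V \<Longrightarrow> d \<in> D \<Longrightarrow> co (x \<oplus>\<^bsub>V\<^esub> y) d = co x d + co y d"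
    and co_smult: "x \<in> carrier V \<Longrightarrow> d \<in> D \<Longrightarrow> co (c \<odot>\<^bsub>V\<^esub> x) d = c * co x d"
    and co_inj: "x \<in> carrier V \<Longrightarrow> (\<And>d. d \<in> D \<Longrightarrow> co x d = 0) \<Longrightarrow> x = \<zero>\<^bsub>V\<^esub>"
    and z_mem: "d \<in> D \<Longrightarrow> z d \<in> carrier V"
    and co_z: "d \<in> D \<Longrightarrow> d' \<in> D \<Longrightarrow> co (z d) d' = of_bool (d' = d)"
begin

sublocale V: vectorspace class_ring V by (rule vs)

lemma co_zero: "d \<in> D \<Longrightarrow> co \<zero>\<^bsub>V\<^esub> d = 0"
  using co_add[of "\<zero>\<^bsub>V\<^esub>" "\<zero>\<^bsub>V\<^esub>" d] by (simp only: V.zero_closed V.l_zero simp_thms add_cancel_right_right)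

lemma co_minus: "x \<in> carrier V \<Longrightarrow> y \<in> carrier V \<Longrightarrow> d \<in> D \<Longrightarrow> co (x \<ominus>\<^bsub>V\<^esub> y) d = co x d - co y d"
  by (simp add: class_vs_minus[OF vs] co_add co_smult)

lemma co_eqI: "x \<in> carrier V \<Longrightarrow> y \<in> carrier V \<Longrightarrow> (\<And>d. d \<in> D \<Longrightarrow> co x d = co y d) \<Longrightarrow> x = y"
  using co_inj[of "x \<ominus>\<^bsub>V\<^esub> y"] by (simp add: co_minus)

lemma z_neq_0: "d \<in> D \<Longrightarrow> z d \<noteq> \<zero>\<^bsub>V\<^esub>"
  using co_z[of d d] co_zero[of d] by auto

lemma inj_z: "inj_on z D"
  by (rule inj_onI) (metis co_z of_bool_eq(1,2) zero_neq_one)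

lemma co_finsum: "finite S \<Longrightarrow> h \<in> S \<rightarrow> carrier V \<Longrightarrow> d \<in> D \<Longrightarrow> co (\<Oplus>\<^bsub>V\<^esub>s\<in>S. h s) d = (\<Sum>s\<in>S. co (h s) d)"
proof (induct S rule: finite_induct)
  case (insert s S)
  then have "h \<in> S \<rightarrow> carrier V" "h s \<in> carrier V" by auto
  then show ?case using insert by (simp add: co_add V.finsum_insert)
qed (simp add: co_zero)

definition comb :: "('d \<Rightarrow> cq) \<Rightarrow> 'v" where
  "comb f = (\<Oplus>\<^bsub>V\<^esub>d\<in>D. f d \<odot>\<^bsub>V\<^esub> z d)"

lemma comb_mem: "comb f \<in> carrier V"
  unfolding comb_def using z_mem by (intro V.finsum_closed) auto

lemma co_comb: assumes "d \<in> D" shows "co (comb f) d = f d"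
proof -
  have "co (comb f) d = (\<Sum>s\<in>D. f s * of_bool (d = s))"
    unfolding comb_def using assms z_mem by (subst co_finsum) (auto simp: finite_D co_smult co_z intro!: sum.cong)
  then show ?thesis using assms finite_D by simp
qed

lemma comb_co: "x \<in> carrier V \<Longrightarrow> comb (co x) = x"
  by (rule co_eqI) (simp_all add: comb_mem co_comb)

lemma linear_finsum:
  assumes "linear_map class_ring V V T"
  shows "finite S \<Longrightarrow> h \<in> S \<rightarrow> carrier V \<Longrightarrow> T (\<Oplus>\<^bsub>V\<^esub>s\<in>S. h s) = (\<Oplus>\<^bsub>V\<^esub>s\<in>S. T (h s))"
proof (induct S rule: finite_induct)
  case (insert s S)
  note T = class_linearD[OF assms]
  have "h \<in> S \<rightarrow> carrier V" "h s \<in> carrier V" using insert(4) by auto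
  moreover from this have "(\<lambda>s. T (h s)) \<in> S \<rightarrow> carrier V" using T(1) by auto
  ultimately show ?case using insert T by (simp add: V.finsum_insert)
qed (simp add: class_linearD(5)[OF assms])

lemma co_linear:
  assumes "linear_map class_ring V V T" "x \<in> carrier V" "d \<in> D"
  shows "co (T x) d = (\<Sum>e\<in>D. co x e * co (T (z e)) d)"
proof -
  note T = class_linearD[OF assms(1)]
  have "T x = T (comb (co x))" using comb_co[OF assms(2)] by simp
  also have "\<dots> = (\<Oplus>\<^bsub>V\<^esub>e\<in>D. T (co x e \<odot>\<^bsub>V\<^esub> z e))"
    unfolding comb_def using z_mem by (intro linear_finsum[OF assms(1) finite_D]) auto
  finally have "co (T x) d = (\<Sum>e\<in>D. co (T (co x e \<odot>\<^bsub>V\<^esub> z e)) d)"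
    using z_mem T(1) assms(3) by (simp add: co_finsum finite_D)
  then show ?thesis using T(1,3) z_mem assms(3) by (simp add: co_smult)
qed

text \<open>The linear map with given values on the basis, restricted to the carrier because the
  Kashiwara operators are specified as extensional maps.\<close>

definition extend :: "('d \<Rightarrow> 'v) \<Rightarrow> 'v \<Rightarrow> 'v" where
  "extend t = restrict (\<lambda>x. \<Oplus>\<^bsub>V\<^esub>d\<in>D. co x d \<odot>\<^bsub>V\<^esub> t d) (carrier V)"

lemma co_extend:
  assumes "t \<in> D \<rightarrow> carrier V" "x \<in> carrier V" "d \<in> D"
  shows "co (extend t x) d = (\<Sum>e\<in>D. co x e * co (t e) d)"
proof -
  have "(\<lambda>d. co x d \<odot>\<^bsub>V\<^esub> t d) \<in> D \<rightarrow> carrier V" using assms by auto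
  then show ?thesis using assms by (simp add: extend_def co_finsum finite_D co_smult Pi_iff)
qed

lemma extend_mem: "t \<in> D \<rightarrow> carrier V \<Longrightarrow> x \<in> carrier V \<Longrightarrow> extend t x \<in> carrier V"
  unfolding extend_def by (auto intro!: V.finsum_closed)

lemma linear_extend: assumes t: "t \<in> D \<rightarrow> carrier V" shows "linear_map class_ring V V (extend t)"
proof (rule class_linearI[OF vs vs])
  fix x y assume "x \<in> carrier V" "y \<in> carrier V"
  then show "extend t (x \<oplus>\<^bsub>V\<^esub> y) = extend t x \<oplus>\<^bsub>V\<^esub> extend t y"
    by (intro co_eqI) (simp_all add: extend_mem t co_extend co_add sum.distrib distrib_right)
next
  fix c x assume "x \<in> carrier V"
  then show "extend t (c \<odot>\<^bsub>V\<^esub> x) = c \<odot>\<^bsub>V\<^esub> extend t x"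
    by (intro co_eqI) (simp_all add: extend_mem t co_extend co_smult sum_distrib_left mult.assoc)
qed (rule extend_mem[OF t])

lemma extensional_extend: "extend t \<in> extensional (carrier V)"
  by (simp add: extend_def)

lemma linear_eqI:
  assumes T: "linear_map class_ring V V T" "linear_map class_ring V V T'"
    and e: "\<And>d. d \<in> D \<Longrightarrow> T (z d) = T' (z d)" and x: "x \<in> carrier V"
  shows "T x = T' x"
  by (rule co_eqI) (use class_linearD(1)[OF T(1)] class_linearD(1)[OF T(2)] x in \<open>simp_all add: co_linear[OF T(1)] co_linear[OF T(2)] e\<close>)

lemma lattice_eq: "crystal_lattice V (z ` D) = {x \<in> carrier V. \<forall>d\<in>D. co x d \<in> \<A>}"
proof (rule subset_antisym; rule subsetI)
  fix x assume "x \<in> crystal_lattice V (z ` D)"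
  then obtain a S where x: "x = (\<Oplus>\<^bsub>V\<^esub>b\<in>S. a b \<odot>\<^bsub>V\<^esub> b)" "finite S" "S \<subseteq> z ` D" "a \<in> S \<rightarrow> \<A>"
    by (auto simp: crystal_lattice_def)
  have S: "S \<subseteq> carrier V" using x(3) z_mem by auto
  then have h: "(\<lambda>b. a b \<odot>\<^bsub>V\<^esub> b) \<in> S \<rightarrow> carrier V" by auto
  have "co x d \<in> \<A>" if d: "d \<in> D" for d
  proof -
    have "co x d = (\<Sum>b\<in>S. a b * co b d)" unfolding x(1) using S d by (simp add: co_finsum[OF x(2) h d] co_smult subset_iff)
    also have "\<dots> \<in> \<A>"
    proof (rule regq_sum)
      fix b assume b: "b \<in> S"
      then obtain e where "b = z e" "e \<in> D" using x(3) by auto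
      then show "a b * co b d \<in> \<A>" using x(4) b d by (auto simp: co_z)
    qed
    finally show ?thesis .
  qed
  then show "x \<in> {x \<in> carrier V. \<forall>d\<in>D. co x d \<in> \<A>}" unfolding x(1) using h by (auto intro: V.finsum_closed)
next
  fix x assume x: "x \<in> {x \<in> carrier V. \<forall>d\<in>D. co x d \<in> \<A>}"
  \<comment> \<open>Coefficients of lattice elements are indexed by basis vectors, so the coordinate
    is taken at the index of the vector.\<close>
  let ?a = "\<lambda>b. co x (inv_into D z b)"
  have "(\<Oplus>\<^bsub>V\<^esub>b\<in>z ` D. ?a b \<odot>\<^bsub>V\<^esub> b) = (\<Oplus>\<^bsub>V\<^esub>d\<in>D. ?a (z d) \<odot>\<^bsub>V\<^esub> z d)"
    by (rule V.finsum_reindex[OF _ inj_z]) (use z_mem in auto)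
  also have "\<dots> = comb (co x)" unfolding comb_def
    by (rule V.finsum_cong') (use z_mem in \<open>auto simp: inv_into_f_f[OF inj_z]\<close>)
  finally have "x = (\<Oplus>\<^bsub>V\<^esub>b\<in>z ` D. ?a b \<odot>\<^bsub>V\<^esub> b)" using x comb_co[of x] by simp
  moreover have "?a \<in> z ` D \<rightarrow> \<A>" using x by (auto simp: inv_into_f_f[OF inj_z])
  ultimately show "x \<in> crystal_lattice V (z ` D)"
    unfolding crystal_lattice_def using finite_D by (intro CollectI exI[of _ ?a] exI[of _ "z ` D"]) auto
qed

lemma cong_iff:
  assumes "x \<in> carrier V" "y \<in> carrier V"
  shows "cong_mod_q V (crystal_lattice V (z ` D)) x y \<longleftrightarrow> (\<forall>d\<in>D. co x d - co y d \<in> qideal)"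
proof
  assume "cong_mod_q V (crystal_lattice V (z ` D)) x y"
  then obtain v where v: "v \<in> carrier V" "\<forall>d\<in>D. co v d \<in> \<A>" "x \<ominus>\<^bsub>V\<^esub> y = qq \<odot>\<^bsub>V\<^esub> v"
    by (auto simp: cong_mod_q_def lattice_eq)
  then show "\<forall>d\<in>D. co x d - co y d \<in> qideal"
    using assms by (metis co_minus co_smult qidealI)
next
  assume *: "\<forall>d\<in>D. co x d - co y d \<in> qideal"
  let ?v = "comb (\<lambda>d. (co x d - co y d) / qq)"
  have "(co x d - co y d) / qq \<in> \<A>" if "d \<in> D" for d using * that by (auto simp: qideal_def)
  then have "?v \<in> crystal_lattice V (z ` D)" by (simp add: lattice_eq comb_mem co_comb)
  moreover have "x \<ominus>\<^bsub>V\<^esub> y = qq \<odot>\<^bsub>V\<^esub> ?v"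
    by (rule co_eqI) (use assms in \<open>simp_all add: comb_mem co_comb co_minus co_smult\<close>)
  ultimately show "cong_mod_q V (crystal_lattice V (z ` D)) x y" unfolding cong_mod_q_def by blast
qed

lemma basis_z: "vectorspace.basis class_ring V (z ` D)"
proof (subst V.basis_criterion)
  show "finite (z ` D)" "z ` D \<subseteq> carrier V" using finite_D z_mem by auto
  have lin: "V.lincomb a (z ` D) \<in> carrier V" "d \<in> D \<Longrightarrow> co (V.lincomb a (z ` D)) d = a (z d)" for a d
  proof -
    have h: "(\<lambda>b. a b \<odot>\<^bsub>V\<^esub> b) \<in> z ` D \<rightarrow> carrier V" using z_mem by auto
    then show "V.lincomb a (z ` D) \<in> carrier V" by (simp add: V.lincomb_def)
    have "V.lincomb a (z ` D) = comb (\<lambda>d. a (z d))"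
      unfolding V.lincomb_def comb_def by (rule V.finsum_reindex[OF h inj_z])
    then show "d \<in> D \<Longrightarrow> co (V.lincomb a (z ` D)) d = a (z d)" by (simp add: co_comb)
  qed
  show "\<forall>v. v \<in> carrier V \<longrightarrow> (\<exists>!a. a \<in> z ` D \<rightarrow>\<^sub>E carrier class_ring \<and> V.lincomb a (z ` D) = v)"
  proof (intro allI impI)
    fix v assume v: "v \<in> carrier V"
    show "\<exists>!a. a \<in> z ` D \<rightarrow>\<^sub>E carrier class_ring \<and> V.lincomb a (z ` D) = v"
    proof (rule ex1I[of _ "restrict (\<lambda>b. co v (inv_into D z b)) (z ` D)"])
      have "V.lincomb (restrict (\<lambda>b. co v (inv_into D z b)) (z ` D)) (z ` D) = v"
        by (rule co_eqI) (simp_all add: lin v inv_into_f_f[OF inj_z])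
      then show "restrict (\<lambda>b. co v (inv_into D z b)) (z ` D) \<in> z ` D \<rightarrow>\<^sub>E carrier class_ring \<and>
        V.lincomb (restrict (\<lambda>b. co v (inv_into D z b)) (z ` D)) (z ` D) = v" by (simp add: class_ring_simps)
    next
      fix a assume a: "a \<in> z ` D \<rightarrow>\<^sub>E carrier class_ring \<and> V.lincomb a (z ` D) = v"
      show "a = restrict (\<lambda>b. co v (inv_into D z b)) (z ` D)"
      proof (rule extensionalityI[of _ "z ` D"])
        show "a \<in> extensional (z ` D)" using a by (auto simp: PiE_def)
        fix b assume "b \<in> z ` D"
        then obtain d where "d \<in> D" "b = z d" by auto
        then show "a b = restrict (\<lambda>b. co v (inv_into D z b)) (z ` D) b"
          using a lin(2)[of d a] by (simp add: inv_into_f_f[OF inj_z])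
      qed simp
    qed
  qed
qed

text \<open>The transition matrix is congruent to the identity modulo q and hence invertible over
  the local ring, with an inverse of the same kind. Both bases thus span the same lattice, the same
  multiple of it by q, and have the same classes.\<close>

lemma change_basis:
  assumes y: "\<And>d. d \<in> D \<Longrightarrow> y d \<in> carrier V"
    and M: "\<And>d d'. d \<in> D \<Longrightarrow> d' \<in> D \<Longrightarrow> co (y d) d' - of_bool (d' = d) \<in> qideal"
  obtains coy where "coords V D coy y"
    "\<And>x. x \<in> carrier V \<Longrightarrow> (\<forall>d\<in>D. coy x d \<in> \<A>) \<longleftrightarrow> (\<forall>d\<in>D. co x d \<in> \<A>)"
    "\<And>x. x \<in> carrier V \<Longrightarrow> (\<forall>d\<in>D. coy x d \<in> qideal) \<longleftrightarrow> (\<forall>d\<in>D. co x d \<in> qideal)"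
    "\<And>d d'. d \<in> D \<Longrightarrow> d' \<in> D \<Longrightarrow> coy (z d) d' - of_bool (d' = d) \<in> qideal"
proof -
  obtain N where N: "\<And>a b. a \<in> D \<Longrightarrow> b \<in> D \<Longrightarrow> N a b - of_bool (b = a) \<in> qideal"
    "\<And>a b. a \<in> D \<Longrightarrow> b \<in> D \<Longrightarrow> (\<Sum>c\<in>D. N a c * co (y c) b) = of_bool (b = a)"
    "\<And>a b. a \<in> D \<Longrightarrow> b \<in> D \<Longrightarrow> (\<Sum>c\<in>D. co (y a) c * N c b) = of_bool (b = a)"
    by (rule near_identity_inverse[of D "\<lambda>d d'. co (y d) d'"], rule finite_D, erule (1) M) (rule that; assumption)
  define coy where "coy x d = (\<Sum>e\<in>D. co x e * N e d)" for x d
  have coord: "co x d = (\<Sum>e\<in>D. coy x e * co (y e) d)" if "d \<in> D" for x d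
  proof -
    have "(\<Sum>e\<in>D. coy x e * co (y e) d) = (\<Sum>c\<in>D. co x c * (\<Sum>e\<in>D. N c e * co (y e) d))"
      unfolding coy_def sum_distrib_right sum_distrib_left by (subst sum.swap) (simp add: mult.assoc)
    also have "\<dots> = (\<Sum>c\<in>D. co x c * of_bool (d = c))" using that by (intro sum.cong refl) (simp add: N)
    also have "\<dots> = co x d" using that finite_D by simp
    finally show ?thesis by simp
  qed
  have A: "a - of_bool P \<in> qideal \<Longrightarrow> a \<in> \<A>" for a :: cq and P
    using regq_add[OF qideal_subset, of "a - of_bool P" "of_bool P"] by simp
  show ?thesis
  proof (rule that[of coy])
    show "coords V D coy y"
    proof
      fix x assume x: "x \<in> carrier V" "\<And>d. d \<in> D \<Longrightarrow> coy x d = 0"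
      show "x = \<zero>\<^bsub>V\<^esub>"
      proof (rule co_inj[OF x(1)])
        fix d assume d: "d \<in> D"
        show "co x d = 0" unfolding coord[OF d, of x] using x(2) by simp
      qed
    qed (simp_all add: coy_def finite_D co_add co_smult y N sum.distrib distrib_right sum_distrib_left mult.assoc)
    show "(\<forall>d\<in>D. coy x d \<in> \<A>) \<longleftrightarrow> (\<forall>d\<in>D. co x d \<in> \<A>)" for x
    proof (intro iffI ballI)
      fix d assume "\<forall>d\<in>D. coy x d \<in> \<A>" "d \<in> D"
      then show "co x d \<in> \<A>" unfolding coord[OF \<open>d \<in> D\<close>, of x] by (intro regq_sum regq_mult A[OF M]) auto
    next
      fix d assume "\<forall>d\<in>D. co x d \<in> \<A>" "d \<in> D"
      then show "coy x d \<in> \<A>" unfolding coy_def by (intro regq_sum regq_mult A[OF N(1)]) auto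
    qed
    show "(\<forall>d\<in>D. coy x d \<in> qideal) \<longleftrightarrow> (\<forall>d\<in>D. co x d \<in> qideal)" for x
    proof (intro iffI ballI)
      fix d assume "\<forall>d\<in>D. coy x d \<in> qideal" "d \<in> D"
      then show "co x d \<in> qideal" unfolding coord[OF \<open>d \<in> D\<close>, of x] by (intro qideal_sum qideal_mult(1) A[OF M]) auto
    next
      fix d assume "\<forall>d\<in>D. co x d \<in> qideal" "d \<in> D"
      then show "coy x d \<in> qideal" unfolding coy_def by (intro qideal_sum qideal_mult(1) A[OF N(1)]) auto
    qed
    fix d d' assume d: "d \<in> D" "d' \<in> D"
    have "coy (z d) d' = (\<Sum>e\<in>D. N e d' * of_bool (e = d))"
      unfolding coy_def using d by (intro sum.cong refl) (simp add: co_z)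
    also have "\<dots> = N d d'" using d finite_D by simp
    finally show "coy (z d) d' - of_bool (d' = d) \<in> qideal" using N(1)[OF d] by simp
  qed
qed

end

section \<open>Kashiwara operators in a basis of strings\<close>

locale string_basis = coords V D co y + strings D len pos along
  for V :: "(cq, 'v) module" and D :: "'d set" and co y len pos along +
  fixes E F :: "'v \<Rightarrow> 'v" and wt :: "'v \<Rightarrow> bool"
  assumes lin_E: "linear_map class_ring V V E" and lin_F: "linear_map class_ring V V F"
    and E_y: "d \<in> D \<Longrightarrow> E (y d) = (if pos d = 0 then \<zero>\<^bsub>V\<^esub> else
      qi (int (len d) - int (pos d) + 1) \<odot>\<^bsub>V\<^esub> y (along d (pos d - 1)))"
    and F_y: "d \<in> D \<Longrightarrow> F (y d) = (if pos d = len d then \<zero>\<^bsub>V\<^esub> else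
      qi (int (pos d) + 1) \<odot>\<^bsub>V\<^esub> y (along d (Suc (pos d))))"
    and wt_y: "d \<in> D \<Longrightarrow> wt (y d)" and wt_zero: "wt \<zero>\<^bsub>V\<^esub>" and wt_mem: "wt x \<Longrightarrow> x \<in> carrier V"
    and wt_len: "wt x \<Longrightarrow> d \<in> D \<Longrightarrow> d' \<in> D \<Longrightarrow> co x d \<noteq> 0 \<Longrightarrow> co x d' \<noteq> 0 \<Longrightarrow> pos d = 0 \<Longrightarrow> pos d' = 0 \<Longrightarrow> len d = len d'"
begin

abbreviation dp where "dp \<equiv> divided_power V F"

text \<open>Successor and predecessor on a string are inverse to each other; from this comes the
  equivalence between the two Kashiwara operators in the crystal axioms.\<close>

lemma along_eq_iff:
  assumes "d \<in> D" "e \<in> D"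
  shows "(pos e < len e \<and> along e (Suc (pos e)) = d) \<longleftrightarrow> (0 < pos d \<and> along d (pos d - 1) = e)"
proof
  assume a: "pos e < len e \<and> along e (Suc (pos e)) = d"
  then have "pos d = Suc (pos e)" "along d (pos e) = along e (pos e)"
    using pos_at[of e "Suc (pos e)"] at_at[of e "Suc (pos e)" "pos e"] assms by auto
  then show "0 < pos d \<and> along d (pos d - 1) = e" using at_pos assms by simp
next
  assume a: "0 < pos d \<and> along d (pos d - 1) = e"
  have p: "pos d \<le> len d" using pos_le assms by simp
  then have "pos e = pos d - 1" "len e = len d" "along e (pos d) = along d (pos d)"
    using pos_at[of d "pos d - 1"] len_at[of d "pos d - 1"] at_at[of d "pos d - 1" "pos d"] assms a by auto
  then show "pos e < len e \<and> along e (Suc (pos e)) = d" using at_pos assms a p by auto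
qed

lemma sum_of_bool_unique:
  fixes f :: "'d \<Rightarrow> cq"
  assumes "\<And>e. e \<in> D \<Longrightarrow> P e \<Longrightarrow> e = e0" "Q \<Longrightarrow> e0 \<in> D" "e0 \<in> D \<Longrightarrow> P e0 \<longleftrightarrow> Q"
  shows "(\<Sum>e\<in>D. f e * of_bool (P e)) = (if Q then f e0 else 0)"
proof (cases Q)
  case True
  then have e0: "e0 \<in> D" "P e0" using assms(2,3) by blast+
  have "(\<Sum>e\<in>D. f e * of_bool (P e)) = (\<Sum>e\<in>D. if e = e0 then f e0 else 0)"
  proof (rule sum.cong[OF refl])
    fix e assume "e \<in> D"
    then have "P e \<longleftrightarrow> e = e0" using assms(1) e0 by blast
    then show "f e * of_bool (P e) = (if e = e0 then f e0 else 0)" by simp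
  qed
  then show ?thesis using True e0 finite_D by simp
next
  case False
  have "\<not> P e" if "e \<in> D" for e
  proof
    assume "P e"
    then have "e = e0" by (rule assms(1)[OF that])
    then show False using \<open>P e\<close> that assms(3) False by blast
  qed
  then have "(\<Sum>e\<in>D. f e * of_bool (P e)) = 0" by (intro sum.neutral ballI) simp
  then show ?thesis using False by simp
qed

definition Te :: "'v \<Rightarrow> 'v" where
  "Te = extend (\<lambda>d. if pos d = 0 then \<zero>\<^bsub>V\<^esub> else y (along d (pos d - 1)))"

definition Tf :: "'v \<Rightarrow> 'v" where
  "Tf = extend (\<lambda>d. if pos d = len d then \<zero>\<^bsub>V\<^esub> else y (along d (Suc (pos d))))"

lemma prev_mem: "d \<in> D \<Longrightarrow> along d (pos d - 1) \<in> D"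
  using at_mem[of d "pos d - 1"] pos_le[of d] by simp

lemma next_mem: "d \<in> D \<Longrightarrow> pos d \<noteq> len d \<Longrightarrow> along d (Suc (pos d)) \<in> D"
  using at_mem[of d "Suc (pos d)"] pos_le[of d] by simp

lemma Te_mem: "(\<lambda>d. if pos d = 0 then \<zero>\<^bsub>V\<^esub> else y (along d (pos d - 1))) \<in> D \<rightarrow> carrier V"
  using z_mem prev_mem by auto

lemma Tf_mem: "(\<lambda>d. if pos d = len d then \<zero>\<^bsub>V\<^esub> else y (along d (Suc (pos d)))) \<in> D \<rightarrow> carrier V"
  using z_mem next_mem by auto

lemma co_Te:
  assumes "x \<in> carrier V" "d \<in> D"
  shows "co (Te x) d = (if pos d < len d then co x (along d (Suc (pos d))) else 0)"
proof -
  have "co (Te x) d = (\<Sum>e\<in>D. co x e * of_bool (0 < pos e \<and> along e (pos e - 1) = d))"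
    unfolding Te_def co_extend[OF Te_mem assms]
    by (intro sum.cong refl) (use assms prev_mem in \<open>auto simp: co_zero co_z\<close>)
  also have "\<dots> = (if pos d < len d then co x (along d (Suc (pos d))) else 0)"
  proof (rule sum_of_bool_unique)
    fix e assume e: "e \<in> D" "0 < pos e \<and> along e (pos e - 1) = d"
    then have "along d (Suc (pos d)) = e" using along_eq_iff[OF e(1) assms(2)] by blast
    then show "e = along d (Suc (pos d))" by simp
  next
    assume "pos d < len d"
    then show "along d (Suc (pos d)) \<in> D" using next_mem[OF assms(2)] by simp
  next
    assume m: "along d (Suc (pos d)) \<in> D"
    show "(0 < pos (along d (Suc (pos d))) \<and> along (along d (Suc (pos d))) (pos (along d (Suc (pos d))) - 1) = d) \<longleftrightarrow> pos d < len d"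
      using along_eq_iff[OF m assms(2)] by blast
  qed
  finally show ?thesis .
qed

lemma co_Tf:
  assumes "x \<in> carrier V" "d \<in> D"
  shows "co (Tf x) d = (if 0 < pos d then co x (along d (pos d - 1)) else 0)"
proof -
  have "co (Tf x) d = (\<Sum>e\<in>D. co x e * of_bool (pos e < len e \<and> along e (Suc (pos e)) = d))"
    unfolding Tf_def co_extend[OF Tf_mem assms]
    by (intro sum.cong refl) (use assms next_mem pos_le in \<open>force simp: co_zero co_z\<close>)
  also have "\<dots> = (if 0 < pos d then co x (along d (pos d - 1)) else 0)"
  proof (rule sum_of_bool_unique)
    fix e assume e: "e \<in> D" "pos e < len e \<and> along e (Suc (pos e)) = d"
    then have "along d (pos d - 1) = e" using along_eq_iff[OF assms(2) e(1)] by blast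
    then show "e = along d (pos d - 1)" by simp
  next
    show "along d (pos d - 1) \<in> D" by (rule prev_mem[OF assms(2)])
  next
    assume m: "along d (pos d - 1) \<in> D"
    show "(pos (along d (pos d - 1)) < len (along d (pos d - 1)) \<and> along (along d (pos d - 1)) (Suc (pos (along d (pos d - 1)))) = d) \<longleftrightarrow> 0 < pos d"
      using along_eq_iff[OF assms(2) m] by blast
  qed
  finally show ?thesis .
qed

text \<open>Distinct basis vectors have distinct predecessors, and E moves each to its predecessor
  with a nonzero quantum integer. A vector killed by E therefore has coordinates at the tops of
  strings only.\<close>

lemma E_zero_co:
  assumes "x \<in> carrier V" "E x = \<zero>\<^bsub>V\<^esub>" "d \<in> D" "pos d \<noteq> 0"
  shows "co x d = 0"
proof -
  let ?e = "along d (pos d - 1)"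
  have e: "?e \<in> D" by (rule prev_mem[OF assms(3)])
  have "0 = co (E x) ?e" using assms(2) co_zero[OF e] by simp
  also have "\<dots> = (\<Sum>c\<in>D. (qi (int (len c) - int (pos c) + 1) * co x c) * of_bool (0 < pos c \<and> along c (pos c - 1) = ?e))"
    unfolding co_linear[OF lin_E assms(1) e]
    by (intro sum.cong refl) (use e prev_mem z_mem in \<open>auto simp: E_y co_zero co_smult co_z\<close>)
  also have "\<dots> = (if True then qi (int (len d) - int (pos d) + 1) * co x d else 0)"
  proof (rule sum_of_bool_unique)
    fix c assume "c \<in> D" "0 < pos c \<and> along c (pos c - 1) = ?e"
    then show "c = d" using along_eq_iff[OF \<open>c \<in> D\<close> e] along_eq_iff[OF assms(3) e] assms(4) by blast
  qed (use assms in auto)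
  finally show ?thesis using qi_neq_0[of "int (len d) - int (pos d) + 1"] pos_le[OF assms(3)] by simp
qed

lemma dp_mem: assumes "x \<in> carrier V" shows "dp r x \<in> carrier V"
proof -
  have "(F ^^ r) x \<in> carrier V" using assms class_linearD(1)[OF lin_F] by (induct r) auto
  then show ?thesis by (simp add: divided_power_def)
qed

lemma lin_dp: "linear_map class_ring V V (dp r)"
proof -
  note L = class_linearD[OF lin_F]
  have m: "(F ^^ r) x \<in> carrier V" if "x \<in> carrier V" for x using that L(1) by (induct r) auto
  have a: "(F ^^ r) (x \<oplus>\<^bsub>V\<^esub> w) = (F ^^ r) x \<oplus>\<^bsub>V\<^esub> (F ^^ r) w" if "x \<in> carrier V" "w \<in> carrier V" for x w
  proof (induct r)
    case (Suc r)
    have "(F ^^ r) x \<in> carrier V" "(F ^^ r) w \<in> carrier V" using that L(1) by (induct r) auto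
    then show ?case using Suc L(2) by simp
  qed simp
  have s: "(F ^^ r) (c \<odot>\<^bsub>V\<^esub> x) = c \<odot>\<^bsub>V\<^esub> (F ^^ r) x" if "x \<in> carrier V" for c x
  proof (induct r)
    case (Suc r)
    have "(F ^^ r) x \<in> carrier V" using that L(1) by (induct r) auto
    then show ?case using Suc L(3) by simp
  qed simp
  show ?thesis
  proof (rule class_linearI[OF vs vs])
    fix x w assume "x \<in> carrier V" "w \<in> carrier V"
    then show "dp r (x \<oplus>\<^bsub>V\<^esub> w) = dp r x \<oplus>\<^bsub>V\<^esub> dp r w"
      by (intro co_eqI) (simp_all add: dp_mem, simp add: divided_power_def a m co_smult co_add distrib_left)
  next
    fix c x assume "x \<in> carrier V"
    then show "dp r (c \<odot>\<^bsub>V\<^esub> x) = c \<odot>\<^bsub>V\<^esub> dp r x"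
      by (intro co_eqI) (simp_all add: dp_mem, simp add: divided_power_def s m co_smult)
  qed (rule dp_mem)
qed

lemma dp_y:
  assumes "d \<in> D" "pos d = 0"
  shows "dp r (y d) = (if r \<le> len d then y (along d r) else \<zero>\<^bsub>V\<^esub>)"
proof -
  note L = class_linearD[OF lin_F]
  have qf: "qfact r \<noteq> 0" for r
    using qi_neq_0 by (auto simp: qfact_def qint_qi)
  have p: "(F ^^ r) (y d) = (if r \<le> len d then qfact r \<odot>\<^bsub>V\<^esub> y (along d r) else \<zero>\<^bsub>V\<^esub>)"
  proof (induct r)
    case 0
    show ?case using at_pos[OF assms(1)] assms by (intro co_eqI) (auto simp: z_mem co_smult qfact_def)
  next
    case (Suc r)
    show ?case
    proof (cases "r \<le> len d")
      case True
      note t = at_mem[OF assms(1) True] pos_at[OF assms(1) True] len_at[OF assms(1) True]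
      have q: "qfact (Suc r) = qfact r * qi (int r + 1)" by (simp add: qfact_def qint_qi add.commute)
      have "F (qfact r \<odot>\<^bsub>V\<^esub> y (along d r)) = qfact r \<odot>\<^bsub>V\<^esub> F (y (along d r))" using L(3) z_mem t by simp
      also have "\<dots> = (if Suc r \<le> len d then qfact (Suc r) \<odot>\<^bsub>V\<^esub> y (along d (Suc r)) else \<zero>\<^bsub>V\<^esub>)"
      proof (cases "r = len d")
        case True
        then show ?thesis using t F_y[of "along d r"] by (intro co_eqI) (auto simp: co_smult co_zero)
      next
        case False
        then have m: "along d (Suc r) \<in> D" and e: "along (along d r) (Suc r) = along d (Suc r)"
          using True at_mem[OF assms(1)] at_at[OF assms(1) True] by auto
        then show ?thesis using False True t F_y[of "along d r"] unfolding q
          by (intro co_eqI) (auto simp: co_smult z_mem mult.assoc)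
      qed
      finally show ?thesis using Suc True by simp
    qed (use Suc L(5) in auto)
  qed
  show ?thesis unfolding divided_power_def p using at_mem[OF assms(1), of r] qf[of r]
    by (intro co_eqI) (auto simp: co_smult co_zero z_mem)
qed

lemma co_dp:
  assumes "x \<in> carrier V" "E x = \<zero>\<^bsub>V\<^esub>" "e \<in> D"
  shows "co (dp r x) e = (if pos e = r then co x (along e 0) else 0)"
proof -
  have "co (dp r x) e = (\<Sum>d\<in>D. co x d * of_bool (pos d = 0 \<and> r \<le> len d \<and> along d r = e))"
    unfolding co_linear[OF lin_dp assms(1,3)]
  proof (intro sum.cong refl)
    fix d assume d: "d \<in> D"
    show "co x d * co (dp r (y d)) e = co x d * of_bool (pos d = 0 \<and> r \<le> len d \<and> along d r = e)"
      using E_zero_co[OF assms(1,2) d] d at_mem[OF d, of r] assms(3) by (cases "pos d = 0") (auto simp: dp_y co_zero co_z)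
  qed
  also have "\<dots> = (if pos e = r then co x (along e 0) else 0)"
  proof (rule sum_of_bool_unique)
    fix d assume d: "d \<in> D" "pos d = 0 \<and> r \<le> len d \<and> along d r = e"
    then show "d = along e 0" using at_at[of d r 0] at_pos[of d] by auto
  next
    show "along e 0 \<in> D" using at_mem[OF assms(3)] by simp
    have z: "pos (along e 0) = 0" "len (along e 0) = len e" "r \<le> len e \<Longrightarrow> along (along e 0) r = along e r"
      "r \<le> len e \<Longrightarrow> pos (along e r) = r"
      using pos_at[OF assms(3)] len_at[OF assms(3)] at_at[OF assms(3)] by auto
    show "(pos (along e 0) = 0 \<and> r \<le> len (along e 0) \<and> along (along e 0) r = e) \<longleftrightarrow> pos e = r"
      using z pos_le[OF assms(3)] at_pos[OF assms(3)] by auto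
  qed
  finally show ?thesis .
qed

text \<open>Since the divided power is nonzero, r is at most the length of some string met by x, and
  by \<open>wt_len\<close> all strings met by x have this length. So F^(r) has lost no part of x at
  the end of a shorter string, and the shift can go back one step.\<close>

lemma Te_dp:
  assumes x: "wt x" "E x = \<zero>\<^bsub>V\<^esub>" and n: "dp r x \<noteq> \<zero>\<^bsub>V\<^esub>"
  shows "Te (dp r x) = (if r = 0 then \<zero>\<^bsub>V\<^esub> else dp (r - 1) x)"
proof -
  note m = wt_mem[OF x(1)]
  obtain e' where e': "e' \<in> D" "pos e' = r" "co x (along e' 0) \<noteq> 0"
    using co_inj[OF dp_mem[OF m, of r]] n co_dp[OF m x(2)] by (metis (no_types, lifting))
  have L: "len e' = len e" if "e \<in> D" "co x (along e 0) \<noteq> 0" for e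
    using wt_len[OF x(1) at_mem[OF e'(1)] at_mem[OF that(1)] e'(3) that(2)] e'(1) that(1) by (simp add: pos_at len_at)
  show ?thesis
  proof (rule co_eqI)
    show "Te (dp r x) \<in> carrier V" unfolding Te_def by (rule extend_mem[OF Te_mem dp_mem[OF m]])
    show "(if r = 0 then \<zero>\<^bsub>V\<^esub> else dp (r - 1) x) \<in> carrier V" by (simp add: dp_mem m)
    fix e assume e: "e \<in> D"
    have n': "pos e < len e \<Longrightarrow> along e (Suc (pos e)) \<in> D" "pos e < len e \<Longrightarrow> pos (along e (Suc (pos e))) = Suc (pos e)"
      "pos e < len e \<Longrightarrow> along (along e (Suc (pos e))) 0 = along e 0"
      using e at_mem pos_at at_at by auto
    have "co (Te (dp r x)) e = (if pos e < len e \<and> Suc (pos e) = r then co x (along e 0) else 0)"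
    proof (cases "pos e < len e")
      case True
      show ?thesis unfolding co_Te[OF dp_mem[OF m] e] co_dp[OF m x(2) n'(1)[OF True]] n'(2,3)[OF True] using True by simp
    qed (simp add: co_Te[OF dp_mem[OF m] e])
    also have "\<dots> = co (if r = 0 then \<zero>\<^bsub>V\<^esub> else dp (r - 1) x) e"
    proof (cases "co x (along e 0) = 0")
      case True
      then show ?thesis by (simp add: co_dp[OF m x(2) e] co_zero[OF e])
    next
      case False
      then show ?thesis using L[OF e False] pos_le[OF e] pos_le[OF e'(1)] e'(2)
        by (auto simp: co_dp[OF m x(2) e] co_zero[OF e])
    qed
    finally show "co (Te (dp r x)) e = co (if r = 0 then \<zero>\<^bsub>V\<^esub> else dp (r - 1) x) e" .
  qed
qed

lemma Tf_dp:
  assumes x: "wt x" "E x = \<zero>\<^bsub>V\<^esub>"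
  shows "Tf (dp r x) = dp (r + 1) x"
proof (rule co_eqI)
  note m = wt_mem[OF x(1)]
  show "Tf (dp r x) \<in> carrier V" unfolding Tf_def by (rule extend_mem[OF Tf_mem dp_mem[OF m]])
  show "dp (r + 1) x \<in> carrier V" by (rule dp_mem[OF m])
  fix e assume e: "e \<in> D"
  have "0 < pos e \<Longrightarrow> pos (along e (pos e - 1)) = pos e - 1" "0 < pos e \<Longrightarrow> along (along e (pos e - 1)) 0 = along e 0"
    using e pos_at[of e "pos e - 1"] at_at[of e "pos e - 1" 0] pos_le[of e] by auto
  then show "co (Tf (dp r x)) e = co (dp (r + 1) x) e"
    using prev_mem[OF e] by (auto simp: co_Tf[OF dp_mem[OF m] e] co_dp[OF m x(2)] e)
qed

lemma string_decomposition_y: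
  assumes d: "d \<in> D"
  shows "string_decomposition wt V E F (y d) (\<lambda>r. if r = pos d then y (along d 0) else \<zero>\<^bsub>V\<^esub>)"
    and "{r. (if r = pos d then y (along d 0) else \<zero>\<^bsub>V\<^esub>) \<noteq> \<zero>\<^bsub>V\<^esub>} = {pos d}"
    and "dp r (y (along d 0)) = (if r \<le> len d then y (along d r) else \<zero>\<^bsub>V\<^esub>)"
proof -
  have a: "along d 0 \<in> D" "pos (along d 0) = 0" "len (along d 0) = len d" using at_mem[OF d] pos_at[OF d] len_at[OF d] by auto
  show dp: "dp r (y (along d 0)) = (if r \<le> len d then y (along d r) else \<zero>\<^bsub>V\<^esub>)" for r
    using dp_y[OF a(1,2)] a at_at[OF d, of 0 r] by simp
  show s: "{r. (if r = pos d then y (along d 0) else \<zero>\<^bsub>V\<^esub>) \<noteq> \<zero>\<^bsub>V\<^esub>} = {pos d}" using z_neq_0[OF a(1)] by auto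
  show "string_decomposition wt V E F (y d) (\<lambda>r. if r = pos d then y (along d 0) else \<zero>\<^bsub>V\<^esub>)"
    unfolding string_decomposition_def s
    using a d dp[of "pos d"] pos_le[OF d] at_pos[OF d] z_neq_0[OF d] wt_y[OF a(1)] wt_zero E_y[OF a(1)]
      class_linearD(5)[OF lin_E] z_mem[OF d]
    by auto
qed

text \<open>Existence: the shift is correct on every component of any string decomposition.
  Uniqueness: each basis vector has a decomposition with a single component, which forces the values
  of the operator on the basis.\<close>

lemma kashiwara_E_eq: "kashiwara_E wt V E F = Te"
proof -
  have lin: "linear_map class_ring V V Te" unfolding Te_def by (rule linear_extend[OF Te_mem])
  have ex: "linear_map class_ring V V Te \<and> Te \<in> extensional (carrier V) \<and>
    (\<forall>u us. wt u \<and> string_decomposition wt V E F u us \<longrightarrow>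
      Te u = (\<Oplus>\<^bsub>V\<^esub>r\<in>{r. r \<ge> 1 \<and> us r \<noteq> \<zero>\<^bsub>V\<^esub>}. divided_power V F (r - 1) (us r)))"
  proof (intro conjI allI impI lin)
    show "Te \<in> extensional (carrier V)" unfolding Te_def by (rule extensional_extend)
    fix u us assume "wt u \<and> string_decomposition wt V E F u us"
    then have us: "finite {r. us r \<noteq> \<zero>\<^bsub>V\<^esub>}" "\<And>r. wt (us r)" "\<And>r. E (us r) = \<zero>\<^bsub>V\<^esub>"
      "\<And>r. dp r (us r) = \<zero>\<^bsub>V\<^esub> \<Longrightarrow> us r = \<zero>\<^bsub>V\<^esub>" and u: "u = (\<Oplus>\<^bsub>V\<^esub>r\<in>{r. us r \<noteq> \<zero>\<^bsub>V\<^esub>}. dp r (us r))"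
      by (auto simp: string_decomposition_def)
    have m: "dp r (us r') \<in> carrier V" for r r' by (rule dp_mem[OF wt_mem[OF us(2)]])
    have "Te u = (\<Oplus>\<^bsub>V\<^esub>r\<in>{r. us r \<noteq> \<zero>\<^bsub>V\<^esub>}. Te (dp r (us r)))"
      unfolding u by (rule linear_finsum[OF lin us(1)]) (use m in auto)
    also have "\<dots> = (\<Oplus>\<^bsub>V\<^esub>r\<in>{r. us r \<noteq> \<zero>\<^bsub>V\<^esub>}. if r = 0 then \<zero>\<^bsub>V\<^esub> else dp (r - 1) (us r))"
    proof (rule V.finsum_cong'[OF refl])
      show "(\<lambda>r. if r = 0 then \<zero>\<^bsub>V\<^esub> else dp (r - 1) (us r)) \<in> {r. us r \<noteq> \<zero>\<^bsub>V\<^esub>} \<rightarrow> carrier V" using m by auto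
      fix r assume "r \<in> {r. us r \<noteq> \<zero>\<^bsub>V\<^esub>}"
      then have "dp r (us r) \<noteq> \<zero>\<^bsub>V\<^esub>" using us(4)[of r] by blast
      then show "Te (dp r (us r)) = (if r = 0 then \<zero>\<^bsub>V\<^esub> else dp (r - 1) (us r))" by (rule Te_dp[OF us(2,3)])
    qed
    also have "\<dots> = (\<Oplus>\<^bsub>V\<^esub>r\<in>{r. r \<ge> 1 \<and> us r \<noteq> \<zero>\<^bsub>V\<^esub>}. dp (r - 1) (us r))"
    proof (rule co_eqI)
      fix d assume d: "d \<in> D"
      have f: "finite {r. r \<ge> 1 \<and> us r \<noteq> \<zero>\<^bsub>V\<^esub>}" by (rule finite_subset[OF _ us(1)]) auto
      have "(\<Sum>r\<in>{r. us r \<noteq> \<zero>\<^bsub>V\<^esub>}. co (if r = 0 then \<zero>\<^bsub>V\<^esub> else dp (r - 1) (us r)) d) =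
          (\<Sum>r\<in>{r. r \<ge> 1 \<and> us r \<noteq> \<zero>\<^bsub>V\<^esub>}. co (dp (r - 1) (us r)) d)"
        by (rule sum.mono_neutral_cong_right[OF us(1)]) (use d co_zero in auto)
      then show "co (\<Oplus>\<^bsub>V\<^esub>r\<in>{r. us r \<noteq> \<zero>\<^bsub>V\<^esub>}. if r = 0 then \<zero>\<^bsub>V\<^esub> else dp (r - 1) (us r)) d =
          co (\<Oplus>\<^bsub>V\<^esub>r\<in>{r. r \<ge> 1 \<and> us r \<noteq> \<zero>\<^bsub>V\<^esub>}. dp (r - 1) (us r)) d"
        using m d by (subst (1 2) co_finsum) (auto simp: us(1) f)
    qed (use m in \<open>auto intro!: V.finsum_closed\<close>)
    finally show "Te u = (\<Oplus>\<^bsub>V\<^esub>r\<in>{r. r \<ge> 1 \<and> us r \<noteq> \<zero>\<^bsub>V\<^esub>}. dp (r - 1) (us r))" .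
  qed
  show ?thesis unfolding kashiwara_E_def
  proof (rule the_equality, rule ex)
  fix T assume T: "linear_map class_ring V V T \<and> T \<in> extensional (carrier V) \<and>
    (\<forall>u us. wt u \<and> string_decomposition wt V E F u us \<longrightarrow>
      T u = (\<Oplus>\<^bsub>V\<^esub>r\<in>{r. r \<ge> 1 \<and> us r \<noteq> \<zero>\<^bsub>V\<^esub>}. divided_power V F (r - 1) (us r)))"
  show "T = Te"
  proof (rule extensionalityI[of _ "carrier V"])
    show "T \<in> extensional (carrier V)" using T by blast
    show "Te \<in> extensional (carrier V)" unfolding Te_def by (rule extensional_extend)
    fix x assume x: "x \<in> carrier V"
    show "T x = Te x"
    proof (rule linear_eqI[OF conjunct1[OF T] lin _ x])
      fix d assume d: "d \<in> D"
      let ?us = "\<lambda>r. if r = pos d then y (along d 0) else \<zero>\<^bsub>V\<^esub>"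
      note S = string_decomposition_y[OF d]
      have 1: "T (y d) = (\<Oplus>\<^bsub>V\<^esub>r\<in>{r. r \<ge> 1 \<and> ?us r \<noteq> \<zero>\<^bsub>V\<^esub>}. dp (r - 1) (?us r))"
        using T S(1) wt_y[OF d] by blast
      have 2: "Te (y d) = (\<Oplus>\<^bsub>V\<^esub>r\<in>{r. r \<ge> 1 \<and> ?us r \<noteq> \<zero>\<^bsub>V\<^esub>}. dp (r - 1) (?us r))"
        using ex S(1) wt_y[OF d] by blast
      show "T (y d) = Te (y d)" unfolding 1 2 ..
    qed
  qed
  qed
qed

lemma kashiwara_F_eq: "kashiwara_F wt V E F = Tf"
proof -
  have lin: "linear_map class_ring V V Tf" unfolding Tf_def by (rule linear_extend[OF Tf_mem])
  have ex: "linear_map class_ring V V Tf \<and> Tf \<in> extensional (carrier V) \<and>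
    (\<forall>u us. wt u \<and> string_decomposition wt V E F u us \<longrightarrow>
      Tf u = (\<Oplus>\<^bsub>V\<^esub>r\<in>{r. us r \<noteq> \<zero>\<^bsub>V\<^esub>}. divided_power V F (r + 1) (us r)))"
  proof (intro conjI allI impI lin)
    show "Tf \<in> extensional (carrier V)" unfolding Tf_def by (rule extensional_extend)
    fix u us assume "wt u \<and> string_decomposition wt V E F u us"
    then have us: "finite {r. us r \<noteq> \<zero>\<^bsub>V\<^esub>}" "\<And>r. wt (us r)" "\<And>r. E (us r) = \<zero>\<^bsub>V\<^esub>"
      and u: "u = (\<Oplus>\<^bsub>V\<^esub>r\<in>{r. us r \<noteq> \<zero>\<^bsub>V\<^esub>}. dp r (us r))"
      by (auto simp: string_decomposition_def)
    have m: "dp r (us r') \<in> carrier V" for r r' by (rule dp_mem[OF wt_mem[OF us(2)]])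
    have "Tf u = (\<Oplus>\<^bsub>V\<^esub>r\<in>{r. us r \<noteq> \<zero>\<^bsub>V\<^esub>}. Tf (dp r (us r)))"
      unfolding u by (rule linear_finsum[OF lin us(1)]) (use m in auto)
    also have "\<dots> = (\<Oplus>\<^bsub>V\<^esub>r\<in>{r. us r \<noteq> \<zero>\<^bsub>V\<^esub>}. dp (r + 1) (us r))"
    proof (rule V.finsum_cong'[OF refl])
      show "(\<lambda>r. dp (r + 1) (us r)) \<in> {r. us r \<noteq> \<zero>\<^bsub>V\<^esub>} \<rightarrow> carrier V" using m by auto
      fix r assume "r \<in> {r. us r \<noteq> \<zero>\<^bsub>V\<^esub>}"
      show "Tf (dp r (us r)) = dp (r + 1) (us r)" by (rule Tf_dp[OF us(2,3)])
    qed
    finally show "Tf u = (\<Oplus>\<^bsub>V\<^esub>r\<in>{r. us r \<noteq> \<zero>\<^bsub>V\<^esub>}. dp (r + 1) (us r))" .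
  qed
  show ?thesis unfolding kashiwara_F_def
  proof (rule the_equality, rule ex)
  fix T assume T: "linear_map class_ring V V T \<and> T \<in> extensional (carrier V) \<and>
    (\<forall>u us. wt u \<and> string_decomposition wt V E F u us \<longrightarrow>
      T u = (\<Oplus>\<^bsub>V\<^esub>r\<in>{r. us r \<noteq> \<zero>\<^bsub>V\<^esub>}. divided_power V F (r + 1) (us r)))"
  show "T = Tf"
  proof (rule extensionalityI[of _ "carrier V"])
    show "T \<in> extensional (carrier V)" using T by blast
    show "Tf \<in> extensional (carrier V)" unfolding Tf_def by (rule extensional_extend)
    fix x assume x: "x \<in> carrier V"
    show "T x = Tf x"
    proof (rule linear_eqI[OF conjunct1[OF T] lin _ x])
      fix d assume d: "d \<in> D"
      let ?us = "\<lambda>r. if r = pos d then y (along d 0) else \<zero>\<^bsub>V\<^esub>"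
      note S = string_decomposition_y[OF d]
      have 1: "T (y d) = (\<Oplus>\<^bsub>V\<^esub>r\<in>{r. ?us r \<noteq> \<zero>\<^bsub>V\<^esub>}. dp (r + 1) (?us r))"
        using T S(1) wt_y[OF d] by blast
      have 2: "Tf (y d) = (\<Oplus>\<^bsub>V\<^esub>r\<in>{r. ?us r \<noteq> \<zero>\<^bsub>V\<^esub>}. dp (r + 1) (?us r))"
        using ex S(1) wt_y[OF d] by blast
      show "T (y d) = Tf (y d)" unfolding 1 2 ..
    qed
  qed
  qed
qed

text \<open>The vectors z d and y d have the same class modulo q and generate the same lattice, so
  the shifts permute the classes of the z d, up to zero, as they permute the strings.\<close>

lemma crystal_pair:
  assumes Z: "coords V D coz z"
    and A: "\<And>x. x \<in> carrier V \<Longrightarrow> (\<forall>d\<in>D. co x d \<in> \<A>) \<longleftrightarrow> (\<forall>d\<in>D. coz x d \<in> \<A>)"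
    and q: "\<And>x. x \<in> carrier V \<Longrightarrow> (\<forall>d\<in>D. co x d \<in> qideal) \<longleftrightarrow> (\<forall>d\<in>D. coz x d \<in> qideal)"
    and zy: "\<And>d d'. d \<in> D \<Longrightarrow> d' \<in> D \<Longrightarrow> co (z d) d' - of_bool (d' = d) \<in> qideal"
    and B: "B = z ` D"
  shows "let L = crystal_lattice V B; Et = kashiwara_E wt V E F; Ft = kashiwara_F wt V E F
      in Et ` L \<subseteq> L \<and> Ft ` L \<subseteq> L \<and>
         (\<forall>b\<in>B. \<exists>b'\<in>B \<union> {\<zero>\<^bsub>V\<^esub>}. cong_mod_q V L (Et b) b') \<and>
         (\<forall>b\<in>B. \<exists>b'\<in>B \<union> {\<zero>\<^bsub>V\<^esub>}. cong_mod_q V L (Ft b) b') \<and>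
         (\<forall>b\<in>B. \<forall>b'\<in>B. cong_mod_q V L (Et b) b' \<longleftrightarrow> cong_mod_q V L (Ft b') b)"
proof -
  interpret Z: coords V D coz z by (rule Z)
  define L where "L = crystal_lattice V B"
  have L: "L = {x \<in> carrier V. \<forall>d\<in>D. co x d \<in> \<A>}"
    unfolding L_def B Z.lattice_eq using A by auto
  have cong: "cong_mod_q V L x w \<longleftrightarrow> (\<forall>d\<in>D. co x d - co w d \<in> qideal)" if "x \<in> carrier V" "w \<in> carrier V" for x w
    using Z.cong_iff[OF that] q[of "x \<ominus>\<^bsub>V\<^esub> w"] that unfolding L_def B by (simp add: co_minus Z.co_minus)
  have Tm: "Te x \<in> carrier V" "Tf x \<in> carrier V" if "x \<in> carrier V" for x
    unfolding Te_def Tf_def using that by (simp_all add: extend_mem[OF Te_mem] extend_mem[OF Tf_mem])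
  \<comment> \<open>An arrow from e to d: d follows e on a string. Modulo q, \<open>Te\<close> goes
    against the arrows and \<open>Tf\<close> along them.\<close>
  define nx where "nx e d \<longleftrightarrow> pos e < len e \<and> along e (Suc (pos e)) = d" for e d
  have nx: "nx e d \<longleftrightarrow> 0 < pos d \<and> along d (pos d - 1) = e" if "e \<in> D" "d \<in> D" for e d
    unfolding nx_def by (rule along_eq_iff[OF that(2,1)])
  have ze: "co (Te (z d)) e - of_bool (nx e d) \<in> qideal" if "d \<in> D" "e \<in> D" for d e
    unfolding co_Te[OF Z.z_mem[OF that(1)] that(2)] nx_def
    using zy[OF that(1), of "along e (Suc (pos e))"] next_mem[OF that(2)] by auto
  have zf: "co (Tf (z d)) e - of_bool (nx d e) \<in> qideal" if "d \<in> D" "e \<in> D" for d e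
    unfolding co_Tf[OF Z.z_mem[OF that(1)] that(2)] nx[OF that]
    using zy[OF that(1), of "along e (pos e - 1)"] prev_mem[OF that(2)] by auto
  have tr: "a - b \<in> qideal \<longleftrightarrow> a' - b' \<in> qideal" if "a - a' \<in> qideal" "b - b' \<in> qideal" for a b a' b' :: cq
    using qideal_shift[of "a - b" "a' - b'"] qideal_diff[OF that] by (simp add: algebra_simps)
  have cE: "cong_mod_q V L (Te (z d)) (z d') \<longleftrightarrow> nx d' d" if "d \<in> D" "d' \<in> D" for d d'
  proof -
    have "cong_mod_q V L (Te (z d)) (z d') \<longleftrightarrow> (\<forall>e\<in>D. nx e d \<longleftrightarrow> e = d')"
      unfolding cong[OF Tm(1)[OF Z.z_mem[OF that(1)]] Z.z_mem[OF that(2)]]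
      by (intro ball_cong refl) (rule tr[OF ze[OF that(1)] zy[OF that(2)], unfolded of_bool_diff_qideal]; assumption)
    then show ?thesis using that nx by metis
  qed
  have cF: "cong_mod_q V L (Tf (z d)) (z d') \<longleftrightarrow> nx d d'" if "d \<in> D" "d' \<in> D" for d d'
  proof -
    have "cong_mod_q V L (Tf (z d)) (z d') \<longleftrightarrow> (\<forall>e\<in>D. nx d e \<longleftrightarrow> e = d')"
      unfolding cong[OF Tm(2)[OF Z.z_mem[OF that(1)]] Z.z_mem[OF that(2)]]
      by (intro ball_cong refl) (rule tr[OF zf[OF that(1)] zy[OF that(2)], unfolded of_bool_diff_qideal]; assumption)
    then show ?thesis using that nx_def by metis
  qed
  have "\<exists>b'\<in>B \<union> {\<zero>\<^bsub>V\<^esub>}. cong_mod_q V L (Te (z d)) b'" if d: "d \<in> D" for d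
  proof (cases "\<exists>d'\<in>D. nx d' d")
    case True
    then show ?thesis using cE[OF d] unfolding B by blast
  next
    case False
    have "cong_mod_q V L (Te (z d)) \<zero>\<^bsub>V\<^esub>"
      unfolding cong[OF Tm(1)[OF Z.z_mem[OF d]] V.zero_closed] using ze[OF d] False by (auto simp: co_zero)
    then show ?thesis by blast
  qed
  moreover have "\<exists>b'\<in>B \<union> {\<zero>\<^bsub>V\<^esub>}. cong_mod_q V L (Tf (z d)) b'" if d: "d \<in> D" for d
  proof (cases "\<exists>d'\<in>D. nx d d'")
    case True
    then show ?thesis using cF[OF d] unfolding B by blast
  next
    case False
    have "cong_mod_q V L (Tf (z d)) \<zero>\<^bsub>V\<^esub>"
      unfolding cong[OF Tm(2)[OF Z.z_mem[OF d]] V.zero_closed] using zf[OF d] False by (auto simp: co_zero)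
    then show ?thesis by blast
  qed
  moreover have "Te ` L \<subseteq> L" unfolding L using Tm next_mem by (auto simp: co_Te)
  moreover have "Tf ` L \<subseteq> L" unfolding L using Tm prev_mem by (auto simp: co_Tf)
  ultimately show ?thesis unfolding kashiwara_E_eq kashiwara_F_eq Let_def L_def[symmetric] using cE cF
    by (auto simp: B)
qed

end

subsection \<open>Sorted words\<close>

lemma nwords_unique:
  assumes w: "w \<in> nwords m n k" "w' \<in> nwords m n k" and e: "mset w = mset w'"
  shows "w = w'"
proof -
  \<comment> \<open>Numbers the letters in column order: row indices are at most m, so the base m +
    1 keeps the columns apart. Uniqueness then follows from that of sorted lists of numbers.\<close>
  define key where "key a = snd a * Suc m + fst a" for a :: letter
  have lt: "lt_letter b a \<longleftrightarrow> key b < key a" if a: "a \<in> letters m n" "b \<in> letters m n" for a b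
  proof -
    have 1: "key x < key y" if "snd x < snd y" "fst x \<le> m" for x y
    proof -
      have "key x < Suc (snd x) * Suc m" using that(2) by (simp add: key_def)
      also have "\<dots> \<le> snd y * Suc m" using that(1) by (intro mult_le_mono1) simp
      finally show ?thesis by (simp add: key_def)
    qed
    consider "snd b < snd a" | "snd a < snd b" | "snd a = snd b" by linarith
    then show ?thesis using 1[of a b] 1[of b a] a by cases (auto simp: lt_letter_def key_def letters_def)
  qed
  have s: "sorted (map key v)" if "v \<in> nwords m n k" for v
  proof -
    have v: "set v \<subseteq> letters m n" "sorted_wrt (\<lambda>x y. \<not> lt_letter y x) v" using that by (auto simp: nwords_def words_def)
    have "sorted_wrt (\<lambda>x y. key x \<le> key y) v"
    proof (rule sorted_wrt_mono_rel[OF _ v(2)])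
      fix x y assume a: "x \<in> set v" "y \<in> set v" "\<not> lt_letter y x"
      then have "x \<in> letters m n" "y \<in> letters m n" using v(1) by auto
      from lt[OF this] a(3) show "key x \<le> key y" by simp
    qed
    then show ?thesis by (simp add: sorted_map)
  qed
  have "mset (map key w) = mset (map key w')" by (simp add: e)
  then have "map key w = map key w'" using properties_for_sort s[OF w(1)] s[OF w(2)] by metis
  moreover have "inj_on key (set w \<union> set w')"
  proof (rule inj_onI)
    fix a b assume "a \<in> set w \<union> set w'" "b \<in> set w \<union> set w'" and k: "key a = key b"
    then have "a \<in> letters m n" "b \<in> letters m n" using w by (auto simp: nwords_def words_def)
    then have "\<not> lt_letter a b" "\<not> lt_letter b a" using lt k by auto
    then show "a = b" by (auto simp: lt_letter_def prod_eq_iff not_less)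
  qed
  ultimately show ?thesis by (rule map_inj_on)
qed

text \<open>The new letter passes smaller letters only if they form an antidiagonal pair with it,
  where \<open>al\<close> is 1 and \<open>be\<close> is 0. Hence neither a coefficient nor a second
  term arises.\<close>

lemma ZZ_insert:
  "s \<in> nwords m n k \<Longrightarrow> a \<in> letters m n \<Longrightarrow>
    \<forall>b\<in>set s. \<not> lt_letter b a \<or> fst a < fst b \<and> snd b < snd a \<Longrightarrow>
    \<exists>s'\<in>nwords m n (Suc k). mset s' = add_mset a (mset s) \<and> ZZ m n a (ket s) = ket s'"
proof (induct s arbitrary: k)
  case Nil
  then show ?case using length_nwords[OF Nil(1)]
    by (intro bexI[of _ "[a]"]) (auto simp: ZZ_ket_Cons nwords_Cons)
next
  case (Cons b s)
  obtain k' where k: "k = Suc k'" using length_nwords[OF Cons(2)] by (cases k) auto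
  note bs = Cons(2)[unfolded k nwords_Cons]
  show ?case
  proof (cases "lt_letter b a")
    case False
    then have "\<forall>x\<in>set (b # s). \<not> lt_letter x a" using bs by (auto simp: lt_letter_def)
    then show ?thesis using Cons(2,3) ZZ_ket_Cons[of "b # s" a m n k]
      by (intro bexI[of _ "a # b # s"]) (auto simp: nwords_Cons)
  next
    case True
    then have c: "fst a < fst b" "snd b < snd a" using Cons(4) by auto
    obtain s' where s': "s' \<in> nwords m n k" "mset s' = add_mset a (mset s)" "ZZ m n a (ket s) = ket s'"
      using Cons(1)[of k'] bs Cons(3,4) k by auto
    have "set s' = insert a (set s)" using arg_cong[OF s'(2), of set_mset] by simp
    then have n: "\<forall>x\<in>set s'. \<not> lt_letter x b" using bs c by (auto simp: lt_letter_def)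
    have "ZZ m n a (ket (b # s)) = ZZ m n b (ZZ m n a (ket s))"
      using ZZ_ket_rewrite[OF Cons(2)[unfolded k] True] c by (simp add: al_def be_def)
    also have "\<dots> = ket (b # s')" unfolding s'(3) by (rule ZZ_ket_Cons[OF n s'(1)])
    finally show ?thesis using s' n bs by (intro bexI[of _ "b # s'"]) (auto simp: nwords_Cons)
  qed
qed

lemma Zs_sort:
  "w \<in> words m n k \<Longrightarrow> sorted_wrt (\<lambda>a b. \<not> lt_letter b a \<or> fst a < fst b \<and> snd b < snd a) w \<Longrightarrow>
    \<exists>s\<in>nwords m n k. mset s = mset w \<and> Zs m n w (ket []) = ket s"
proof (induct w arbitrary: k)
  case Nil
  then show ?case by (intro bexI[of _ "[]"]) (auto simp: words_def nwords_Nil)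
next
  case (Cons a w)
  then obtain k' where k: "k = Suc k'" "a \<in> letters m n" "w \<in> words m n k'" by (auto simp: words_Cons)
  obtain s where s: "s \<in> nwords m n k'" "mset s = mset w" "Zs m n w (ket []) = ket s"
    using Cons(1)[OF k(3)] Cons(3) by auto
  have "set s = set w" using arg_cong[OF s(2), of set_mset] by simp
  then show ?case using ZZ_insert[OF s(1) k(2)] Cons(3) s k by auto
qed

lemma count_mset_concat: "count (mset (concat (map f xs))) a = (\<Sum>x\<leftarrow>xs. count (mset (f x)) a)"
  by (induct xs) auto

lemma sorted_wrt_concat:
  "(\<And>x. x \<in> set xs \<Longrightarrow> sorted_wrt R (f x)) \<Longrightarrow>
    sorted_wrt (\<lambda>x y. \<forall>a\<in>set (f x). \<forall>b\<in>set (f y). R a b) xs \<Longrightarrow> sorted_wrt R (concat (map f xs))"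
  by (induct xs) (auto simp: sorted_wrt_append)

lemma sum_list_upt: "(\<Sum>x\<leftarrow>[1..<Suc N]. if x = j then f x else 0) = (if j \<in> {1..N} then f j else (0 :: nat))"
proof -
  have "(\<Sum>x\<leftarrow>[1..<Suc N]. if x = j then f x else 0) = (\<Sum>x\<in>{1..N}. if x = j then f x else 0)"
    by (simp only: interv_sum_list_conv_sum_set_nat set_upt atLeastLessThanSuc_atLeastAtMost)
  then show ?thesis by simp
qed

lemma Zs_sum:
  "Zs m n w (\<lambda>v. \<Sum>i\<in>I. f i * g i v) = (\<lambda>v. \<Sum>i\<in>I. f i * Zs m n w (g i) v)"
  by (induct w) (simp_all add: ZZ_sum)

section \<open>Monomials with two neighbouring indices varying on each line\<close>

context grid
begin

definition gword :: "nat \<Rightarrow> nat \<Rightarrow> (letter \<Rightarrow> nat) \<Rightarrow> letter list" where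
  "gword N M e = concat (map (line_word N e) [1..<Suc M])"

text \<open>The parameter p is the entry at index i + 1, so p = 0 is the highest weight end of the
  line; the entry at i is fixed by the sum of the two.\<close>

definition cell_word :: "nat \<Rightarrow> nat \<Rightarrow> (letter \<Rightarrow> nat) \<Rightarrow> nat \<Rightarrow> nat \<Rightarrow> letter list" where
  "cell_word N i e y p = line_word N (e(mk i y := e (mk i y) + e (mk (Suc i) y) - p, mk (Suc i) y := p)) y"

fun cell_words :: "nat \<Rightarrow> nat \<Rightarrow> (letter \<Rightarrow> nat) \<Rightarrow> nat list \<Rightarrow> nat list \<Rightarrow> letter list" where
  "cell_words N i e (y # os) (p # ps) = cell_word N i e y p @ cell_words N i e os ps"
| "cell_words N i e _ _ = []"

definition cell_sums :: "nat \<Rightarrow> (letter \<Rightarrow> nat) \<Rightarrow> nat list \<Rightarrow> nat list" where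
  "cell_sums i e os = map (\<lambda>y. e (mk i y) + e (mk (Suc i) y)) os"

lemma cell_sums_simps [simp]: "cell_sums i e [] = []"
  "cell_sums i e (y # os) = (e (mk i y) + e (mk (Suc i) y)) # cell_sums i e os"
  by (simp_all add: cell_sums_def)

definition cells_upd :: "nat \<Rightarrow> (nat \<rightharpoonup> nat) \<Rightarrow> (letter \<Rightarrow> nat) \<Rightarrow> letter \<Rightarrow> nat" where
  "cells_upd i \<pi> e x = (case \<pi> (d x) of None \<Rightarrow> e x | Some p \<Rightarrow>
    if c x = i then e x + e (mk (Suc i) (d x)) - p else if c x = Suc i then p else e x)"

lemma line_word_cong: "(\<And>x. e (mk x y) = e' (mk x y)) \<Longrightarrow> line_word N e y = line_word N e' y"
  by (simp add: line_word_def)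

lemma cell_words_eq:
  assumes "distinct os" "length ps = length os"
  shows "concat (map (line_word N (cells_upd i (map_of (zip os ps)) e)) os) = cell_words N i e os ps"
proof -
  \<comment> \<open>The map is kept general while the lists shrink: it has to agree with the pairing
    of the remaining lists only on the remaining lines.\<close>
  have "concat (map (line_word N (cells_upd i \<pi> e)) os) = cell_words N i e os ps"
    if "length ps = length os" "distinct os" "\<And>y. y \<in> set os \<Longrightarrow> \<pi> y = map_of (zip os ps) y" for \<pi> os ps
    using that
  proof (induct ps os rule: list_induct2)
    case (Cons p ps y os)
    have "line_word N (cells_upd i \<pi> e) y = cell_word N i e y p"
      unfolding cell_word_def by (rule line_word_cong) (use Cons(4)[of y] in \<open>auto simp: cells_upd_def\<close>)
    moreover have "concat (map (line_word N (cells_upd i \<pi> e)) os) = cell_words N i e os ps"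
      by (rule Cons(2)) (use Cons(3,4) in auto)
    ultimately show ?case by simp
  qed simp
  then show ?thesis using assms by blast
qed

context
  fixes m n N i k0 :: nat and e :: "letter \<Rightarrow> nat" and u :: "letter list \<Rightarrow> cq"
  assumes i: "1 \<le> i" "i < N" and u: "degree_supp k0 u"
begin

lemma cell_word_split:
  obtains P S where "\<And>p. cell_word N i e y p = P @ replicate (e (mk i y) + e (mk (Suc i) y) - p) (mk i y) @ replicate p (mk (Suc i) y) @ S"
    "\<And>a. a \<in> set P \<union> set S \<Longrightarrow> c a \<noteq> i \<and> c a \<noteq> Suc i"
proof (rule line_word_split[OF i, where e = e and y = y])
  fix P S
  assume 1: "\<And>e'. (\<And>x. x \<noteq> i \<Longrightarrow> x \<noteq> Suc i \<Longrightarrow> e' (mk x y) = e (mk x y)) \<Longrightarrow>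
      line_word N e' y = P @ replicate (e' (mk i y)) (mk i y) @ replicate (e' (mk (Suc i) y)) (mk (Suc i) y) @ S"
    and 2: "\<And>a. a \<in> set P \<union> set S \<Longrightarrow> c a \<noteq> i \<and> c a \<noteq> Suc i"
  show thesis by (rule that[of P S]) (simp_all add: cell_word_def 1 2)
qed

lemma cell_word_char:
  obtains K where "\<And>p. p \<le> e (mk i y) + e (mk (Suc i) y) \<Longrightarrow>
    P.charw \<chi> (cell_word N i e y p) = K * (\<chi> i ^ (e (mk i y) + e (mk (Suc i) y) - p) * \<chi> (Suc i) ^ p)"
proof -
  obtain P S where PS: "\<And>p. cell_word N i e y p = P @ replicate (e (mk i y) + e (mk (Suc i) y) - p) (mk i y) @ replicate p (mk (Suc i) y) @ S"
    by (rule cell_word_split) (rule that; assumption)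
  show ?thesis by (rule that[of "P.charw \<chi> P * P.charw \<chi> S"]) (simp add: PS P.charw_append P.charw_replicate mult_ac)
qed

lemma charw_kp_cell_word:
  assumes "p \<le> e (mk i y) + e (mk (Suc i) y)"
  shows "P.charw (P.kp i) (cell_word N i e y p) = qq powi (int (e (mk i y) + e (mk (Suc i) y)) - 2 * int p)"
proof -
  obtain P S where PS: "\<And>p. cell_word N i e y p = P @ replicate (e (mk i y) + e (mk (Suc i) y) - p) (mk i y) @ replicate p (mk (Suc i) y) @ S"
    "\<And>a. a \<in> set P \<union> set S \<Longrightarrow> c a \<noteq> i \<and> c a \<noteq> Suc i"
    by (rule cell_word_split) (rule that; assumption)
  have k: "P.charw (P.kp i) P = 1" "P.charw (P.kp i) S = 1"
    using PS(2) by (induct P; auto) (use PS(2) in \<open>induct S; auto\<close>)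
  have "int (e (mk i y) + e (mk (Suc i) y)) - 2 * int p = int (e (mk i y) + e (mk (Suc i) y) - p) + (- int p)"
    using assms by simp
  then have "qq powi (int (e (mk i y) + e (mk (Suc i) y)) - 2 * int p) = qq ^ (e (mk i y) + e (mk (Suc i) y) - p) * inverse qq ^ p"
    by (simp only: power_int_add qq_neq_0 simp_thms power_int_of_nat power_int_minus power_inverse)
  then show ?thesis by (simp add: PS(1) P.charw_append P.charw_replicate k)
qed

text \<open>A character sees only how often i and i + 1 occur in total; the other letters contribute
  a constant that is the same on the whole box.\<close>

lemma cell_words_char:
  obtains K where "\<And>ps. ps \<in> box (cell_sums i e os) \<Longrightarrow>
    P.charw \<chi> (cell_words N i e os ps) = K * (\<chi> i ^ (sum_list (cell_sums i e os) - sum_list ps) * \<chi> (Suc i) ^ sum_list ps)"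
proof -
  have le: "sum_list ps \<le> sum_list C" if "ps \<in> box C" for ps C
    using that unfolding box_def by (simp add: sum_list_mono2 list_all2_conv_all_nth)
  have "\<exists>K. \<forall>ps\<in>box (cell_sums i e os). P.charw \<chi> (cell_words N i e os ps) =
      K * (\<chi> i ^ (sum_list (cell_sums i e os) - sum_list ps) * \<chi> (Suc i) ^ sum_list ps)"
  proof (induct os)
    case Nil
    show ?case by (intro exI[of _ 1]) (simp add: box_Nil)
  next
    case (Cons y os)
    obtain K where K: "\<forall>ps\<in>box (cell_sums i e os). P.charw \<chi> (cell_words N i e os ps) =
      K * (\<chi> i ^ (sum_list (cell_sums i e os) - sum_list ps) * \<chi> (Suc i) ^ sum_list ps)" using Cons by blast
    let ?A = "e (mk i y) + e (mk (Suc i) y)"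
    obtain K' where K': "\<And>p. p \<le> ?A \<Longrightarrow> P.charw \<chi> (cell_word N i e y p) = K' * (\<chi> i ^ (?A - p) * \<chi> (Suc i) ^ p)"
      using cell_word_char by blast
    show ?case
    proof (intro exI[of _ "K' * K"] ballI)
      fix x assume "x \<in> box (cell_sums i e (y # os))"
      then obtain p ps where x: "x = p # ps" "p \<le> ?A" "ps \<in> box (cell_sums i e os)" by (cases x) auto
      have "?A + sum_list (cell_sums i e os) - (p + sum_list ps) = (?A - p) + (sum_list (cell_sums i e os) - sum_list ps)"
        using x(2) le[OF x(3)] by simp
      then show "P.charw \<chi> (cell_words N i e (y # os) x) =
        K' * K * (\<chi> i ^ (sum_list (cell_sums i e (y # os)) - sum_list x) * \<chi> (Suc i) ^ sum_list x)"
        using K x(3) by (simp add: x(1) P.charw_append K'[OF x(2)] power_add mult_ac)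
    qed
  qed
  then show ?thesis using that by blast
qed

lemma charw_kp_cell_words:
  "ps \<in> box (cell_sums i e os) \<Longrightarrow> P.charw (P.kp i) (cell_words N i e os ps) = qq powi box_wt (cell_sums i e os) ps"
proof (induct os arbitrary: ps)
  case (Cons y os)
  let ?A = "e (mk i y) + e (mk (Suc i) y)"
  obtain p ps' where x: "ps = p # ps'" "p \<le> ?A" "ps' \<in> box (cell_sums i e os)" using Cons(2) by (cases ps) auto
  have "box_wt (cell_sums i e (y # os)) ps = (int ?A - 2 * int p) + box_wt (cell_sums i e os) ps'"
    by (simp add: box_wt_def x(1))
  then show ?case
    by (simp only: x(1) cell_words.simps P.charw_append charw_kp_cell_word[OF x(2)] Cons(1)[OF x(3)] power_int_add qq_neq_0 simp_thms)
qed (auto simp: box_wt_def dest: box_Nil[THEN equalityD1, THEN subsetD])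

lemma length_cell_words:
  obtains l where "\<And>ps. ps \<in> box (cell_sums i e os) \<Longrightarrow> length (cell_words N i e os ps) = l"
proof -
  have "\<exists>l. \<forall>ps\<in>box (cell_sums i e os). length (cell_words N i e os ps) = l"
  proof (induct os)
    case (Cons y os)
    then obtain l where l: "\<forall>ps\<in>box (cell_sums i e os). length (cell_words N i e os ps) = l" by blast
    let ?A = "e (mk i y) + e (mk (Suc i) y)"
    obtain P S where PS: "\<And>p. cell_word N i e y p = P @ replicate (?A - p) (mk i y) @ replicate p (mk (Suc i) y) @ S"
      by (rule cell_word_split) (rule that; assumption)
    show ?case
    proof (intro exI[of _ "length P + ?A + length S + l"] ballI)
      fix x assume "x \<in> box (cell_sums i e (y # os))"
      then obtain p ps where x: "x = p # ps" "p \<le> ?A" "ps \<in> box (cell_sums i e os)" by (cases x) auto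
      then show "length (cell_words N i e (y # os) x) = length P + ?A + length S + l" using l by (simp add: PS)
    qed
  qed (simp add: box_Nil)
  then show ?thesis using that by blast
qed

definition span_words :: "nat list \<Rightarrow> (nat list \<Rightarrow> cq) \<Rightarrow> letter list \<Rightarrow> cq" where
  "span_words os f v = (\<Sum>ps\<in>box (cell_sums i e os). f ps * Zs m n (cell_words N i e os ps) u v)"

lemma sum_box_Cons: "(\<Sum>ps\<in>box (A # C). h ps) = (\<Sum>p\<le>A. \<Sum>ps\<in>box C. (h (p # ps) :: cq))"
  unfolding box_Cons sum.cartesian_product by (subst sum.reindex) (auto simp: inj_on_def case_prod_unfold)

lemma span_words_Cons:
  "span_words (y # os) f v = (\<Sum>p\<le>e (mk i y) + e (mk (Suc i) y). Zs m n (cell_word N i e y p) (span_words os (\<lambda>ps. f (p # ps))) v)"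
  unfolding span_words_def[abs_def] cell_sums_simps sum_box_Cons Zs_sum by simp

lemma span_words_add: "span_words os (\<lambda>ps. f ps + g ps) v = span_words os f v + span_words os g v"
  by (simp add: span_words_def distrib_right sum.distrib)

lemma span_words_cmult: "span_words os (\<lambda>ps. a * f ps) v = a * span_words os f v"
  by (simp add: span_words_def sum_distrib_left mult.assoc)

lemma degree_supp_cell_words: "\<exists>k. degree_supp k (Zs m n (cell_words N i e os ps) u)"
  using degree_supp_Zs[OF u] by blast

context
  fixes ys :: "nat set"
  assumes comm: "\<And>y u k. y \<in> ys \<Longrightarrow> degree_supp k u \<Longrightarrow> ZZ m n (mk (Suc i) y) (ZZ m n (mk i y) u) =
      (\<lambda>v. qq * ZZ m n (mk i y) (ZZ m n (mk (Suc i) y) u) v)"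
begin

lemma EZ_cell_word:
  assumes "degree_supp k w" "y \<in> ys" "p \<le> e (mk i y) + e (mk (Suc i) y)"
  shows "P.EZ m n i (cell_word N i e y p) w = (\<lambda>v. qq powi (int p - int (e (mk i y) + e (mk (Suc i) y))) * qn p *
    Zs m n (cell_word N i e y (p - 1)) w v)"
proof (cases "p = 0")
  case True
  then show ?thesis unfolding cell_word_def by (subst EZ_line[OF comm[OF assms(2)] i assms(1)]) auto
next
  case False
  let ?A = "e (mk i y) + e (mk (Suc i) y)"
  have "raise i y (e(mk i y := ?A - p, mk (Suc i) y := p)) = e(mk i y := ?A - (p - 1), mk (Suc i) y := p - 1)"
    using False assms(3) by (auto simp: raise_def fun_eq_iff)
  then show ?thesis unfolding cell_word_def using assms(3)
    by (subst EZ_line[OF comm[OF assms(2)] i assms(1)]) (auto simp: of_nat_diff)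
qed

lemma FZ_cell_word:
  assumes "degree_supp k w" "y \<in> ys" "p \<le> e (mk i y) + e (mk (Suc i) y)"
  shows "P.FZ m n i (cell_word N i e y p) w = (\<lambda>v. qq powi (- int p) * qn (e (mk i y) + e (mk (Suc i) y) - p) *
    Zs m n (cell_word N i e y (Suc p)) w v)"
proof -
  let ?A = "e (mk i y) + e (mk (Suc i) y)"
  have "lower i y (e(mk i y := ?A - p, mk (Suc i) y := p)) = e(mk i y := ?A - Suc p, mk (Suc i) y := Suc p)"
    by (auto simp: lower_def fun_eq_iff)
  then show ?thesis unfolding cell_word_def
    by (subst FZ_line[OF comm[OF assms(2)] i assms(1)]) auto
qed

text \<open>Under the map \<open>span_words\<close> from coordinates to vectors, E_i becomes
  \<open>mE\<close>: it either acts on the first line, or on the remaining lines with q^(-h_i) on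
  the first.\<close>

lemma EZ_span:
  "set os \<subseteq> ys \<Longrightarrow> (\<Sum>ps\<in>box (cell_sums i e os). f ps * P.EZ m n i (cell_words N i e os ps) u v) =
    span_words os (mE (cell_sums i e os) f) v"
proof (induct os arbitrary: f v)
  case Nil
  show ?case by (simp add: span_words_def box_Nil)
next
  case (Cons y os)
  let ?A = "e (mk i y) + e (mk (Suc i) y)" and ?C = "cell_sums i e os"
  let ?Z = "\<lambda>p. Zs m n (cell_word N i e y p)"
  let ?h = "\<lambda>p. qq powi (int p - int ?A) * qn p * ?Z (p - 1) (span_words os (\<lambda>ps. f (p # ps))) v"
  let ?g = "\<lambda>p. qq powi (2 * int p - int ?A) * ?Z p (span_words os (mE ?C (\<lambda>ps. f (p # ps)))) v"
  have IH: "(\<lambda>v. \<Sum>ps\<in>box ?C. f (p # ps) * P.EZ m n i (cell_words N i e os ps) u v) = span_words os (mE ?C (\<lambda>ps. f (p # ps)))" for p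
    using Cons(1)[of "\<lambda>ps. f (p # ps)"] Cons(2) by (intro ext) simp
  have "(\<Sum>ps\<in>box (cell_sums i e (y # os)). f ps * P.EZ m n i (cell_words N i e (y # os) ps) u v) =
      (\<Sum>p\<le>?A. \<Sum>ps\<in>box ?C. f (p # ps) * P.EZ m n i (cell_word N i e y p @ cell_words N i e os ps) u v)"
    by (simp add: sum_box_Cons)
  also have "\<dots> = (\<Sum>p\<le>?A. ?h p + ?g p)"
  proof (intro sum.cong refl)
    fix p assume "p \<in> {..?A}"
    then have p: "p \<le> ?A" by simp
    have ch: "inverse (P.charw (P.kp i) (cell_word N i e y p)) = qq powi (2 * int p - int ?A)"
      unfolding charw_kp_cell_word[OF p] power_int_minus[symmetric] by simp
    have E1: "P.EZ m n i (cell_word N i e y p) (Zs m n (cell_words N i e os ps) u) v =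
        qq powi (int p - int ?A) * qn p * ?Z (p - 1) (Zs m n (cell_words N i e os ps) u) v" for ps
    proof -
      obtain k where "degree_supp k (Zs m n (cell_words N i e os ps) u)" using degree_supp_cell_words by blast
      from EZ_cell_word[OF this _ p] show ?thesis using Cons(2) by simp
    qed
    have "(\<Sum>ps\<in>box ?C. f (p # ps) * P.EZ m n i (cell_word N i e y p @ cell_words N i e os ps) u v) =
      qq powi (int p - int ?A) * qn p * (\<Sum>ps\<in>box ?C. f (p # ps) * ?Z (p - 1) (Zs m n (cell_words N i e os ps) u) v) +
      qq powi (2 * int p - int ?A) * (\<Sum>ps\<in>box ?C. f (p # ps) * ?Z p (P.EZ m n i (cell_words N i e os ps) u) v)"
      unfolding P.EZ_append E1 ch sum_distrib_left distrib_left sum.distrib by (simp only: mult_ac)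
    also have "(\<Sum>ps\<in>box ?C. f (p # ps) * ?Z (p - 1) (Zs m n (cell_words N i e os ps) u) v) = ?Z (p - 1) (span_words os (\<lambda>ps. f (p # ps))) v"
      unfolding span_words_def[abs_def] Zs_sum ..
    also have "(\<Sum>ps\<in>box ?C. f (p # ps) * ?Z p (P.EZ m n i (cell_words N i e os ps) u) v) =
        ?Z p (span_words os (mE ?C (\<lambda>ps. f (p # ps)))) v"
      unfolding IH[symmetric] Zs_sum ..
    finally show "(\<Sum>ps\<in>box ?C. f (p # ps) * P.EZ m n i (cell_word N i e y p @ cell_words N i e os ps) u v) = ?h p + ?g p" .
  qed
  also have "\<dots> = (\<Sum>p\<le>?A. ?h p) + (\<Sum>p\<le>?A. ?g p)" by (rule sum.distrib)
  \<comment> \<open>The summand p = 0 drops out because of \<open>qn 0\<close>, so the sum can be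
    indexed by the entry after the action.\<close>
  also have "(\<Sum>p\<le>?A. ?h p) = (\<Sum>p<?A. ?h (Suc p))" unfolding sum.atMost_shift by simp
  also have "\<dots> = (\<Sum>p\<le>?A. if p < ?A then ?h (Suc p) else 0)" by (simp flip: lessThan_Suc_atMost)
  also have "\<dots> + (\<Sum>p\<le>?A. ?g p) = (\<Sum>p\<le>?A. ?Z p (span_words os (\<lambda>ps. mE (?A # ?C) f (p # ps))) v)"
    unfolding sum.distrib[symmetric]
  proof (intro sum.cong refl)
    fix p
    have "span_words os (\<lambda>ps. mE (?A # ?C) f (p # ps)) = (\<lambda>v. (if p < ?A then qq powi (1 + int p - int ?A) * qn (Suc p) else 0) *
        span_words os (\<lambda>ps. f (Suc p # ps)) v + qq powi (2 * int p - int ?A) * span_words os (mE ?C (\<lambda>ps. f (p # ps))) v)"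
      unfolding span_words_cmult[symmetric] span_words_add[symmetric]
      by (intro ext arg_cong2[where f = "span_words os"] refl) auto
    then show "(if p < ?A then ?h (Suc p) else 0) + ?g p = ?Z p (span_words os (\<lambda>ps. mE (?A # ?C) f (p # ps))) v"
      by (simp add: Zs_add Zs_cmult)
  qed
  finally show ?case unfolding span_words_Cons cell_sums_simps .
qed

lemma FZ_span:
  "set os \<subseteq> ys \<Longrightarrow> (\<Sum>ps\<in>box (cell_sums i e os). f ps * P.FZ m n i (cell_words N i e os ps) u v) =
    span_words os (mF (cell_sums i e os) f) v"
proof (induct os arbitrary: f v)
  case Nil
  show ?case by (simp add: span_words_def box_Nil)
next
  case (Cons y os)
  let ?A = "e (mk i y) + e (mk (Suc i) y)" and ?C = "cell_sums i e os"
  let ?Z = "\<lambda>p. Zs m n (cell_word N i e y p)"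
  \<comment> \<open>When F_i acts on the first line, q^(h_i) acts on all later ones; their weight
    depends on ps and is absorbed into the coefficients.\<close>
  let ?f = "\<lambda>p ps. qq powi box_wt ?C ps * f (p # ps)"
  let ?h = "\<lambda>p. qq powi (- int p) * qn (?A - p) * ?Z (Suc p) (span_words os (?f p)) v"
  let ?g = "\<lambda>p. ?Z p (span_words os (mF ?C (\<lambda>ps. f (p # ps)))) v"
  have IH: "(\<lambda>v. \<Sum>ps\<in>box ?C. f (p # ps) * P.FZ m n i (cell_words N i e os ps) u v) = span_words os (mF ?C (\<lambda>ps. f (p # ps)))" for p
    using Cons(1)[of "\<lambda>ps. f (p # ps)"] Cons(2) by (intro ext) simp
  have "(\<Sum>ps\<in>box (cell_sums i e (y # os)). f ps * P.FZ m n i (cell_words N i e (y # os) ps) u v) =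
      (\<Sum>p\<le>?A. \<Sum>ps\<in>box ?C. f (p # ps) * P.FZ m n i (cell_word N i e y p @ cell_words N i e os ps) u v)"
    by (simp add: sum_box_Cons)
  also have "\<dots> = (\<Sum>p\<le>?A. ?h p + ?g p)"
  proof (intro sum.cong refl)
    fix p assume "p \<in> {..?A}"
    then have p: "p \<le> ?A" by simp
    have E1: "P.FZ m n i (cell_word N i e y p) (Zs m n (cell_words N i e os ps) u) v =
        qq powi (- int p) * qn (?A - p) * ?Z (Suc p) (Zs m n (cell_words N i e os ps) u) v" for ps
    proof -
      obtain k where "degree_supp k (Zs m n (cell_words N i e os ps) u)" using degree_supp_cell_words by blast
      from FZ_cell_word[OF this _ p] show ?thesis using Cons(2) by simp
    qed
    have "(\<Sum>ps\<in>box ?C. f (p # ps) * P.FZ m n i (cell_word N i e y p @ cell_words N i e os ps) u v) =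
      (\<Sum>ps\<in>box ?C. qq powi (- int p) * qn (?A - p) * (?f p ps * ?Z (Suc p) (Zs m n (cell_words N i e os ps) u) v) +
        f (p # ps) * ?Z p (P.FZ m n i (cell_words N i e os ps) u) v)"
      by (intro sum.cong refl) (simp add: P.FZ_append E1 charw_kp_cell_words algebra_simps)
    also have "\<dots> = qq powi (- int p) * qn (?A - p) * (\<Sum>ps\<in>box ?C. ?f p ps * ?Z (Suc p) (Zs m n (cell_words N i e os ps) u) v) +
      (\<Sum>ps\<in>box ?C. f (p # ps) * ?Z p (P.FZ m n i (cell_words N i e os ps) u) v)"
      unfolding sum.distrib sum_distrib_left ..
    also have "(\<Sum>ps\<in>box ?C. ?f p ps * ?Z (Suc p) (Zs m n (cell_words N i e os ps) u) v) = ?Z (Suc p) (span_words os (?f p)) v"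
      unfolding span_words_def[abs_def] Zs_sum ..
    also have "(\<Sum>ps\<in>box ?C. f (p # ps) * ?Z p (P.FZ m n i (cell_words N i e os ps) u) v) = ?g p"
      unfolding IH[symmetric] Zs_sum ..
    finally show "(\<Sum>ps\<in>box ?C. f (p # ps) * P.FZ m n i (cell_word N i e y p @ cell_words N i e os ps) u v) = ?h p + ?g p" .
  qed
  also have "\<dots> = (\<Sum>p\<le>?A. ?h p) + (\<Sum>p\<le>?A. ?g p)" by (rule sum.distrib)
  also have "(\<Sum>p\<le>?A. ?h p) = (\<Sum>p<?A. ?h p)" by (simp flip: lessThan_Suc_atMost)
  also have "\<dots> = (\<Sum>p\<le>?A. if 0 < p then ?h (p - 1) else 0)" unfolding sum.atMost_shift by simp
  also have "\<dots> + (\<Sum>p\<le>?A. ?g p) = (\<Sum>p\<le>?A. ?Z p (span_words os (\<lambda>ps. mF (?A # ?C) f (p # ps))) v)"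
    unfolding sum.distrib[symmetric]
  proof (intro sum.cong refl)
    fix p assume "p \<in> {..?A}"
    then have p: "0 < p \<Longrightarrow> ?A - (p - 1) = Suc (?A - p)" by auto
    have q: "0 < p \<Longrightarrow> qq powi (box_wt ?C ps + 1 - int p) = qq powi (- int (p - 1)) * qq powi box_wt ?C ps" for ps
      by (simp add: power_int_add[symmetric] of_nat_diff algebra_simps)
    have "span_words os (\<lambda>ps. mF (?A # ?C) f (p # ps)) = (\<lambda>v. (if 0 < p then qq powi (- int (p - 1)) * qn (Suc (?A - p)) else 0) *
        span_words os (?f (p - 1)) v + span_words os (mF ?C (\<lambda>ps. f (p # ps))) v)"
      unfolding span_words_cmult[symmetric] span_words_add[symmetric]
      by (intro ext arg_cong2[where f = "span_words os"] refl) (auto simp: q mult_ac)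
    then show "(if 0 < p then ?h (p - 1) else 0) + ?g p = ?Z p (span_words os (\<lambda>ps. mF (?A # ?C) f (p # ps))) v"
      using p by (simp add: Zs_add Zs_cmult)
  qed
  finally show ?case unfolding span_words_Cons cell_sums_simps .
qed

lemmas EZ_span_sum = EZ_span[unfolded span_words_def] and FZ_span_sum = FZ_span[unfolded span_words_def]

end

end

end

section \<open>Monomials in either order of the letters\<close>

lemma nf_sum: "nf m n k (\<lambda>w. \<Sum>i\<in>I. f i * g i w) = (\<lambda>v. \<Sum>i\<in>I. f i * nf m n k (g i) v)"
  by (induct I rule: infinite_finite_induct) (simp_all add: nf_add nf_cmult)

lemma degree_supp_Nil: "degree_supp 0 (ket [])"
  by (simp add: degree_supp_def ket_def)

context coordinate
begin

lemma opE_sum: "opE i w (\<lambda>v. \<Sum>j\<in>J. f j * g j v) = (\<Sum>j\<in>J. f j * opE i w (g j))"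
  by (induct J rule: infinite_finite_induct) (simp_all add: opE_add opE_cmult)

lemma opF_sum: "opF i w (\<lambda>v. \<Sum>j\<in>J. f j * g j v) = (\<Sum>j\<in>J. f j * opF i w (g j))"
  by (induct J rule: infinite_finite_induct) (simp_all add: opF_add opF_cmult)

lemma charw_qx_power: "\<exists>a. charw (qx i) w = qq powi a"
proof (induct w)
  case Nil
  show ?case by (rule exI[of _ 0]) simp
next
  case (Cons b w)
  then obtain a where "charw (qx i) w = qq powi a" by blast
  moreover have "qx i (c b) = qq powi of_bool (c b = i)" by (simp add: qx_def)
  ultimately show ?case by (intro exI[of _ "of_bool (c b = i) + a"]) (simp add: power_int_add)
qed

lemma charw_const: "(\<And>a. a \<in> set w \<Longrightarrow> c a = y) \<Longrightarrow> charw \<chi> w = \<chi> y ^ length w"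
  by (induct w) auto

end

text \<open>Lines are indexed by d up to M, and c runs up to N along each line. Taking columns as
  lines gives the order of z^d, taking rows as lines the order suited to the other action.\<close>

locale letter_grid = grid c mv d dmv mk
  for c mv d dmv mk +
  fixes m n N M :: nat
  assumes mk_cd: "mk (c a) (d a) = a"
    and letters_iff: "a \<in> letters m n \<longleftrightarrow> c a \<in> {1..N} \<and> d a \<in> {1..M}"
begin

abbreviation gw where "gw \<equiv> gword N M"

lemma mk_eq: "mk x y = a \<longleftrightarrow> x = c a \<and> y = d a"
  using mk_cd by (metis mk_simps(1,2))

lemma eq_mk: "a = mk x y \<longleftrightarrow> x = c a \<and> y = d a"
  using mk_eq[of x y a] by auto

lemma count_line_word: "count (mset (line_word N e y)) a = (if y = d a \<and> c a \<in> {1..N} then e a else 0)"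
proof -
  have "count (mset (line_word N e y)) a = (\<Sum>x\<leftarrow>[1..<Suc N]. if x = c a then (if y = d a then e (mk x y) else 0) else 0)"
    unfolding line_word_def count_mset_concat by (rule arg_cong[where f = sum_list], rule map_cong) (auto simp: mk_eq eq_mk mk_cd)
  also have "\<dots> = (if c a \<in> {1..N} then (if y = d a then e (mk (c a) y) else 0) else 0)" by (rule sum_list_upt)
  finally show ?thesis by (auto simp: mk_cd)
qed

lemma count_gw: "count (mset (gw e)) a = (if a \<in> letters m n then e a else 0)"
proof -
  have "count (mset (gw e)) a = (\<Sum>y\<leftarrow>[1..<Suc M]. if y = d a then (if c a \<in> {1..N} then e a else 0) else 0)"
    unfolding gword_def count_mset_concat by (rule arg_cong[where f = sum_list], rule map_cong) (auto simp: count_line_word)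
  also have "\<dots> = (if d a \<in> {1..M} then (if c a \<in> {1..N} then e a else 0) else 0)" by (rule sum_list_upt)
  finally show ?thesis by (auto simp: letters_iff)
qed

lemma set_gw: "set (gw e) \<subseteq> letters m n"
proof
  fix a assume "a \<in> set (gw e)"
  then have "count (mset (gw e)) a \<noteq> 0" by (simp add: count_mset_0_iff)
  then show "a \<in> letters m n" unfolding count_gw by (cases "a \<in> letters m n") auto
qed

lemma length_gw: "length (gw e) = (\<Sum>a\<in>letters m n. e a)"
proof -
  have "length (gw e) = (\<Sum>a\<in>set (gw e). count (mset (gw e)) a)"
    using size_multiset_overloaded_eq[of "mset (gw e)"] by simp
  also have "\<dots> = (\<Sum>a\<in>letters m n. count (mset (gw e)) a)"
    by (rule sum.mono_neutral_left) (use set_gw in \<open>auto simp: count_mset_0_iff\<close>)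
  also have "\<dots> = (\<Sum>a\<in>letters m n. e a)" by (intro sum.cong refl) (simp add: count_gw)
  finally show ?thesis .
qed

lemma gw_words: "e \<in> exponent_matrices m n k \<Longrightarrow> gw e \<in> words m n k"
  using set_gw[of e] length_gw[of e] by (simp add: words_def exponent_matrices_def)

lemma sorted_gw: "sorted_wrt (\<lambda>a b. d a < d b \<or> d a = d b \<and> c a \<le> c b) (gw e)"
proof -
  have in_line: "a \<in> set (line_word N e y) \<Longrightarrow> d a = y" for a y by (auto simp: line_word_def)
  show ?thesis unfolding gword_def
  proof (rule sorted_wrt_concat)
    fix y
    show "sorted_wrt (\<lambda>a b. d a < d b \<or> d a = d b \<and> c a \<le> c b) (line_word N e y)" unfolding line_word_def
    proof (rule sorted_wrt_concat)
      show "sorted_wrt (\<lambda>x x'. \<forall>a\<in>set (replicate (e (mk x y)) (mk x y)). \<forall>b\<in>set (replicate (e (mk x' y)) (mk x' y)).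
          d a < d b \<or> d a = d b \<and> c a \<le> c b) [1..<Suc N]"
        by (rule sorted_wrt_mono_rel[OF _ sorted_wrt_upt]) auto
    qed (auto simp: sorted_wrt_iff_nth_less)
  next
    show "sorted_wrt (\<lambda>y y'. \<forall>a\<in>set (line_word N e y). \<forall>b\<in>set (line_word N e y'). d a < d b \<or> d a = d b \<and> c a \<le> c b) [1..<Suc M]"
      by (rule sorted_wrt_mono_rel[OF _ sorted_wrt_upt]) (use in_line in auto)
  qed
qed

end

interpretation LG: letter_grid fst "\<lambda>i a. (i, snd a)" snd "\<lambda>j a. (fst a, j)" "\<lambda>x y. (x, y)" m n m n for m n
  by unfold_locales (auto simp: letters_def)

interpretation RG: letter_grid snd "\<lambda>j a. (fst a, j)" fst "\<lambda>i a. (i, snd a)" "\<lambda>x y. (y, x)" m n n m for m n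
  by unfold_locales (auto simp: letters_def)

lemma z_word_gword: "z_word m n e = LR.gword m n e"
  by (simp only: z_word_def LR.gword_def LR.line_word_def[abs_def])

lemma z_word_nwords: "e \<in> exponent_matrices m n k \<Longrightarrow> z_word m n e \<in> nwords m n k"
  using LG.gw_words[of e m n k] LG.sorted_gw[of m n e] unfolding z_word_gword nwords_def
  by (auto elim!: sorted_wrt_mono_rel[rotated] simp: lt_letter_def)

lemma z_word_unique:
  assumes "w \<in> nwords m n k"
  shows "count (mset w) \<in> exponent_matrices m n k" "z_word m n (count (mset w)) = w"
proof -
  have w: "set w \<subseteq> letters m n" "length w = k" using assms by (auto simp: nwords_def words_def)
  have "k = (\<Sum>a\<in>set w. count (mset w) a)" using size_multiset_overloaded_eq[of "mset w"] w(2) by simp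
  also have "\<dots> = (\<Sum>a\<in>letters m n. count (mset w) a)"
    by (rule sum.mono_neutral_left) (use w(1) in \<open>auto simp: count_mset_0_iff\<close>)
  finally show e: "count (mset w) \<in> exponent_matrices m n k"
    using w(1) by (auto simp: exponent_matrices_def count_mset_0_iff)
  have "mset (z_word m n (count (mset w))) = mset w"
    unfolding z_word_gword by (rule multiset_eqI) (use w(1) in \<open>auto simp: LG.count_gw count_mset_0_iff\<close>)
  then show "z_word m n (count (mset w)) = w" by (rule nwords_unique[OF z_word_nwords[OF e] assms])
qed

lemma count_z_word: "e \<in> exponent_matrices m n k \<Longrightarrow> count (mset (z_word m n e)) = e"
  unfolding z_word_gword by (rule ext) (auto simp: LG.count_gw exponent_matrices_def)

lemma finite_exponent_matrices: "finite (exponent_matrices m n k)"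
proof (rule finite_subset)
  show "exponent_matrices m n k \<subseteq> (\<lambda>w. count (mset w)) ` nwords m n k"
    using count_z_word z_word_nwords by (auto simp: image_iff) metis
qed simp

subsection \<open>Coordinates on \<open>S\<^sub>k(X)\<close>\<close>

text \<open>The choice of a representative does not matter, because the normal form is constant on
  cosets; e stands for the sorted word of z^e.\<close>

definition co_S :: "nat \<Rightarrow> nat \<Rightarrow> nat \<Rightarrow> (letter list \<Rightarrow> cq) set \<Rightarrow> (letter \<Rightarrow> nat) \<Rightarrow> cq" where
  "co_S m n k X e = nf m n k (SOME u. u \<in> carrier (tensor_space m n k) \<and> rel_submodule m n k +>\<^bsub>tensor_space m n k\<^esub> u = X) (z_word m n e)"

context
  fixes m n k :: nat
  assumes mn: "m \<ge> 1" "n \<ge> 1"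
begin

interpretation Q: quotient "tensor_space m n k" "rel_submodule m n k"
  by (rule quotient.intro[OF vectorspace_tensor rel_subspace[OF mn]])

lemma pr_eq_nf:
  assumes "u \<in> carrier (tensor_space m n k)" "u' \<in> carrier (tensor_space m n k)"
  shows "Q.pr u = Q.pr u' \<longleftrightarrow> nf m n k u = nf m n k u'"
proof -
  have e: "u \<ominus>\<^bsub>tensor_space m n k\<^esub> u' = (\<lambda>w. u w + (- 1) * u' w)" using assms by (simp add: tensor_minus)
  have "(\<lambda>w. u w + (- 1) * u' w) \<in> carrier (tensor_space m n k)" using assms by (auto simp: tensor_carrier)
  from R_iff[OF mn this] show ?thesis
    unfolding Q.pr_eq_iff[OF assms] e nf_add nf_cmult by (auto simp: fun_eq_iff)
qed

lemma co_pr: "u \<in> carrier (tensor_space m n k) \<Longrightarrow> co_S m n k (Q.pr u) e = nf m n k u (z_word m n e)"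
proof -
  assume u: "u \<in> carrier (tensor_space m n k)"
  let ?P = "\<lambda>v. v \<in> carrier (tensor_space m n k) \<and> Q.pr v = Q.pr u"
  have "?P (SOME v. ?P v)" by (rule someI[of ?P u]) (simp add: u)
  then have "nf m n k (SOME v. ?P v) = nf m n k u" using pr_eq_nf u by blast
  then show ?thesis by (simp add: co_S_def)
qed

lemma pr_add: "u \<in> carrier (tensor_space m n k) \<Longrightarrow> v \<in> carrier (tensor_space m n k) \<Longrightarrow>
    Q.pr u \<oplus>\<^bsub>S_space m n k\<^esub> Q.pr v = Q.pr (\<lambda>w. u w + v w)"
  unfolding S_space_def by (simp add: Q.Q_add)

lemma pr_smult: "u \<in> carrier (tensor_space m n k) \<Longrightarrow> a \<odot>\<^bsub>S_space m n k\<^esub> Q.pr u = Q.pr (\<lambda>w. a * u w)"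
  unfolding S_space_def by (simp add: Q.Q_smult)

lemma carrier_S: "carrier (S_space m n k) = Q.pr ` carrier (tensor_space m n k)"
  unfolding S_space_def by (rule Q.carrier_Q)

lemma ket_z_word: "e \<in> exponent_matrices m n k \<Longrightarrow> ket (z_word m n e) \<in> carrier (tensor_space m n k)"
  using z_word_nwords[of e m n k] by (auto simp: tensor_carrier ket_def nwords_def)

lemma nf_ket_z_word:
  assumes "e \<in> exponent_matrices m n k"
  shows "nf m n k (ket (z_word m n e)) = ket (z_word m n e)"
  using nf_ket[of "z_word m n e" m n k] Zs_ket_nword[of "z_word m n e" m n k] z_word_nwords[OF assms] by (auto simp: nwords_def)

text \<open>Coordinates separate points because the normal form vanishes exactly on the relations
  and sorted words correspond to matrices. They are dual to the monomials because sorted words are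
  their own normal forms.\<close>

lemma coords_S: "coords (S_space m n k) (exponent_matrices m n k) (co_S m n k) (z_monomial m n k)"
proof (rule coords.intro)
  show "vectorspace class_ring (S_space m n k)" unfolding S_space_def by (rule Q.vectorspace_Q)
  show "finite (exponent_matrices m n k)" by (rule finite_exponent_matrices)
next
  fix X Y e assume "X \<in> carrier (S_space m n k)" "Y \<in> carrier (S_space m n k)"
  then obtain u v where u: "u \<in> carrier (tensor_space m n k)" "X = Q.pr u" and v: "v \<in> carrier (tensor_space m n k)" "Y = Q.pr v"
    by (auto simp: carrier_S)
  have "(\<lambda>w. u w + v w) \<in> carrier (tensor_space m n k)" using u v by (auto simp: tensor_carrier)
  then show "co_S m n k (X \<oplus>\<^bsub>S_space m n k\<^esub> Y) e = co_S m n k X e + co_S m n k Y e"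
    by (simp add: u v pr_add co_pr nf_add)
next
  fix X e a assume "X \<in> carrier (S_space m n k)"
  then obtain u where u: "u \<in> carrier (tensor_space m n k)" "X = Q.pr u" by (auto simp: carrier_S)
  have "(\<lambda>w. a * u w) \<in> carrier (tensor_space m n k)" using u by (auto simp: tensor_carrier)
  then show "co_S m n k (a \<odot>\<^bsub>S_space m n k\<^esub> X) e = a * co_S m n k X e"
    by (simp add: u pr_smult co_pr nf_cmult)
next
  fix X assume "X \<in> carrier (S_space m n k)" and z: "\<And>e. e \<in> exponent_matrices m n k \<Longrightarrow> co_S m n k X e = 0"
  then obtain u where u: "u \<in> carrier (tensor_space m n k)" "X = Q.pr u" by (auto simp: carrier_S)
  have "nf m n k u = (\<lambda>v. 0)"
  proof (rule ext)
    fix v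
    show "nf m n k u v = 0"
    proof (cases "v \<in> nwords m n k")
      case True
      then show ?thesis using z[of "count (mset v)"] z_word_unique[OF True] by (simp add: u co_pr)
    qed (simp add: nf_support)
  qed
  then have "Q.pr u = rel_submodule m n k" using R_iff[OF mn u(1)] Q.pr_zero_iff[OF u(1)] by simp
  then show "X = \<zero>\<^bsub>S_space m n k\<^esub>" unfolding u S_space_def Q.Q_zero' .
next
  fix e assume e: "e \<in> exponent_matrices m n k"
  show "z_monomial m n k e \<in> carrier (S_space m n k)" unfolding z_monomial_def carrier_S using ket_z_word[OF e] by blast
  fix e' assume e': "e' \<in> exponent_matrices m n k"
  show "co_S m n k (z_monomial m n k e) e' = of_bool (e' = e)"
    unfolding z_monomial_def co_pr[OF ket_z_word[OF e]] nf_ket_z_word[OF e]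
    using count_z_word[OF e] count_z_word[OF e'] by (auto simp: ket_def)
qed

end

context grid
begin

text \<open>Redistributing entries within a line keeps the length of the line, and all letters of a
  line have the same second coordinate.\<close>

lemma cell_words_dchar:
  assumes i: "1 \<le> i" "i < N"
  obtains K where "\<And>ps. ps \<in> box (cell_sums i e os) \<Longrightarrow> Q.charw \<chi> (cell_words N i e os ps) = K"
proof -
  have "\<exists>K. \<forall>ps\<in>box (cell_sums i e os). Q.charw \<chi> (cell_words N i e os ps) = K"
  proof (induct os)
    case (Cons y os)
    then obtain K where K: "\<forall>ps\<in>box (cell_sums i e os). Q.charw \<chi> (cell_words N i e os ps) = K" by blast
    let ?A = "e (mk i y) + e (mk (Suc i) y)"
    obtain P S where PS: "\<And>p. cell_word N i e y p = P @ replicate (?A - p) (mk i y) @ replicate p (mk (Suc i) y) @ S"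
      by (rule cell_word_split[OF i degree_supp_Nil, where e = e and y = y]) (rule that; assumption)
    have ch: "Q.charw \<chi> (cell_word N i e y p) = \<chi> y ^ (length P + ?A + length S)" if "p \<le> ?A" for p
    proof -
      have "Q.charw \<chi> (cell_word N i e y p) = \<chi> y ^ length (cell_word N i e y p)"
        by (rule Q.charw_const) (auto simp: cell_word_def line_word_def)
      then show ?thesis using that by (simp add: PS add.assoc)
    qed
    show ?case
    proof (intro exI[of _ "\<chi> y ^ (length P + ?A + length S) * K"] ballI)
      fix x assume "x \<in> box (cell_sums i e (y # os))"
      then obtain p ps where x: "x = p # ps" "p \<le> ?A" "ps \<in> box (cell_sums i e os)" by (cases x) auto
      then show "Q.charw \<chi> (cell_words N i e (y # os) x) = \<chi> y ^ (length P + ?A + length S) * K"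
        using K by (simp add: Q.charw_append ch)
    qed
  qed (simp add: box_Nil)
  then show ?thesis using that by blast
qed

end

section \<open>The crystal structure for one pair of neighbouring indices\<close>

context letter_grid
begin

definition line_sums :: "nat \<Rightarrow> (letter \<Rightarrow> nat) \<Rightarrow> nat list" where
  "line_sums i e = cell_sums i e [1..<Suc M]"

definition entries :: "nat \<Rightarrow> (letter \<Rightarrow> nat) \<Rightarrow> nat list" where
  "entries i e = map (\<lambda>y. e (mk (Suc i) y)) [1..<Suc M]"

definition upd :: "nat \<Rightarrow> (letter \<Rightarrow> nat) \<Rightarrow> nat list \<Rightarrow> letter \<Rightarrow> nat" where
  "upd i e ps = cells_upd i (map_of (zip [1..<Suc M] ps)) e"

lemma sums_entries:
  "length (line_sums i e) = M" "length (entries i e) = M"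
  "t < M \<Longrightarrow> line_sums i e ! t = e (mk i (Suc t)) + e (mk (Suc i) (Suc t))" "t < M \<Longrightarrow> entries i e ! t = e (mk (Suc i) (Suc t))"
  by (simp_all add: line_sums_def entries_def cell_sums_def del: upt_Suc)

lemma box_sums: "ps \<in> box (line_sums i e) \<longleftrightarrow> length ps = M \<and> (\<forall>t<M. ps ! t \<le> e (mk i (Suc t)) + e (mk (Suc i) (Suc t)))"
  by (simp add: box_def list_all2_conv_all_nth sums_entries cong: conj_cong)

lemma map_of_upt: "length ps = M \<Longrightarrow> map_of (zip [1..<Suc M] ps) y = (if 1 \<le> y \<and> y \<le> M then Some (ps ! (y - 1)) else None)"
proof (cases "1 \<le> y \<and> y \<le> M")
  case True
  assume l: "length ps = M"
  have "map_of (zip [1..<Suc M] ps) ([1..<Suc M] ! (y - 1)) = Some (ps ! (y - 1))"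
    by (rule map_of_zip_nth) (use True l in \<open>auto simp del: upt_Suc\<close>)
  moreover have "[1..<Suc M] ! (y - 1) = y" using True by (subst nth_upt) auto
  ultimately show ?thesis using True by simp
next
  case False
  assume l: "length ps = M"
  then show ?thesis using False by (auto simp: map_of_zip_is_None simp del: upt_Suc)
qed

lemma upd_apply:
  assumes "length ps = M"
  shows "upd i e ps x = (if 1 \<le> d x \<and> d x \<le> M then
    (if c x = i then e (mk i (d x)) + e (mk (Suc i) (d x)) - ps ! (d x - 1) else if c x = Suc i then ps ! (d x - 1) else e x) else e x)"
  unfolding upd_def cells_upd_def map_of_upt[OF assms] by (auto simp: mk_cd)

lemma entries_box: "entries i e \<in> box (line_sums i e)"
  by (simp add: box_sums sums_entries)

lemma upd_entries: "upd i e (entries i e) = e"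
proof (rule ext)
  fix x
  have "mk i (d x) = x" if "c x = i" using that mk_cd[of x] by simp
  moreover have "mk (Suc i) (d x) = x" if "c x = Suc i" using that mk_cd[of x] by simp
  ultimately show "upd i e (entries i e) x = e x"
    by (subst upd_apply) (auto simp: sums_entries)
qed

lemma upd_facts:
  assumes ps: "ps \<in> box (line_sums i e)"
  shows "line_sums i (upd i e ps) = line_sums i e" "entries i (upd i e ps) = ps"
    "ps' \<in> box (line_sums i e) \<Longrightarrow> upd i (upd i e ps) ps' = upd i e ps'"
proof -
  have l: "length ps = M" and b: "t < M \<Longrightarrow> ps ! t \<le> e (mk i (Suc t)) + e (mk (Suc i) (Suc t))" for t
    using ps by (auto simp: box_sums)
  show "line_sums i (upd i e ps) = line_sums i e"
    by (rule nth_equalityI) (use b in \<open>auto simp: sums_entries upd_apply[OF l]\<close>)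
  show "entries i (upd i e ps) = ps"
    by (rule nth_equalityI) (auto simp: sums_entries upd_apply[OF l] l)
  assume "ps' \<in> box (line_sums i e)"
  then have l': "length ps' = M" by (simp add: box_sums)
  show "upd i (upd i e ps) ps' = upd i e ps'"
  proof (rule ext)
    fix x
    have "1 \<le> d x \<Longrightarrow> d x \<le> M \<Longrightarrow> ps ! (d x - 1) \<le> e (mk i (d x)) + e (mk (Suc i) (d x))" using b[of "d x - 1"] by simp
    then show "upd i (upd i e ps) ps' x = upd i e ps' x"
      by (simp add: upd_apply[OF l] upd_apply[OF l'])
  qed
qed

lemma gw_upd: "ps \<in> box (line_sums i e) \<Longrightarrow> gw (upd i e ps) = cell_words N i e [1..<Suc M] ps"
  unfolding gword_def upd_def by (rule cell_words_eq) (auto simp: box_sums simp del: upt_Suc)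

text \<open>The sum of all entries is the length of the monomial, which is constant on the
  box.\<close>

lemma upd_exponent:
  assumes "1 \<le> i" "i < N" and e: "e \<in> exponent_matrices m n k" and ps: "ps \<in> box (line_sums i e)"
  shows "upd i e ps \<in> exponent_matrices m n k"
proof -
  obtain l where l: "\<And>ps. ps \<in> box (line_sums i e) \<Longrightarrow> length (cell_words N i e [1..<Suc M] ps) = l"
    using length_cell_words[OF assms(1,2) degree_supp_Nil, of e "[1..<Suc M]"] unfolding line_sums_def by blast
  have "length (gw (upd i e ps)) = length (gw (upd i e (entries i e)))"
    using l[OF ps] l[OF entries_box] by (simp add: gw_upd ps entries_box)
  then have "(\<Sum>a\<in>letters m n. upd i e ps a) = k" using e by (simp add: upd_entries length_gw exponent_matrices_def)
  moreover have "upd i e ps a = 0" if "a \<notin> letters m n" for a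
  proof -
    have "\<not> (1 \<le> d a \<and> d a \<le> M \<and> (c a = i \<or> c a = Suc i))" using that assms(1,2) letters_iff[of a] by auto
    moreover have "length ps = M" using ps by (simp add: box_sums)
    ultimately have "upd i e ps a = e a" by (simp add: upd_apply)
    then show ?thesis using e that by (cases a) (simp add: exponent_matrices_def)
  qed
  ultimately show ?thesis by (simp add: exponent_matrices_def)
qed

end

text \<open>One of the two actions, written in the coordinate that it moves. The assumption
  \<open>order\<close> says that the order of the grid deviates from column order only on
  antidiagonal pairs. Of weight vectors, only the eigenvalues under this action are recorded in
  \<open>wtD\<close>, while \<open>wtI\<close> asks for one common weight under both.\<close>

locale acted_grid = letter_grid +
  fixes k :: nat and \<rho> :: "uq_gen \<Rightarrow> (letter list \<Rightarrow> cq) set \<Rightarrow> (letter list \<Rightarrow> cq) set" and wt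
  assumes mn: "m \<ge> 1" "n \<ge> 1"
    and order: "d a < d b \<or> d a = d b \<and> c a \<le> c b \<Longrightarrow> \<not> lt_letter b a \<or> fst a < fst b \<and> snd b < snd a"
    and same_line: "fst (mk x y) = fst (mk x' y) \<or> snd (mk x y) = snd (mk x' y)"
    and lin: "g \<in> uq_gens N \<Longrightarrow> linear_map class_ring (S_space m n k) (S_space m n k) (\<rho> g)"
    and act_mem: "g \<in> uq_gens N \<Longrightarrow> u \<in> carrier (tensor_space m n k) \<Longrightarrow> P.uop g u \<in> carrier (tensor_space m n k)"
    and act: "g \<in> uq_gens N \<Longrightarrow> u \<in> carrier (tensor_space m n k) \<Longrightarrow>
      \<rho> g (rel_submodule m n k +>\<^bsub>tensor_space m n k\<^esub> u) = rel_submodule m n k +>\<^bsub>tensor_space m n k\<^esub> P.uop g u"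
    and wt_mem: "wt X \<Longrightarrow> X \<in> carrier (S_space m n k)"
    and wt_zero: "wt \<zero>\<^bsub>S_space m n k\<^esub>"
    and wtD: "wt X \<Longrightarrow> x \<in> {1..N} \<Longrightarrow> \<exists>a::int. \<rho> (GQ x) X = (qq powi a) \<odot>\<^bsub>S_space m n k\<^esub> X"
    and wtI: "u \<in> carrier (tensor_space m n k) \<Longrightarrow>
      (\<And>w x. u w \<noteq> 0 \<Longrightarrow> P.charw (P.qx x) w = P.charw (P.qx x) w0 \<and> Q.charw (Q.qx x) w = Q.charw (Q.qx x) w0) \<Longrightarrow>
      wt (rel_submodule m n k +>\<^bsub>tensor_space m n k\<^esub> u)"
begin

abbreviation pr where "pr u \<equiv> rel_submodule m n k +>\<^bsub>tensor_space m n k\<^esub> u"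
abbreviation DD where "DD \<equiv> exponent_matrices m n k"
abbreviation SS where "SS \<equiv> S_space m n k"

sublocale Z: coords SS DD "co_S m n k" "z_monomial m n k" by (rule coords_S[OF mn])

lemma Zs_gw: "e \<in> DD \<Longrightarrow> Zs m n (gw e) (ket []) = ket (z_word m n e)"
proof -
  assume e: "e \<in> DD"
  have "sorted_wrt (\<lambda>a b. \<not> lt_letter b a \<or> fst a < fst b \<and> snd b < snd a) (gw e)"
    by (rule sorted_wrt_mono_rel[OF _ sorted_gw]) (use order in blast)
  then obtain s where s: "s \<in> nwords m n k" "mset s = mset (gw e)" "Zs m n (gw e) (ket []) = ket s"
    using Zs_sort[OF gw_words[OF e]] by blast
  have "mset (gw e) = mset (z_word m n e)"
    using e by (intro multiset_eqI) (simp add: count_gw z_word_gword LG.count_gw)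
  then have "s = z_word m n e" using nwords_unique[OF s(1) z_word_nwords[OF e]] s(2) by simp
  then show ?thesis using s(3) by simp
qed

text \<open>Two letters of one line share a row or a column, so their straightening consists of the
  factor q alone.\<close>

lemma comm:
  assumes i: "1 \<le> i" "i < N" and y: "y \<in> {1..M}" and u: "degree_supp j u"
  shows "ZZ m n (mk (Suc i) y) (ZZ m n (mk i y) u) = (\<lambda>v. qq * ZZ m n (mk i y) (ZZ m n (mk (Suc i) y) u) v)"
proof -
  have l: "mk i y \<in> letters m n" "mk (Suc i) y \<in> letters m n" using i y by (auto simp: letters_iff)
  have "\<not> lt_letter (mk (Suc i) y) (mk i y) \<or> fst (mk i y) < fst (mk (Suc i) y) \<and> snd (mk (Suc i) y) < snd (mk i y)"
    by (rule order) simp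
  moreover have s: "fst (mk (Suc i) y) = fst (mk i y) \<or> snd (mk (Suc i) y) = snd (mk i y)" by (rule same_line)
  moreover have "mk i y \<noteq> mk (Suc i) y" by simp
  ultimately have lt: "lt_letter (mk i y) (mk (Suc i) y)" by (auto simp: lt_letter_def prod_eq_iff)
  show ?thesis using ZZ_straight[OF l(2,1) lt u] s unfolding straight_def al_def be_def by auto
qed


lemma coords_pr:
  "u \<in> carrier (tensor_space m n k) \<Longrightarrow> pr u \<in> carrier SS"
  "u \<in> carrier (tensor_space m n k) \<Longrightarrow> co_S m n k (pr u) e = nf m n k u (z_word m n e)"
  "u \<in> carrier (tensor_space m n k) \<Longrightarrow> v \<in> carrier (tensor_space m n k) \<Longrightarrow> nf m n k u = nf m n k v \<Longrightarrow> pr u = pr v"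
  "u \<in> carrier (tensor_space m n k) \<Longrightarrow> a \<odot>\<^bsub>SS\<^esub> pr u = pr (\<lambda>w. a * u w)"
proof -
  show "pr u \<in> carrier SS" if "u \<in> carrier (tensor_space m n k)" unfolding carrier_S[OF mn] using that by (rule imageI)
  show "co_S m n k (pr u) e = nf m n k u (z_word m n e)" if "u \<in> carrier (tensor_space m n k)" by (rule co_pr[OF mn that])
  show "pr u = pr v" if "u \<in> carrier (tensor_space m n k)" "v \<in> carrier (tensor_space m n k)" "nf m n k u = nf m n k v"
    using pr_eq_nf[OF mn that(1,2)] that(3) by (rule iffD2)
  show "a \<odot>\<^bsub>SS\<^esub> pr u = pr (\<lambda>w. a * u w)" if "u \<in> carrier (tensor_space m n k)" by (rule pr_smult[OF mn that])
qed

context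
  fixes i :: nat
  assumes i: "1 \<le> i" "i < N"
begin

text \<open>The vector with coordinates \<open>f\<close> on the monomials that differ from \<open>z\<^sup>e\<close> only in the lines \<open>i\<close> and
  \<open>i + 1\<close>, with the same line_sums of the pairs of entries.\<close>

definition line_vec :: "(letter \<Rightarrow> nat) \<Rightarrow> (nat list \<Rightarrow> cq) \<Rightarrow> letter list \<Rightarrow> cq" where
  "line_vec e f w = (\<Sum>ps\<in>box (line_sums i e). f ps * ket (gw (upd i e ps)) w)"

lemma vec_mem:
  assumes e: "e \<in> DD"
  shows "line_vec e f \<in> carrier (tensor_space m n k)"
proof -
  have "ket (gw (upd i e ps)) w = 0" if "ps \<in> box (line_sums i e)" "w \<notin> words m n k" for ps w
    using gw_words[OF upd_exponent[OF i e that(1)]] that(2) by (auto simp: ket_def)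
  then show ?thesis by (simp add: tensor_carrier line_vec_def)
qed

lemma nf_vec:
  assumes e: "e \<in> DD"
  shows "nf m n k (line_vec e f) v = (\<Sum>ps\<in>box (line_sums i e). f ps * Zs m n (cell_words N i e [1..<Suc M] ps) (ket []) v)"
  unfolding line_vec_def[abs_def] nf_sum
proof (intro sum.cong refl)
  fix ps assume ps: "ps \<in> box (line_sums i e)"
  show "f ps * nf m n k (ket (gw (upd i e ps))) v = f ps * Zs m n (cell_words N i e [1..<Suc M] ps) (ket []) v"
    unfolding nf_ket[OF gw_words[OF upd_exponent[OF i e ps]]] unfolding gw_upd[OF ps] ..
qed

lemma nf_vec_z_word:
  assumes e: "e \<in> DD" and e': "e' \<in> DD"
  shows "nf m n k (line_vec e f) (z_word m n e') = (\<Sum>ps\<in>box (line_sums i e). f ps * of_bool (upd i e ps = e'))"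
  unfolding nf_vec[OF e]
proof (intro sum.cong refl)
  fix ps assume ps: "ps \<in> box (line_sums i e)"
  have "Zs m n (cell_words N i e [1..<Suc M] ps) (ket []) = ket (z_word m n (upd i e ps))"
    using Zs_gw[OF upd_exponent[OF i e ps]] by (simp add: gw_upd[OF ps] del: upt_Suc)
  moreover have "z_word m n e' = z_word m n (upd i e ps) \<longleftrightarrow> upd i e ps = e'"
    using count_z_word[OF e'] count_z_word[OF upd_exponent[OF i e ps]] by metis
  ultimately show "f ps * Zs m n (cell_words N i e [1..<Suc M] ps) (ket []) (z_word m n e') = f ps * of_bool (upd i e ps = e')"
    by (simp add: ket_def)
qed

lemma vec_cong: "(\<And>ps. ps \<in> box (line_sums i e) \<Longrightarrow> f ps = g ps) \<Longrightarrow> line_vec e f = line_vec e g"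
  by (simp add: line_vec_def fun_eq_iff)

lemma vec_upd: "ps \<in> box (line_sums i e) \<Longrightarrow> line_vec (upd i e ps) f = line_vec e f"
  by (simp add: line_vec_def fun_eq_iff upd_facts)

lemma vec_cmult: "(\<lambda>w. a * line_vec e f w) = line_vec e (\<lambda>ps. a * f ps)"
  by (simp add: line_vec_def fun_eq_iff sum_distrib_left mult.assoc)

lemma gens: "GE i \<in> uq_gens N" "GF i \<in> uq_gens N" "GQ i \<in> uq_gens N" "GQ (Suc i) \<in> uq_gens N"
  using i by (auto simp: uq_gens_def)

lemma mv_letters:
  assumes "a \<in> letters m n" "x \<in> {1..N}" shows "mv x a \<in> letters m n"
proof -
  have "mv x a = mk x (d a)" using mk_simps(3)[of x "c a" "d a"] by (simp add: mk_cd)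
  then show ?thesis using assms by (simp add: letters_iff)
qed

lemma E_vec: assumes e: "e \<in> DD" shows "\<rho> (GE i) (pr (line_vec e f)) = pr (line_vec e (mE (line_sums i e) f))"
proof -
  have "nf m n k (P.uop (GE i) (line_vec e f)) v = nf m n k (line_vec e (mE (line_sums i e) f)) v" for v
  proof -
    have "nf m n k (P.uop (GE i) (line_vec e f)) v =
        (\<Sum>ps\<in>box (line_sums i e). f ps * P.EZ m n i (cell_words N i e [1..<Suc M] ps) (ket []) v)"
      unfolding P.uop.simps line_vec_def[abs_def] P.opE_sum nf_sum
    proof (intro sum.cong refl)
      fix ps assume ps: "ps \<in> box (line_sums i e)"
      have "nf m n k (\<lambda>x. P.opE i x (ket (gw (upd i e ps)))) = P.EZ m n i (gw (upd i e ps)) (ket [])"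
        by (rule P.nf_opE_ket[OF mv_letters gw_words[OF upd_exponent[OF i e ps]]]) (use i in auto)
      then show "f ps * nf m n k (\<lambda>w. P.opE i w (ket (gw (upd i e ps)))) v = f ps * P.EZ m n i (cell_words N i e [1..<Suc M] ps) (ket []) v"
        unfolding gw_upd[OF ps] by (simp only:)
    qed
    also have "\<dots> = nf m n k (line_vec e (mE (line_sums i e) f)) v"
      unfolding nf_vec[OF e] line_sums_def
      by (rule EZ_span_sum[OF i degree_supp_Nil, where ys = "{1..M}"]) (erule (1) comm[OF i], auto)
    finally show ?thesis .
  qed
  then have "nf m n k (P.uop (GE i) (line_vec e f)) = nf m n k (line_vec e (mE (line_sums i e) f))" by (rule ext)
  from coords_pr(3)[OF act_mem[OF gens(1) vec_mem[OF e]] vec_mem[OF e] this] show ?thesis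
    unfolding act[OF gens(1) vec_mem[OF e]] .
qed

lemma F_vec: assumes e: "e \<in> DD" shows "\<rho> (GF i) (pr (line_vec e f)) = pr (line_vec e (mF (line_sums i e) f))"
proof -
  have "nf m n k (P.uop (GF i) (line_vec e f)) v = nf m n k (line_vec e (mF (line_sums i e) f)) v" for v
  proof -
    have "nf m n k (P.uop (GF i) (line_vec e f)) v =
        (\<Sum>ps\<in>box (line_sums i e). f ps * P.FZ m n i (cell_words N i e [1..<Suc M] ps) (ket []) v)"
      unfolding P.uop.simps line_vec_def[abs_def] P.opF_sum nf_sum
    proof (intro sum.cong refl)
      fix ps assume ps: "ps \<in> box (line_sums i e)"
      have "nf m n k (\<lambda>x. P.opF i x (ket (gw (upd i e ps)))) = P.FZ m n i (gw (upd i e ps)) (ket [])"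
        by (rule P.nf_opF_ket[OF mv_letters gw_words[OF upd_exponent[OF i e ps]]]) (use i in auto)
      then show "f ps * nf m n k (\<lambda>w. P.opF i w (ket (gw (upd i e ps)))) v = f ps * P.FZ m n i (cell_words N i e [1..<Suc M] ps) (ket []) v"
        unfolding gw_upd[OF ps] by (simp only:)
    qed
    also have "\<dots> = nf m n k (line_vec e (mF (line_sums i e) f)) v"
      unfolding nf_vec[OF e] line_sums_def
      by (rule FZ_span_sum[OF i degree_supp_Nil, where ys = "{1..M}"]) (erule (1) comm[OF i], auto)
    finally show ?thesis .
  qed
  then have "nf m n k (P.uop (GF i) (line_vec e f)) = nf m n k (line_vec e (mF (line_sums i e) f))" by (rule ext)
  from coords_pr(3)[OF act_mem[OF gens(2) vec_mem[OF e]] vec_mem[OF e] this] show ?thesis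
    unfolding act[OF gens(2) vec_mem[OF e]] .
qed

text \<open>Moving entries between i and i + 1 within lines leaves the weight for the other action
  unchanged, and affects the weight for this action only through the sum of the entries, which is
  fixed on the support of f.\<close>

lemma vec_weight:
  assumes e: "e \<in> DD" and f: "\<And>ps. ps \<in> box (line_sums i e) \<Longrightarrow> f ps \<noteq> 0 \<Longrightarrow> sum_list ps = sum_list (entries i e)"
    and w: "line_vec e f w \<noteq> 0"
  shows "P.charw \<chi> w = P.charw \<chi> (gw e)" "Q.charw \<chi> w = Q.charw \<chi> (gw e)"
proof -
  obtain ps where ps: "ps \<in> box (line_sums i e)" "f ps * ket (gw (upd i e ps)) w \<noteq> 0"
    using w unfolding line_vec_def by (rule sum.not_neutral_contains_not_neutral)
  then have s: "sum_list ps = sum_list (entries i e)" and w: "w = gw (upd i e ps)" using f by (auto simp: ket_def)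
  obtain K where "\<And>ps. ps \<in> box (line_sums i e) \<Longrightarrow> P.charw \<chi> (cell_words N i e [1..<Suc M] ps) =
      K * (\<chi> i ^ (sum_list (line_sums i e) - sum_list ps) * \<chi> (Suc i) ^ sum_list ps)"
  proof (rule cell_words_char[OF i degree_supp_Nil, where e = e and os = "[1..<Suc M]" and \<chi> = \<chi>])
    fix K
    assume K: "\<And>ps. ps \<in> box (cell_sums i e [1..<Suc M]) \<Longrightarrow> P.charw \<chi> (cell_words N i e [1..<Suc M] ps) =
      K * (\<chi> i ^ (sum_list (cell_sums i e [1..<Suc M]) - sum_list ps) * \<chi> (Suc i) ^ sum_list ps)"
    show thesis by (rule that[of K], unfold line_sums_def, rule K)
  qed
  from this[OF ps(1)] this[OF entries_box] show "P.charw \<chi> w = P.charw \<chi> (gw e)"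
    unfolding w using gw_upd[OF ps(1)] gw_upd[OF entries_box[of i e]] upd_entries[of i e] s by simp
  obtain K where "\<And>ps. ps \<in> box (line_sums i e) \<Longrightarrow> Q.charw \<chi> (cell_words N i e [1..<Suc M] ps) = K"
  proof (rule cell_words_dchar[OF i, where e = e and os = "[1..<Suc M]" and \<chi> = \<chi>])
    fix K
    assume K: "\<And>ps. ps \<in> box (cell_sums i e [1..<Suc M]) \<Longrightarrow> Q.charw \<chi> (cell_words N i e [1..<Suc M] ps) = K"
    show thesis by (rule that[of K], unfold line_sums_def, rule K)
  qed
  from this[OF ps(1)] this[OF entries_box] show "Q.charw \<chi> w = Q.charw \<chi> (gw e)"
    unfolding w using gw_upd[OF ps(1)] gw_upd[OF entries_box[of i e]] upd_entries[of i e] by simp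
qed

lemma charw_kp_gw: "P.charw (P.kp i) (gw e) = qq powi box_wt (line_sums i e) (entries i e)"
  using charw_kp_cell_words[OF i degree_supp_Nil, of "entries i e" e "[1..<Suc M]"] entries_box[of i e] gw_upd[OF entries_box[of i e]] upd_entries[of i e]
  by (simp add: line_sums_def del: upt_Suc)

text \<open>The vectors y e, built from string families, form a basis of strings for E_i and F_i
  that is congruent to the monomials modulo q. The crystal axioms then transfer from the strings to
  the monomials.\<close>

theorem crystal_line:
  "let L = crystal_lattice SS (z_monomial m n k ` DD); Et = kashiwara_E wt SS (\<rho> (GE i)) (\<rho> (GF i));
      Ft = kashiwara_F wt SS (\<rho> (GE i)) (\<rho> (GF i))
    in Et ` L \<subseteq> L \<and> Ft ` L \<subseteq> L \<and>
       (\<forall>b\<in>z_monomial m n k ` DD. \<exists>b'\<in>z_monomial m n k ` DD \<union> {\<zero>\<^bsub>SS\<^esub>}. cong_mod_q SS L (Et b) b') \<and>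
       (\<forall>b\<in>z_monomial m n k ` DD. \<exists>b'\<in>z_monomial m n k ` DD \<union> {\<zero>\<^bsub>SS\<^esub>}. cong_mod_q SS L (Ft b) b') \<and>
       (\<forall>b\<in>z_monomial m n k ` DD. \<forall>b'\<in>z_monomial m n k ` DD. cong_mod_q SS L (Et b) b' \<longleftrightarrow> cong_mod_q SS L (Ft b') b)"
proof -
  \<comment> \<open>A string family is chosen for every list of bounds, since different matrices e
    have different line sums.\<close>
  have "\<exists>t. \<forall>C. string_family C (fst (t C)) (fst (snd (t C))) (fst (snd (snd (t C)))) (snd (snd (snd (t C))))"
  proof (rule choice, rule allI)
    fix C
    obtain len pos along Y where "string_family C len pos along Y" using string_family_exists by blast
    then show "\<exists>t. string_family C (fst t) (fst (snd t)) (fst (snd (snd t))) (snd (snd (snd t)))"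
      by (intro exI[of _ "(len, pos, along, Y)"]) simp
  qed
  then obtain t where t: "\<And>C. string_family C (fst (t C)) (fst (snd (t C))) (fst (snd (snd (t C)))) (snd (snd (snd (t C))))"
    by blast
  define len where "len C = fst (t C)" for C
  define pos where "pos C = fst (snd (t C))" for C
  define along where "along C = fst (snd (snd (t C)))" for C
  define Y where "Y C = snd (snd (snd (t C)))" for C
  have SF: "string_family C (len C) (pos C) (along C) (Y C)" for C
    unfolding len_def pos_def along_def Y_def by (rule t)
  note ST = string_family.axioms(1)[OF SF]
  \<comment> \<open>A matrix e is split into its line sums, which stay fixed, and its entries at i +
    1, which run through the box; the strings in the box are transported to matrices by
    \<open>upd\<close>.\<close>
  define len' where "len' e = len (line_sums i e) (entries i e)" for e
  define pos' where "pos' e = pos (line_sums i e) (entries i e)" for e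
  define along' where "along' e r = upd i e (along (line_sums i e) (entries i e) r)" for e r
  define y where "y e = pr (line_vec e (Y (line_sums i e) (entries i e)))" for e
  have al: "along (line_sums i e) (entries i e) r \<in> box (line_sums i e)" "len (line_sums i e) (along (line_sums i e) (entries i e) r) = len' e"
    "pos (line_sums i e) (along (line_sums i e) (entries i e) r) = r" if "r \<le> len' e" for e r
    using strings.at_mem[OF ST entries_box] strings.len_at[OF ST entries_box] strings.pos_at[OF ST entries_box] that
    by (auto simp: len'_def)
  have along': "along' e r \<in> DD" "line_sums i (along' e r) = line_sums i e" "entries i (along' e r) = along (line_sums i e) (entries i e) r"
    if "e \<in> DD" "r \<le> len' e" for e r
    unfolding along'_def using upd_exponent[OF i that(1) al(1)[OF that(2)]] upd_facts[OF al(1)[OF that(2)]] by auto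
  have y_along: "y (along' e r) = pr (line_vec e (Y (line_sums i e) (along (line_sums i e) (entries i e) r)))" if "e \<in> DD" "r \<le> len' e" for e r
    unfolding y_def along'[OF that] unfolding along'_def vec_upd[OF al(1)[OF that(2)]] ..
  have strings: "strings DD len' pos' along'"
  proof
    fix e r r' assume e: "e \<in> DD"
    show "pos' e \<le> len' e" unfolding pos'_def len'_def by (rule strings.pos_le[OF ST entries_box])
    show "along' e (pos' e) = e" unfolding along'_def pos'_def strings.at_pos[OF ST entries_box] by (rule upd_entries)
    assume r: "r \<le> len' e"
    show "along' e r \<in> DD" by (rule along'(1)[OF e r])
    show "len' (along' e r) = len' e" "pos' (along' e r) = r"
      using along'(2,3)[OF e r] al[OF r] unfolding len'_def[of "along' e r"] pos'_def by simp_all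
    assume r': "r' \<le> len' e"
    show "along' (along' e r) r' = along' e r'"
      unfolding along'_def[of "along' e r"] along'(2,3)[OF e r]
      using strings.at_at[OF ST entries_box, of r i e r'] upd_facts(3)[OF al(1)[OF r] al(1)[OF r']] r r'
      by (simp add: along'_def len'_def)
  qed
  have y_mem: "y e \<in> carrier SS" if "e \<in> DD" for e unfolding y_def by (rule coords_pr(1)[OF vec_mem[OF that]])
  have near: "co_S m n k (y e) e' - of_bool (e' = e) \<in> qideal" if e: "e \<in> DD" and e': "e' \<in> DD" for e e'
  proof -
    let ?f = "Y (line_sums i e) (entries i e)"
    have "(\<Sum>ps\<in>box (line_sums i e). of_bool (ps = entries i e) * of_bool (upd i e ps = e')) = (of_bool (e' = e) :: cq)"
    proof -
      have "(\<Sum>ps\<in>box (line_sums i e). of_bool (ps = entries i e) * of_bool (upd i e ps = e')) =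
          (\<Sum>ps\<in>box (line_sums i e). if ps = entries i e then (of_bool (e = e') :: cq) else 0)"
        by (intro sum.cong refl) (auto simp: upd_entries)
      then show ?thesis using entries_box[of i e] by (simp add: eq_commute)
    qed
    then have "co_S m n k (y e) e' - of_bool (e' = e) =
        (\<Sum>ps\<in>box (line_sums i e). (?f ps - of_bool (ps = entries i e)) * of_bool (upd i e ps = e'))"
      unfolding y_def coords_pr(2)[OF vec_mem[OF e]] nf_vec_z_word[OF e e'] left_diff_distrib sum_subtractf by simp
    also have "\<dots> \<in> qideal"
      by (intro qideal_sum qideal_mult(1) string_family.Y_cong[OF SF entries_box]) (auto simp: of_bool_def)
    finally show ?thesis .
  qed
  obtain coy where C: "coords SS DD coy y"
    "\<And>x. x \<in> carrier SS \<Longrightarrow> (\<forall>e\<in>DD. coy x e \<in> \<A>) \<longleftrightarrow> (\<forall>e\<in>DD. co_S m n k x e \<in> \<A>)"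
    "\<And>x. x \<in> carrier SS \<Longrightarrow> (\<forall>e\<in>DD. coy x e \<in> qideal) \<longleftrightarrow> (\<forall>e\<in>DD. co_S m n k x e \<in> qideal)"
    "\<And>e e'. e \<in> DD \<Longrightarrow> e' \<in> DD \<Longrightarrow> coy (z_monomial m n k e) e' - of_bool (e' = e) \<in> qideal"
    by (rule Z.change_basis[of y], erule y_mem, erule (1) near) (rule that; assumption)
  interpret Y: coords SS DD coy y by (rule C(1))
  have supp: "sum_list ps = sum_list (entries i e)" if "Y (line_sums i e) (entries i e) ps \<noteq> 0" for e ps
    using string_family.Y_supp[OF SF entries_box that] by simp
  have vw: "P.charw \<chi> w = P.charw \<chi> (gw e)" "Q.charw \<chi> w = Q.charw \<chi> (gw e)"
    if "e \<in> DD" "line_vec e (Y (line_sums i e) (entries i e)) w \<noteq> 0" for e w \<chi>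
    by (rule vec_weight[OF that(1) _ that(2)], erule supp)+
  have Qy: "\<rho> (GQ x) (y e) = P.charw (P.qx x) (gw e) \<odot>\<^bsub>SS\<^esub> y e" if e: "e \<in> DD" and x: "GQ x \<in> uq_gens N" for e x
  proof -
    let ?v = "line_vec e (Y (line_sums i e) (entries i e))"
    have eq: "P.uop (GQ x) ?v = (\<lambda>w. P.charw (P.qx x) (gw e) * ?v w)"
    proof (rule ext)
      fix w
      show "P.uop (GQ x) ?v w = P.charw (P.qx x) (gw e) * ?v w"
        using vw(1)[OF e, of w "P.qx x"] by (cases "?v w = 0") auto
    qed
    show ?thesis unfolding y_def act[OF x vec_mem[OF e]] coords_pr(4)[OF vec_mem[OF e]] eq ..
  qed
  \<comment> \<open>The y e are eigenvectors, so an eigenvector X has nonzero coordinates only at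
    those e whose eigenvalue is that of X.\<close>
  have ev: "P.charw (P.qx x) (gw e) = qq powi a"
    if X: "X \<in> carrier SS" "\<rho> (GQ x) X = (qq powi a) \<odot>\<^bsub>SS\<^esub> X" and x: "GQ x \<in> uq_gens N" and e: "e \<in> DD" "coy X e \<noteq> 0" for X x a e
  proof -
    have "(qq powi a) * coy X e = coy (\<rho> (GQ x) X) e" using X e by (simp add: Y.co_smult)
    also have "\<dots> = (\<Sum>e'\<in>DD. coy X e' * (P.charw (P.qx x) (gw e') * of_bool (e = e')))"
      unfolding Y.co_linear[OF lin[OF x] X(1) e(1)]
      by (intro sum.cong refl) (simp add: Qy[OF _ x] Y.co_smult y_mem e(1) Y.co_z)
    also have "\<dots> = (\<Sum>e'\<in>DD. if e' = e then coy X e * P.charw (P.qx x) (gw e) else 0)"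
      by (intro sum.cong refl) auto
    also have "\<dots> = coy X e * P.charw (P.qx x) (gw e)" using e Y.finite_D by simp
    finally show ?thesis using e(2) by simp
  qed
  interpret B: string_basis SS DD coy y len' pos' along' "\<rho> (GE i)" "\<rho> (GF i)" wt
  proof (intro string_basis.intro C(1) strings string_basis_axioms.intro lin gens wt_zero)
    fix e assume e: "e \<in> DD"
    let ?C = "line_sums i e" and ?p = "entries i e"
    note pl = strings.pos_le[OF strings e]
    show "\<rho> (GE i) (y e) = (if pos' e = 0 then \<zero>\<^bsub>SS\<^esub> else
      qi (int (len' e) - int (pos' e) + 1) \<odot>\<^bsub>SS\<^esub> y (along' e (pos' e - 1)))"
    proof (cases "pos' e = 0")
      case True
      have "line_vec e (mE ?C (Y ?C ?p)) = line_vec e (\<lambda>ps. 0 * Y ?C ?p ps)"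
        by (rule vec_cong) (use string_family.mE_Y[OF SF entries_box] True in \<open>simp add: pos'_def\<close>)
      then have "\<rho> (GE i) (y e) = 0 \<odot>\<^bsub>SS\<^esub> y e"
        unfolding y_def E_vec[OF e] coords_pr(4)[OF vec_mem[OF e]] vec_cmult by simp
      then show ?thesis using True Y.co_eqI[of "0 \<odot>\<^bsub>SS\<^esub> y e" "\<zero>\<^bsub>SS\<^esub>"] by (simp add: Y.co_smult Y.co_zero y_mem e)
    next
      case False
      have l: "pos' e - 1 \<le> len' e" using pl by simp
      have "line_vec e (mE ?C (Y ?C ?p)) = line_vec e (\<lambda>ps. qi (int (len' e) - int (pos' e) + 1) * Y ?C (along ?C ?p (pos' e - 1)) ps)"
        by (rule vec_cong) (use string_family.mE_Y[OF SF entries_box] False in \<open>simp add: pos'_def len'_def\<close>)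
      then show ?thesis
        unfolding y_along[OF e l] unfolding y_def E_vec[OF e] coords_pr(4)[OF vec_mem[OF e]] vec_cmult using False by simp
    qed
    show "\<rho> (GF i) (y e) = (if pos' e = len' e then \<zero>\<^bsub>SS\<^esub> else
      qi (int (pos' e) + 1) \<odot>\<^bsub>SS\<^esub> y (along' e (Suc (pos' e))))"
    proof (cases "pos' e = len' e")
      case True
      have "line_vec e (mF ?C (Y ?C ?p)) = line_vec e (\<lambda>ps. 0 * Y ?C ?p ps)"
        by (rule vec_cong) (use string_family.mF_Y[OF SF entries_box] True in \<open>simp add: pos'_def len'_def\<close>)
      then have "\<rho> (GF i) (y e) = 0 \<odot>\<^bsub>SS\<^esub> y e"
        unfolding y_def F_vec[OF e] coords_pr(4)[OF vec_mem[OF e]] vec_cmult by simp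
      then show ?thesis using True Y.co_eqI[of "0 \<odot>\<^bsub>SS\<^esub> y e" "\<zero>\<^bsub>SS\<^esub>"] by (simp add: Y.co_smult Y.co_zero y_mem e)
    next
      case False
      have l: "Suc (pos' e) \<le> len' e" using pl False by simp
      have "line_vec e (mF ?C (Y ?C ?p)) = line_vec e (\<lambda>ps. qi (int (pos' e) + 1) * Y ?C (along ?C ?p (Suc (pos' e))) ps)"
        by (rule vec_cong) (use string_family.mF_Y[OF SF entries_box] False in \<open>simp add: pos'_def len'_def\<close>)
      then show ?thesis
        unfolding y_along[OF e l] unfolding y_def F_vec[OF e] coords_pr(4)[OF vec_mem[OF e]] vec_cmult using False by simp
    qed
    show "wt (y e)" unfolding y_def
    proof (rule wtI[OF vec_mem[OF e], where ?w0.0 = "gw e"])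
      fix w x assume w: "line_vec e (Y ?C ?p) w \<noteq> 0"
      show "P.charw (P.qx x) w = P.charw (P.qx x) (gw e) \<and> Q.charw (Q.qx x) w = Q.charw (Q.qx x) (gw e)"
        by (intro conjI vw[OF e w])
    qed
  next
    fix X assume "wt X" then show "X \<in> carrier SS" by (rule wt_mem)
  next
    fix X e e' assume X: "wt X" and e: "e \<in> DD" "e' \<in> DD" "coy X e \<noteq> 0" "coy X e' \<noteq> 0" and p: "pos' e = 0" "pos' e' = 0"
    obtain a where a: "\<rho> (GQ i) X = (qq powi a) \<odot>\<^bsub>SS\<^esub> X" using wtD[OF X, of i] i by auto
    obtain b where b: "\<rho> (GQ (Suc i)) X = (qq powi b) \<odot>\<^bsub>SS\<^esub> X" using wtD[OF X, of "Suc i"] i by auto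
    \<comment> \<open>At the top of a string the length is the h_i-weight, and this weight is the
      same for all coordinates of X.\<close>
    have L: "qq powi int (len' e) = qq powi a * inverse (qq powi b)" if "e \<in> DD" "coy X e \<noteq> 0" "pos' e = 0" for e
    proof -
      have "int (len' e) = box_wt (line_sums i e) (entries i e)"
        using string_family.len_pos[OF SF entries_box[of i e]] that(3) by (simp add: len'_def pos'_def)
      then have "qq powi int (len' e) = P.charw (P.kp i) (gw e)" by (simp only: charw_kp_gw)
      also have "\<dots> = qq powi a * inverse (qq powi b)"
        unfolding P.charw_kp ev[OF wt_mem[OF X] a gens(3) that(1,2)] ev[OF wt_mem[OF X] b gens(4) that(1,2)] ..
      finally show ?thesis .
    qed
    have "qq powi int (len' e) = qq powi int (len' e')" using L[OF e(1,3) p(1)] L[OF e(2,4) p(2)] by simp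
    then have "int (len' e) = int (len' e')" by (simp only: qq_powi_inj)
    then show "len' e = len' e'" by simp
  qed
  show ?thesis by (rule B.crystal_pair[OF coords_S[OF mn] C(2,3,4) refl])
qed

end

end

section \<open>Both actions on the quotient\<close>

lemma letters_mv:
  "a \<in> letters m n \<Longrightarrow> i \<in> {1..m} \<Longrightarrow> (i, snd a) \<in> letters m n"
  "a \<in> letters m n \<Longrightarrow> j \<in> {1..n} \<Longrightarrow> (fst a, j) \<in> letters m n"
  by (auto simp: letters_def)

context
  fixes m n k :: nat
  assumes mn: "m \<ge> 1" "n \<ge> 1"
begin

interpretation Q: quotient "tensor_space m n k" "rel_submodule m n k"
  by (rule quotient.intro[OF vectorspace_tensor rel_subspace[OF mn]])

lemma uop_mem:
  "g \<in> uq_gens m \<Longrightarrow> u \<in> carrier (tensor_space m n j) \<Longrightarrow> cL.uop g u \<in> carrier (tensor_space m n j)"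
  "g \<in> uq_gens n \<Longrightarrow> u \<in> carrier (tensor_space m n j) \<Longrightarrow> cR.uop g u \<in> carrier (tensor_space m n j)"
  by (rule cL.uop_carrier; auto simp: letters_def) (rule cR.uop_carrier; auto simp: letters_def)

lemma uop_rel:
  "g \<in> uq_gens m \<Longrightarrow> u \<in> rel_submodule m n k \<Longrightarrow> cL.uop g u \<in> rel_submodule m n k"
  "g \<in> uq_gens n \<Longrightarrow> u \<in> rel_submodule m n k \<Longrightarrow> cR.uop g u \<in> rel_submodule m n k"
proof -
  show "g \<in> uq_gens m \<Longrightarrow> u \<in> rel_submodule m n k \<Longrightarrow> cL.uop g u \<in> rel_submodule m n k"
    by (rule cL.rel_invariant[OF mn, where N = m]) (auto intro: letters_mv uop_mem Im2_facts(5)[OF mn])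
  show "g \<in> uq_gens n \<Longrightarrow> u \<in> rel_submodule m n k \<Longrightarrow> cR.uop g u \<in> rel_submodule m n k"
    by (rule cR.rel_invariant[OF mn, where N = n]) (auto intro: letters_mv uop_mem Im2_facts(6)[OF mn])
qed

lemma act_rel:
  "g \<in> uq_gens m \<Longrightarrow> tensor_actL m n k g ` rel_submodule m n k \<subseteq> rel_submodule m n k"
  "g \<in> uq_gens n \<Longrightarrow> tensor_actR m n k g ` rel_submodule m n k \<subseteq> rel_submodule m n k"
  using uop_rel R_facts(1)[OF mn] by (auto simp: tensor_actL_uop tensor_actR_uop)

lemma bimodule_S: "uq_gl_bimodule m n (S_space m n k) (S_actL m n k) (S_actR m n k)"
  unfolding S_space_def S_actL_def[abs_def] S_actR_def[abs_def]
  by (rule uq_gl_bimodule_quotient[OF uq_gl_bimodule_tensor rel_subspace[OF mn]]) (erule act_rel)+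

lemma linear_tensor:
  "g \<in> uq_gens m \<Longrightarrow> linear_map class_ring (tensor_space m n k) (tensor_space m n k) (tensor_actL m n k g)"
  "g \<in> uq_gens n \<Longrightarrow> linear_map class_ring (tensor_space m n k) (tensor_space m n k) (tensor_actR m n k g)"
  using uq_gl_bimodule_tensor[of m n k] by (simp_all add: uq_gl_bimodule_def uq_gl_module_def)

lemma linear_S:
  "g \<in> uq_gens m \<Longrightarrow> linear_map class_ring (S_space m n k) (S_space m n k) (S_actL m n k g)"
  "g \<in> uq_gens n \<Longrightarrow> linear_map class_ring (S_space m n k) (S_space m n k) (S_actR m n k g)"
  using bimodule_S by (simp_all add: uq_gl_bimodule_def uq_gl_module_def)

lemma act_pr:
  "g \<in> uq_gens m \<Longrightarrow> u \<in> carrier (tensor_space m n k) \<Longrightarrow> S_actL m n k g (Q.pr u) = Q.pr (cL.uop g u)"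
  "g \<in> uq_gens n \<Longrightarrow> u \<in> carrier (tensor_space m n k) \<Longrightarrow> S_actR m n k g (Q.pr u) = Q.pr (cR.uop g u)"
  using Q.quotient_map_pr[OF linear_tensor(1) act_rel(1)] Q.quotient_map_pr[OF linear_tensor(2) act_rel(2)]
  by (simp_all add: S_actL_def S_actR_def tensor_actL_uop tensor_actR_uop)

abbreviation wtv where "wtv \<equiv> weight_vector m n (S_space m n k) (S_actL m n k) (S_actR m n k)"

lemma weight_vector_zero: "wtv \<zero>\<^bsub>S_space m n k\<^esub>"
proof -
  interpret S: coords "S_space m n k" "exponent_matrices m n k" "co_S m n k" "z_monomial m n k" by (rule coords_S[OF mn])
  have g: "x \<in> {1..N} \<Longrightarrow> GQ x \<in> uq_gens N" for x N by (auto simp: uq_gens_def)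
  have z: "\<zero>\<^bsub>S_space m n k\<^esub> = (qq powi 0) \<odot>\<^bsub>S_space m n k\<^esub> \<zero>\<^bsub>S_space m n k\<^esub>" by simp
  show ?thesis unfolding weight_vector_def
    using class_linearD(5)[OF linear_S(1)[OF g]] class_linearD(5)[OF linear_S(2)[OF g]] z by auto
qed

lemma weight_vectorI:
  assumes u: "u \<in> carrier (tensor_space m n k)"
    and c: "\<And>w x. u w \<noteq> 0 \<Longrightarrow> cL.charw (cL.qx x) w = cL.charw (cL.qx x) w0 \<and> cR.charw (cR.qx x) w = cR.charw (cR.qx x) w0"
  shows "wtv (Q.pr u)"
proof -
  have g: "x \<in> {1..N} \<Longrightarrow> GQ x \<in> uq_gens N" for x N by (auto simp: uq_gens_def)
  have L: "\<exists>a::int. S_actL m n k (GQ x) (Q.pr u) = (qq powi a) \<odot>\<^bsub>S_space m n k\<^esub> Q.pr u" if "x \<in> {1..m}" for x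
  proof -
    obtain a where a: "cL.charw (cL.qx x) w0 = qq powi a" using cL.charw_qx_power by blast
    have "cL.uop (GQ x) u = (\<lambda>w. qq powi a * u w)"
    proof (rule ext)
      fix w show "cL.uop (GQ x) u w = qq powi a * u w" using c[of w x] a by (cases "u w = 0") auto
    qed
    then show ?thesis using act_pr(1)[OF g[OF that] u] pr_smult[OF mn u] by metis
  qed
  have R: "\<exists>a::int. S_actR m n k (GQ x) (Q.pr u) = (qq powi a) \<odot>\<^bsub>S_space m n k\<^esub> Q.pr u" if "x \<in> {1..n}" for x
  proof -
    obtain a where a: "cR.charw (cR.qx x) w0 = qq powi a" using cR.charw_qx_power by blast
    have "cR.uop (GQ x) u = (\<lambda>w. qq powi a * u w)"
    proof (rule ext)
      fix w show "cR.uop (GQ x) u w = qq powi a * u w" using c[of w x] a by (cases "u w = 0") auto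
    qed
    then show ?thesis using act_pr(2)[OF g[OF that] u] pr_smult[OF mn u] by metis
  qed
  have "Q.pr u \<in> carrier (S_space m n k)" unfolding carrier_S[OF mn] using u by blast
  then show ?thesis unfolding weight_vector_def using L R by blast
qed

lemma acted_L: "acted_grid fst (\<lambda>i a. (i, snd a)) snd (\<lambda>j a. (fst a, j)) (\<lambda>x y. (x, y)) m n m n k (S_actL m n k) wtv"
proof (rule acted_grid.intro[OF LG.letter_grid_axioms], rule acted_grid_axioms.intro)
  show "1 \<le> m" "1 \<le> n" by (rule mn)+
  show "\<not> lt_letter b a \<or> fst a < fst b \<and> snd b < snd a" if "snd a < snd b \<or> snd a = snd b \<and> fst a \<le> fst b" for a b
    using that by (auto simp: lt_letter_def)
  show "fst (x, y) = fst (x', y) \<or> snd (x, y) = snd (x', y)" for x x' y :: nat by simp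
  show "linear_map class_ring (S_space m n k) (S_space m n k) (S_actL m n k g)" if "g \<in> uq_gens m" for g
    by (rule linear_S(1)[OF that])
  show "cL.uop g u \<in> carrier (tensor_space m n k)" if "g \<in> uq_gens m" "u \<in> carrier (tensor_space m n k)" for g u
    by (rule uop_mem(1)[OF that])
  show "S_actL m n k g (Q.pr u) = Q.pr (cL.uop g u)" if "g \<in> uq_gens m" "u \<in> carrier (tensor_space m n k)" for g u
    by (rule act_pr(1)[OF that])
  show "X \<in> carrier (S_space m n k)" if "wtv X" for X using that by (simp add: weight_vector_def)
  show "wtv \<zero>\<^bsub>S_space m n k\<^esub>" by (rule weight_vector_zero)
  show "\<exists>a::int. S_actL m n k (GQ x) X = (qq powi a) \<odot>\<^bsub>S_space m n k\<^esub> X" if "wtv X" "x \<in> {1..m}" for X x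
    using that unfolding weight_vector_def by blast
  show "wtv (Q.pr u)" if "u \<in> carrier (tensor_space m n k)"
    "\<And>w x. u w \<noteq> 0 \<Longrightarrow> cL.charw (cL.qx x) w = cL.charw (cL.qx x) w0 \<and> cR.charw (cR.qx x) w = cR.charw (cR.qx x) w0" for u w0
    by (rule weight_vectorI[OF that(1), of w0]) (use that(2) in blast)
qed

lemma acted_R: "acted_grid snd (\<lambda>j a. (fst a, j)) fst (\<lambda>i a. (i, snd a)) (\<lambda>x y. (y, x)) m n n m k (S_actR m n k) wtv"
proof (rule acted_grid.intro[OF RG.letter_grid_axioms], rule acted_grid_axioms.intro)
  show "1 \<le> m" "1 \<le> n" by (rule mn)+
  \<comment> \<open>In row order, a letter may precede b although it comes later in column order; it
    then lies in a smaller row and a larger column, which is an antidiagonal pair.\<close>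
  show "\<not> lt_letter b a \<or> fst a < fst b \<and> snd b < snd a" if "fst a < fst b \<or> fst a = fst b \<and> snd a \<le> snd b" for a b
    using that by (auto simp: lt_letter_def)
  show "fst (y, x) = fst (y, x') \<or> snd (y, x) = snd (y, x')" for x x' y :: nat by simp
  show "linear_map class_ring (S_space m n k) (S_space m n k) (S_actR m n k g)" if "g \<in> uq_gens n" for g
    by (rule linear_S(2)[OF that])
  show "cR.uop g u \<in> carrier (tensor_space m n k)" if "g \<in> uq_gens n" "u \<in> carrier (tensor_space m n k)" for g u
    by (rule uop_mem(2)[OF that])
  show "S_actR m n k g (Q.pr u) = Q.pr (cR.uop g u)" if "g \<in> uq_gens n" "u \<in> carrier (tensor_space m n k)" for g u
    by (rule act_pr(2)[OF that])
  show "X \<in> carrier (S_space m n k)" if "wtv X" for X using that by (simp add: weight_vector_def)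
  show "wtv \<zero>\<^bsub>S_space m n k\<^esub>" by (rule weight_vector_zero)
  show "\<exists>a::int. S_actR m n k (GQ x) X = (qq powi a) \<odot>\<^bsub>S_space m n k\<^esub> X" if "wtv X" "x \<in> {1..n}" for X x
    using that unfolding weight_vector_def by blast
  show "wtv (Q.pr u)" if "u \<in> carrier (tensor_space m n k)"
    "\<And>w x. u w \<noteq> 0 \<Longrightarrow> cR.charw (cR.qx x) w = cR.charw (cR.qx x) w0 \<and> cL.charw (cL.qx x) w = cL.charw (cL.qx x) w0" for u w0
    by (rule weight_vectorI[OF that(1), of w0]) (use that(2) in blast)
qed

lemma weight_vector_z: "e \<in> exponent_matrices m n k \<Longrightarrow> wtv (z_monomial m n k e)"
  unfolding z_monomial_def by (rule weight_vectorI[OF ket_z_word[OF mn], of e "z_word m n e"]) (auto simp: ket_def split: if_splits)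

end

theorem proposition47:
  fixes m n k :: nat
  assumes "m \<ge> 1" and "n \<ge> 1"
  shows "uq_gl_bimodule m n (S_space m n k) (S_actL m n k) (S_actR m n k) \<and>
    inj_on (z_monomial m n k) (exponent_matrices m n k) \<and>
    crystal_basis m n (S_space m n k) (S_actL m n k) (S_actR m n k)
      (z_monomial m n k ` exponent_matrices m n k)"
proof (intro conjI)
  interpret S: coords "S_space m n k" "exponent_matrices m n k" "co_S m n k" "z_monomial m n k" by (rule coords_S[OF assms])
  show "uq_gl_bimodule m n (S_space m n k) (S_actL m n k) (S_actR m n k)" by (rule bimodule_S[OF assms])
  show "inj_on (z_monomial m n k) (exponent_matrices m n k)" by (rule S.inj_z)
  show "crystal_basis m n (S_space m n k) (S_actL m n k) (S_actR m n k) (z_monomial m n k ` exponent_matrices m n k)"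
    unfolding crystal_basis_def
  proof (intro conjI ballI)
    show "vectorspace.basis class_ring (S_space m n k) (z_monomial m n k ` exponent_matrices m n k)" by (rule S.basis_z)
    fix b assume "b \<in> z_monomial m n k ` exponent_matrices m n k"
    then show "weight_vector m n (S_space m n k) (S_actL m n k) (S_actR m n k) b" using weight_vector_z[OF assms] by blast
  next
    \<comment> \<open>Each pair of operators concerns two neighbouring rows or two neighbouring
      columns, so the two instances of \<open>crystal_line\<close> cover all pairs.\<close>
    fix p assume "p \<in> EF_pairs m n (S_actL m n k) (S_actR m n k)"
    then consider i where "1 \<le> i" "i < m" "p = (S_actL m n k (GE i), S_actL m n k (GF i))"
      | j where "1 \<le> j" "j < n" "p = (S_actR m n k (GE j), S_actR m n k (GF j))"
      by (auto simp: EF_pairs_def)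
    then show "case p of (E, F) \<Rightarrow>
      let L = crystal_lattice (S_space m n k) (z_monomial m n k ` exponent_matrices m n k);
          Et = kashiwara_E (weight_vector m n (S_space m n k) (S_actL m n k) (S_actR m n k)) (S_space m n k) E F;
          Ft = kashiwara_F (weight_vector m n (S_space m n k) (S_actL m n k) (S_actR m n k)) (S_space m n k) E F
      in Et ` L \<subseteq> L \<and> Ft ` L \<subseteq> L \<and>
         (\<forall>b\<in>z_monomial m n k ` exponent_matrices m n k.
            \<exists>b'\<in>z_monomial m n k ` exponent_matrices m n k \<union> {\<zero>\<^bsub>S_space m n k\<^esub>}. cong_mod_q (S_space m n k) L (Et b) b') \<and>
         (\<forall>b\<in>z_monomial m n k ` exponent_matrices m n k.
            \<exists>b'\<in>z_monomial m n k ` exponent_matrices m n k \<union> {\<zero>\<^bsub>S_space m n k\<^esub>}. cong_mod_q (S_space m n k) L (Ft b) b') \<and>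
         (\<forall>b\<in>z_monomial m n k ` exponent_matrices m n k. \<forall>b'\<in>z_monomial m n k ` exponent_matrices m n k.
            cong_mod_q (S_space m n k) L (Et b) b' \<longleftrightarrow> cong_mod_q (S_space m n k) L (Ft b') b)"
    proof cases
      case (1 i)
      show ?thesis unfolding 1(3) prod.case by (rule acted_grid.crystal_line[OF acted_L[OF assms] 1(1,2)])
    next
      case (2 j)
      show ?thesis unfolding 2(3) prod.case by (rule acted_grid.crystal_line[OF acted_R[OF assms] 2(1,2)])
    qed
  qed
qed

end
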